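(* Let $R$ be a commutative Noetherian ring with $1$, $I$ a proper ideal of $R$, $M$ a finitely generated $R$-module and $N$ a weakly Laskerian $R$-module. Assume that the pair $M,N$ is $I$-cohomologically injective. If there is an integer $s\ge 0$ such that $H^i_I(M,N)$ is $I$-weakly cofinite for all $i\neq s$, then $H^s_I(M,N)$ is $I$-weakly cofinite.
   Context: An $R$-module $W$ is weakly Laskerian if $\mathrm{Ass}_R(W/U)$ is finite for every $R$-submodule $U$ of $W$. An $R$-module $W$ is $I$-weakly cofinite if $\mathrm{Supp}_R W\subset V(I)=\{P\in\mathrm{Spec}\,R\mid I\subset P\}$ and $\mathrm{Ext}^i_R(R/I,W)$ is weakly Laskerian for all $i\ge 0$. The generalized local cohomology modules are $H^i_I(M,N)=\varinjlim_n \mathrm{Ext}^i_R(M/I^nM,N)$, where the direct system is induced by the natural surjections $M/I^{n+1}M\to M/I^nM$; $H^i_I(N)=H^i_I(R,N)$ is ordinary local cohomology. For $M$ finitely generated, the pair $M,N$ is $I$-cohomologically injective if there is some injective resolution $E^\bullet$ of $N$ such that the module $H^0_I(\mathrm{Hom}_R(M,E^i))$ is injective for every $E^i$ appearing in $E^\bullet$. *)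

theory Defs
  imports "HOL-Algebra.Module" "HOL-Algebra.QuotRing" "HOL-Algebra.Ideal_Product" "HOL-Algebra.Ring_Divisibility"
begin

section \<open>Modules\<close>

definition ring_as_module :: "('r, 'x) ring_scheme \<Rightarrow> ('r, 'r) module"
  where "ring_as_module R =
    \<lparr>carrier = carrier R, monoid.mult = monoid.mult R, one = one R, zero = zero R, add = add R,
     smult = monoid.mult R\<rparr>"

text \<open>The multiplicative fields of the record, which are inherited from rings, play no role
  for a module.\<close>

definition quotient_module :: "('r, 'a) module \<Rightarrow> 'a set \<Rightarrow> ('r, 'a set) module"
  where "quotient_module W U =
    \<lparr>carrier = a_rcosets\<^bsub>W\<^esub> U, monoid.mult = undefined, one = undefined, zero = U,
     add = set_add W, smult = (\<lambda>r X. \<Union>x\<in>X. U +>\<^bsub>W\<^esub> (r \<odot>\<^bsub>W\<^esub> x))\<rparr>"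

definition module_homs ::
    "('r, 'x) ring_scheme \<Rightarrow> ('r, 'a) module \<Rightarrow> ('r, 'b) module \<Rightarrow> ('a \<Rightarrow> 'b) set"
  where "module_homs R A B =
    {f \<in> carrier A \<rightarrow> carrier B.
      (\<forall>x\<in>carrier A. \<forall>y\<in>carrier A. f (x \<oplus>\<^bsub>A\<^esub> y) = f x \<oplus>\<^bsub>B\<^esub> f y) \<and>
      (\<forall>r\<in>carrier R. \<forall>x\<in>carrier A. f (r \<odot>\<^bsub>A\<^esub> x) = r \<odot>\<^bsub>B\<^esub> f x)}"

definition hom_module ::
    "('r, 'x) ring_scheme \<Rightarrow> ('r, 'a) module \<Rightarrow> ('r, 'b) module \<Rightarrow> ('r, 'a \<Rightarrow> 'b) module"
  where "hom_module R A B =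
    \<lparr>carrier = module_homs R A B \<inter> extensional (carrier A),
     monoid.mult = undefined, one = undefined,
     zero = (\<lambda>x\<in>carrier A. \<zero>\<^bsub>B\<^esub>),
     add = (\<lambda>f g. \<lambda>x\<in>carrier A. f x \<oplus>\<^bsub>B\<^esub> g x),
     smult = (\<lambda>r f. \<lambda>x\<in>carrier A. r \<odot>\<^bsub>B\<^esub> f x)\<rparr>"

definition finitely_generated_module :: "('r, 'x) ring_scheme \<Rightarrow> ('r, 'a) module \<Rightarrow> bool"
  where "finitely_generated_module R M \<longleftrightarrow>
    (\<exists>S \<subseteq> carrier M. finite S \<and> carrier M = \<Inter>{H. submodule H R M \<and> S \<subseteq> H})"

text \<open>The submodule $JW$ of $W$, for an ideal $J$; compare \<^const>\<open>ideal_prod\<close>.\<close>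

inductive_set ideal_smult :: "('r, 'a) module \<Rightarrow> 'r set \<Rightarrow> 'a set" for W and J where
    smult: "r \<in> J \<Longrightarrow> x \<in> carrier W \<Longrightarrow> r \<odot>\<^bsub>W\<^esub> x \<in> ideal_smult W J"
  | sum: "x \<in> ideal_smult W J \<Longrightarrow> y \<in> ideal_smult W J \<Longrightarrow> x \<oplus>\<^bsub>W\<^esub> y \<in> ideal_smult W J"


section \<open>Associated primes and support\<close>

definition spec :: "('r, 'x) ring_scheme \<Rightarrow> 'r set set"
  where "spec R = {P. primeideal P R}"

definition zero_locus :: "('r, 'x) ring_scheme \<Rightarrow> 'r set \<Rightarrow> 'r set set"
  where "zero_locus R I = {P \<in> spec R. I \<subseteq> P}"

definition annihilator :: "('r, 'x) ring_scheme \<Rightarrow> ('r, 'a) module \<Rightarrow> 'a \<Rightarrow> 'r set"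
  where "annihilator R W x = {r \<in> carrier R. r \<odot>\<^bsub>W\<^esub> x = \<zero>\<^bsub>W\<^esub>}"

definition Ass :: "('r, 'x) ring_scheme \<Rightarrow> ('r, 'a) module \<Rightarrow> 'r set set"
  where "Ass R W = {P \<in> spec R. \<exists>x\<in>carrier W. P = annihilator R W x}"

text \<open>The fraction $x/s$ in the localization $W_P$, as an equivalence class of pairs
  (numerator, denominator).\<close>

definition fraction ::
    "('r, 'x) ring_scheme \<Rightarrow> ('r, 'a) module \<Rightarrow> 'r set \<Rightarrow> 'a \<Rightarrow> 'r \<Rightarrow> ('a \<times> 'r) set"
  where "fraction R W P x s =
    {(y, t). y \<in> carrier W \<and> t \<in> carrier R - P \<and>
      (\<exists>u\<in>carrier R - P. u \<odot>\<^bsub>W\<^esub> (t \<odot>\<^bsub>W\<^esub> x) = u \<odot>\<^bsub>W\<^esub> (s \<odot>\<^bsub>W\<^esub> y))}"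

definition localization ::
    "('r, 'x) ring_scheme \<Rightarrow> ('r, 'a) module \<Rightarrow> 'r set \<Rightarrow> ('a \<times> 'r) set set"
  where "localization R W P =
    {fraction R W P x s | x s. x \<in> carrier W \<and> s \<in> carrier R - P}"

definition Supp :: "('r, 'x) ring_scheme \<Rightarrow> ('r, 'a) module \<Rightarrow> 'r set set"
  where "Supp R W =
    {P \<in> spec R. localization R W P \<noteq> {fraction R W P \<zero>\<^bsub>W\<^esub> \<one>\<^bsub>R\<^esub>}}"

definition weakly_laskerian :: "('r, 'x) ring_scheme \<Rightarrow> ('r, 'a) module \<Rightarrow> bool"
  where "weakly_laskerian R W \<longleftrightarrow>
    (\<forall>U. submodule U R W \<longrightarrow> finite (Ass R (quotient_module W U)))"


section \<open>The standard free resolution\<close>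

text \<open>A functorial resolution of an arbitrary module $A$ by free modules, all of whose terms live
  in one type. The free module $F_0$ has the elements of $A$ as basis, and $F_{n+1}$ has as basis
  all formal linear combinations $\sum_i r_i x_i$ of basis elements of $F_n$ (represented by lists
  of pairs $(r_i, x_i)$) whose value in $F_n$ lies in the kernel of
  $F_n \to F_{n-1}$, where $F_{-1} = A$.\<close>

datatype ('r, 'a) resgen = Gen 'a | Syz "('r \<times> ('r, 'a) resgen) list"

definition free_module :: "('r, 'x) ring_scheme \<Rightarrow> 'b set \<Rightarrow> ('r, 'b \<Rightarrow> 'r) module"
  where "free_module R X =
    \<lparr>carrier = {f. range f \<subseteq> carrier R \<and> finite {x. f x \<noteq> \<zero>\<^bsub>R\<^esub>} \<and> {x. f x \<noteq> \<zero>\<^bsub>R\<^esub>} \<subseteq> X},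
     monoid.mult = undefined, one = undefined,
     zero = (\<lambda>x. \<zero>\<^bsub>R\<^esub>),
     add = (\<lambda>f g x. f x \<oplus>\<^bsub>R\<^esub> g x),
     smult = (\<lambda>r f x. r \<otimes>\<^bsub>R\<^esub> f x)\<rparr>"

definition basis_vector :: "('r, 'x) ring_scheme \<Rightarrow> 'b \<Rightarrow> 'b \<Rightarrow> 'r"
  where "basis_vector R x = (\<lambda>y. if y = x then \<one>\<^bsub>R\<^esub> else \<zero>\<^bsub>R\<^esub>)"

definition formal_sum :: "('r, 'x) ring_scheme \<Rightarrow> ('r \<times> 'b) list \<Rightarrow> 'b \<Rightarrow> 'r"
  where "formal_sum R l = (\<lambda>y. foldr (\<lambda>(r, x) c. if x = y then r \<oplus>\<^bsub>R\<^esub> c else c) l \<zero>\<^bsub>R\<^esub>)"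

text \<open>The linear map from a free module to $W$ that maps the basis element $x$ to $g(x)$.\<close>

definition linear_extension ::
    "('r, 'x) ring_scheme \<Rightarrow> ('r, 'a) module \<Rightarrow> ('b \<Rightarrow> 'a) \<Rightarrow> ('b \<Rightarrow> 'r) \<Rightarrow> 'a"
  where "linear_extension R W g f = (\<Oplus>\<^bsub>W\<^esub>x\<in>{x. f x \<noteq> \<zero>\<^bsub>R\<^esub>}. f x \<odot>\<^bsub>W\<^esub> g x)"

definition res_augmentation ::
    "('r, 'x) ring_scheme \<Rightarrow> ('r, 'a) module \<Rightarrow> (('r, 'a) resgen \<Rightarrow> 'r) \<Rightarrow> 'a"
  where "res_augmentation R A =
    linear_extension R A (\<lambda>x. case x of Gen a \<Rightarrow> a | Syz l \<Rightarrow> \<zero>\<^bsub>A\<^esub>)"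

definition res_differential ::
    "('r, 'x) ring_scheme \<Rightarrow> (('r, 'a) resgen \<Rightarrow> 'r) \<Rightarrow> (('r, 'a) resgen \<Rightarrow> 'r)"
  where "res_differential R =
    linear_extension R (free_module R UNIV)
      (\<lambda>x. case x of Gen a \<Rightarrow> \<zero>\<^bsub>free_module R UNIV\<^esub> | Syz l \<Rightarrow> formal_sum R l)"

primrec res_basis :: "('r, 'x) ring_scheme \<Rightarrow> ('r, 'a) module \<Rightarrow> nat \<Rightarrow> ('r, 'a) resgen set"
  where
    "res_basis R A 0 = Gen ` carrier A"
  | "res_basis R A (Suc n) =
      Syz ` {l \<in> lists (carrier R \<times> res_basis R A n).
        if n = 0 then res_augmentation R A (formal_sum R l) = \<zero>\<^bsub>A\<^esub>
        else res_differential R (formal_sum R l) = \<zero>\<^bsub>free_module R UNIV\<^esub>}"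

definition res_module ::
    "('r, 'x) ring_scheme \<Rightarrow> ('r, 'a) module \<Rightarrow> nat \<Rightarrow> ('r, ('r, 'a) resgen \<Rightarrow> 'r) module"
  where "res_module R A n = free_module R (res_basis R A n)"

text \<open>The chain map between the standard resolutions induced by a homomorphism $f$.\<close>

definition res_map ::
    "('r, 'x) ring_scheme \<Rightarrow> ('a \<Rightarrow> 'b) \<Rightarrow> (('r, 'a) resgen \<Rightarrow> 'r) \<Rightarrow> (('r, 'b) resgen \<Rightarrow> 'r)"
  where "res_map R f =
    linear_extension R (free_module R UNIV) (\<lambda>x. basis_vector R (map_resgen id f x))"


section \<open>Ext\<close>

definition ext_cochains ::
    "('r, 'x) ring_scheme \<Rightarrow> nat \<Rightarrow> ('r, 'a) module \<Rightarrow> ('r, 'b) module \<Rightarrow>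
      ('r, (('r, 'a) resgen \<Rightarrow> 'r) \<Rightarrow> 'b) module"
  where "ext_cochains R n A B = hom_module R (res_module R A n) B"

definition ext_coboundary ::
    "('r, 'x) ring_scheme \<Rightarrow> nat \<Rightarrow> ('r, 'a) module \<Rightarrow>
      ((('r, 'a) resgen \<Rightarrow> 'r) \<Rightarrow> 'b) \<Rightarrow> (('r, 'a) resgen \<Rightarrow> 'r) \<Rightarrow> 'b"
  where "ext_coboundary R n A h =
    (\<lambda>x\<in>carrier (res_module R A (Suc n)). h (res_differential R x))"

definition ext_cocycles ::
    "('r, 'x) ring_scheme \<Rightarrow> nat \<Rightarrow> ('r, 'a) module \<Rightarrow> ('r, 'b) module \<Rightarrow>
      ((('r, 'a) resgen \<Rightarrow> 'r) \<Rightarrow> 'b) set"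
  where "ext_cocycles R n A B =
    {h \<in> carrier (ext_cochains R n A B).
      ext_coboundary R n A h = \<zero>\<^bsub>ext_cochains R (Suc n) A B\<^esub>}"

definition ext_coboundaries ::
    "('r, 'x) ring_scheme \<Rightarrow> nat \<Rightarrow> ('r, 'a) module \<Rightarrow> ('r, 'b) module \<Rightarrow>
      ((('r, 'a) resgen \<Rightarrow> 'r) \<Rightarrow> 'b) set"
  where "ext_coboundaries R n A B =
    (case n of 0 \<Rightarrow> {\<zero>\<^bsub>ext_cochains R 0 A B\<^esub>}
     | Suc m \<Rightarrow> ext_coboundary R m A ` carrier (ext_cochains R m A B))"

definition Ext ::
    "('r, 'x) ring_scheme \<Rightarrow> nat \<Rightarrow> ('r, 'a) module \<Rightarrow> ('r, 'b) module \<Rightarrow>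
      ('r, ((('r, 'a) resgen \<Rightarrow> 'r) \<Rightarrow> 'b) set) module"
  where "Ext R n A B =
    quotient_module (ext_cochains R n A B\<lparr>carrier := ext_cocycles R n A B\<rparr>)
      (ext_coboundaries R n A B)"

text \<open>The map $\mathrm{Ext}^n(A', B) \to \mathrm{Ext}^n(A, B)$ induced by $f : A \to A'$.\<close>

definition Ext_map ::
    "('r, 'x) ring_scheme \<Rightarrow> nat \<Rightarrow> ('r, 'a) module \<Rightarrow> ('a \<Rightarrow> 'c) \<Rightarrow> ('r, 'b) module \<Rightarrow>
      ((('r, 'c) resgen \<Rightarrow> 'r) \<Rightarrow> 'b) set \<Rightarrow> ((('r, 'a) resgen \<Rightarrow> 'r) \<Rightarrow> 'b) set"
  where "Ext_map R n A f B X =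
    (\<Union>h\<in>X. ext_coboundaries R n A B +>\<^bsub>ext_cochains R n A B\<^esub>
      (\<lambda>x\<in>carrier (res_module R A n). h (res_map R f x)))"


section \<open>Direct limits and local cohomology\<close>

text \<open>Direct limit of a sequence $G_0 \to G_1 \to \cdots$ with maps $\phi_n : G_n \to G_{n+1}$:
  the disjoint union of the $G_n$ modulo eventual equality.\<close>

definition transition :: "(nat \<Rightarrow> 'a \<Rightarrow> 'a) \<Rightarrow> nat \<Rightarrow> nat \<Rightarrow> 'a \<Rightarrow> 'a"
  where "transition \<phi> m k = fold \<phi> [m..<k]"

definition limit_class ::
    "(nat \<Rightarrow> ('r, 'a) module) \<Rightarrow> (nat \<Rightarrow> 'a \<Rightarrow> 'a) \<Rightarrow> nat \<Rightarrow> 'a \<Rightarrow> (nat \<times> 'a) set"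
  where "limit_class G \<phi> n x =
    {(m, y). y \<in> carrier (G m) \<and> (\<exists>k\<ge>max m n. transition \<phi> m k y = transition \<phi> n k x)}"

definition direct_limit ::
    "(nat \<Rightarrow> ('r, 'a) module) \<Rightarrow> (nat \<Rightarrow> 'a \<Rightarrow> 'a) \<Rightarrow> ('r, (nat \<times> 'a) set) module"
  where "direct_limit G \<phi> =
    \<lparr>carrier = {limit_class G \<phi> n x | n x. x \<in> carrier (G n)},
     monoid.mult = undefined, one = undefined,
     zero = limit_class G \<phi> 0 \<zero>\<^bsub>G 0\<^esub>,
     add = (\<lambda>X Y. \<Union>(m, x)\<in>X. \<Union>(n, y)\<in>Y. limit_class G \<phi> (max m n)
       (transition \<phi> m (max m n) x \<oplus>\<^bsub>G (max m n)\<^esub> transition \<phi> n (max m n) y)),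
     smult = (\<lambda>r X. \<Union>(m, x)\<in>X. limit_class G \<phi> m (r \<odot>\<^bsub>G m\<^esub> x))\<rparr>"

definition power_submodule ::
    "('r, 'x) ring_scheme \<Rightarrow> 'r set \<Rightarrow> ('r, 'a) module \<Rightarrow> nat \<Rightarrow> 'a set"
  where "power_submodule R I M n = ideal_smult M (I [^]\<^bsub>ideals_set R\<^esub> n)"

definition power_quotient ::
    "('r, 'x) ring_scheme \<Rightarrow> 'r set \<Rightarrow> ('r, 'a) module \<Rightarrow> nat \<Rightarrow> ('r, 'a set) module"
  where "power_quotient R I M n = quotient_module M (power_submodule R I M n)"

text \<open>The natural surjection $M/I^{n+1}M \to M/I^nM$.\<close>

definition power_projection ::
    "('r, 'x) ring_scheme \<Rightarrow> 'r set \<Rightarrow> ('r, 'a) module \<Rightarrow> nat \<Rightarrow> 'a set \<Rightarrow> 'a set"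
  where "power_projection R I M n X = (\<Union>x\<in>X. power_submodule R I M n +>\<^bsub>M\<^esub> x)"

definition gen_local_cohomology ::
    "('r, 'x) ring_scheme \<Rightarrow> 'r set \<Rightarrow> nat \<Rightarrow> ('r, 'm) module \<Rightarrow> ('r, 'n) module \<Rightarrow>
      ('r, (nat \<times> ((('r, 'm set) resgen \<Rightarrow> 'r) \<Rightarrow> 'n) set) set) module"
  where "gen_local_cohomology R I i M N =
    direct_limit (\<lambda>n. Ext R i (power_quotient R I M n) N)
      (\<lambda>n. Ext_map R i (power_quotient R I M (Suc n)) (power_projection R I M n) N)"

definition local_cohomology ::
    "('r, 'x) ring_scheme \<Rightarrow> 'r set \<Rightarrow> nat \<Rightarrow> ('r, 'n) module \<Rightarrow>
      ('r, (nat \<times> ((('r, 'r set) resgen \<Rightarrow> 'r) \<Rightarrow> 'n) set) set) module"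
  where "local_cohomology R I i N = gen_local_cohomology R I i (ring_as_module R) N"

definition weakly_cofinite :: "('r, 'x) ring_scheme \<Rightarrow> 'r set \<Rightarrow> ('r, 'a) module \<Rightarrow> bool"
  where "weakly_cofinite R I W \<longleftrightarrow>
    Supp R W \<subseteq> zero_locus R I \<and>
    (\<forall>i. weakly_laskerian R (Ext R i (quotient_module (ring_as_module R) I) W))"


section \<open>Injective modules and resolutions\<close>

definition extension_property ::
    "('r, 'x) ring_scheme \<Rightarrow> ('r, 'a) module \<Rightarrow> ('r, 'b) module \<Rightarrow> ('r, 'e) module \<Rightarrow> bool"
  where "extension_property R A B E \<longleftrightarrow>
    (\<forall>i\<in>module_homs R A B. inj_on i (carrier A) \<longrightarrow>
      (\<forall>f\<in>module_homs R A E. \<exists>g\<in>module_homs R B E. \<forall>x\<in>carrier A. g (i x) = f x))"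

text \<open>A definition cannot quantify over types, so the test modules $A$ and $B$ have their elements
  in the type of the ring. This is no restriction: \<open>injective_module_extension\<close> below derives the
  extension property for modules over arbitrary types.\<close>

definition injective_module :: "('r, 'x) ring_scheme \<Rightarrow> ('r, 'e) module \<Rightarrow> bool"
  where "injective_module R E \<longleftrightarrow> module R E \<and>
    (\<forall>(A :: ('r, 'r) module) (B :: ('r, 'r) module).
      module R A \<longrightarrow> module R B \<longrightarrow> extension_property R A B E)"

definition injective_resolution ::
    "('r, 'x) ring_scheme \<Rightarrow> ('r, 'n) module \<Rightarrow> ('n \<Rightarrow> 'e) \<Rightarrow> (nat \<Rightarrow> ('r, 'e) module) \<Rightarrow>
      (nat \<Rightarrow> 'e \<Rightarrow> 'e) \<Rightarrow> bool"
  where "injective_resolution R N \<epsilon> E d \<longleftrightarrow>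
    (\<forall>i. injective_module R (E i)) \<and>
    \<epsilon> \<in> module_homs R N (E 0) \<and> (\<forall>i. d i \<in> module_homs R (E i) (E (Suc i))) \<and>
    inj_on \<epsilon> (carrier N) \<and>
    a_kernel (E 0) (E 1) (d 0) = \<epsilon> ` carrier N \<and>
    (\<forall>i. a_kernel (E (Suc i)) (E (Suc (Suc i))) (d (Suc i)) = d i ` carrier (E i))"

text \<open>The type argument is the type in which the terms of the injective resolution live.\<close>

definition cohomologically_injective ::
    "'e itself \<Rightarrow> ('r, 'x) ring_scheme \<Rightarrow> 'r set \<Rightarrow> ('r, 'm) module \<Rightarrow> ('r, 'n) module \<Rightarrow> bool"
  where "cohomologically_injective _ R I M N \<longleftrightarrow>
    (\<exists>\<epsilon> (E :: nat \<Rightarrow> ('r, 'e) module) d. injective_resolution R N \<epsilon> E d \<and>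
      (\<forall>i. injective_module R (local_cohomology R I 0 (hom_module R M (E i)))))"


section \<open>Injective modules extend along arbitrary monomorphisms\<close>

text \<open>Baer's argument: only ideals of $R$ (as submodules of $R$) are used as test modules.\<close>

lemma ring_as_module_simps [simp]:
  "carrier (ring_as_module R) = carrier R" "zero (ring_as_module R) = zero R"
  "add (ring_as_module R) = add R" "smult (ring_as_module R) = monoid.mult R"
  by (simp_all add: ring_as_module_def)

lemma (in cring) module_ring_as_module: "module R (ring_as_module R)"
proof (intro moduleI)
  show "abelian_group (ring_as_module R)"
    by (rule abelian_groupI)
      (auto simp: a_ac intro: bexI[where x = "\<ominus> _"] l_neg)
qed (auto simp: l_distr r_distr m_assoc is_cring)

lemma injective_module_extension:
  fixes R :: "('r, 'x) ring_scheme" and E :: "('r, 'e) module"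
    and A :: "('r, 'a) module" and B :: "('r, 'b) module"
  assumes inj: "injective_module R E" and "module R A" and "module R B"
  shows "extension_property R A B E"
  unfolding extension_property_def
proof (intro ballI impI)
  fix i f assume i: "i \<in> module_homs R A B" and inji: "inj_on i (carrier A)"
    and f: "f \<in> module_homs R A E"
  interpret A: module R A by fact
  interpret B: module R B by fact
  interpret E: module R E using inj by (simp add: injective_module_def)
  interpret RM: module R "ring_as_module R" by (rule A.R.module_ring_as_module)
  let ?G0 = "(\<lambda>a. (i a, f a)) ` carrier A"
  define Gs where "Gs = {G. G \<subseteq> carrier B \<times> carrier E \<and> ?G0 \<subseteq> G \<and>
     (\<forall>x y x' y'. (x, y) \<in> G \<longrightarrow> (x', y') \<in> G \<longrightarrow> (x \<oplus>\<^bsub>B\<^esub> x', y \<oplus>\<^bsub>E\<^esub> y') \<in> G) \<and>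
     (\<forall>r x y. r \<in> carrier R \<longrightarrow> (x, y) \<in> G \<longrightarrow> (r \<odot>\<^bsub>B\<^esub> x, r \<odot>\<^bsub>E\<^esub> y) \<in> G) \<and>
     (\<forall>y. (\<zero>\<^bsub>B\<^esub>, y) \<in> G \<longrightarrow> y = \<zero>\<^bsub>E\<^esub>)}"
  have i_c: "i a \<in> carrier B" and f_c: "f a \<in> carrier E" if "a \<in> carrier A" for a
    using i f that by (auto simp: module_homs_def)
  have i_add: "i (a \<oplus>\<^bsub>A\<^esub> b) = i a \<oplus>\<^bsub>B\<^esub> i b" and f_add: "f (a \<oplus>\<^bsub>A\<^esub> b) = f a \<oplus>\<^bsub>E\<^esub> f b"
    if "a \<in> carrier A" "b \<in> carrier A" for a b
    using i f that by (auto simp: module_homs_def)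
  have i_sm: "i (r \<odot>\<^bsub>A\<^esub> a) = r \<odot>\<^bsub>B\<^esub> i a" and f_sm: "f (r \<odot>\<^bsub>A\<^esub> a) = r \<odot>\<^bsub>E\<^esub> f a"
    if "r \<in> carrier R" "a \<in> carrier A" for r a
    using i f that by (auto simp: module_homs_def)
  have i0: "i \<zero>\<^bsub>A\<^esub> = \<zero>\<^bsub>B\<^esub>" and f0: "f \<zero>\<^bsub>A\<^esub> = \<zero>\<^bsub>E\<^esub>"
    using i_sm[of "\<zero>\<^bsub>R\<^esub>" "\<zero>\<^bsub>A\<^esub>"] f_sm[of "\<zero>\<^bsub>R\<^esub>" "\<zero>\<^bsub>A\<^esub>"] i_c f_c by auto
  have "?G0 \<in> Gs"
    unfolding Gs_def
  proof (intro CollectI conjI allI impI)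
    show "?G0 \<subseteq> carrier B \<times> carrier E" using i_c f_c by auto
  next
    fix x y x' y' assume "(x, y) \<in> ?G0" "(x', y') \<in> ?G0"
    then obtain a b where "a \<in> carrier A" "b \<in> carrier A" "x = i a" "y = f a" "x' = i b" "y' = f b"
      by auto
    then show "(x \<oplus>\<^bsub>B\<^esub> x', y \<oplus>\<^bsub>E\<^esub> y') \<in> ?G0"
      by (intro image_eqI[of _ _ "a \<oplus>\<^bsub>A\<^esub> b"]) (auto simp: i_add f_add)
  next
    fix r x y assume "r \<in> carrier R" "(x, y) \<in> ?G0"
    then obtain a where "a \<in> carrier A" "x = i a" "y = f a" by auto
    then show "(r \<odot>\<^bsub>B\<^esub> x, r \<odot>\<^bsub>E\<^esub> y) \<in> ?G0" using \<open>r \<in> carrier R\<close>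
      by (intro image_eqI[of _ _ "r \<odot>\<^bsub>A\<^esub> a"]) (auto simp: i_sm f_sm)
  next
    fix y assume "(\<zero>\<^bsub>B\<^esub>, y) \<in> ?G0"
    then obtain a where "a \<in> carrier A" "i a = i \<zero>\<^bsub>A\<^esub>" "y = f a" by (auto simp: i0)
    then show "y = \<zero>\<^bsub>E\<^esub>" using inji f0 by (auto dest: inj_onD)
  qed auto
  moreover have "\<Union>C \<in> Gs" if "C \<noteq> {}" "subset.chain Gs C" for C
  proof -
    have CG: "C \<subseteq> Gs" using that(2) by (auto simp: subset.chain_def)
    have pair: "\<exists>G\<in>C. p \<in> G \<and> q \<in> G" if pq: "p \<in> \<Union>C" "q \<in> \<Union>C" for p q
    proof -
      obtain G H where GH: "G \<in> C" "H \<in> C" "p \<in> G" "q \<in> H" using pq by blast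
      then have "G \<subseteq> H \<or> H \<subseteq> G"
        using \<open>subset.chain Gs C\<close> unfolding subset_chain_def by blast
      with GH show ?thesis by blast
    qed
    show ?thesis unfolding Gs_def
    proof (intro CollectI conjI allI impI)
      show "\<Union>C \<subseteq> carrier B \<times> carrier E" using CG by (auto simp: Gs_def)
      show "?G0 \<subseteq> \<Union>C" using CG \<open>C \<noteq> {}\<close> by (fastforce simp: Gs_def)
    next
      fix x y x' y' assume "(x, y) \<in> \<Union>C" "(x', y') \<in> \<Union>C"
      from pair[OF this] obtain G where G: "G \<in> C" "(x, y) \<in> G" "(x', y') \<in> G" by blast
      then have "G \<in> Gs" using CG by blast
      then have "(x \<oplus>\<^bsub>B\<^esub> x', y \<oplus>\<^bsub>E\<^esub> y') \<in> G" using G(2,3) by (simp add: Gs_def)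
      then show "(x \<oplus>\<^bsub>B\<^esub> x', y \<oplus>\<^bsub>E\<^esub> y') \<in> \<Union>C" using G(1) by blast
    next
      fix r x y assume r: "r \<in> carrier R" and "(x, y) \<in> \<Union>C"
      then obtain G where G: "G \<in> C" "(x, y) \<in> G" by blast
      then have "G \<in> Gs" using CG by blast
      then have "(r \<odot>\<^bsub>B\<^esub> x, r \<odot>\<^bsub>E\<^esub> y) \<in> G" using G(2) r by (simp add: Gs_def)
      then show "(r \<odot>\<^bsub>B\<^esub> x, r \<odot>\<^bsub>E\<^esub> y) \<in> \<Union>C" using G(1) by blast
    next
      fix y assume "(\<zero>\<^bsub>B\<^esub>, y) \<in> \<Union>C"
      then obtain G where G: "G \<in> C" "(\<zero>\<^bsub>B\<^esub>, y) \<in> G" by blast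
      then have "G \<in> Gs" using CG by blast
      then show "y = \<zero>\<^bsub>E\<^esub>" using G(2) by (simp add: Gs_def)
    qed
  qed
  ultimately obtain G where G: "G \<in> Gs" and max: "\<And>H. H \<in> Gs \<Longrightarrow> G \<subseteq> H \<Longrightarrow> H = G"
    using subset_Zorn_nonempty[of Gs] by blast
  have G_c: "x \<in> carrier B" "y \<in> carrier E" if "(x, y) \<in> G" for x y
    using G that by (auto simp: Gs_def)
  have G_0: "?G0 \<subseteq> G" using G by (auto simp: Gs_def)
  have G_add: "(x \<oplus>\<^bsub>B\<^esub> x', y \<oplus>\<^bsub>E\<^esub> y') \<in> G" if "(x, y) \<in> G" "(x', y') \<in> G" for x y x' y'
    using G that by (auto simp: Gs_def)
  have G_sm: "(r \<odot>\<^bsub>B\<^esub> x, r \<odot>\<^bsub>E\<^esub> y) \<in> G" if "r \<in> carrier R" "(x, y) \<in> G" for r x y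
    using G that by (auto simp: Gs_def)
  have G_z: "y = \<zero>\<^bsub>E\<^esub>" if "(\<zero>\<^bsub>B\<^esub>, y) \<in> G" for y
    using G that by (auto simp: Gs_def)
  have G_neg: "(\<ominus>\<^bsub>B\<^esub> x, \<ominus>\<^bsub>E\<^esub> y) \<in> G" if "(x, y) \<in> G" for x y
    using G_sm[OF _ that, of "\<ominus>\<^bsub>R\<^esub> \<one>\<^bsub>R\<^esub>"] G_c[OF that]
    by (simp add: B.smult_l_minus E.smult_l_minus)
  have G_zz: "(\<zero>\<^bsub>B\<^esub>, \<zero>\<^bsub>E\<^esub>) \<in> G"
    using subsetD[OF G_0, OF imageI[OF A.M.zero_closed]] by (simp add: i0 f0)
  have G_u: "y = y'" if "(x, y) \<in> G" "(x, y') \<in> G" for x y y'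
  proof -
    have "(\<zero>\<^bsub>B\<^esub>, y \<oplus>\<^bsub>E\<^esub> \<ominus>\<^bsub>E\<^esub> y') \<in> G"
      using G_add[OF that(1) G_neg[OF that(2)]] G_c[OF that(1)] by (simp add: B.M.r_neg)
    then have "y \<oplus>\<^bsub>E\<^esub> \<ominus>\<^bsub>E\<^esub> y' = \<zero>\<^bsub>E\<^esub>" by (rule G_z)
    then show ?thesis using G_c[OF that(1)] G_c[OF that(2)]
      using E.M.minus_equality[of y "\<ominus>\<^bsub>E\<^esub> y'"] by simp
  qed
  have dom: "\<exists>y. (b, y) \<in> G" if b: "b \<in> carrier B" for b
  proof -
    define J where "J = {r \<in> carrier R. \<exists>y. (r \<odot>\<^bsub>B\<^esub> b, y) \<in> G}"
    have J: "submodule J R (ring_as_module R)"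
    proof (rule RM.submoduleI)
      show "\<zero>\<^bsub>ring_as_module R\<^esub> \<in> J" using G_zz b by (auto simp: J_def)
      fix r assume r: "r \<in> J"
      have "\<ominus>\<^bsub>ring_as_module R\<^esub> r = \<ominus>\<^bsub>R\<^esub> r" 
        using r by (intro RM.M.minus_equality) (auto simp: J_def A.R.l_neg)
      then show "\<ominus>\<^bsub>ring_as_module R\<^esub> r \<in> J" using r b G_neg by (auto simp: J_def B.smult_l_minus)
    next
      fix r s assume "r \<in> J" "s \<in> J"
      then show "r \<oplus>\<^bsub>ring_as_module R\<^esub> s \<in> J" using b G_add
        by (auto simp: J_def B.smult_l_distr) blast
    next
      fix r s assume "r \<in> carrier R" "s \<in> J"
      then show "r \<odot>\<^bsub>ring_as_module R\<^esub> s \<in> J" using b G_sm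
        by (auto simp: J_def B.smult_assoc1)
    qed (auto simp: J_def)
    let ?J = "(ring_as_module R)\<lparr>carrier := J\<rparr>"
    define h where "h r = (THE y. (r \<odot>\<^bsub>B\<^esub> b, y) \<in> G)" for r
    have h: "h r = y" if "(r \<odot>\<^bsub>B\<^esub> b, y) \<in> G" for r y
      unfolding h_def using that G_u by blast
    have "h \<in> module_homs R ?J E"
      unfolding module_homs_def
    proof (intro CollectI conjI ballI Pi_I)
      fix r assume "r \<in> carrier ?J"
      then obtain y where "(r \<odot>\<^bsub>B\<^esub> b, y) \<in> G" by (auto simp: J_def)
      then show "h r \<in> carrier E" using h G_c by auto
    next
      fix r s assume "r \<in> carrier ?J" "s \<in> carrier ?J"
      then obtain y z where yz: "r \<in> carrier R" "s \<in> carrier R" "(r \<odot>\<^bsub>B\<^esub> b, y) \<in> G" "(s \<odot>\<^bsub>B\<^esub> b, z) \<in> G"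
        by (auto simp: J_def)
      from G_add[OF yz(3,4)] yz b have "((r \<oplus>\<^bsub>R\<^esub> s) \<odot>\<^bsub>B\<^esub> b, y \<oplus>\<^bsub>E\<^esub> z) \<in> G"
        by (simp add: B.smult_l_distr)
      then show "h (r \<oplus>\<^bsub>?J\<^esub> s) = h r \<oplus>\<^bsub>E\<^esub> h s" using h yz by simp
    next
      fix r s assume "r \<in> carrier R" "s \<in> carrier ?J"
      then obtain z where yz: "r \<in> carrier R" "s \<in> carrier R" "(s \<odot>\<^bsub>B\<^esub> b, z) \<in> G"
        by (auto simp: J_def)
      from G_sm[OF yz(1,3)] yz b have "((r \<otimes>\<^bsub>R\<^esub> s) \<odot>\<^bsub>B\<^esub> b, r \<odot>\<^bsub>E\<^esub> z) \<in> G"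
        by (simp add: B.smult_assoc1)
      then show "h (r \<odot>\<^bsub>?J\<^esub> s) = r \<odot>\<^bsub>E\<^esub> h s" using h yz by simp
    qed
    moreover have "extension_property R ?J (ring_as_module R) E"
      using inj submodule.submodule_is_module[OF J RM.module_axioms] RM.module_axioms
      by (simp add: injective_module_def)
    moreover have "id \<in> module_homs R ?J (ring_as_module R)"
      by (auto simp: module_homs_def J_def)
    ultimately obtain g where g: "g \<in> module_homs R (ring_as_module R) E" "\<forall>r\<in>J. g r = h r"
      unfolding extension_property_def by fastforce
    define e where "e = g \<one>\<^bsub>R\<^esub>"
    have e: "e \<in> carrier E" using g by (auto simp: module_homs_def e_def)
    have ge: "g r = r \<odot>\<^bsub>E\<^esub> e" if "r \<in> carrier R" for r
    proof -
      have "g (r \<odot>\<^bsub>ring_as_module R\<^esub> \<one>\<^bsub>R\<^esub>) = r \<odot>\<^bsub>E\<^esub> g \<one>\<^bsub>R\<^esub>"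
        using g(1) that A.R.one_closed by (simp add: module_homs_def del: A.R.r_one A.R.one_closed)
      then show ?thesis using that by (simp add: e_def)
    qed
    define H where "H = {(x \<oplus>\<^bsub>B\<^esub> r \<odot>\<^bsub>B\<^esub> b, y \<oplus>\<^bsub>E\<^esub> r \<odot>\<^bsub>E\<^esub> e) | x y r. (x, y) \<in> G \<and> r \<in> carrier R}"
    have HI: "(u, v) \<in> H" if "(x, y) \<in> G" "r \<in> carrier R" "u = x \<oplus>\<^bsub>B\<^esub> r \<odot>\<^bsub>B\<^esub> b" "v = y \<oplus>\<^bsub>E\<^esub> r \<odot>\<^bsub>E\<^esub> e"
      for u v x y r using that by (auto simp: H_def)
    have GH: "G \<subseteq> H"
      using HI[where r = "\<zero>\<^bsub>R\<^esub>"] G_c b e by auto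
    have "H \<in> Gs"
      unfolding Gs_def
    proof (intro CollectI conjI allI impI)
      show "H \<subseteq> carrier B \<times> carrier E" using G_c b e by (auto simp: H_def)
      show "?G0 \<subseteq> H" using G_0 GH by blast
    next
      fix u v u' v' assume "(u, v) \<in> H" "(u', v') \<in> H"
      then obtain x y r x' y' r' where *: "(x, y) \<in> G" "(x', y') \<in> G" "r \<in> carrier R" "r' \<in> carrier R"
        "u = x \<oplus>\<^bsub>B\<^esub> r \<odot>\<^bsub>B\<^esub> b" "v = y \<oplus>\<^bsub>E\<^esub> r \<odot>\<^bsub>E\<^esub> e" "u' = x' \<oplus>\<^bsub>B\<^esub> r' \<odot>\<^bsub>B\<^esub> b" "v' = y' \<oplus>\<^bsub>E\<^esub> r' \<odot>\<^bsub>E\<^esub> e"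
        by (auto simp: H_def)
      show "(u \<oplus>\<^bsub>B\<^esub> u', v \<oplus>\<^bsub>E\<^esub> v') \<in> H"
        using * b e G_c[OF *(1)] G_c[OF *(2)]
        by (intro HI[OF G_add[OF *(1,2)], of "r \<oplus>\<^bsub>R\<^esub> r'"])
          (auto simp: B.smult_l_distr E.smult_l_distr B.M.a_ac E.M.a_ac)
    next
      fix r' u v assume r': "r' \<in> carrier R" and "(u, v) \<in> H"
      then obtain x y r where *: "(x, y) \<in> G" "r \<in> carrier R"
        "u = x \<oplus>\<^bsub>B\<^esub> r \<odot>\<^bsub>B\<^esub> b" "v = y \<oplus>\<^bsub>E\<^esub> r \<odot>\<^bsub>E\<^esub> e"
        by (auto simp: H_def)
      show "(r' \<odot>\<^bsub>B\<^esub> u, r' \<odot>\<^bsub>E\<^esub> v) \<in> H"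
        using * r' b e G_c[OF *(1)]
        by (intro HI[OF G_sm[OF r' *(1)], of "r' \<otimes>\<^bsub>R\<^esub> r"])
          (auto simp: B.smult_r_distr E.smult_r_distr B.smult_assoc1 E.smult_assoc1)
    next
      fix v assume "(\<zero>\<^bsub>B\<^esub>, v) \<in> H"
      then obtain x y r where *: "(x, y) \<in> G" "r \<in> carrier R"
        "\<zero>\<^bsub>B\<^esub> = x \<oplus>\<^bsub>B\<^esub> r \<odot>\<^bsub>B\<^esub> b" "v = y \<oplus>\<^bsub>E\<^esub> r \<odot>\<^bsub>E\<^esub> e"
        by (auto simp: H_def)
      have "r \<odot>\<^bsub>B\<^esub> b = \<ominus>\<^bsub>B\<^esub> x"
        using *(2,3) b G_c[OF *(1)]
        by (metis B.M.a_comm B.M.minus_equality B.smult_closed)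
      then have n: "(r \<odot>\<^bsub>B\<^esub> b, \<ominus>\<^bsub>E\<^esub> y) \<in> G" using G_neg[OF *(1)] by simp
      then have "r \<in> J" using *(2) by (auto simp: J_def)
      then have "r \<odot>\<^bsub>E\<^esub> e = \<ominus>\<^bsub>E\<^esub> y" using g(2) ge[OF *(2)] h[OF n] by simp
      then show "v = \<zero>\<^bsub>E\<^esub>" using * G_c[OF *(1)] by (simp add: E.M.r_neg)
    qed
    then have "H = G" using max GH by blast
    moreover have "(b, e) \<in> H" using HI[OF G_zz, of "\<one>\<^bsub>R\<^esub>"] b e by simp
    ultimately show ?thesis by blast
  qed
  define g where "g b = (THE y. (b, y) \<in> G)" for b
  have gG: "(b, g b) \<in> G" if b: "b \<in> carrier B" for b
    unfolding g_def using dom[OF b] G_u by (metis (no_types, lifting) theI)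
  have gu: "g b = y" if "(b, y) \<in> G" for b y
    using that gG G_c G_u by blast
  have "g \<in> module_homs R B E"
    unfolding module_homs_def
    using gG G_c(2)[OF gG] gu[OF G_add[OF gG gG]] gu[OF G_sm[OF _ gG]] by auto
  moreover have "g (i a) = f a" if "a \<in> carrier A" for a
    using that G_0 by (auto intro: gu)
  ultimately show "\<exists>g\<in>module_homs R B E. \<forall>x\<in>carrier A. g (i x) = f x" by blast
qed


section \<open>Exactness and functoriality of the standard resolution\<close>

lemma free_module_simps [simp]:
  "zero (free_module R X) = (\<lambda>x. \<zero>\<^bsub>R\<^esub>)"
  "add (free_module R X) = (\<lambda>f g x. f x \<oplus>\<^bsub>R\<^esub> g x)"
  "smult (free_module R X) = (\<lambda>r f x. r \<otimes>\<^bsub>R\<^esub> f x)"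
  by (simp_all add: free_module_def)

lemma free_module_carrier:
  "f \<in> carrier (free_module R X) \<longleftrightarrow>
    (\<forall>x. f x \<in> carrier R) \<and> finite {x. f x \<noteq> \<zero>\<^bsub>R\<^esub>} \<and> (\<forall>x. x \<notin> X \<longrightarrow> f x = \<zero>\<^bsub>R\<^esub>)"
  by (auto simp: free_module_def)

context cring
begin

lemma module_free_module: "module R (free_module R X)"
proof (intro moduleI)
  have add: "(\<lambda>x. f x \<oplus> g x) \<in> carrier (free_module R X)"
    if "f \<in> carrier (free_module R X)" "g \<in> carrier (free_module R X)" for f g
  proof -
    have "finite ({x. f x \<noteq> \<zero>} \<union> {x. g x \<noteq> \<zero>})"
      using that by (simp add: free_module_carrier)
    moreover have "{x. f x \<oplus> g x \<noteq> \<zero>} \<subseteq> {x. f x \<noteq> \<zero>} \<union> {x. g x \<noteq> \<zero>}"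
      by auto
    ultimately have "finite {x. f x \<oplus> g x \<noteq> \<zero>}"
      by (rule rev_finite_subset)
    then show ?thesis using that by (auto simp: free_module_carrier)
  qed
  have sm: "(\<lambda>x. r \<otimes> f x) \<in> carrier (free_module R X)"
    if "r \<in> carrier R" "f \<in> carrier (free_module R X)" for r f
  proof -
    have "{x. r \<otimes> f x \<noteq> \<zero>} \<subseteq> {x. f x \<noteq> \<zero>}" using that(1) by auto
    then have "finite {x. r \<otimes> f x \<noteq> \<zero>}"
      by (rule finite_subset) (use that in \<open>simp add: free_module_carrier\<close>)
    then show ?thesis using that by (auto simp: free_module_carrier)
  qed
  show "abelian_group (free_module R X)"
  proof (rule abelian_groupI)
    fix f assume f: "f \<in> carrier (free_module R X)"
    then have "(\<lambda>x. (\<ominus> \<one>) \<otimes> f x) \<in> carrier (free_module R X)" by (intro sm) auto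
    moreover have "(\<lambda>x. (\<ominus> \<one>) \<otimes> f x \<oplus> f x) = (\<lambda>x. \<zero>)"
      using f by (auto simp: free_module_carrier l_minus l_neg)
    ultimately show "\<exists>g\<in>carrier (free_module R X). g \<oplus>\<^bsub>free_module R X\<^esub> f = \<zero>\<^bsub>free_module R X\<^esub>"
      by auto
    show "f \<oplus>\<^bsub>free_module R X\<^esub> g \<in> carrier (free_module R X)"
      if "f \<in> carrier (free_module R X)" "g \<in> carrier (free_module R X)" for f g
      using add[OF that] by simp
  qed (auto simp: free_module_carrier a_ac)
  show "r \<odot>\<^bsub>free_module R X\<^esub> f \<in> carrier (free_module R X)"
    if "r \<in> carrier R" "f \<in> carrier (free_module R X)" for r f
    using sm[OF that] by simp
qed (auto simp: free_module_carrier l_distr r_distr m_assoc is_cring)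

lemma free_module_mono: "X \<subseteq> Y \<Longrightarrow> f \<in> carrier (free_module R X) \<Longrightarrow> f \<in> carrier (free_module R Y)"
  by (auto simp: free_module_carrier)

lemma free_module_add_closed:
  "f \<in> carrier (free_module R X) \<Longrightarrow> g \<in> carrier (free_module R X) \<Longrightarrow>
    (\<lambda>x. f x \<oplus> g x) \<in> carrier (free_module R X)"
  using abelian_monoid.a_closed[of "free_module R X" f g] module_free_module[of X]
  by (simp add: module_def abelian_group_def)

lemma free_module_smult_closed:
  "r \<in> carrier R \<Longrightarrow> f \<in> carrier (free_module R X) \<Longrightarrow>
    (\<lambda>x. r \<otimes> f x) \<in> carrier (free_module R X)"
  using module.smult_closed[OF module_free_module[of X], of r f] by simp

lemma basis_vector_closed: "x \<in> X \<Longrightarrow> basis_vector R x \<in> carrier (free_module R X)"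
  by (auto simp: free_module_carrier basis_vector_def)

lemma formal_sum_Nil [simp]: "formal_sum R [] = (\<lambda>x. \<zero>)"
  by (simp add: formal_sum_def)

lemma
  assumes "l \<in> lists (carrier R \<times> X)"
  shows formal_sum_closed: "formal_sum R l \<in> carrier (free_module R X)"
    and formal_sum_Cons: "r \<in> carrier R \<Longrightarrow> x \<in> X \<Longrightarrow>
      formal_sum R ((r, x) # l) = (\<lambda>y. r \<otimes> basis_vector R x y \<oplus> formal_sum R l y)"
proof -
  have *: "formal_sum R ((r, x) # l) = (\<lambda>y. r \<otimes> basis_vector R x y \<oplus> formal_sum R l y)"
    if "formal_sum R l \<in> carrier (free_module R X)" "r \<in> carrier R" for r x l
    using that by (auto simp: formal_sum_def basis_vector_def free_module_carrier)
  show cl: "formal_sum R l \<in> carrier (free_module R X)"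
    using assms
  proof (induction l)
    case (Cons p l)
    then show ?case
      by (cases p) (auto simp: * intro!: free_module_add_closed free_module_smult_closed basis_vector_closed)
  qed (auto simp: free_module_carrier)
  then show "r \<in> carrier R \<Longrightarrow> x \<in> X \<Longrightarrow>
      formal_sum R ((r, x) # l) = (\<lambda>y. r \<otimes> basis_vector R x y \<oplus> formal_sum R l y)"
    by (rule *)
qed

lemma linear_extension_finsum:
  assumes "module R W" and g: "g \<in> X \<rightarrow> carrier W" and f: "f \<in> carrier (free_module R X)"
    and S: "finite S" "{x. f x \<noteq> \<zero>} \<subseteq> S" "S \<subseteq> X"
  shows "linear_extension R W g f = (\<Oplus>\<^bsub>W\<^esub>x\<in>S. f x \<odot>\<^bsub>W\<^esub> g x)"
proof -
  interpret W: module R W by fact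
  show ?thesis unfolding linear_extension_def
    using S f g by (intro W.M.add.finprod_mono_neutral_cong_left) (auto simp: free_module_carrier Pi_def)
qed

lemma linear_extension_hom:
  assumes "module R W" and g: "g \<in> X \<rightarrow> carrier W"
  shows "linear_extension R W g \<in> module_homs R (free_module R X) W"
  unfolding module_homs_def
proof (intro CollectI conjI ballI Pi_I)
  interpret W: module R W by fact
  interpret F: module R "free_module R X" by (rule module_free_module)
  note fs = linear_extension_finsum[OF assms]
  fix f assume f: "f \<in> carrier (free_module R X)"
  then have supp: "finite {x. f x \<noteq> \<zero>}" "{x. f x \<noteq> \<zero>} \<subseteq> X" by (auto simp: free_module_carrier)
  show "linear_extension R W g f \<in> carrier W"
    unfolding linear_extension_def
    using f g supp by (intro W.M.finsum_closed) (auto simp: free_module_carrier Pi_def)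
  show "linear_extension R W g (r \<odot>\<^bsub>free_module R X\<^esub> f) = r \<odot>\<^bsub>W\<^esub> linear_extension R W g f"
    if r: "r \<in> carrier R" for r
  proof -
    have "linear_extension R W g (\<lambda>x. r \<otimes> f x)
        = (\<Oplus>\<^bsub>W\<^esub>x\<in>{x. f x \<noteq> \<zero>}. (r \<otimes> f x) \<odot>\<^bsub>W\<^esub> g x)"
      using free_module_smult_closed[OF r f] supp r by (intro fs) auto
    also have "\<dots> = (\<Oplus>\<^bsub>W\<^esub>x\<in>{x. f x \<noteq> \<zero>}. r \<odot>\<^bsub>W\<^esub> (f x \<odot>\<^bsub>W\<^esub> g x))"
      using r f g supp
      by (intro W.M.finsum_cong') (auto simp: W.smult_assoc1 free_module_carrier Pi_def subset_iff)
    also have "\<dots> = r \<odot>\<^bsub>W\<^esub> linear_extension R W g f"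
      unfolding linear_extension_def using r f g supp
      by (subst W.finsum_smult_ldistr) (auto simp: free_module_carrier Pi_def subset_iff)
    finally show ?thesis by simp
  qed
  fix h assume h: "h \<in> carrier (free_module R X)"
  then have supph: "finite {x. h x \<noteq> \<zero>}" "{x. h x \<noteq> \<zero>} \<subseteq> X" by (auto simp: free_module_carrier)
  let ?S = "{x. f x \<noteq> \<zero>} \<union> {x. h x \<noteq> \<zero>}"
  have fc: "f x \<in> carrier R" and hc: "h x \<in> carrier R" for x
    using f h by (auto simp: free_module_carrier)
  have gS: "f x \<noteq> \<zero> \<Longrightarrow> g x \<in> carrier W" "h x \<noteq> \<zero> \<Longrightarrow> g x \<in> carrier W" for x
    using g supp supph by blast+
  have "linear_extension R W g (\<lambda>x. f x \<oplus> h x) = (\<Oplus>\<^bsub>W\<^esub>x\<in>?S. (f x \<oplus> h x) \<odot>\<^bsub>W\<^esub> g x)"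
    using free_module_add_closed[OF f h] supp supph by (intro fs) auto
  also have "\<dots> = (\<Oplus>\<^bsub>W\<^esub>x\<in>?S. f x \<odot>\<^bsub>W\<^esub> g x \<oplus>\<^bsub>W\<^esub> h x \<odot>\<^bsub>W\<^esub> g x)"
    using fc hc gS by (intro W.M.finsum_cong') (auto simp: W.smult_l_distr)
  also have "\<dots> = (\<Oplus>\<^bsub>W\<^esub>x\<in>?S. f x \<odot>\<^bsub>W\<^esub> g x) \<oplus>\<^bsub>W\<^esub> (\<Oplus>\<^bsub>W\<^esub>x\<in>?S. h x \<odot>\<^bsub>W\<^esub> g x)"
    using fc hc gS by (intro W.M.finsum_addf) (auto)
  also have "\<dots> = linear_extension R W g f \<oplus>\<^bsub>W\<^esub> linear_extension R W g h"
    using supp supph by (simp add: fs[OF f, of ?S] fs[OF h, of ?S])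
  finally show "linear_extension R W g (f \<oplus>\<^bsub>free_module R X\<^esub> h)
      = linear_extension R W g f \<oplus>\<^bsub>W\<^esub> linear_extension R W g h"
    by simp
qed

lemma linear_extension_basis_vector:
  assumes "module R W" and g: "g \<in> X \<rightarrow> carrier W" and x: "x \<in> X"
  shows "linear_extension R W g (basis_vector R x) = g x"
proof -
  interpret W: module R W by fact
  have "linear_extension R W g (basis_vector R x) = (\<Oplus>\<^bsub>W\<^esub>y\<in>{x}. basis_vector R x y \<odot>\<^bsub>W\<^esub> g y)"
    using x by (intro linear_extension_finsum[OF assms(1,2) basis_vector_closed]) (auto simp: basis_vector_def)
  also have "\<dots> = \<one> \<odot>\<^bsub>W\<^esub> g x"
    using funcset_mem[OF g x] by (subst W.M.finsum_insert) (auto simp: basis_vector_def)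
  finally show ?thesis using funcset_mem[OF g x] by simp
qed

text \<open>Every element of a free module is a formal sum.\<close>

lemma free_module_eq_formal_sum:
  assumes "f \<in> carrier (free_module R X)"
  obtains l where "l \<in> lists (carrier R \<times> X)" "f = formal_sum R l"
proof -
  have "\<exists>l\<in>lists (carrier R \<times> X). f = formal_sum R l"
    if "finite S" "{x. f x \<noteq> \<zero>} = S" "f \<in> carrier (free_module R X)" for S f
    using that
  proof (induction S arbitrary: f)
    case empty
    then show ?case by (intro bexI[of _ "[]"]) auto
  next
    case (insert x S)
    define h where "h = f(x := \<zero>)"
    have h: "h \<in> carrier (free_module R X)" and supp: "{x. h x \<noteq> \<zero>} = S"
      using insert by (auto simp: free_module_carrier h_def intro: rev_finite_subset)
    obtain l where l: "l \<in> lists (carrier R \<times> X)" "h = formal_sum R l"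
      using insert.IH[OF supp h] by blast
    have fx: "f x \<in> carrier R" "x \<in> X" using insert.prems by (auto simp: free_module_carrier)
    have "f = formal_sum R ((f x, x) # l)"
      using formal_sum_Cons[OF l(1) fx] l(2)[symmetric] insert.prems
      by (auto simp: h_def basis_vector_def free_module_carrier)
    then show ?case using l(1) fx by (intro bexI[of _ "(f x, x) # l"]) auto
  qed
  from this[OF _ refl assms] assms obtain l where "l \<in> lists (carrier R \<times> X)" "f = formal_sum R l"
    by (auto simp: free_module_carrier)
  then show ?thesis by (rule that)
qed

lemma free_module_induct [consumes 1, case_names zero add]:
  assumes "f \<in> carrier (free_module R X)" and "P (\<lambda>x. \<zero>)"
    and step: "\<And>r x f. r \<in> carrier R \<Longrightarrow> x \<in> X \<Longrightarrow> f \<in> carrier (free_module R X) \<Longrightarrow> P f \<Longrightarrow>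
      P (\<lambda>y. r \<otimes> basis_vector R x y \<oplus> f y)"
  shows "P f"
proof -
  obtain l where l: "l \<in> lists (carrier R \<times> X)" "f = formal_sum R l"
    using free_module_eq_formal_sum[OF assms(1)] .
  from l(1) have "P (formal_sum R l)"
  proof (induction l)
    case (Cons p l)
    then show ?case
      by (cases p) (auto simp: formal_sum_Cons intro!: step formal_sum_closed)
  qed (use assms(2) in simp)
  with l(2) show ?thesis by simp
qed

lemma module_homs_combination:
  assumes "\<phi> \<in> module_homs R (free_module R X) W" "r \<in> carrier R" "x \<in> X" "f \<in> carrier (free_module R X)"
  shows "\<phi> (\<lambda>y. r \<otimes> basis_vector R x y \<oplus> f y) = r \<odot>\<^bsub>W\<^esub> \<phi> (basis_vector R x) \<oplus>\<^bsub>W\<^esub> \<phi> f"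
proof -
  have "\<phi> (\<lambda>y. r \<otimes> basis_vector R x y \<oplus> f y) = \<phi> (\<lambda>y. r \<otimes> basis_vector R x y) \<oplus>\<^bsub>W\<^esub> \<phi> f"
    using assms free_module_smult_closed[OF assms(2) basis_vector_closed[OF assms(3)]]
    by (simp add: module_homs_def)
  moreover have "\<phi> (\<lambda>y. r \<otimes> basis_vector R x y) = r \<odot>\<^bsub>W\<^esub> \<phi> (basis_vector R x)"
    using assms basis_vector_closed[OF assms(3)] by (simp add: module_homs_def)
  ultimately show ?thesis by simp
qed

lemma module_homs_zero:
  assumes "module R A" "module R B" "\<phi> \<in> module_homs R A B"
  shows "\<phi> \<zero>\<^bsub>A\<^esub> = \<zero>\<^bsub>B\<^esub>"
proof -
  interpret A: module R A by fact
  interpret B: module R B by fact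
  have "\<phi> (\<zero> \<odot>\<^bsub>A\<^esub> \<zero>\<^bsub>A\<^esub>) = \<zero> \<odot>\<^bsub>B\<^esub> \<phi> \<zero>\<^bsub>A\<^esub>" "\<phi> \<zero>\<^bsub>A\<^esub> \<in> carrier B"
    using assms(3) A.M.zero_closed by (auto simp: module_homs_def simp del: A.smult_l_null A.smult_r_null)
  then show ?thesis by simp
qed

context
  fixes A :: "('a, 'm) module"
  assumes A: "module R A"
begin

lemma res_augmentation_hom: "res_augmentation R A \<in> module_homs R (res_module R A 0) A"
  unfolding res_augmentation_def res_module_def
  by (rule linear_extension_hom[OF A]) auto

lemma res_differential_gens:
  "(\<lambda>x. case x of Gen a \<Rightarrow> \<zero>\<^bsub>free_module R UNIV\<^esub> | Syz l \<Rightarrow> formal_sum R l)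
    \<in> res_basis R A (Suc n) \<rightarrow> carrier (free_module R (res_basis R A n))"
  by (auto intro: formal_sum_closed)

lemma res_differential_hom_UNIV:
  "res_differential R \<in> module_homs R (res_module R A (Suc n)) (free_module R UNIV)"
  unfolding res_differential_def res_module_def
  by (rule linear_extension_hom[OF module_free_module])
    (auto simp del: res_basis.simps free_module_simps
      intro: free_module_mono[OF subset_UNIV funcset_mem[OF res_differential_gens]])

lemma res_differential_basis_vector:
  "Syz l \<in> res_basis R A (Suc n) \<Longrightarrow> res_differential R (basis_vector R (Syz l)) = formal_sum R l"
  unfolding res_differential_def
  by (subst linear_extension_basis_vector[OF module_free_module, where X = "res_basis R A (Suc n)"])
    (auto simp del: res_basis.simps free_module_simps
      intro: free_module_mono[OF subset_UNIV funcset_mem[OF res_differential_gens]])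

lemma res_differential_hom:
  "res_differential R \<in> module_homs R (res_module R A (Suc n)) (res_module R A n)"
proof -
  have z: "res_differential R (\<lambda>x :: ('a, 'm) resgen. \<zero>) = (\<lambda>x. \<zero>)"
    using module_homs_zero[OF module_free_module module_free_module
        res_differential_hom_UNIV[of n, unfolded res_module_def]] by simp
  have "res_differential R f \<in> carrier (res_module R A n)"
    if "f \<in> carrier (res_module R A (Suc n))" for f
    using that unfolding res_module_def
  proof (induction f rule: free_module_induct)
    case zero
    then show ?case by (simp only: z) (simp add: free_module_carrier)
  next
    case (add r x f)
    then obtain l where x: "x = Syz l" and l: "l \<in> lists (carrier R \<times> res_basis R A n)" by auto
    show ?case
      using add l res_differential_basis_vector[of l n]
      by (auto simp: module_homs_combination[OF res_differential_hom_UNIV[of n, unfolded res_module_def]] x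
          intro!: free_module_add_closed free_module_smult_closed formal_sum_closed)
  qed
  then show ?thesis
    using res_differential_hom_UNIV[of n] by (auto simp: module_homs_def res_module_def)
qed

lemma res_augmentation_surj: "res_augmentation R A ` carrier (res_module R A 0) = carrier A"
proof -
  have "res_augmentation R A (basis_vector R (Gen a)) = a" if "a \<in> carrier A" for a
    unfolding res_augmentation_def using that
    by (subst linear_extension_basis_vector[OF A, where X = "Gen ` carrier A"]) auto
  moreover have "basis_vector R (Gen a) \<in> carrier (res_module R A 0)" if "a \<in> carrier A" for a
    using that by (auto simp: res_module_def intro!: basis_vector_closed)
  ultimately show ?thesis
    using res_augmentation_hom unfolding module_homs_def by (auto intro!: rev_image_eqI)
qed

lemma res_exact_aux:
  assumes "module R W" and \<phi>: "\<phi> \<in> module_homs R (res_module R A n) W"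
    and ker: "\<And>l. Syz l \<in> res_basis R A (Suc n) \<longleftrightarrow>
      l \<in> lists (carrier R \<times> res_basis R A n) \<and> \<phi> (formal_sum R l) = \<zero>\<^bsub>W\<^esub>"
  shows "res_differential R ` carrier (res_module R A (Suc n)) = a_kernel (res_module R A n) W \<phi>"
proof (intro equalityI subsetI)
  interpret W: module R W by fact
  fix v assume "v \<in> res_differential R ` carrier (res_module R A (Suc n))"
  then obtain f where f: "f \<in> carrier (free_module R (res_basis R A (Suc n)))" and v: "v = res_differential R f"
    by (auto simp: res_module_def)
  have dcl: "res_differential R g \<in> carrier (res_module R A n)" if "g \<in> carrier (res_module R A (Suc n))" for g
    using res_differential_hom[of n] that by (auto simp: module_homs_def)
  note z = module_homs_zero[OF module_free_module module_free_module
      res_differential_hom[of n, unfolded res_module_def]]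
  note z' = module_homs_zero[OF module_free_module assms(1) \<phi>[unfolded res_module_def]]
  have "\<phi> (res_differential R f) = \<zero>\<^bsub>W\<^esub>"
    using f
  proof (induction f rule: free_module_induct)
    case zero
    then show ?case using z z' by simp
  next
    case (add r x f)
    then obtain l where x: "x = Syz l" by auto
    have l: "l \<in> lists (carrier R \<times> res_basis R A n)" "\<phi> (formal_sum R l) = \<zero>\<^bsub>W\<^esub>"
      using ker[of l] add(2) x by auto
    have fs: "formal_sum R l \<in> carrier (res_module R A n)"
      using l(1) by (simp add: res_module_def formal_sum_closed)
    have "\<phi> (\<lambda>y. r \<otimes> formal_sum R l y \<oplus> res_differential R f y)
        = \<phi> ((r \<odot>\<^bsub>res_module R A n\<^esub> formal_sum R l) \<oplus>\<^bsub>res_module R A n\<^esub> res_differential R f)"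
      by (simp add: res_module_def)
    also have "\<dots> = r \<odot>\<^bsub>W\<^esub> \<phi> (formal_sum R l) \<oplus>\<^bsub>W\<^esub> \<phi> (res_differential R f)"
    proof -
      have "r \<odot>\<^bsub>res_module R A n\<^esub> formal_sum R l \<in> carrier (res_module R A n)"
        using free_module_smult_closed[OF add(1)] fs by (simp add: res_module_def)
      with \<phi> fs add(1) dcl[of f] add(3) show ?thesis
        unfolding module_homs_def by (simp add: res_module_def)
    qed
    also have "\<dots> = \<zero>\<^bsub>W\<^esub>" using l(2) add by simp
    finally show ?case
      using module_homs_combination[OF res_differential_hom[of n, unfolded res_module_def] add(1-3)]
        res_differential_basis_vector[of l n] add(2) x by simp
  qed
  then show "v \<in> a_kernel (res_module R A n) W \<phi>"
    using dcl f v by (simp add: a_kernel_def kernel_def res_module_def)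
next
  fix v assume "v \<in> a_kernel (res_module R A n) W \<phi>"
  then have v: "v \<in> carrier (free_module R (res_basis R A n))" "\<phi> v = \<zero>\<^bsub>W\<^esub>"
    by (auto simp: a_kernel_def kernel_def res_module_def)
  obtain l where l: "l \<in> lists (carrier R \<times> res_basis R A n)" "v = formal_sum R l"
    using free_module_eq_formal_sum[OF v(1)] .
  then have "Syz l \<in> res_basis R A (Suc n)" using ker v(2) by blast
  then show "v \<in> res_differential R ` carrier (res_module R A (Suc n))"
    using res_differential_basis_vector[of l n] l(2)
    by (auto simp: res_module_def simp del: res_basis.simps intro!: rev_image_eqI basis_vector_closed)
qed

lemma standard_resolution_exact:
  "res_differential R ` carrier (res_module R A 1)
    = a_kernel (res_module R A 0) A (res_augmentation R A)"
  "res_differential R ` carrier (res_module R A (Suc (Suc n)))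
    = a_kernel (res_module R A (Suc n)) (res_module R A n) (res_differential R)"
  unfolding One_nat_def
  by (rule res_exact_aux[OF A res_augmentation_hom];
      auto)
    (rule res_exact_aux[OF _ res_differential_hom];
      auto simp: res_module_def intro: module_free_module)

end

end


context cring
begin

lemma module_homs_comp:
  "\<phi> \<in> module_homs R U V \<Longrightarrow> \<psi> \<in> module_homs R V W \<Longrightarrow> \<psi> \<circ> \<phi> \<in> module_homs R U W"
  by (auto simp: module_homs_def Pi_iff)

lemma free_module_hom_eq:
  assumes "module R W" "\<phi> \<in> module_homs R (free_module R X) W" "\<psi> \<in> module_homs R (free_module R X) W"
    and "\<And>x. x \<in> X \<Longrightarrow> \<phi> (basis_vector R x) = \<psi> (basis_vector R x)"
    and "f \<in> carrier (free_module R X)"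
  shows "\<phi> f = \<psi> f"
  using assms(5)
proof (induction f rule: free_module_induct)
  case zero
  show ?case
    using module_homs_zero[OF module_free_module assms(1,2)] module_homs_zero[OF module_free_module assms(1,3)]
    by simp
next
  case (add r x f)
  then show ?case
    using assms(4) by (simp add: module_homs_combination[OF assms(2)] module_homs_combination[OF assms(3)])
qed

context
  fixes A :: "('a, 'm) module" and A' :: "('a, 'n) module" and f :: "'m \<Rightarrow> 'n"
  assumes A: "module R A" and A': "module R A'" and f: "f \<in> module_homs R A A'"
begin

lemma res_map_aux:
  assumes b: "\<And>x. x \<in> res_basis R A n \<Longrightarrow> map_resgen id f x \<in> res_basis R A' n"
  shows "res_map R f \<in> module_homs R (res_module R A n) (res_module R A' n)" (is ?hom)
    and "x \<in> res_basis R A n \<Longrightarrow> res_map R f (basis_vector R x) = basis_vector R (map_resgen id f x)"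
    and "l \<in> lists (carrier R \<times> res_basis R A n) \<Longrightarrow>
      formal_sum R (map (map_prod id (map_resgen id f)) l) = res_map R f (formal_sum R l)"
proof -
  have h: "res_map R f \<in> module_homs R (res_module R A n) (free_module R UNIV)"
    unfolding res_map_def res_module_def
    by (rule linear_extension_hom[OF module_free_module]) (simp add: basis_vector_closed)
  have e: "res_map R f (basis_vector R x) = basis_vector R (map_resgen id f x)"
    if "x \<in> res_basis R A n" for x
    unfolding res_map_def using that
    by (subst linear_extension_basis_vector[OF module_free_module]) (auto simp: basis_vector_closed)
  then show "x \<in> res_basis R A n \<Longrightarrow> res_map R f (basis_vector R x) = basis_vector R (map_resgen id f x)" .
  note h' = h[unfolded res_module_def]
  have z: "res_map R f (\<lambda>x. \<zero>) = (\<lambda>x. \<zero>)"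
    using module_homs_zero[OF module_free_module module_free_module h'] by simp
  have "res_map R f v \<in> carrier (res_module R A' n)" if "v \<in> carrier (res_module R A n)" for v
    using that unfolding res_module_def
  proof (induction v rule: free_module_induct)
    case zero
    then show ?case unfolding z by (simp add: free_module_carrier)
  next
    case (add r x v)
    then show ?case
      using module_homs_combination[OF h' add(1-3)] e[of x] b[of x]
      by (auto intro!: free_module_add_closed free_module_smult_closed basis_vector_closed)
  qed
  then show ?hom using h by (auto simp: module_homs_def res_module_def)
  show "formal_sum R (map (map_prod id (map_resgen id f)) l) = res_map R f (formal_sum R l)"
    if "l \<in> lists (carrier R \<times> res_basis R A n)"
    using that
  proof (induction l)
    case (Cons p l)
    obtain r x where p: "p = (r, x)" "r \<in> carrier R" "x \<in> res_basis R A n" using Cons(1) by auto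
    have l': "map (map_prod id (map_resgen id f)) l \<in> lists (carrier R \<times> res_basis R A' n)"
      using Cons(2) b by fastforce
    show ?case
      using module_homs_combination[OF h' p(2,3) formal_sum_closed[OF Cons(2)]] Cons(3) e[OF p(3)]
        formal_sum_Cons[OF Cons(2) p(2,3)] formal_sum_Cons[OF l' p(2) b[OF p(3)]]
      by (simp add: p(1) id_def)
  qed (simp add: z)
qed

lemma res_map_augmentation:
  assumes "v \<in> carrier (res_module R A 0)"
  shows "res_augmentation R A' (res_map R f v) = f (res_augmentation R A v)"
proof -
  have b: "map_resgen id f x \<in> res_basis R A' 0" if "x \<in> res_basis R A 0" for x
    using that f by (auto simp: module_homs_def)
  have aug: "res_augmentation R B (basis_vector R (Gen a)) = a" if "module R B" "a \<in> carrier B"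
    for B :: "('a, 'z) module" and a
    unfolding res_augmentation_def using that
    by (subst linear_extension_basis_vector[OF that(1), where X = "Gen ` carrier B"]) auto
  have "(res_augmentation R A' \<circ> res_map R f) v = (f \<circ> res_augmentation R A) v"
  proof (rule free_module_hom_eq[OF A', of _ "res_basis R A 0"])
    show "res_augmentation R A' \<circ> res_map R f \<in> module_homs R (free_module R (res_basis R A 0)) A'"
      using module_homs_comp[OF res_map_aux(1)[OF b] res_augmentation_hom[OF A']]
      by (simp add: res_module_def)
    show "f \<circ> res_augmentation R A \<in> module_homs R (free_module R (res_basis R A 0)) A'"
      using module_homs_comp[OF res_augmentation_hom[OF A] f] by (simp add: res_module_def)
    show "(res_augmentation R A' \<circ> res_map R f) (basis_vector R x) =
        (f \<circ> res_augmentation R A) (basis_vector R x)" if "x \<in> res_basis R A 0" for x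
      using that res_map_aux(2)[OF b that] f aug[OF A] aug[OF A' funcset_mem] by (auto simp: module_homs_def)
    show "v \<in> carrier (free_module R (res_basis R A 0))" using assms by (simp add: res_module_def)
  qed
  then show ?thesis by simp
qed

lemma res_map_differential_aux:
  assumes b: "\<And>x. x \<in> res_basis R A n \<Longrightarrow> map_resgen id f x \<in> res_basis R A' n"
    and b': "\<And>x. x \<in> res_basis R A (Suc n) \<Longrightarrow> map_resgen id f x \<in> res_basis R A' (Suc n)"
    and v: "v \<in> carrier (res_module R A (Suc n))"
  shows "res_differential R (res_map R f v) = res_map R f (res_differential R v)"
proof -
  note mod = module_free_module[of "res_basis R A' n", folded res_module_def]
  have "(res_differential R \<circ> res_map R f) v = (res_map R f \<circ> res_differential R) v"
  proof (rule free_module_hom_eq[OF mod, of _ "res_basis R A (Suc n)"])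
    show "res_differential R \<circ> res_map R f
        \<in> module_homs R (free_module R (res_basis R A (Suc n))) (res_module R A' n)"
      using module_homs_comp[OF res_map_aux(1)[OF b'] res_differential_hom[OF A']]
      by (simp add: res_module_def)
    show "res_map R f \<circ> res_differential R
        \<in> module_homs R (free_module R (res_basis R A (Suc n))) (res_module R A' n)"
      using module_homs_comp[OF res_differential_hom[OF A] res_map_aux(1)[OF b]]
      by (simp add: res_module_def)
    show "(res_differential R \<circ> res_map R f) (basis_vector R x) =
        (res_map R f \<circ> res_differential R) (basis_vector R x)" if x: "x \<in> res_basis R A (Suc n)" for x
    proof -
      obtain l where l: "x = Syz l" "l \<in> lists (carrier R \<times> res_basis R A n)" using x by auto
      then show ?thesis
        using res_map_aux(2)[OF b' x] res_map_aux(3)[OF b l(2)] b'[OF x] x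
          res_differential_basis_vector[OF A, of l n]
          res_differential_basis_vector[OF A', of "map (map_prod id (map_resgen id f)) l" n]
        by (simp del: res_basis.simps)
    qed
    show "v \<in> carrier (free_module R (res_basis R A (Suc n)))" using v by (simp add: res_module_def)
  qed
  then show ?thesis by simp
qed

lemma res_map_basis: "x \<in> res_basis R A n \<Longrightarrow> map_resgen id f x \<in> res_basis R A' n"
proof (induction n arbitrary: x rule: less_induct)
  case (less n)
  show ?case
  proof (cases n)
    case 0
    then show ?thesis using less.prems f by (auto simp: module_homs_def)
  next
    case (Suc m)
    have b: "map_resgen id f x \<in> res_basis R A' m" if "x \<in> res_basis R A m" for x
      by (rule less.IH[OF _ that]) (simp add: Suc)
    obtain l where l: "x = Syz l" "l \<in> lists (carrier R \<times> res_basis R A m)"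
      using less.prems Suc by auto
    let ?l = "map (map_prod id (map_resgen id f)) l"
    have l': "?l \<in> lists (carrier R \<times> res_basis R A' m)" using l(2) b by fastforce
    have fs: "formal_sum R l \<in> carrier (res_module R A m)"
      using formal_sum_closed[OF l(2)] by (simp add: res_module_def)
    note eq = res_map_aux(3)[OF b l(2)]
    show ?thesis
    proof (cases m)
      case 0
      have "res_augmentation R A (formal_sum R l) = \<zero>\<^bsub>A\<^esub>" using less.prems Suc 0 l by auto
      then have "res_augmentation R A' (formal_sum R ?l) = \<zero>\<^bsub>A'\<^esub>"
        using eq res_map_augmentation[of "formal_sum R l"] fs 0 module_homs_zero[OF A A' f] by simp
      then show ?thesis using l' l(1) Suc 0 by (simp add: id_def)
    next
      case (Suc k)
      have bk: "map_resgen id f x \<in> res_basis R A' k" if "x \<in> res_basis R A k" for x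
        by (rule less.IH[OF _ that]) (simp add: Suc \<open>n = Suc m\<close>)
      have d: "res_differential R (formal_sum R l) = (\<lambda>x. \<zero>)"
        using less.prems Suc \<open>n = Suc m\<close> l by auto
      have "res_map R f (\<lambda>x. \<zero>) = (\<lambda>x. \<zero>)"
        using module_homs_zero[OF module_free_module module_free_module
            res_map_aux(1)[OF bk, unfolded res_module_def]] by simp
      then have "res_differential R (formal_sum R ?l) = (\<lambda>x. \<zero>)"
        using eq res_map_differential_aux[OF bk, of "formal_sum R l"] b fs Suc d
        by (simp del: res_basis.simps)
      then show ?thesis using l' l(1) Suc \<open>n = Suc m\<close> by (simp add: id_def)
    qed
  qed
qed

lemma res_map_hom: "res_map R f \<in> module_homs R (res_module R A n) (res_module R A' n)"
  by (rule res_map_aux(1)[OF res_map_basis])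

lemma res_map_differential:
  "v \<in> carrier (res_module R A (Suc n)) \<Longrightarrow>
    res_differential R (res_map R f v) = res_map R f (res_differential R v)"
  by (rule res_map_differential_aux[OF res_map_basis res_map_basis])

end

end


section \<open>The constructions above yield modules\<close>

lemma quotient_module_simps:
  "carrier (quotient_module W U) = {U +>\<^bsub>W\<^esub> x | x. x \<in> carrier W}"
  "zero (quotient_module W U) = U"
  "add (quotient_module W U) = set_add W"
  "smult (quotient_module W U) = (\<lambda>r X. \<Union>x\<in>X. U +>\<^bsub>W\<^esub> (r \<odot>\<^bsub>W\<^esub> x))"
  by (auto simp: quotient_module_def A_RCOSETS_defs a_r_coset_def)

lemma
  assumes "module R W" "submodule U R W"
  shows quotient_module_smult: "r \<in> carrier R \<Longrightarrow> x \<in> carrier W \<Longrightarrow>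
      r \<odot>\<^bsub>quotient_module W U\<^esub> (U +>\<^bsub>W\<^esub> x) = U +>\<^bsub>W\<^esub> (r \<odot>\<^bsub>W\<^esub> x)"
    and quotient_module_add: "x \<in> carrier W \<Longrightarrow> y \<in> carrier W \<Longrightarrow>
      (U +>\<^bsub>W\<^esub> x) \<oplus>\<^bsub>quotient_module W U\<^esub> (U +>\<^bsub>W\<^esub> y) = U +>\<^bsub>W\<^esub> (x \<oplus>\<^bsub>W\<^esub> y)"
    and module_quotient_module: "module R (quotient_module W U)"
proof -
  interpret W: module R W by fact
  interpret U: submodule U R W by fact
  interpret S: abelian_subgroup U W
    by (intro abelian_subgroupI3 additive_subgroup.intro U.subgroup_axioms W.M.abelian_group_axioms)
  have sm: "r \<odot>\<^bsub>quotient_module W U\<^esub> (U +>\<^bsub>W\<^esub> x) = U +>\<^bsub>W\<^esub> (r \<odot>\<^bsub>W\<^esub> x)"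
    if "r \<in> carrier R" "x \<in> carrier W" for r x
  proof -
    have "U +>\<^bsub>W\<^esub> (r \<odot>\<^bsub>W\<^esub> z) = U +>\<^bsub>W\<^esub> (r \<odot>\<^bsub>W\<^esub> x)" if z: "z \<in> U +>\<^bsub>W\<^esub> x" for z
    proof -
      obtain u where u: "u \<in> U" "z = u \<oplus>\<^bsub>W\<^esub> x" using z by (auto simp: a_r_coset_def r_coset_def)
      have uc: "u \<in> carrier W" using u S.a_Hcarr by blast
      have "r \<odot>\<^bsub>W\<^esub> z = r \<odot>\<^bsub>W\<^esub> u \<oplus>\<^bsub>W\<^esub> r \<odot>\<^bsub>W\<^esub> x"
        using u uc \<open>r \<in> carrier R\<close> \<open>x \<in> carrier W\<close> by (simp add: W.smult_r_distr)
      then have "r \<odot>\<^bsub>W\<^esub> z \<in> U +>\<^bsub>W\<^esub> (r \<odot>\<^bsub>W\<^esub> x)"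
        using U.smult_closed[OF \<open>r \<in> carrier R\<close> u(1)] by (auto simp: a_r_coset_def r_coset_def)
      then show ?thesis
        using S.a_repr_independence' \<open>r \<in> carrier R\<close> \<open>x \<in> carrier W\<close> by (metis W.smult_closed)
    qed
    moreover have "x \<in> U +>\<^bsub>W\<^esub> x" using S.a_rcos_self that by blast
    ultimately show ?thesis
      unfolding quotient_module_simps by (intro SUP_eq_const) blast+
  qed
  have ad: "(U +>\<^bsub>W\<^esub> x) \<oplus>\<^bsub>quotient_module W U\<^esub> (U +>\<^bsub>W\<^esub> y) = U +>\<^bsub>W\<^esub> (x \<oplus>\<^bsub>W\<^esub> y)"
    if "x \<in> carrier W" "y \<in> carrier W" for x y
    using S.a_rcos_sum[OF that] by (simp add: quotient_module_simps)
  have z: "\<zero>\<^bsub>quotient_module W U\<^esub> = U +>\<^bsub>W\<^esub> \<zero>\<^bsub>W\<^esub>"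
    by (simp add: quotient_module_simps W.M.a_coset_add_zero[OF S.a_subset])
  show "r \<in> carrier R \<Longrightarrow> x \<in> carrier W \<Longrightarrow>
      r \<odot>\<^bsub>quotient_module W U\<^esub> (U +>\<^bsub>W\<^esub> x) = U +>\<^bsub>W\<^esub> (r \<odot>\<^bsub>W\<^esub> x)" by (rule sm)
  show "x \<in> carrier W \<Longrightarrow> y \<in> carrier W \<Longrightarrow>
      (U +>\<^bsub>W\<^esub> x) \<oplus>\<^bsub>quotient_module W U\<^esub> (U +>\<^bsub>W\<^esub> y) = U +>\<^bsub>W\<^esub> (x \<oplus>\<^bsub>W\<^esub> y)" by (rule ad)
  have c: "X \<in> carrier (quotient_module W U) \<longleftrightarrow> (\<exists>x\<in>carrier W. X = U +>\<^bsub>W\<^esub> x)" for X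
    by (auto simp: quotient_module_simps)
  show "module R (quotient_module W U)"
  proof (intro moduleI abelian_groupI)
    fix X assume "X \<in> carrier (quotient_module W U)"
    then obtain x where x: "x \<in> carrier W" "X = U +>\<^bsub>W\<^esub> x" by (auto simp: c)
    then show "\<exists>Y\<in>carrier (quotient_module W U). Y \<oplus>\<^bsub>quotient_module W U\<^esub> X = \<zero>\<^bsub>quotient_module W U\<^esub>"
      by (intro bexI[of _ "U +>\<^bsub>W\<^esub> (\<ominus>\<^bsub>W\<^esub> x)"]) (auto simp: c z ad W.M.l_neg)
  qed (auto simp: c sm ad z W.R.is_cring W.M.a_ac W.smult_l_distr W.smult_r_distr W.smult_assoc1)
qed

lemma hom_module_simps:
  "carrier (hom_module R A B) = module_homs R A B \<inter> extensional (carrier A)"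
  "zero (hom_module R A B) = (\<lambda>x\<in>carrier A. \<zero>\<^bsub>B\<^esub>)"
  "add (hom_module R A B) = (\<lambda>f g. \<lambda>x\<in>carrier A. f x \<oplus>\<^bsub>B\<^esub> g x)"
  "smult (hom_module R A B) = (\<lambda>r f. \<lambda>x\<in>carrier A. r \<odot>\<^bsub>B\<^esub> f x)"
  by (simp_all add: hom_module_def)

lemma module_hom_module:
  assumes "module R A" "module R B"
  shows "module R (hom_module R A B)"
proof -
  interpret A: module R A by fact
  interpret B: module R B by fact
  have fD: "f x \<in> carrier B" if "f \<in> carrier (hom_module R A B)" "x \<in> carrier A" for f x
    using that by (auto simp: hom_module_simps module_homs_def)
  have ext: "f = (\<lambda>x\<in>carrier A. f x)" if "f \<in> carrier (hom_module R A B)" for f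
    using that by (simp add: hom_module_simps extensional_restrict)
  have sm: "r \<odot>\<^bsub>hom_module R A B\<^esub> f \<in> carrier (hom_module R A B)"
    if r: "r \<in> carrier R" and f: "f \<in> carrier (hom_module R A B)" for r f
  proof -
    have "r \<odot>\<^bsub>B\<^esub> (s \<odot>\<^bsub>B\<^esub> y) = s \<odot>\<^bsub>B\<^esub> (r \<odot>\<^bsub>B\<^esub> y)" if "s \<in> carrier R" "y \<in> carrier B" for s y
      using that r by (simp flip: B.smult_assoc1 add: A.R.m_comm)
    then show ?thesis
      using r f by (auto simp: hom_module_simps module_homs_def B.smult_r_distr Pi_iff)
  qed
  have ad: "f \<oplus>\<^bsub>hom_module R A B\<^esub> g \<in> carrier (hom_module R A B)"
    if "f \<in> carrier (hom_module R A B)" "g \<in> carrier (hom_module R A B)" for f g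
    using that by (auto simp: hom_module_simps module_homs_def B.smult_r_distr Pi_iff B.M.a_ac)
  have eqI: "f = g" if "f \<in> extensional (carrier A)" "g \<in> extensional (carrier A)"
    "\<And>x. x \<in> carrier A \<Longrightarrow> f x = g x" for f g :: "'c \<Rightarrow> 'd"
    using that by (rule extensionalityI)
  show ?thesis
  proof (intro moduleI abelian_groupI)
    fix f assume f: "f \<in> carrier (hom_module R A B)"
    show "\<exists>g\<in>carrier (hom_module R A B). g \<oplus>\<^bsub>hom_module R A B\<^esub> f = \<zero>\<^bsub>hom_module R A B\<^esub>"
    proof
      show "(\<ominus>\<^bsub>R\<^esub> \<one>\<^bsub>R\<^esub>) \<odot>\<^bsub>hom_module R A B\<^esub> f \<in> carrier (hom_module R A B)"
        using sm[OF _ f] by simp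
      show "(\<ominus>\<^bsub>R\<^esub> \<one>\<^bsub>R\<^esub>) \<odot>\<^bsub>hom_module R A B\<^esub> f \<oplus>\<^bsub>hom_module R A B\<^esub> f = \<zero>\<^bsub>hom_module R A B\<^esub>"
        using fD[OF f] by (auto simp: hom_module_simps B.smult_l_minus B.M.l_neg)
    qed
    show "\<zero>\<^bsub>hom_module R A B\<^esub> \<oplus>\<^bsub>hom_module R A B\<^esub> f = f"
      using f fD[OF f] by (subst (2) ext[OF f]) (auto simp: hom_module_simps)
    show "\<one>\<^bsub>R\<^esub> \<odot>\<^bsub>hom_module R A B\<^esub> f = f"
      using f fD[OF f] by (subst (2) ext[OF f]) (auto simp: hom_module_simps)
    fix g assume g: "g \<in> carrier (hom_module R A B)"
    show "f \<oplus>\<^bsub>hom_module R A B\<^esub> g = g \<oplus>\<^bsub>hom_module R A B\<^esub> f"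
      using fD[OF f] fD[OF g] by (auto simp: hom_module_simps B.M.a_comm)
  next
    show "\<zero>\<^bsub>hom_module R A B\<^esub> \<in> carrier (hom_module R A B)"
      by (auto simp: hom_module_simps module_homs_def)
  next
    fix f g h assume "f \<in> carrier (hom_module R A B)" "g \<in> carrier (hom_module R A B)"
       "h \<in> carrier (hom_module R A B)"
    then show "f \<oplus>\<^bsub>hom_module R A B\<^esub> g \<oplus>\<^bsub>hom_module R A B\<^esub> h = f \<oplus>\<^bsub>hom_module R A B\<^esub> (g \<oplus>\<^bsub>hom_module R A B\<^esub> h)"
      using fD by (auto simp: hom_module_simps B.M.a_assoc)
  next
    fix r s f assume "r \<in> carrier R" "s \<in> carrier R" and f: "f \<in> carrier (hom_module R A B)"
    then show "(r \<oplus>\<^bsub>R\<^esub> s) \<odot>\<^bsub>hom_module R A B\<^esub> f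
          = r \<odot>\<^bsub>hom_module R A B\<^esub> f \<oplus>\<^bsub>hom_module R A B\<^esub> s \<odot>\<^bsub>hom_module R A B\<^esub> f"
      and "(r \<otimes>\<^bsub>R\<^esub> s) \<odot>\<^bsub>hom_module R A B\<^esub> f
          = r \<odot>\<^bsub>hom_module R A B\<^esub> (s \<odot>\<^bsub>hom_module R A B\<^esub> f)"
      using fD[OF f] by (auto simp: hom_module_simps B.smult_l_distr B.smult_assoc1)
  next
    fix r f g assume "r \<in> carrier R" and f: "f \<in> carrier (hom_module R A B)"
      and g: "g \<in> carrier (hom_module R A B)"
    then show "r \<odot>\<^bsub>hom_module R A B\<^esub> (f \<oplus>\<^bsub>hom_module R A B\<^esub> g)
          = r \<odot>\<^bsub>hom_module R A B\<^esub> f \<oplus>\<^bsub>hom_module R A B\<^esub> r \<odot>\<^bsub>hom_module R A B\<^esub> g"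
      using fD[OF f] fD[OF g] by (auto simp: hom_module_simps B.smult_r_distr)
  qed (simp_all add: sm ad A.R.is_cring)
qed

context cring
begin

context
  fixes A :: "('a, 'm) module" and B :: "('a, 'n) module"
  assumes A: "module R A" and B: "module R B"
begin

lemma module_ext_cochains: "module R (ext_cochains R n A B)"
  unfolding ext_cochains_def res_module_def by (intro module_hom_module module_free_module B)

lemma ext_coboundary_hom:
  "ext_coboundary R n A \<in> module_homs R (ext_cochains R n A B) (ext_cochains R (Suc n) A B)"
proof -
  note d = res_differential_hom[OF A, of n]
  interpret F: module R "res_module R A n" unfolding res_module_def by (rule module_free_module)
  interpret F': module R "res_module R A (Suc n)" unfolding res_module_def by (rule module_free_module)
  have dc: "res_differential R x \<in> carrier (res_module R A n)" if "x \<in> carrier (res_module R A (Suc n))" for x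
    using d that by (auto simp: module_homs_def)
  have "ext_coboundary R n A h \<in> carrier (ext_cochains R (Suc n) A B)"
    if h: "h \<in> carrier (ext_cochains R n A B)" for h
  proof -
    have "h \<circ> res_differential R \<in> module_homs R (res_module R A (Suc n)) B"
      by (rule module_homs_comp[OF d]) (use h in \<open>simp add: ext_cochains_def hom_module_simps\<close>)
    then show ?thesis
      by (auto simp: ext_cochains_def hom_module_simps ext_coboundary_def module_homs_def)
  qed
  then show ?thesis
    unfolding module_homs_def[of R "ext_cochains R n A B"]
    using dc by (auto simp: ext_coboundary_def ext_cochains_def hom_module_simps)
qed

end

lemma submodule_kernel:
  assumes "module R U" "module R V" and \<phi>: "\<phi> \<in> module_homs R U V"
  shows "submodule {x \<in> carrier U. \<phi> x = \<zero>\<^bsub>V\<^esub>} R U"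
proof -
  interpret U: module R U by fact
  interpret V: module R V by fact
  have sm: "\<phi> (r \<odot>\<^bsub>U\<^esub> x) = r \<odot>\<^bsub>V\<^esub> \<phi> x" if "r \<in> carrier R" "x \<in> carrier U" for r x
    using \<phi> that by (simp add: module_homs_def)
  show ?thesis
  proof (rule U.submoduleI)
    fix x assume x: "x \<in> {x \<in> carrier U. \<phi> x = \<zero>\<^bsub>V\<^esub>}"
    then have "\<ominus>\<^bsub>U\<^esub> x = (\<ominus> \<one>) \<odot>\<^bsub>U\<^esub> x" by (simp add: U.smult_l_minus)
    then show "\<ominus>\<^bsub>U\<^esub> x \<in> {x \<in> carrier U. \<phi> x = \<zero>\<^bsub>V\<^esub>}"
      using x sm[of "\<ominus> \<one>" x] by auto
  qed (use \<phi> sm module_homs_zero[OF assms] in \<open>auto simp: module_homs_def\<close>)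
qed

lemma submodule_image:
  assumes "module R U" "module R V" and \<phi>: "\<phi> \<in> module_homs R U V"
  shows "submodule (\<phi> ` carrier U) R V"
proof -
  interpret U: module R U by fact
  interpret V: module R V by fact
  have c: "\<phi> x \<in> carrier V" if "x \<in> carrier U" for x using \<phi> that by (auto simp: module_homs_def)
  have sm: "r \<odot>\<^bsub>V\<^esub> \<phi> x = \<phi> (r \<odot>\<^bsub>U\<^esub> x)" if "r \<in> carrier R" "x \<in> carrier U" for r x
    using \<phi> that by (simp add: module_homs_def)
  have ad: "\<phi> x \<oplus>\<^bsub>V\<^esub> \<phi> y = \<phi> (x \<oplus>\<^bsub>U\<^esub> y)" if "x \<in> carrier U" "y \<in> carrier U" for x y
    using \<phi> that by (simp add: module_homs_def)
  show ?thesis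
  proof (rule V.submoduleI)
    show "\<zero>\<^bsub>V\<^esub> \<in> \<phi> ` carrier U" using module_homs_zero[OF assms] by (metis U.M.zero_closed imageI)
    fix y assume "y \<in> \<phi> ` carrier U"
    then obtain x where x: "x \<in> carrier U" "y = \<phi> x" by auto
    then have "\<ominus>\<^bsub>V\<^esub> y = (\<ominus> \<one>) \<odot>\<^bsub>V\<^esub> y" using c by (simp add: V.smult_l_minus)
    then show "\<ominus>\<^bsub>V\<^esub> y \<in> \<phi> ` carrier U" using x by (auto simp: sm)
  qed (auto simp: c sm ad)
qed

lemma submodule_restrict:
  assumes "module R W" "submodule K R W" "submodule H R W" "H \<subseteq> K"
  shows "submodule H R (W\<lparr>carrier := K\<rparr>)"
proof -
  interpret K: module R "W\<lparr>carrier := K\<rparr>" by (rule submodule.submodule_is_module[OF assms(2,1)])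
  show ?thesis
    using submodule.submodule_is_module[OF assms(3,1)] assms(4)
    by (intro K.module_incl_imp_submodule) auto
qed

lemma module_Ext:
  fixes A :: "('a, 'm) module" and B :: "('a, 'n) module"
  assumes A: "module R A" and B: "module R B"
  shows "module R (Ext R n A B)"
proof -
  note C = module_ext_cochains[OF A B] and d = ext_coboundary_hom[OF A B]
  have z: "submodule (ext_cocycles R n A B) R (ext_cochains R n A B)"
    unfolding ext_cocycles_def by (rule submodule_kernel[OF C C d])
  have "submodule (ext_coboundaries R n A B) R (ext_cochains R n A B)
      \<and> ext_coboundaries R n A B \<subseteq> ext_cocycles R n A B"
  proof (cases n)
    case 0
    interpret C: module R "ext_cochains R 0 A B" by (rule C)
    show ?thesis
      using module_homs_zero[OF C C d[of 0]] C.M.zero_closed unfolding 0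
      by (auto simp: ext_coboundaries_def ext_cocycles_def intro!: C.submoduleI)
  next
    case (Suc m)
    have "ext_coboundary R (Suc m) A (ext_coboundary R m A h) = \<zero>\<^bsub>ext_cochains R (Suc (Suc m)) A B\<^esub>"
      if h: "h \<in> carrier (ext_cochains R m A B)" for h
    proof -
      have "res_differential R (res_differential R x) = \<zero>\<^bsub>res_module R A m\<^esub>"
        "res_differential R x \<in> carrier (res_module R A (Suc m))"
        if "x \<in> carrier (res_module R A (Suc (Suc m)))" for x
      proof -
        have "res_differential R x \<in> a_kernel (res_module R A (Suc m)) (res_module R A m) (res_differential R)"
          using standard_resolution_exact(2)[OF A, of m] that by blast
        then show "res_differential R (res_differential R x) = \<zero>\<^bsub>res_module R A m\<^esub>"
          "res_differential R x \<in> carrier (res_module R A (Suc m))"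
          by (simp_all add: a_kernel_def kernel_def)
      qed
      moreover have "h \<zero>\<^bsub>res_module R A m\<^esub> = \<zero>\<^bsub>B\<^esub>"
        using h module_homs_zero[OF module_free_module[of "res_basis R A m", folded res_module_def] B]
        by (simp add: ext_cochains_def hom_module_simps)
      ultimately show ?thesis
        by (auto simp: ext_coboundary_def ext_cochains_def hom_module_simps)
    qed
    moreover have "ext_coboundary R m A h \<in> carrier (ext_cochains R (Suc m) A B)"
      if "h \<in> carrier (ext_cochains R m A B)" for h
      using d[of m] that by (auto simp: module_homs_def)
    ultimately have "ext_coboundaries R n A B \<subseteq> ext_cocycles R n A B"
      unfolding ext_coboundaries_def ext_cocycles_def Suc by auto
    moreover have "submodule (ext_coboundaries R n A B) R (ext_cochains R n A B)"
      using submodule_image[OF C C d[of m]] by (simp add: ext_coboundaries_def Suc)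
    ultimately show ?thesis by simp
  qed
  then have "submodule (ext_coboundaries R n A B) R
      (ext_cochains R n A B\<lparr>carrier := ext_cocycles R n A B\<rparr>)"
    using submodule_restrict[OF C z] by blast
  with submodule.submodule_is_module[OF z C] show ?thesis
    unfolding Ext_def by (rule module_quotient_module)
qed

end


context
  fixes R :: "('r, 'x) ring_scheme" and G :: "nat \<Rightarrow> ('r, 'a) module" and \<phi> :: "nat \<Rightarrow> 'a \<Rightarrow> 'a"
  assumes R: "cring R" and G: "\<And>n. module R (G n)"
    and \<phi>: "\<And>n. \<phi> n \<in> module_homs R (G n) (G (Suc n))"
begin

lemma transition_hom: "m \<le> k \<Longrightarrow> transition \<phi> m k \<in> module_homs R (G m) (G k)"
proof (induction k rule: dec_induct)
  case base
  then show ?case by (simp add: transition_def module_homs_def)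
next
  case (step k)
  then show ?case using \<phi>[of k]
    by (auto simp: transition_def module_homs_def Pi_iff)
qed

lemma transition_closed: "m \<le> k \<Longrightarrow> x \<in> carrier (G m) \<Longrightarrow> transition \<phi> m k x \<in> carrier (G k)"
  using transition_hom[of m k] by (auto simp: module_homs_def)

lemma transition_transition:
  assumes "m \<le> k" "k \<le> l"
  shows "transition \<phi> k l (transition \<phi> m k x) = transition \<phi> m l x"
proof -
  have "[m..<l] = [m..<k] @ [k..<l]" using assms by (metis le_add_diff_inverse upt_add_eq_append)
  then show ?thesis by (simp add: transition_def)
qed

lemma limit_class_eq:
  assumes "n \<le> k" "m \<le> k" "transition \<phi> n k x = transition \<phi> m k y"
  shows "limit_class G \<phi> n x = limit_class G \<phi> m y"
proof -
  have *: "limit_class G \<phi> n x \<subseteq> limit_class G \<phi> m y"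
    if "n \<le> k" "m \<le> k" "transition \<phi> n k x = transition \<phi> m k y" for n m x y
  proof clarify
    fix p z assume "(p, z) \<in> limit_class G \<phi> n x"
    then obtain l where l: "z \<in> carrier (G p)" "l \<ge> max p n" "transition \<phi> p l z = transition \<phi> n l x"
      by (auto simp: limit_class_def)
    have "transition \<phi> p (max k l) z = transition \<phi> n (max k l) x"
      using l transition_transition[of p l "max k l" z] transition_transition[of n l "max k l" x] by simp
    also have "\<dots> = transition \<phi> m (max k l) y"
      using that transition_transition[of n k "max k l" x] transition_transition[of m k "max k l" y] by simp
    finally show "(p, z) \<in> limit_class G \<phi> m y"
      using l that by (auto simp: limit_class_def intro!: exI[of _ "max k l"])
  qed
  show ?thesis using *[OF assms] *[OF assms(2,1) assms(3)[symmetric]] by blast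
qed

lemma limit_class_mem_eq: "(m, y) \<in> limit_class G \<phi> n x \<Longrightarrow> limit_class G \<phi> m y = limit_class G \<phi> n x"
proof -
  assume "(m, y) \<in> limit_class G \<phi> n x"
  then obtain k where "k \<ge> max m n" "transition \<phi> m k y = transition \<phi> n k x"
    by (auto simp: limit_class_def)
  then show ?thesis by (intro limit_class_eq[of _ k]) auto
qed

lemma limit_class_self: "x \<in> carrier (G n) \<Longrightarrow> (n, x) \<in> limit_class G \<phi> n x"
  by (auto simp: limit_class_def)

lemma limit_class_transition: "n \<le> k \<Longrightarrow> limit_class G \<phi> k (transition \<phi> n k x) = limit_class G \<phi> n x"
  by (rule limit_class_eq[of _ k]) (auto simp: transition_def)

lemma direct_limit_add:
  assumes x: "x \<in> carrier (G k)" and y: "y \<in> carrier (G k)"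
  shows "limit_class G \<phi> k x \<oplus>\<^bsub>direct_limit G \<phi>\<^esub> limit_class G \<phi> k y = limit_class G \<phi> k (x \<oplus>\<^bsub>G k\<^esub> y)"
proof -
  have "limit_class G \<phi> (max m n)
       (transition \<phi> m (max m n) u \<oplus>\<^bsub>G (max m n)\<^esub> transition \<phi> n (max m n) v)
     = limit_class G \<phi> k (x \<oplus>\<^bsub>G k\<^esub> y)"
    if u: "(m, u) \<in> limit_class G \<phi> k x" and v: "(n, v) \<in> limit_class G \<phi> k y" for m u n v
  proof -
    obtain p q where pq: "p \<ge> max m k" "transition \<phi> m p u = transition \<phi> k p x"
      "q \<ge> max n k" "transition \<phi> n q v = transition \<phi> k q y"
      using u v by (auto simp: limit_class_def)
    have uv: "u \<in> carrier (G m)" "v \<in> carrier (G n)" using u v by (auto simp: limit_class_def)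
    define l where "l = max p q"
    have 1: "transition \<phi> m l u = transition \<phi> k l x"
      using transition_transition[of m p l u] transition_transition[of k p l x] pq by (simp add: l_def)
    have 2: "transition \<phi> n l v = transition \<phi> k l y"
      using transition_transition[of n q l v] transition_transition[of k q l y] pq by (simp add: l_def)
    have hom: "transition \<phi> s l (a \<oplus>\<^bsub>G s\<^esub> b) = transition \<phi> s l a \<oplus>\<^bsub>G l\<^esub> transition \<phi> s l b"
      if "s \<le> l" "a \<in> carrier (G s)" "b \<in> carrier (G s)" for s a b
      using transition_hom[OF that(1)] that by (simp add: module_homs_def)
    have le: "m \<le> l" "n \<le> l" "k \<le> l" "max m n \<le> l" using pq by (auto simp: l_def)
    show ?thesis
    proof (rule limit_class_eq[OF le(4) le(3)])
      show "transition \<phi> (max m n) l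
           (transition \<phi> m (max m n) u \<oplus>\<^bsub>G (max m n)\<^esub> transition \<phi> n (max m n) v)
         = transition \<phi> k l (x \<oplus>\<^bsub>G k\<^esub> y)"
        using hom[OF le(4) transition_closed[OF _ uv(1)] transition_closed[OF _ uv(2)]] hom[OF le(3) x y] 1 2
          transition_transition[OF _ le(4), of m u] transition_transition[OF _ le(4), of n v]
        by simp
    qed
  qed
  then show ?thesis
    using limit_class_self[OF x] limit_class_self[OF y] unfolding direct_limit_def
    by (simp, intro SUP_eq_const) (auto intro!: SUP_eq_const simp del: UN_simps)
qed

lemma direct_limit_smult:
  assumes r: "r \<in> carrier R" and x: "x \<in> carrier (G k)"
  shows "r \<odot>\<^bsub>direct_limit G \<phi>\<^esub> limit_class G \<phi> k x = limit_class G \<phi> k (r \<odot>\<^bsub>G k\<^esub> x)"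
proof -
  have "limit_class G \<phi> m (r \<odot>\<^bsub>G m\<^esub> u) = limit_class G \<phi> k (r \<odot>\<^bsub>G k\<^esub> x)"
    if u: "(m, u) \<in> limit_class G \<phi> k x" for m u
  proof -
    obtain p where p: "p \<ge> max m k" "transition \<phi> m p u = transition \<phi> k p x" "u \<in> carrier (G m)"
      using u by (auto simp: limit_class_def)
    then show ?thesis
      using transition_hom[of m p] transition_hom[of k p] r x
      by (intro limit_class_eq[of _ p]) (auto simp: module_homs_def)
  qed
  then show ?thesis
    using limit_class_self[OF x] unfolding direct_limit_def module.simps
    by (intro SUP_eq_const) (blast, clarify, blast)
qed

lemma module_direct_limit: "module R (direct_limit G \<phi>)"
proof -
  let ?L = "direct_limit G \<phi>"
  have car: "carrier ?L = {limit_class G \<phi> n x | n x. x \<in> carrier (G n)}"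
    by (simp add: direct_limit_def)
  have cl: "limit_class G \<phi> n x \<in> carrier ?L" if "x \<in> carrier (G n)" for n x
    using that by (auto simp: car)
  have up: "\<exists>x\<in>carrier (G k). X = limit_class G \<phi> k x" if "n \<le> k" "a \<in> carrier (G n)" "X = limit_class G \<phi> n a"
    for n k a X
    using transition_closed[OF that(1,2)] limit_class_transition[OF that(1)] that(3) by metis
  have rep3: "\<exists>k x y z. x \<in> carrier (G k) \<and> y \<in> carrier (G k) \<and> z \<in> carrier (G k) \<and>
      X = limit_class G \<phi> k x \<and> Y = limit_class G \<phi> k y \<and> Z = limit_class G \<phi> k z"
    if "X \<in> carrier ?L" "Y \<in> carrier ?L" "Z \<in> carrier ?L" for X Y Z
  proof -
    obtain l m n a b c where *: "a \<in> carrier (G l)" "X = limit_class G \<phi> l a"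
      "b \<in> carrier (G m)" "Y = limit_class G \<phi> m b" "c \<in> carrier (G n)" "Z = limit_class G \<phi> n c"
      using \<open>X \<in> _\<close> \<open>Y \<in> _\<close> \<open>Z \<in> _\<close> unfolding car by blast
    show ?thesis
      using up[of l "l + m + n", OF _ *(1,2)] up[of m "l + m + n", OF _ *(3,4)]
        up[of n "l + m + n", OF _ *(5,6)] by fastforce
  qed
  have z: "\<zero>\<^bsub>?L\<^esub> = limit_class G \<phi> k \<zero>\<^bsub>G k\<^esub>" for k
  proof -
    interpret G0: module R "G 0" by (rule G)
    interpret Gk: module R "G k" by (rule G)
    have "transition \<phi> 0 k (\<zero>\<^bsub>R\<^esub> \<odot>\<^bsub>G 0\<^esub> \<zero>\<^bsub>G 0\<^esub>) = \<zero>\<^bsub>R\<^esub> \<odot>\<^bsub>G k\<^esub> transition \<phi> 0 k \<zero>\<^bsub>G 0\<^esub>"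
      using transition_hom[of 0 k] unfolding module_homs_def
      by (simp del: G0.smult_l_null G0.smult_r_null Gk.smult_l_null)
    then have "transition \<phi> 0 k \<zero>\<^bsub>G 0\<^esub> = \<zero>\<^bsub>G k\<^esub>"
      using transition_closed[of 0 k "\<zero>\<^bsub>G 0\<^esub>"] by simp
    then show ?thesis
      using limit_class_transition[of 0 k "\<zero>\<^bsub>G 0\<^esub>"] by (simp add: direct_limit_def)
  qed
  note ops = direct_limit_add direct_limit_smult
  show ?thesis
  proof (intro moduleI abelian_groupI R)
    fix X Y Z r s assume X: "X \<in> carrier ?L"
    then obtain k x where x: "x \<in> carrier (G k)" "X = limit_class G \<phi> k x" by (auto simp: car)
    interpret K: module R "G k" by (rule G)
    show "\<zero>\<^bsub>?L\<^esub> \<oplus>\<^bsub>?L\<^esub> X = X" using x by (simp add: z[of k] ops)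
    show "\<exists>Y\<in>carrier ?L. Y \<oplus>\<^bsub>?L\<^esub> X = \<zero>\<^bsub>?L\<^esub>"
      using x by (intro bexI[of _ "limit_class G \<phi> k (\<ominus>\<^bsub>G k\<^esub> x)"]) (auto simp: z[of k] ops K.M.l_neg cl)
    show "\<one>\<^bsub>R\<^esub> \<odot>\<^bsub>?L\<^esub> X = X" using x by (simp add: ops)
    assume r: "r \<in> carrier R"
    show "r \<odot>\<^bsub>?L\<^esub> X \<in> carrier ?L" using x r by (simp add: ops cl)
    assume s: "s \<in> carrier R"
    show "(r \<oplus>\<^bsub>R\<^esub> s) \<odot>\<^bsub>?L\<^esub> X = r \<odot>\<^bsub>?L\<^esub> X \<oplus>\<^bsub>?L\<^esub> s \<odot>\<^bsub>?L\<^esub> X"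
      "(r \<otimes>\<^bsub>R\<^esub> s) \<odot>\<^bsub>?L\<^esub> X = r \<odot>\<^bsub>?L\<^esub> (s \<odot>\<^bsub>?L\<^esub> X)"
      using x r s by (simp_all add: ops K.smult_l_distr K.smult_assoc1)
  next
    fix X Y Z assume X: "X \<in> carrier ?L" and Y: "Y \<in> carrier ?L" and "Z \<in> carrier ?L"
    then obtain k x y z where x: "x \<in> carrier (G k)" "y \<in> carrier (G k)" "z \<in> carrier (G k)" 
      "X = limit_class G \<phi> k x" "Y = limit_class G \<phi> k y" "Z = limit_class G \<phi> k z"
      using rep3 by meson
    interpret K: module R "G k" by (rule G)
    show "X \<oplus>\<^bsub>?L\<^esub> Y \<oplus>\<^bsub>?L\<^esub> Z = X \<oplus>\<^bsub>?L\<^esub> (Y \<oplus>\<^bsub>?L\<^esub> Z)" using x by (simp add: ops K.M.a_assoc)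
  next
    fix X Y r assume X: "X \<in> carrier ?L" and Y: "Y \<in> carrier ?L"
    then obtain k x y where x: "x \<in> carrier (G k)" "y \<in> carrier (G k)"
      "X = limit_class G \<phi> k x" "Y = limit_class G \<phi> k y"
      using rep3[of X Y Y] by meson
    interpret K: module R "G k" by (rule G)
    show "X \<oplus>\<^bsub>?L\<^esub> Y = Y \<oplus>\<^bsub>?L\<^esub> X" using x by (simp add: ops K.M.a_comm)
    show "X \<oplus>\<^bsub>?L\<^esub> Y \<in> carrier ?L" using x by (simp add: ops cl)
    assume r: "r \<in> carrier R"
    show "r \<odot>\<^bsub>?L\<^esub> (X \<oplus>\<^bsub>?L\<^esub> Y) = r \<odot>\<^bsub>?L\<^esub> X \<oplus>\<^bsub>?L\<^esub> r \<odot>\<^bsub>?L\<^esub> Y"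
      using x r by (simp add: ops K.smult_r_distr)
  next
    interpret G0: module R "G 0" by (rule G)
    show "\<zero>\<^bsub>?L\<^esub> \<in> carrier ?L" by (simp add: z[of 0] cl)
  qed
qed

end

end

theory Submission
  imports Defs
begin

text \<open>Let $0 \to N \to E^0 \to E^1 \to \cdots$ be an injective resolution for which the modules
  $T^q = \Gamma_I(\mathrm{Hom}(M, E^q)) = H^0_I(\mathrm{Hom}(M, E^q))$ are injective. The proof consists of
  the following observations on the complex $T^\bullet$.

  \<^item> Its cohomology in degree $q$ is $H^q_I(M, N)$. An element of $T^q$ is a homomorphism that vanishes
  on some $I^n M$, so $T^\bullet$ is the union of the complexes $\mathrm{Hom}(M/I^n M, E^\bullet)$, and these
  compute $\mathrm{Ext}^q(M/I^n M, N)$. Here Ext is defined by a free resolution of the first argument;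
  the comparison with the injective resolution is a staircase through the double complex
  (\<open>zigzag\<close>). It is natural in $M/I^n M$, and so it passes to the direct limit
  (\<open>gen_local_cohomology_presentation\<close>).

  \<^item> The subcomplex of the elements annihilated by $I$ is
  $\mathrm{Hom}(R/I, T^\bullet) = \mathrm{Hom}(M/IM, E^\bullet)$. Its cohomology
  $\mathrm{Ext}^q(M/IM, N)$ is weakly Laskerian, because $M/IM$ is finitely generated and $R$ is
  Noetherian (\<open>weakly_laskerian_hom_finitely_generated\<close>).

  \<^item> Write $Z^q$ and $B^q$ for the cocycles and coboundaries of $T^\bullet$. The short exact sequences
  $0 \to B^q \to Z^q \to H^q_I(M, N) \to 0$ and $0 \to Z^q \to T^q \to B^{q+1} \to 0$ give long exact
  sequences for $\mathrm{Ext}^j(R/I, -)$, which vanishes on $T^q$ for $j > 0$. In degree $0$ they are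
  controlled by the second observation. Weakly Laskerian modules form a Serre class. Therefore
  $\mathrm{Ext}^j(R/I, B^q)$ is weakly Laskerian for $j > 0$ and $q \le s$, by induction on $q$ from
  below; and $\mathrm{Ext}^j(R/I, Z^q)$ is weakly Laskerian for $j > 0$ and $q \ge s$, by induction on
  $j$. At $q = s$ these two facts enclose $\mathrm{Ext}^j(R/I, H^s_I(M, N))$
  (\<open>weakly_laskerian_Ext_remaining_cohomology\<close>). This replaces the spectral sequence
  $\mathrm{Ext}^p(R/I, H^q_I(M, N)) \Rightarrow \mathrm{Ext}^{p+q}(M/IM, N)$.

  \<^item> The support of $H^s_I(M, N)$ lies in $V(I)$, since each of its elements is annihilated by a
  power of $I$.

  Quotient modules and connecting homomorphisms are avoided throughout: a subquotient is a pair of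
  submodules, and a map between subquotients is a linear relation between the ambient modules.\<close>

section \<open>Homomorphisms out of free modules and into injective modules\<close>

lemma module_homs_closed: "f \<in> module_homs R A B \<Longrightarrow> x \<in> carrier A \<Longrightarrow> f x \<in> carrier B"
  and module_homs_add: "f \<in> module_homs R A B \<Longrightarrow> x \<in> carrier A \<Longrightarrow> y \<in> carrier A \<Longrightarrow>
    f (x \<oplus>\<^bsub>A\<^esub> y) = f x \<oplus>\<^bsub>B\<^esub> f y"
  and module_homs_smult: "f \<in> module_homs R A B \<Longrightarrow> r \<in> carrier R \<Longrightarrow> x \<in> carrier A \<Longrightarrow>
    f (r \<odot>\<^bsub>A\<^esub> x) = r \<odot>\<^bsub>B\<^esub> f x"
  by (auto simp: module_homs_def)

lemma module_homsI:
  assumes "\<And>x. x \<in> carrier A \<Longrightarrow> f x \<in> carrier B"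
    and "\<And>x y. x \<in> carrier A \<Longrightarrow> y \<in> carrier A \<Longrightarrow> f (x \<oplus>\<^bsub>A\<^esub> y) = f x \<oplus>\<^bsub>B\<^esub> f y"
    and "\<And>r x. r \<in> carrier R \<Longrightarrow> x \<in> carrier A \<Longrightarrow> f (r \<odot>\<^bsub>A\<^esub> x) = r \<odot>\<^bsub>B\<^esub> f x"
  shows "f \<in> module_homs R A B"
  using assms by (auto simp: module_homs_def)

lemma module_homs_cong:
  assumes "module R A" "f \<in> module_homs R A B" "\<And>x. x \<in> carrier A \<Longrightarrow> g x = f x"
  shows "g \<in> module_homs R A B"
proof -
  interpret A: module R A by fact
  show ?thesis using assms(2,3) by (intro module_homsI) (auto simp: module_homs_def)
qed

lemma (in module) submoduleI':
  assumes "H \<subseteq> carrier M" and "\<zero>\<^bsub>M\<^esub> \<in> H"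
    and "\<And>x y. x \<in> H \<Longrightarrow> y \<in> H \<Longrightarrow> x \<oplus>\<^bsub>M\<^esub> y \<in> H"
    and sm: "\<And>r x. r \<in> carrier R \<Longrightarrow> x \<in> H \<Longrightarrow> r \<odot>\<^bsub>M\<^esub> x \<in> H"
  shows "submodule H R M"
proof (rule submoduleI)
  fix x assume "x \<in> H"
  then show "\<ominus>\<^bsub>M\<^esub> x \<in> H" using sm[of "\<ominus> \<one>" x] assms(1) by (auto simp: smult_l_minus)
qed (use assms in auto)

lemma (in module) submoduleD:
  assumes "submodule H R M"
  shows "H \<subseteq> carrier M" and "x \<in> H \<Longrightarrow> x \<in> carrier M" and "\<zero>\<^bsub>M\<^esub> \<in> H"
    and "x \<in> H \<Longrightarrow> y \<in> H \<Longrightarrow> x \<oplus>\<^bsub>M\<^esub> y \<in> H"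
    and "r \<in> carrier R \<Longrightarrow> x \<in> H \<Longrightarrow> r \<odot>\<^bsub>M\<^esub> x \<in> H"
    and "x \<in> H \<Longrightarrow> y \<in> H \<Longrightarrow> x \<ominus>\<^bsub>M\<^esub> y \<in> H"
proof -
  interpret submodule H R M by fact
  show "H \<subseteq> carrier M" using subset by simp
  then show "x \<in> H \<Longrightarrow> x \<in> carrier M" by blast
  show "\<zero>\<^bsub>M\<^esub> \<in> H" using one_closed by simp
  show add: "x \<oplus>\<^bsub>M\<^esub> y \<in> H" if "x \<in> H" "y \<in> H" for x y using m_closed that by simp
  show "r \<in> carrier R \<Longrightarrow> x \<in> H \<Longrightarrow> r \<odot>\<^bsub>M\<^esub> x \<in> H" by (rule smult_closed)
  show "x \<in> H \<Longrightarrow> y \<in> H \<Longrightarrow> x \<ominus>\<^bsub>M\<^esub> y \<in> H"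
    using submoduleE(3)[OF assms, of y] add by (simp add: a_minus_def)
qed

lemma (in abelian_group) minus_eq_zero_iff:
  assumes "x \<in> carrier G" "y \<in> carrier G"
  shows "x \<ominus> y = \<zero> \<longleftrightarrow> x = y"
proof
  assume "x \<ominus> y = \<zero>"
  then have "x \<oplus> \<ominus> y = \<zero>" by (simp add: minus_eq)
  then show "x = y" using assms minus_equality[of x "\<ominus> y"] by simp
qed (use assms in \<open>simp add: minus_eq r_neg\<close>)

lemma (in abelian_group) add_minus_cancel:
  assumes "x \<in> carrier G" "y \<in> carrier G"
  shows "y \<oplus> (x \<ominus> y) = x" "(x \<ominus> y) \<oplus> y = x" "x \<oplus> y \<ominus> y = x" "y \<oplus> x \<ominus> y = x"
    "x \<ominus> (x \<ominus> y) = y"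
proof -
  show *: "(x \<ominus> y) \<oplus> y = x" "x \<oplus> y \<ominus> y = x"
    using assms by (simp_all add: minus_eq a_assoc r_neg l_neg)
  show "y \<oplus> (x \<ominus> y) = x" "y \<oplus> x \<ominus> y = x"
    using assms * by (simp_all add: a_comm)
  then show "x \<ominus> (x \<ominus> y) = y"
    using assms by (simp add: minus_eq minus_add r_neg1 a_assoc[symmetric] r_neg)
qed

context cring
begin

lemma module_homs_minus:
  assumes "module R A" "module R B" "\<phi> \<in> module_homs R A B" "x \<in> carrier A" "y \<in> carrier A"
  shows "\<phi> (x \<ominus>\<^bsub>A\<^esub> y) = \<phi> x \<ominus>\<^bsub>B\<^esub> \<phi> y"
proof -
  interpret A: module R A by fact
  interpret B: module R B by fact
  have "\<phi> ((\<ominus> \<one>) \<odot>\<^bsub>A\<^esub> y) = (\<ominus> \<one>) \<odot>\<^bsub>B\<^esub> \<phi> y"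
    using assms by (intro module_homs_smult) auto
  then have "\<phi> (\<ominus>\<^bsub>A\<^esub> y) = \<ominus>\<^bsub>B\<^esub> \<phi> y"
    using assms module_homs_closed[OF assms(3)] by (simp add: A.smult_l_minus B.smult_l_minus)
  then show ?thesis using assms by (simp add: a_minus_def module_homs_add)
qed

lemma module_homs_comp':
  "\<phi> \<in> module_homs R U V \<Longrightarrow> \<psi> \<in> module_homs R V W \<Longrightarrow> (\<lambda>x. \<psi> (\<phi> x)) \<in> module_homs R U W"
  using module_homs_comp[of \<phi> U V \<psi> W] by (simp add: comp_def)

lemma module_homs_pointwise:
  assumes "module R A" "module R B" "\<phi> \<in> module_homs R A B"
  shows module_homs_pointwise_add: "\<psi> \<in> module_homs R A B \<Longrightarrow> (\<lambda>x. \<phi> x \<oplus>\<^bsub>B\<^esub> \<psi> x) \<in> module_homs R A B"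
    and module_homs_pointwise_diff: "\<psi> \<in> module_homs R A B \<Longrightarrow> (\<lambda>x. \<phi> x \<ominus>\<^bsub>B\<^esub> \<psi> x) \<in> module_homs R A B"
    and module_homs_pointwise_smult: "r \<in> carrier R \<Longrightarrow> (\<lambda>x. r \<odot>\<^bsub>B\<^esub> \<phi> x) \<in> module_homs R A B"
proof -
  interpret A: module R A by fact
  interpret B: module R B by fact
  have c: "s \<odot>\<^bsub>B\<^esub> (t \<odot>\<^bsub>B\<^esub> y) = t \<odot>\<^bsub>B\<^esub> (s \<odot>\<^bsub>B\<^esub> y)" if "s \<in> carrier R" "t \<in> carrier R" "y \<in> carrier B" for s t y
    using that by (simp flip: B.smult_assoc1 add: m_comm)
  have sm: "(\<lambda>x. r \<odot>\<^bsub>B\<^esub> \<phi> x) \<in> module_homs R A B" if "r \<in> carrier R" "\<phi> \<in> module_homs R A B" for r \<phi>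
    using that by (intro module_homsI)
      (auto simp: module_homs_closed module_homs_add module_homs_smult B.smult_r_distr c)
  show "(\<lambda>x. r \<odot>\<^bsub>B\<^esub> \<phi> x) \<in> module_homs R A B" if "r \<in> carrier R" by (rule sm[OF that assms(3)])
  have ad: "(\<lambda>x. \<phi> x \<oplus>\<^bsub>B\<^esub> \<psi> x) \<in> module_homs R A B" if "\<psi> \<in> module_homs R A B" for \<psi>
    using that assms(3) by (intro module_homsI)
      (auto simp: module_homs_closed module_homs_add module_homs_smult B.smult_r_distr B.M.a_ac)
  show "(\<lambda>x. \<phi> x \<oplus>\<^bsub>B\<^esub> \<psi> x) \<in> module_homs R A B" if "\<psi> \<in> module_homs R A B" by (rule ad[OF that])
  show "(\<lambda>x. \<phi> x \<ominus>\<^bsub>B\<^esub> \<psi> x) \<in> module_homs R A B" if psi: "\<psi> \<in> module_homs R A B"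
  proof (rule module_homs_cong[OF assms(1)])
    show "(\<lambda>x. \<phi> x \<oplus>\<^bsub>B\<^esub> (\<ominus> \<one>) \<odot>\<^bsub>B\<^esub> \<psi> x) \<in> module_homs R A B"
      by (rule ad[OF sm[OF _ psi]]) simp
  qed (use psi in \<open>auto simp: a_minus_def B.smult_l_minus module_homs_closed\<close>)
qed

lemma module_homs_const_zero:
  assumes "module R A" "module R B"
  shows "(\<lambda>x. \<zero>\<^bsub>B\<^esub>) \<in> module_homs R A B"
proof -
  interpret A: module R A by fact
  interpret B: module R B by fact
  show ?thesis by (intro module_homsI) auto
qed

text \<open>The universal property of a quotient, without quotient modules.\<close>

lemma surjective_factor:
  assumes "module R A" "module R B" "module R E"
    and u: "u \<in> module_homs R A B" and surj: "carrier B \<subseteq> u ` carrier A"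
    and h: "h \<in> module_homs R A E"
    and ker: "\<And>x. x \<in> carrier A \<Longrightarrow> u x = \<zero>\<^bsub>B\<^esub> \<Longrightarrow> h x = \<zero>\<^bsub>E\<^esub>"
  obtains g where "g \<in> module_homs R B E" "\<And>x. x \<in> carrier A \<Longrightarrow> g (u x) = h x"
proof -
  interpret A: module R A by fact
  interpret B: module R B by fact
  interpret E: module R E by fact
  define g where "g b = h (SOME x. x \<in> carrier A \<and> u x = b)" for b
  have g: "g (u x) = h x" if x: "x \<in> carrier A" for x
  proof -
    define y where "y = (SOME y. y \<in> carrier A \<and> u y = u x)"
    have y: "y \<in> carrier A \<and> u y = u x"
      unfolding y_def by (rule someI[of _ x]) (use x in simp)
    then have "u (y \<ominus>\<^bsub>A\<^esub> x) = \<zero>\<^bsub>B\<^esub>"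
      using x u by (simp add: module_homs_minus[OF assms(1,2) u] module_homs_closed B.M.minus_eq_zero_iff)
    then have "h (y \<ominus>\<^bsub>A\<^esub> x) = \<zero>\<^bsub>E\<^esub>" using x y by (intro ker) auto
    then have "h y = h x"
      using x y h by (simp add: module_homs_minus[OF assms(1,3) h] module_homs_closed E.M.minus_eq_zero_iff)
    then show ?thesis by (simp add: g_def y_def)
  qed
  have "g \<in> module_homs R B E"
  proof (rule module_homsI)
    fix x assume "x \<in> carrier B"
    then obtain a where a: "a \<in> carrier A" "x = u a" using surj by auto
    then show "g x \<in> carrier E" using g h by (simp add: module_homs_closed)
    show "g (r \<odot>\<^bsub>B\<^esub> x) = r \<odot>\<^bsub>E\<^esub> g x" if "r \<in> carrier R" for r
      using a that g[of a] g[of "r \<odot>\<^bsub>A\<^esub> a"] by (simp add: module_homs_smult[OF u] module_homs_smult[OF h])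
    fix y assume "y \<in> carrier B"
    then obtain b where b: "b \<in> carrier A" "y = u b" using surj by auto
    then show "g (x \<oplus>\<^bsub>B\<^esub> y) = g x \<oplus>\<^bsub>E\<^esub> g y"
      using a g[of a] g[of b] g[of "a \<oplus>\<^bsub>A\<^esub> b"] by (simp add: module_homs_add[OF u] module_homs_add[OF h])
  qed
  with g show ?thesis using that by blast
qed

text \<open>Injectivity in the form in which it is used below: a map that vanishes where \<open>u\<close> does
  factors through \<open>u\<close>, by factoring through the image of \<open>u\<close> and extending.\<close>

lemma injective_factor:
  assumes "module R A" "module R B" and inj: "injective_module R E"
    and u: "u \<in> module_homs R A B" and h: "h \<in> module_homs R A E"
    and ker: "\<And>x. x \<in> carrier A \<Longrightarrow> u x = \<zero>\<^bsub>B\<^esub> \<Longrightarrow> h x = \<zero>\<^bsub>E\<^esub>"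
  obtains g where "g \<in> module_homs R B E" "\<And>x. x \<in> carrier A \<Longrightarrow> g (u x) = h x"
proof -
  let ?I = "B\<lparr>carrier := u ` carrier A\<rparr>"
  have E: "module R E" using inj by (simp add: injective_module_def)
  have sub: "submodule (u ` carrier A) R B" by (rule submodule_image[OF assms(1,2) u])
  have I: "module R ?I" by (rule submodule.submodule_is_module[OF sub assms(2)])
  have "u \<in> module_homs R A ?I" using u by (auto simp: module_homs_def)
  then obtain g where g: "g \<in> module_homs R ?I E" "\<And>x. x \<in> carrier A \<Longrightarrow> g (u x) = h x"
    using surjective_factor[OF assms(1) I E _ _ h] ker by auto
  have "id \<in> module_homs R ?I B"
    using u by (auto simp: module_homs_def)
  then obtain g' where "g' \<in> module_homs R B E" "\<forall>y\<in>u ` carrier A. g' y = g y"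
    using injective_module_extension[OF inj I assms(2)] g(1) unfolding extension_property_def by fastforce
  with g show ?thesis using that by auto
qed

text \<open>Projectivity of free modules: the lift is determined by preimages of the images of the basis.\<close>

lemma free_lift:
  assumes "module R B" "module R C"
    and u: "u \<in> module_homs R B C" and h: "h \<in> module_homs R (free_module R X) C"
    and im: "\<And>p. p \<in> carrier (free_module R X) \<Longrightarrow> h p \<in> u ` carrier B"
  obtains g where "g \<in> module_homs R (free_module R X) B" "\<And>p. p \<in> carrier (free_module R X) \<Longrightarrow> u (g p) = h p"
proof -
  have "\<exists>b\<in>carrier B. u b = h (basis_vector R x)" if "x \<in> X" for x
    using im[OF basis_vector_closed[OF that]] by auto
  then obtain b where b: "\<And>x. x \<in> X \<Longrightarrow> b x \<in> carrier B" "\<And>x. x \<in> X \<Longrightarrow> u (b x) = h (basis_vector R x)"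
    by metis
  let ?g = "linear_extension R B b"
  have g: "?g \<in> module_homs R (free_module R X) B" by (rule linear_extension_hom) (use assms b in auto)
  have "u (?g p) = h p" if "p \<in> carrier (free_module R X)" for p
    by (rule free_module_hom_eq[OF assms(2) module_homs_comp'[OF g u] h _ that])
      (use b assms in \<open>simp add: linear_extension_basis_vector[of B b X]\<close>)
  with g show ?thesis using that by blast
qed

end

section \<open>Weakly Laskerian subquotients\<close>

text \<open>The property that the subquotient $Z/B$ of $W$ is weakly Laskerian. The residue class of \<open>y\<close> modulo \<open>U\<close> has
  the annihilator \<open>{r. r y \<in> U}\<close>, so no quotient module is needed to say this.\<close>

definition weakly_laskerian_subquotient ::
    "('r, 'x) ring_scheme \<Rightarrow> ('r, 'a) module \<Rightarrow> 'a set \<Rightarrow> 'a set \<Rightarrow> bool"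
  where "weakly_laskerian_subquotient R W Z B \<longleftrightarrow>
    (\<forall>U. submodule U R W \<longrightarrow> B \<subseteq> U \<longrightarrow> U \<subseteq> Z \<longrightarrow>
      finite {P \<in> spec R. \<exists>y\<in>Z. P = {r \<in> carrier R. r \<odot>\<^bsub>W\<^esub> y \<in> U}})"

text \<open>Maps between subquotients are replaced by linear relations; in this way a connecting
  homomorphism needs neither choices nor residue classes.\<close>

definition linear_relation ::
    "('r, 'x) ring_scheme \<Rightarrow> ('r, 'a) module \<Rightarrow> ('r, 'b) module \<Rightarrow> ('a \<times> 'b) set \<Rightarrow> bool"
  where "linear_relation R X Y F \<longleftrightarrow> F \<subseteq> carrier X \<times> carrier Y \<and> (\<zero>\<^bsub>X\<^esub>, \<zero>\<^bsub>Y\<^esub>) \<in> F \<and>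
    (\<forall>x y x' y'. (x, y) \<in> F \<longrightarrow> (x', y') \<in> F \<longrightarrow> (x \<oplus>\<^bsub>X\<^esub> x', y \<oplus>\<^bsub>Y\<^esub> y') \<in> F) \<and>
    (\<forall>r\<in>carrier R. \<forall>x y. (x, y) \<in> F \<longrightarrow> (r \<odot>\<^bsub>X\<^esub> x, r \<odot>\<^bsub>Y\<^esub> y) \<in> F)"

lemma linear_relationI:
  assumes "\<And>x y. (x, y) \<in> F \<Longrightarrow> x \<in> carrier X \<and> y \<in> carrier Y" "(\<zero>\<^bsub>X\<^esub>, \<zero>\<^bsub>Y\<^esub>) \<in> F"
    "\<And>x y x' y'. (x, y) \<in> F \<Longrightarrow> (x', y') \<in> F \<Longrightarrow> (x \<oplus>\<^bsub>X\<^esub> x', y \<oplus>\<^bsub>Y\<^esub> y') \<in> F"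
    "\<And>r x y. r \<in> carrier R \<Longrightarrow> (x, y) \<in> F \<Longrightarrow> (r \<odot>\<^bsub>X\<^esub> x, r \<odot>\<^bsub>Y\<^esub> y) \<in> F"
  shows "linear_relation R X Y F"
  using assms unfolding linear_relation_def by auto

context cring
begin

lemma linear_relationD:
  assumes "module R X" "module R Y" "linear_relation R X Y F"
  shows "(x, y) \<in> F \<Longrightarrow> x \<in> carrier X" "(x, y) \<in> F \<Longrightarrow> y \<in> carrier Y" "(\<zero>\<^bsub>X\<^esub>, \<zero>\<^bsub>Y\<^esub>) \<in> F"
    "(x, y) \<in> F \<Longrightarrow> (x', y') \<in> F \<Longrightarrow> (x \<oplus>\<^bsub>X\<^esub> x', y \<oplus>\<^bsub>Y\<^esub> y') \<in> F"
    "r \<in> carrier R \<Longrightarrow> (x, y) \<in> F \<Longrightarrow> (r \<odot>\<^bsub>X\<^esub> x, r \<odot>\<^bsub>Y\<^esub> y) \<in> F"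
    "(x, y) \<in> F \<Longrightarrow> (x', y') \<in> F \<Longrightarrow> (x \<ominus>\<^bsub>X\<^esub> x', y \<ominus>\<^bsub>Y\<^esub> y') \<in> F"
proof -
  interpret X: module R X by fact
  interpret Y: module R Y by fact
  show c: "x \<in> carrier X" "y \<in> carrier Y" if "(x, y) \<in> F" for x y
    using assms(3) that unfolding linear_relation_def by auto
  show "(\<zero>\<^bsub>X\<^esub>, \<zero>\<^bsub>Y\<^esub>) \<in> F" using assms(3) unfolding linear_relation_def by auto
  show ad: "(x \<oplus>\<^bsub>X\<^esub> x', y \<oplus>\<^bsub>Y\<^esub> y') \<in> F" if "(x, y) \<in> F" "(x', y') \<in> F" for x y x' y'
    using assms(3) that unfolding linear_relation_def by blast
  show sm: "(r \<odot>\<^bsub>X\<^esub> x, r \<odot>\<^bsub>Y\<^esub> y) \<in> F" if "r \<in> carrier R" "(x, y) \<in> F" for r x y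
    using assms(3) that unfolding linear_relation_def by blast
  show "(x \<ominus>\<^bsub>X\<^esub> x', y \<ominus>\<^bsub>Y\<^esub> y') \<in> F" if "(x, y) \<in> F" "(x', y') \<in> F"
    using ad[OF that(1) sm[OF _ that(2), of "\<ominus> \<one>"]] c[OF that(2)]
    by (simp add: a_minus_def X.smult_l_minus Y.smult_l_minus)
qed

lemma submodule_relation_preimage:
  assumes "module R X" "module R Y" "linear_relation R X Y F" "submodule U R Y"
  shows "submodule {x. \<exists>u\<in>U. (x, u) \<in> F} R X"
proof -
  interpret X: module R X by fact
  interpret Y: module R Y by fact
  note FD = linear_relationD[OF assms(1-3)] and UD = Y.submoduleD[OF assms(4)]
  show ?thesis
  proof (rule X.submoduleI')
    show "{x. \<exists>u\<in>U. (x, u) \<in> F} \<subseteq> carrier X" using FD(1) by blast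
    show "\<zero>\<^bsub>X\<^esub> \<in> {x. \<exists>u\<in>U. (x, u) \<in> F}" using FD(3) UD(3) by blast
    fix x assume "x \<in> {x. \<exists>u\<in>U. (x, u) \<in> F}"
    then obtain u where u: "u \<in> U" "(x, u) \<in> F" by blast
    show "r \<odot>\<^bsub>X\<^esub> x \<in> {x. \<exists>u\<in>U. (x, u) \<in> F}" if "r \<in> carrier R" for r
      using FD(5)[OF that u(2)] UD(5)[OF that u(1)] by blast
    fix y assume "y \<in> {x. \<exists>u\<in>U. (x, u) \<in> F}"
    then obtain v where v: "v \<in> U" "(y, v) \<in> F" by blast
    show "x \<oplus>\<^bsub>X\<^esub> y \<in> {x. \<exists>u\<in>U. (x, u) \<in> F}"
      using FD(4)[OF u(2) v(2)] UD(4)[OF u(1) v(1)] by blast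
  qed
qed

lemma linear_relation_converse:
  assumes "linear_relation R X Y F"
  shows "linear_relation R Y X (F\<inverse>)"
  using assms unfolding linear_relation_def by auto

lemma submodule_relation_image:
  assumes "module R X" "module R Y" "linear_relation R X Y F" "submodule U R X"
  shows "submodule {y. \<exists>u\<in>U. (u, y) \<in> F} R Y"
  using submodule_relation_preimage[OF assms(2,1) linear_relation_converse[OF assms(3)] assms(4)] by simp

lemma submodule_sum:
  assumes "module R W" "submodule U R W" "submodule V R W"
  shows "submodule {u \<oplus>\<^bsub>W\<^esub> v | u v. u \<in> U \<and> v \<in> V} R W"
proof -
  interpret W: module R W by fact
  note UD = W.submoduleD[OF assms(2)] and VD = W.submoduleD[OF assms(3)]
  have I: "u \<oplus>\<^bsub>W\<^esub> v \<in> {u \<oplus>\<^bsub>W\<^esub> v | u v. u \<in> U \<and> v \<in> V}" if "u \<in> U" "v \<in> V" for u v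
    using that by blast
  show ?thesis
  proof (rule W.submoduleI')
    show "{u \<oplus>\<^bsub>W\<^esub> v | u v. u \<in> U \<and> v \<in> V} \<subseteq> carrier W" using UD(2) VD(2) by auto
    show "\<zero>\<^bsub>W\<^esub> \<in> {u \<oplus>\<^bsub>W\<^esub> v | u v. u \<in> U \<and> v \<in> V}"
      using I[OF UD(3) VD(3)] by simp
    fix x assume "x \<in> {u \<oplus>\<^bsub>W\<^esub> v | u v. u \<in> U \<and> v \<in> V}"
    then obtain u v where x: "x = u \<oplus>\<^bsub>W\<^esub> v" "u \<in> U" "v \<in> V" by blast
    then have c: "u \<in> carrier W" "v \<in> carrier W" using UD(2) VD(2) by auto
    show "r \<odot>\<^bsub>W\<^esub> x \<in> {u \<oplus>\<^bsub>W\<^esub> v | u v. u \<in> U \<and> v \<in> V}" if "r \<in> carrier R" for r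
      using I[OF UD(5)[OF that x(2)] VD(5)[OF that x(3)]] c that by (simp add: x(1) W.smult_r_distr)
    fix y assume "y \<in> {u \<oplus>\<^bsub>W\<^esub> v | u v. u \<in> U \<and> v \<in> V}"
    then obtain u' v' where y: "y = u' \<oplus>\<^bsub>W\<^esub> v'" "u' \<in> U" "v' \<in> V" by blast
    then have c': "u' \<in> carrier W" "v' \<in> carrier W" using UD(2) VD(2) by auto
    have "x \<oplus>\<^bsub>W\<^esub> y = (u \<oplus>\<^bsub>W\<^esub> u') \<oplus>\<^bsub>W\<^esub> (v \<oplus>\<^bsub>W\<^esub> v')"
      using c c' by (simp add: x(1) y(1) W.M.a_ac)
    then show "x \<oplus>\<^bsub>W\<^esub> y \<in> {u \<oplus>\<^bsub>W\<^esub> v | u v. u \<in> U \<and> v \<in> V}"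
      using I[OF UD(4)[OF x(2) y(2)] VD(4)[OF x(3) y(3)]] by simp
  qed
qed

lemma submodule_inter:
  assumes "module R W" "submodule U R W" "submodule V R W"
  shows "submodule (U \<inter> V) R W"
proof -
  interpret W: module R W by fact
  note D = W.submoduleD[OF assms(2)] and D' = W.submoduleD[OF assms(3)]
  show ?thesis by (rule W.submoduleI') (use D D' in auto)
qed

lemma submodule_image_of_submodule:
  assumes "module R U" "module R V" "\<phi> \<in> module_homs R U V" "submodule S R U"
  shows "submodule (\<phi> ` S) R V"
proof -
  interpret U: module R U by fact
  have "\<phi> \<in> module_homs R (U\<lparr>carrier := S\<rparr>) V"
    using assms(3) U.submoduleD(2)[OF assms(4)] by (auto simp: module_homs_def)
  then show ?thesis
    using submodule_image[OF submodule.submodule_is_module[OF assms(4,1)] assms(2)] by fastforce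
qed

lemma linear_relation_graph:
  assumes A: "module R A" and B: "module R B" and f: "f \<in> module_homs R A B"
  shows "linear_relation R A B {(x, f x) | x. x \<in> carrier A}"
proof (rule linear_relationI)
  interpret A: module R A by (rule A)
  show "(\<zero>\<^bsub>A\<^esub>, \<zero>\<^bsub>B\<^esub>) \<in> {(x, f x) | x. x \<in> carrier A}"
    using module_homs_zero[OF A B f] by (metis (mono_tags, lifting) A.M.zero_closed mem_Collect_eq)
  fix x y assume "(x, y) \<in> {(x, f x) | x. x \<in> carrier A}"
  then have x: "x \<in> carrier A" "y = f x" by auto
  then show "x \<in> carrier A \<and> y \<in> carrier B" using module_homs_closed[OF f] by simp
  show "(r \<odot>\<^bsub>A\<^esub> x, r \<odot>\<^bsub>B\<^esub> y) \<in> {(x, f x) | x. x \<in> carrier A}" if "r \<in> carrier R" for r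
    using x module_homs_smult[OF f that x(1)] A.smult_closed[OF that x(1)] by auto
  fix x' y' assume "(x', y') \<in> {(x, f x) | x. x \<in> carrier A}"
  then have x': "x' \<in> carrier A" "y' = f x'" by auto
  show "(x \<oplus>\<^bsub>A\<^esub> x', y \<oplus>\<^bsub>B\<^esub> y') \<in> {(x, f x) | x. x \<in> carrier A}"
    using x x' module_homs_add[OF f x(1) x'(1)] A.M.a_closed[OF x(1) x'(1)] by auto
qed

text \<open>Weakly Laskerian modules form a Serre class: the relations \<open>F\<close> and \<open>G\<close> form a sequence
  of subquotients $Z_1/B_1 \to Z_2/B_2 \to Z_3/B_3$ in which the kernel of \<open>G\<close> lies in the image of \<open>F\<close>. If a prime \<open>P\<close> is the
  annihilator of the class of \<open>y\<close> modulo \<open>U\<close>, then every nonzero multiple of that class has the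
  annihilator \<open>P\<close> as well. Either such a multiple comes from $Z_1$, and \<open>P\<close> is associated to a quotient
  of $Z_1/B_1$; or the multiples of the class embed into a quotient of $Z_3/B_3$.\<close>

lemma weakly_laskerian_subquotient_exact:
  fixes X :: "('a, 'm) module" and Y :: "('a, 'n) module" and V :: "('a, 'p) module"
  assumes X: "module R X" and Y: "module R Y" and V: "module R V"
    and wX: "weakly_laskerian_subquotient R X Z1 B1" and wV: "weakly_laskerian_subquotient R V Z3 B3"
    and F: "linear_relation R X Y F" "F \<subseteq> Z1 \<times> Z2" and G: "linear_relation R Y V G" "G \<subseteq> Z2 \<times> Z3"
    and B1: "\<zero>\<^bsub>X\<^esub> \<in> B1" "B1 \<subseteq> Z1" and B2: "submodule B2 R Y" and B3: "submodule B3 R V" "B3 \<subseteq> Z3" and Z3: "submodule Z3 R V"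
    and Ft: "\<And>x. x \<in> Z1 \<Longrightarrow> \<exists>y. (x, y) \<in> F" and Fb: "\<And>x y. (x, y) \<in> F \<Longrightarrow> x \<in> B1 \<Longrightarrow> y \<in> B2"
    and Gt: "\<And>y. y \<in> Z2 \<Longrightarrow> \<exists>z. (y, z) \<in> G"
    and ex: "\<And>y z. (y, z) \<in> G \<Longrightarrow> z \<in> B3 \<Longrightarrow> \<exists>x y'. (x, y') \<in> F \<and> y \<ominus>\<^bsub>Y\<^esub> y' \<in> B2"
  shows "weakly_laskerian_subquotient R Y Z2 B2"
  unfolding weakly_laskerian_subquotient_def
proof (intro allI impI)
  fix U assume U: "submodule U R Y" and BU: "B2 \<subseteq> U" and "U \<subseteq> Z2"
  interpret X: module R X by fact
  interpret Y: module R Y by fact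
  interpret V: module R V by fact
  note FD = linear_relationD[OF X Y F(1)] and GD = linear_relationD[OF Y V G(1)]
  note UD = Y.submoduleD[OF U] and B3D = V.submoduleD[OF B3(1)] and B2D = Y.submoduleD[OF B2]
  define U1 where "U1 = {x. \<exists>u\<in>U. (x, u) \<in> F}"
  define N where "N = {u \<oplus>\<^bsub>Y\<^esub> f | u f. u \<in> U \<and> f \<in> {f. \<exists>x\<in>carrier X. (x, f) \<in> F}}"
  define U3 where "U3 = {z \<oplus>\<^bsub>V\<^esub> b | z b. z \<in> {z. \<exists>y\<in>N. (y, z) \<in> G} \<and> b \<in> B3}"
  have U1: "submodule U1 R X"
    unfolding U1_def by (rule submodule_relation_preimage[OF X Y F(1) U])
  have N: "submodule N R Y"
    unfolding N_def
    by (intro submodule_sum Y U submodule_relation_image[OF X Y F(1)] X.carrier_is_submodule)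
  have U3: "submodule U3 R V"
    unfolding U3_def by (intro submodule_sum V B3(1) submodule_relation_image[OF Y V G(1)] N)
  note ND = Y.submoduleD[OF N]
  have NI: "u \<oplus>\<^bsub>Y\<^esub> f \<in> N" if "u \<in> U" "(x, f) \<in> F" for u x f
    using that FD(1)[OF that(2)] unfolding N_def by blast
  have NE: "\<exists>u\<in>U. \<exists>x f. (x, f) \<in> F \<and> y = u \<oplus>\<^bsub>Y\<^esub> f" if "y \<in> N" for y
    using that unfolding N_def by blast
  have U3I: "z \<oplus>\<^bsub>V\<^esub> b \<in> U3" if "y \<in> N" "(y, z) \<in> G" "b \<in> B3" for y z b
    using that unfolding U3_def by blast
  have U3E: "\<exists>y\<in>N. \<exists>z'. \<exists>b\<in>B3. (y, z') \<in> G \<and> z = z' \<oplus>\<^bsub>V\<^esub> b" if "z \<in> U3" for z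
    using that unfolding U3_def by blast
  have U3I0: "z \<in> U3" if "y \<in> N" "(y, z) \<in> G" for y z
    using U3I[OF that B3D(3)] GD(2)[OF that(2)] by simp
  have UN: "U \<subseteq> N"
  proof
    fix u assume "u \<in> U"
    then show "u \<in> N" using NI[OF _ FD(3), of u] UD(2)[of u] by simp
  qed
  let ?S1 = "{P \<in> spec R. \<exists>y\<in>Z1. P = {r \<in> carrier R. r \<odot>\<^bsub>X\<^esub> y \<in> U1}}"
  let ?S3 = "{P \<in> spec R. \<exists>y\<in>Z3. P = {r \<in> carrier R. r \<odot>\<^bsub>V\<^esub> y \<in> U3}}"
  have "finite ?S1"
  proof -
    have "B1 \<subseteq> U1" using Ft Fb B1(2) BU unfolding U1_def by blast
    moreover have "U1 \<subseteq> Z1" using F(2) unfolding U1_def by blast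
    ultimately show ?thesis using wX U1 unfolding weakly_laskerian_subquotient_def by blast
  qed
  moreover have "finite ?S3"
  proof -
    have "b \<in> U3" if "b \<in> B3" for b
      using U3I[OF ND(3) GD(3) that] B3D(2)[OF that] by simp
    moreover have "U3 \<subseteq> Z3"
    proof
      fix z assume "z \<in> U3"
      then obtain z' b where "z' \<in> Z3" "b \<in> B3" "z = z' \<oplus>\<^bsub>V\<^esub> b" using G(2) U3E by blast
      then show "z \<in> Z3" using V.submoduleD(4)[OF Z3] B3(2) by blast
    qed
    ultimately show ?thesis using wV U3 unfolding weakly_laskerian_subquotient_def by blast
  qed
  moreover have "P \<in> ?S1 \<union> ?S3" if P: "P \<in> spec R" and y: "y \<in> Z2" "P = {r \<in> carrier R. r \<odot>\<^bsub>Y\<^esub> y \<in> U}" for P y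
  proof -
    interpret P: primeideal P R using P by (simp add: spec_def)
    obtain z where z: "(y, z) \<in> G" using Gt[OF y(1)] by blast
    have yc: "y \<in> carrier Y" using GD(1)[OF z] .
    have yP: "t \<in> P \<longleftrightarrow> t \<odot>\<^bsub>Y\<^esub> y \<in> U" if "t \<in> carrier R" for t
      using that by (subst y(2)) blast
    show ?thesis
    proof (cases "\<exists>r\<in>carrier R - P. r \<odot>\<^bsub>Y\<^esub> y \<in> N")
      case True
      \<comment> \<open>A multiple of the class of \<open>y\<close> by some \<open>r \<notin> P\<close> comes from \<open>X\<close>, and still has annihilator \<open>P\<close>.\<close>
      then obtain r u x f where r: "r \<in> carrier R" "r \<notin> P" and u: "u \<in> U" "(x, f) \<in> F" "r \<odot>\<^bsub>Y\<^esub> y = u \<oplus>\<^bsub>Y\<^esub> f"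
        using NE by blast
      have uc: "u \<in> carrier Y" "f \<in> carrier Y" using u UD(2) FD(2) by auto
      have "t \<odot>\<^bsub>X\<^esub> x \<in> U1 \<longleftrightarrow> t \<in> P" if t: "t \<in> carrier R" for t
      proof -
        have tr: "(t \<otimes> r) \<odot>\<^bsub>Y\<^esub> y = t \<odot>\<^bsub>Y\<^esub> u \<oplus>\<^bsub>Y\<^esub> t \<odot>\<^bsub>Y\<^esub> f"
          using t uc u(3) r yc by (simp add: Y.smult_r_distr Y.smult_assoc1)
        show ?thesis
        proof
        assume "t \<odot>\<^bsub>X\<^esub> x \<in> U1"
        then obtain v where v: "v \<in> U" "(t \<odot>\<^bsub>X\<^esub> x, v) \<in> F" unfolding U1_def by blast
        have "(\<zero>\<^bsub>X\<^esub>, t \<odot>\<^bsub>Y\<^esub> f \<ominus>\<^bsub>Y\<^esub> v) \<in> F"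
          using FD(6)[OF FD(5)[OF t u(2)] v(2)] FD(1)[OF v(2)] X.M.minus_eq_zero_iff[of "t \<odot>\<^bsub>X\<^esub> x" "t \<odot>\<^bsub>X\<^esub> x"] by simp
        then have "t \<odot>\<^bsub>Y\<^esub> f \<ominus>\<^bsub>Y\<^esub> v \<in> U" using Fb B1(1) BU by blast
        then have "(t \<odot>\<^bsub>Y\<^esub> f \<ominus>\<^bsub>Y\<^esub> v) \<oplus>\<^bsub>Y\<^esub> v \<in> U" using v UD(4) by blast
        then have "t \<odot>\<^bsub>Y\<^esub> f \<in> U" using t uc UD(2)[OF v(1)] by (simp add: Y.M.add_minus_cancel)
        then have "t \<odot>\<^bsub>Y\<^esub> u \<oplus>\<^bsub>Y\<^esub> t \<odot>\<^bsub>Y\<^esub> f \<in> U" using UD(4) UD(5)[OF t u(1)] by blast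
        then have "(t \<otimes> r) \<odot>\<^bsub>Y\<^esub> y \<in> U" by (simp only: tr)
        then have "t \<otimes> r \<in> P" using yP[OF m_closed[OF t r(1)]] by blast
        then show "t \<in> P" using P.I_prime[OF t r(1)] r(2) by blast
      next
        assume "t \<in> P"
        then have "t \<otimes> r \<in> P" using r(1) P.I_r_closed by blast
        then have "(t \<otimes> r) \<odot>\<^bsub>Y\<^esub> y \<in> U" using yP[OF m_closed[OF t r(1)]] by blast
        then have "(t \<odot>\<^bsub>Y\<^esub> u \<oplus>\<^bsub>Y\<^esub> t \<odot>\<^bsub>Y\<^esub> f) \<ominus>\<^bsub>Y\<^esub> t \<odot>\<^bsub>Y\<^esub> u \<in> U" 
          unfolding tr by (rule UD(6)[OF _ UD(5)[OF t u(1)]])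
        then have "t \<odot>\<^bsub>Y\<^esub> f \<in> U" using t uc by (simp add: Y.M.add_minus_cancel)
        then show "t \<odot>\<^bsub>X\<^esub> x \<in> U1" unfolding U1_def using FD(5)[OF t u(2)] by blast
        qed
      qed
      then have "P = {r \<in> carrier R. r \<odot>\<^bsub>X\<^esub> x \<in> U1}" using P.a_subset by blast
      moreover have "x \<in> Z1" using u(2) F(2) by blast
      ultimately show ?thesis using P by blast
    next
      case False
      have "t \<odot>\<^bsub>V\<^esub> z \<in> U3 \<longleftrightarrow> t \<in> P" if t: "t \<in> carrier R" for t
      proof
        assume "t \<in> P"
        then have "t \<odot>\<^bsub>Y\<^esub> y \<in> N" using yP[OF t] UN by blast
        then show "t \<odot>\<^bsub>V\<^esub> z \<in> U3" using U3I0 GD(5)[OF t z] by blast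
      next
        assume "t \<odot>\<^bsub>V\<^esub> z \<in> U3"
        then obtain y' z' b where *: "y' \<in> N" "b \<in> B3" "(y', z') \<in> G" "t \<odot>\<^bsub>V\<^esub> z = z' \<oplus>\<^bsub>V\<^esub> b"
          using U3E by blast
        have "(t \<odot>\<^bsub>Y\<^esub> y \<ominus>\<^bsub>Y\<^esub> y', b) \<in> G"
          using GD(6)[OF GD(5)[OF t z] *(3)] *(4) GD(2)[OF *(3)] B3D(2)[OF *(2)] by (simp add: V.M.add_minus_cancel)
        from ex[OF this *(2)] obtain x f where f: "(x, f) \<in> F" "(t \<odot>\<^bsub>Y\<^esub> y \<ominus>\<^bsub>Y\<^esub> y') \<ominus>\<^bsub>Y\<^esub> f \<in> B2" by blast
        then have "((t \<odot>\<^bsub>Y\<^esub> y \<ominus>\<^bsub>Y\<^esub> y') \<ominus>\<^bsub>Y\<^esub> f) \<oplus>\<^bsub>Y\<^esub> f \<in> N" using BU NI by blast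
        then have "t \<odot>\<^bsub>Y\<^esub> y \<ominus>\<^bsub>Y\<^esub> y' \<in> N"
          using t yc ND(2)[OF *(1)] FD(2)[OF f(1)] by (simp add: Y.M.add_minus_cancel)
        then have "(t \<odot>\<^bsub>Y\<^esub> y \<ominus>\<^bsub>Y\<^esub> y') \<oplus>\<^bsub>Y\<^esub> y' \<in> N" using ND(4) *(1) by blast
        then have "t \<odot>\<^bsub>Y\<^esub> y \<in> N" using t yc ND(2)[OF *(1)] by (simp add: Y.M.add_minus_cancel)
        then show "t \<in> P" using False t by blast
      qed
      then have "P = {r \<in> carrier R. r \<odot>\<^bsub>V\<^esub> z \<in> U3}" using P.a_subset by blast
      moreover have "z \<in> Z3" using z G(2) by blast
      ultimately show ?thesis using P by blast
    qed
  qed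
  moreover have "{P \<in> spec R. \<exists>y\<in>Z2. P = {r \<in> carrier R. r \<odot>\<^bsub>Y\<^esub> y \<in> U}} \<subseteq> ?S1 \<union> ?S3"
    using calculation(3) by blast
  ultimately show "finite {P \<in> spec R. \<exists>y\<in>Z2. P = {r \<in> carrier R. r \<odot>\<^bsub>Y\<^esub> y \<in> U}}"
    by (meson finite_UnI finite_subset)
qed

text \<open>A zero module has no associated primes, since a prime ideal is proper.\<close>

lemma weakly_laskerian_subquotient_self: "weakly_laskerian_subquotient R W Z Z"
proof -
  have "{P \<in> spec R. \<exists>y\<in>Z. P = {r \<in> carrier R. r \<odot>\<^bsub>W\<^esub> y \<in> U}} = {}"
    if "submodule U R W" "Z \<subseteq> U" "U \<subseteq> Z" for U
  proof -
    have "{r \<in> carrier R. r \<odot>\<^bsub>W\<^esub> y \<in> U} = carrier R" if "y \<in> Z" for y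
      using submodule.smult_closed[OF \<open>submodule U R W\<close>] that \<open>Z \<subseteq> U\<close> by blast
    then show ?thesis using primeideal.I_notcarr by (fastforce simp: spec_def)
  qed
  then show ?thesis unfolding weakly_laskerian_subquotient_def
    by (intro allI impI) (simp only: finite.emptyI)
qed

lemma submodule_zero: "module R W \<Longrightarrow> submodule {\<zero>\<^bsub>W\<^esub>} R W"
proof -
  assume "module R W"
  then interpret W: module R W .
  show ?thesis by (rule W.submoduleI') auto
qed

lemma weakly_laskerian_subquotient_image:
  fixes X :: "('a, 'm) module" and Y :: "('a, 'n) module"
  assumes X: "module R X" and Y: "module R Y" and "weakly_laskerian_subquotient R X Z1 B1"
    and F: "linear_relation R X Y F" "F \<subseteq> Z1 \<times> Z2"
    and B1: "\<zero>\<^bsub>X\<^esub> \<in> B1" "B1 \<subseteq> Z1" and B2: "submodule B2 R Y" and Z2: "submodule Z2 R Y"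
    and "\<And>x. x \<in> Z1 \<Longrightarrow> \<exists>y. (x, y) \<in> F" and "\<And>x y. (x, y) \<in> F \<Longrightarrow> x \<in> B1 \<Longrightarrow> y \<in> B2"
    and ex: "\<And>y. y \<in> Z2 \<Longrightarrow> \<exists>x y'. (x, y') \<in> F \<and> y \<ominus>\<^bsub>Y\<^esub> y' \<in> B2"
  shows "weakly_laskerian_subquotient R Y Z2 B2"
proof -
  interpret Y: module R Y by fact
  note ZD = Y.submoduleD[OF Z2]
  have G: "linear_relation R Y Y (Z2 \<times> {\<zero>\<^bsub>Y\<^esub>})"
    by (rule linear_relationI) (use ZD in auto)
  show ?thesis
    by (rule weakly_laskerian_subquotient_exact[OF X Y Y assms(3)
          weakly_laskerian_subquotient_self[where Z = "{\<zero>\<^bsub>Y\<^esub>}"] F G])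
      (use assms ex submodule_zero[OF Y] in auto)
qed

lemma weakly_laskerian_subquotient_embed:
  fixes Y :: "('a, 'n) module" and V :: "('a, 'p) module"
  assumes Y: "module R Y" and V: "module R V" and "weakly_laskerian_subquotient R V Z3 B3"
    and G: "linear_relation R Y V G" "G \<subseteq> Z2 \<times> Z3"
    and B2: "submodule B2 R Y" and B3: "submodule B3 R V" "B3 \<subseteq> Z3" and Z3: "submodule Z3 R V"
    and Gt: "\<And>y. y \<in> Z2 \<Longrightarrow> \<exists>z. (y, z) \<in> G"
    and ex: "\<And>y z. (y, z) \<in> G \<Longrightarrow> z \<in> B3 \<Longrightarrow> y \<in> B2"
  shows "weakly_laskerian_subquotient R Y Z2 B2"
proof -
  interpret Y: module R Y by fact
  interpret V: module R V by fact
  have F: "linear_relation R Y Y {(\<zero>\<^bsub>Y\<^esub>, \<zero>\<^bsub>Y\<^esub>)}"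
    by (rule linear_relationI) auto
  have "(\<zero>\<^bsub>Y\<^esub>, \<zero>\<^bsub>V\<^esub>) \<in> G" using linear_relationD(3)[OF Y V G(1)] .
  then have "\<zero>\<^bsub>Y\<^esub> \<in> Z2" using G(2) by blast
  moreover have "y \<ominus>\<^bsub>Y\<^esub> \<zero>\<^bsub>Y\<^esub> = y" if "(y, z) \<in> G" for y z
    using linear_relationD(1)[OF Y V G(1) that] by (simp add: a_minus_def)
  ultimately show ?thesis
    by (intro weakly_laskerian_subquotient_exact[OF Y Y V
          weakly_laskerian_subquotient_self[where Z = "{\<zero>\<^bsub>Y\<^esub>}"] assms(3) F _ G])
      (use assms ex Y.submoduleD(3)[OF B2] in auto)
qed

lemma weakly_laskerian_subquotient_iso:
  fixes X :: "('a, 'm) module" and Y :: "('a, 'n) module"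
  assumes X: "module R X" and Y: "module R Y"
    and F: "linear_relation R X Y F" "F \<subseteq> Z1 \<times> Z2"
    and B1: "submodule B1 R X" "B1 \<subseteq> Z1" and Z1: "submodule Z1 R X"
    and B2: "submodule B2 R Y" "B2 \<subseteq> Z2" and Z2: "submodule Z2 R Y"
    and t1: "\<And>x. x \<in> Z1 \<Longrightarrow> \<exists>y. (x, y) \<in> F" and t2: "\<And>y. y \<in> Z2 \<Longrightarrow> \<exists>x. (x, y) \<in> F"
    and iff: "\<And>x y. (x, y) \<in> F \<Longrightarrow> x \<in> B1 \<longleftrightarrow> y \<in> B2"
  shows "weakly_laskerian_subquotient R X Z1 B1 \<longleftrightarrow> weakly_laskerian_subquotient R Y Z2 B2"
proof
  assume w: "weakly_laskerian_subquotient R Y Z2 B2"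
  show "weakly_laskerian_subquotient R X Z1 B1"
    by (rule weakly_laskerian_subquotient_embed[OF X Y w F B1(1) B2 Z2 t1]) (use iff in auto)
next
  assume w: "weakly_laskerian_subquotient R X Z1 B1"
  show "weakly_laskerian_subquotient R Y Z2 B2"
    by (rule weakly_laskerian_subquotient_embed[OF Y X w linear_relation_converse[OF F(1)] _ B2(1) B1 Z1])
      (use iff t2 F(2) in auto)
qed

lemma
  assumes "module R W" "submodule U R W" "x \<in> carrier W"
  shows coset_eq_self_iff: "U +>\<^bsub>W\<^esub> x = U \<longleftrightarrow> x \<in> U"
    and coset_eq_iff: "y \<in> carrier W \<Longrightarrow> U +>\<^bsub>W\<^esub> x = U +>\<^bsub>W\<^esub> y \<longleftrightarrow> x \<ominus>\<^bsub>W\<^esub> y \<in> U"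
    and mem_coset_iff: "y \<in> U +>\<^bsub>W\<^esub> x \<longleftrightarrow> y \<in> carrier W \<and> y \<ominus>\<^bsub>W\<^esub> x \<in> U"
proof -
  interpret W: module R W by fact
  note UD = W.submoduleD[OF assms(2)]
  have mem: "y \<in> U +>\<^bsub>W\<^esub> x \<longleftrightarrow> y \<in> carrier W \<and> y \<ominus>\<^bsub>W\<^esub> x \<in> U" if x: "x \<in> carrier W" for x y
  proof
    assume "y \<in> U +>\<^bsub>W\<^esub> x"
    then obtain u where u: "u \<in> U" "y = u \<oplus>\<^bsub>W\<^esub> x" by (auto simp: a_r_coset_def r_coset_def)
    then show "y \<in> carrier W \<and> y \<ominus>\<^bsub>W\<^esub> x \<in> U"
      using UD(2)[OF u(1)] x by (simp add: W.M.add_minus_cancel)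
  next
    assume y: "y \<in> carrier W \<and> y \<ominus>\<^bsub>W\<^esub> x \<in> U"
    then have "y = (y \<ominus>\<^bsub>W\<^esub> x) \<oplus>\<^bsub>W\<^esub> x" using x by (simp add: W.M.add_minus_cancel)
    then show "y \<in> U +>\<^bsub>W\<^esub> x" using y by (auto simp: a_r_coset_def r_coset_def)
  qed
  then show "y \<in> U +>\<^bsub>W\<^esub> x \<longleftrightarrow> y \<in> carrier W \<and> y \<ominus>\<^bsub>W\<^esub> x \<in> U" using assms(3) by blast
  have iff: "U +>\<^bsub>W\<^esub> x = U +>\<^bsub>W\<^esub> y \<longleftrightarrow> x \<ominus>\<^bsub>W\<^esub> y \<in> U" if x: "x \<in> carrier W" and y: "y \<in> carrier W" for x y
  proof
    assume "U +>\<^bsub>W\<^esub> x = U +>\<^bsub>W\<^esub> y"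
    then show "x \<ominus>\<^bsub>W\<^esub> y \<in> U" using mem[OF x, of x] mem[OF y, of x] UD(3) x
      by (simp add: W.M.minus_eq_zero_iff[THEN iffD2])
  next
    assume d: "x \<ominus>\<^bsub>W\<^esub> y \<in> U"
    have "z \<ominus>\<^bsub>W\<^esub> x \<in> U \<longleftrightarrow> z \<ominus>\<^bsub>W\<^esub> y \<in> U" if z: "z \<in> carrier W" for z
    proof -
      have e: "z \<ominus>\<^bsub>W\<^esub> y = (z \<ominus>\<^bsub>W\<^esub> x) \<oplus>\<^bsub>W\<^esub> (x \<ominus>\<^bsub>W\<^esub> y)"
        using x y z by (simp add: a_minus_def W.M.a_assoc W.M.r_neg1)
      then have "z \<ominus>\<^bsub>W\<^esub> x = (z \<ominus>\<^bsub>W\<^esub> y) \<ominus>\<^bsub>W\<^esub> (x \<ominus>\<^bsub>W\<^esub> y)" using x y z by (simp add: W.M.add_minus_cancel)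
      then show ?thesis using UD(6)[OF _ d, of "z \<ominus>\<^bsub>W\<^esub> y"] UD(4)[OF _ d, of "z \<ominus>\<^bsub>W\<^esub> x"] e by metis
    qed
    then show "U +>\<^bsub>W\<^esub> x = U +>\<^bsub>W\<^esub> y" using mem[OF x] mem[OF y] by blast
  qed
  then show "y \<in> carrier W \<Longrightarrow> U +>\<^bsub>W\<^esub> x = U +>\<^bsub>W\<^esub> y \<longleftrightarrow> x \<ominus>\<^bsub>W\<^esub> y \<in> U" using assms(3) by blast
  have "U +>\<^bsub>W\<^esub> \<zero>\<^bsub>W\<^esub> = U" using W.M.a_coset_add_zero[OF UD(1)] .
  moreover have "x \<ominus>\<^bsub>W\<^esub> \<zero>\<^bsub>W\<^esub> = x" using assms(3) by (simp add: a_minus_def)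
  ultimately show "U +>\<^bsub>W\<^esub> x = U \<longleftrightarrow> x \<in> U" using iff[OF assms(3), of "\<zero>\<^bsub>W\<^esub>"] by simp
qed

lemma quotient_projection_hom:
  assumes "module R W" "submodule U R W"
  shows "(\<lambda>x. U +>\<^bsub>W\<^esub> x) \<in> module_homs R W (quotient_module W U)"
  by (rule module_homsI)
    (simp_all only: quotient_module_smult[OF assms] quotient_module_add[OF assms],
     auto simp: quotient_module_simps(1))

lemma weakly_laskerian_iff:
  assumes W: "module R W"
  shows "weakly_laskerian R W \<longleftrightarrow> weakly_laskerian_subquotient R W (carrier W) {\<zero>\<^bsub>W\<^esub>}"
proof -
  interpret W: module R W by fact
  have "Ass R (quotient_module W U) = {P \<in> spec R. \<exists>y\<in>carrier W. P = {r \<in> carrier R. r \<odot>\<^bsub>W\<^esub> y \<in> U}}"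
    if U: "submodule U R W" for U
  proof -
    have "annihilator R (quotient_module W U) (U +>\<^bsub>W\<^esub> y) = {r \<in> carrier R. r \<odot>\<^bsub>W\<^esub> y \<in> U}"
      if y: "y \<in> carrier W" for y
      unfolding annihilator_def quotient_module_simps(2)
      by (rule Collect_cong) (simp add: quotient_module_smult[OF W U] coset_eq_self_iff[OF W U] y cong: conj_cong)
    then show ?thesis by (auto simp: Ass_def quotient_module_simps(1))
  qed
  moreover have "\<zero>\<^bsub>W\<^esub> \<in> U \<and> U \<subseteq> carrier W" if "submodule U R W" for U
    using W.submoduleD(1,3)[OF that] by blast
  ultimately show ?thesis
    unfolding weakly_laskerian_def weakly_laskerian_subquotient_def by auto
qed

lemma weakly_laskerian_quotient_iff:
  assumes W: "module R W" and Z: "submodule Z R W" and B: "submodule B R W" "B \<subseteq> Z"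
  shows "weakly_laskerian R (quotient_module (W\<lparr>carrier := Z\<rparr>) B) \<longleftrightarrow> weakly_laskerian_subquotient R W Z B"
proof -
  let ?W = "W\<lparr>carrier := Z\<rparr>"
  let ?Q = "quotient_module ?W B"
  have W': "module R ?W" by (rule submodule.submodule_is_module[OF Z W])
  have B': "submodule B R ?W" by (rule submodule_restrict[OF W Z B])
  have Q: "module R ?Q" by (rule module_quotient_module[OF W' B'])
  interpret W: module R W by fact
  interpret Q: module R ?Q by fact
  note p = quotient_projection_hom[OF W' B'] and ZD = W.submoduleD[OF Z]
  define F where "F = {(z, B +>\<^bsub>?W\<^esub> z) | z. z \<in> Z}"
  have FI: "(z, X) \<in> F" if "z \<in> Z" "X = B +>\<^bsub>?W\<^esub> z" for z X using that by (auto simp: F_def)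
  have F: "linear_relation R W ?Q F"
  proof (rule linear_relationI)
    fix z X assume "(z, X) \<in> F"
    then have z: "z \<in> Z" "X = B +>\<^bsub>?W\<^esub> z" by (auto simp: F_def)
    then show "z \<in> carrier W \<and> X \<in> carrier ?Q" using ZD(2) by (auto simp: quotient_module_simps)
    show "(r \<odot>\<^bsub>W\<^esub> z, r \<odot>\<^bsub>?Q\<^esub> X) \<in> F" if "r \<in> carrier R" for r
      using z that module_homs_smult[OF p that, of z] ZD(5) by (intro FI) auto
    fix z' X' assume "(z', X') \<in> F"
    then have z': "z' \<in> Z" "X' = B +>\<^bsub>?W\<^esub> z'" by (auto simp: F_def)
    then show "(z \<oplus>\<^bsub>W\<^esub> z', X \<oplus>\<^bsub>?Q\<^esub> X') \<in> F"
      using z module_homs_add[OF p, of z z'] ZD(4) by (intro FI) auto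
  next
    show "(\<zero>\<^bsub>W\<^esub>, \<zero>\<^bsub>?Q\<^esub>) \<in> F" using module_homs_zero[OF W' Q p] ZD(3) by (intro FI) auto
  qed
  have "weakly_laskerian_subquotient R W Z B \<longleftrightarrow> weakly_laskerian_subquotient R ?Q (carrier ?Q) {\<zero>\<^bsub>?Q\<^esub>}"
  proof (rule weakly_laskerian_subquotient_iso[OF W Q F _ B Z submodule_zero[OF Q] _ Q.carrier_is_submodule])
    show "F \<subseteq> Z \<times> carrier ?Q" by (auto simp: F_def quotient_module_simps)
    show "z \<in> B \<longleftrightarrow> X \<in> {\<zero>\<^bsub>?Q\<^esub>}" if "(z, X) \<in> F" for z X
      using that coset_eq_self_iff[OF W' B'] by (auto simp: F_def quotient_module_simps)
    show "\<exists>z. (z, X) \<in> F" if "X \<in> carrier ?Q" for X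
      using that by (auto simp: F_def quotient_module_simps(1))
  qed (use Q.M.zero_closed in \<open>auto simp: F_def\<close>)
  then show ?thesis using weakly_laskerian_iff[OF Q] by simp
qed

end

section \<open>Ext and long exact sequences\<close>

definition short_exact ::
    "('r, 'x) ring_scheme \<Rightarrow> ('r, 'a) module \<Rightarrow> ('r, 'u) module \<Rightarrow> ('r, 'v) module \<Rightarrow>
      ('a \<Rightarrow> 'u) \<Rightarrow> ('u \<Rightarrow> 'v) \<Rightarrow> bool"
  where "short_exact R B Z H \<beta> \<pi> \<longleftrightarrow> module R B \<and> module R Z \<and> module R H \<and>
    \<beta> \<in> module_homs R B Z \<and> \<pi> \<in> module_homs R Z H \<and> inj_on \<beta> (carrier B) \<and>
    \<pi> ` carrier Z = carrier H \<and> {z \<in> carrier Z. \<pi> z = \<zero>\<^bsub>H\<^esub>} = \<beta> ` carrier B"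

context cring
begin

context
  fixes B :: "('a, 'u) module" and Z :: "('a, 'v) module" and H :: "('a, 'w) module" and \<beta> \<pi>
  assumes ses: "short_exact R B Z H \<beta> \<pi>"
begin

lemma
  shows short_exact_B: "module R B" and short_exact_Z: "module R Z" and short_exact_H: "module R H"
    and short_exact_\<beta>: "\<beta> \<in> module_homs R B Z" and short_exact_\<pi>: "\<pi> \<in> module_homs R Z H"
    and short_exact_inj: "x \<in> carrier B \<Longrightarrow> y \<in> carrier B \<Longrightarrow> \<beta> x = \<beta> y \<Longrightarrow> x = y"
    and short_exact_surj: "carrier H \<subseteq> \<pi> ` carrier Z"
    and short_exact_exact: "z \<in> carrier Z \<Longrightarrow> \<pi> z = \<zero>\<^bsub>H\<^esub> \<Longrightarrow> z \<in> \<beta> ` carrier B"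
    and short_exact_comp: "x \<in> carrier B \<Longrightarrow> \<pi> (\<beta> x) = \<zero>\<^bsub>H\<^esub>"
  using ses unfolding short_exact_def by (auto dest: inj_onD)

lemma short_exact_inj0: "x \<in> carrier B \<Longrightarrow> \<beta> x = \<zero>\<^bsub>Z\<^esub> \<Longrightarrow> x = \<zero>\<^bsub>B\<^esub>"
proof -
  interpret B: module R B by (rule short_exact_B)
  show "x \<in> carrier B \<Longrightarrow> \<beta> x = \<zero>\<^bsub>Z\<^esub> \<Longrightarrow> x = \<zero>\<^bsub>B\<^esub>"
    using short_exact_inj[of x "\<zero>\<^bsub>B\<^esub>"] module_homs_zero[OF short_exact_B short_exact_Z short_exact_\<beta>] by simp
qed

end

context
  fixes A :: "('a, 'm) module"
  assumes A: "module R A"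
begin

private abbreviation "P \<equiv> res_module R A"
private abbreviation "\<delta> \<equiv> res_differential R :: (('a, 'm) resgen \<Rightarrow> 'a) \<Rightarrow> _"

lemma module_res_module: "module R (P n)"
  unfolding res_module_def by (rule module_free_module)

lemma res_differential_closed: "x \<in> carrier (P (Suc n)) \<Longrightarrow> \<delta> x \<in> carrier (P n)"
  by (rule module_homs_closed[OF res_differential_hom[OF A]])

lemma res_kernel:
  "x \<in> carrier (P 0) \<Longrightarrow> res_augmentation R A x = \<zero>\<^bsub>A\<^esub> \<longleftrightarrow> x \<in> \<delta> ` carrier (P (Suc 0))"
  "x \<in> carrier (P (Suc n)) \<Longrightarrow> \<delta> x = \<zero>\<^bsub>P n\<^esub> \<longleftrightarrow> x \<in> \<delta> ` carrier (P (Suc (Suc n)))"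
  using standard_resolution_exact[OF A] by (auto simp: a_kernel_def kernel_def)

lemma res_differential_differential: "x \<in> carrier (P (Suc (Suc n))) \<Longrightarrow> \<delta> (\<delta> x) = \<zero>\<^bsub>P n\<^esub>"
  using res_kernel(2)[of "\<delta> x" n] res_differential_closed by blast

lemma res_augmentation_differential: "x \<in> carrier (P (Suc 0)) \<Longrightarrow> res_augmentation R A (\<delta> x) = \<zero>\<^bsub>A\<^esub>"
  using res_kernel(1)[of "\<delta> x"] res_differential_closed by blast

lemma hom_res_differential:
  "h \<in> module_homs R (P n) B \<Longrightarrow> (\<lambda>x. h (\<delta> x)) \<in> module_homs R (P (Suc n)) B"
  by (rule module_homs_comp'[OF res_differential_hom[OF A]])

lemmas res_lift = free_lift[where X = "res_basis R A n" for n, folded res_module_def]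

lemma ext_cocycles_iff:
  assumes B: "module R B"
  shows "g \<in> ext_cocycles R n A B \<longleftrightarrow> g \<in> module_homs R (P n) B \<and> g \<in> extensional (carrier (P n)) \<and>
    (\<forall>x\<in>carrier (P (Suc n)). g (\<delta> x) = \<zero>\<^bsub>B\<^esub>)"
  unfolding ext_cocycles_def ext_cochains_def ext_coboundary_def
  by (auto simp: hom_module_simps restrict_def fun_eq_iff)

lemma ext_cocycles_closed:
  "module R B \<Longrightarrow> g \<in> ext_cocycles R n A B \<Longrightarrow> x \<in> carrier (P n) \<Longrightarrow> g x \<in> carrier B"
  by (drule (1) ext_cocycles_iff[THEN iffD1]) (rule module_homs_closed[of g R "P n" B x], auto)

lemma ext_coboundaries_0_iff:
  "g \<in> ext_coboundaries R 0 A B \<longleftrightarrow> g \<in> extensional (carrier (P 0)) \<and> (\<forall>x\<in>carrier (P 0). g x = \<zero>\<^bsub>B\<^esub>)"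
  unfolding ext_coboundaries_def ext_cochains_def
  by (auto simp: hom_module_simps restrict_def fun_eq_iff extensional_def)

lemma ext_coboundaries_Suc_iff:
  assumes B: "module R B"
  shows "g \<in> ext_coboundaries R (Suc n) A B \<longleftrightarrow> g \<in> extensional (carrier (P (Suc n))) \<and>
    (\<exists>k\<in>module_homs R (P n) B. \<forall>x\<in>carrier (P (Suc n)). g x = k (\<delta> x))"
proof
  assume "g \<in> ext_coboundaries R (Suc n) A B"
  then show "g \<in> extensional (carrier (P (Suc n))) \<and>
    (\<exists>k\<in>module_homs R (P n) B. \<forall>x\<in>carrier (P (Suc n)). g x = k (\<delta> x))"
    unfolding ext_coboundaries_def ext_cochains_def by (auto simp: hom_module_simps ext_coboundary_def)
next
  assume "g \<in> extensional (carrier (P (Suc n))) \<and>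
    (\<exists>k\<in>module_homs R (P n) B. \<forall>x\<in>carrier (P (Suc n)). g x = k (\<delta> x))"
  then obtain k where k: "g \<in> extensional (carrier (P (Suc n)))" "k \<in> module_homs R (P n) B"
    "\<forall>x\<in>carrier (P (Suc n)). g x = k (\<delta> x)" by blast
  have "restrict k (carrier (P n)) \<in> carrier (ext_cochains R n A B)"
    unfolding ext_cochains_def
    using module_homs_cong[OF module_res_module k(2), of "restrict k (carrier (P n))"]
    by (simp add: hom_module_simps)
  moreover have "g = ext_coboundary R n A (restrict k (carrier (P n)))"
    unfolding ext_coboundary_def
    by (rule extensionalityI[OF k(1)]) (use k(3) res_differential_closed in auto)
  ultimately show "g \<in> ext_coboundaries R (Suc n) A B" unfolding ext_coboundaries_def by simp
qed

lemma restrict_cocycle: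
  assumes "module R B" "g \<in> module_homs R (P n) B" "\<And>x. x \<in> carrier (P (Suc n)) \<Longrightarrow> g (\<delta> x) = \<zero>\<^bsub>B\<^esub>"
  shows "restrict g (carrier (P n)) \<in> ext_cocycles R n A B"
  unfolding ext_cocycles_iff[OF assms(1)]
  using assms(3) res_differential_closed module_homs_cong[OF module_res_module assms(2), of "restrict g (carrier (P n))"]
  by auto

lemma submodule_ext_cocycles:
  assumes B: "module R B"
  shows "submodule (ext_cocycles R n A B) R (ext_cochains R n A B)"
  unfolding ext_cocycles_def
  by (rule submodule_kernel[OF module_ext_cochains[OF A B] module_ext_cochains[OF A B] ext_coboundary_hom[OF A B]])

lemma submodule_ext_coboundaries:
  assumes B: "module R B"
  shows "submodule (ext_coboundaries R n A B) R (ext_cochains R n A B)"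
proof (cases n)
  case 0
  then show ?thesis using submodule_zero[OF module_ext_cochains[OF A B]] by (simp add: ext_coboundaries_def)
next
  case (Suc m)
  then show ?thesis
    using submodule_image[OF module_ext_cochains[OF A B] module_ext_cochains[OF A B] ext_coboundary_hom[OF A B, of m]]
    by (simp add: ext_coboundaries_def)
qed

lemma ext_coboundaries_subset:
  assumes B: "module R B"
  shows "ext_coboundaries R n A B \<subseteq> ext_cocycles R n A B"
proof
  interpret B: module R B by fact
  fix g assume g: "g \<in> ext_coboundaries R n A B"
  have gh: "g \<in> module_homs R (P n) B \<and> g \<in> extensional (carrier (P n))"
    using module.submoduleD(2)[OF module_ext_cochains[OF A B] submodule_ext_coboundaries[OF B] g]
    by (simp add: ext_cochains_def hom_module_simps)
  show "g \<in> ext_cocycles R n A B"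
  proof (cases n)
    case 0
    then show ?thesis using g gh unfolding ext_cocycles_iff[OF B]
      by (auto simp: ext_coboundaries_0_iff res_differential_closed)
  next
    case (Suc m)
    then obtain k where "k \<in> module_homs R (P m) B" "\<forall>x\<in>carrier (P (Suc m)). g x = k (\<delta> x)"
      using g unfolding Suc ext_coboundaries_Suc_iff[OF B] by blast
    then show ?thesis using gh Suc unfolding ext_cocycles_iff[OF B]
      by (simp add: res_differential_closed res_differential_differential module_homs_zero[OF module_res_module B])
  qed
qed

lemma weakly_laskerian_Ext_iff:
  assumes B: "module R B"
  shows "weakly_laskerian R (Ext R n A B) \<longleftrightarrow>
    weakly_laskerian_subquotient R (ext_cochains R n A B) (ext_cocycles R n A B) (ext_coboundaries R n A B)"
  unfolding Ext_def
  by (rule weakly_laskerian_quotient_iff[OF module_ext_cochains[OF A B] submodule_ext_cocycles[OF B]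
        submodule_ext_coboundaries[OF B] ext_coboundaries_subset[OF B]])

lemma ext_cochains_simps:
  "\<zero>\<^bsub>ext_cochains R n A B\<^esub> = (\<lambda>x\<in>carrier (P n). \<zero>\<^bsub>B\<^esub>)"
  "f \<oplus>\<^bsub>ext_cochains R n A B\<^esub> g = (\<lambda>x\<in>carrier (P n). f x \<oplus>\<^bsub>B\<^esub> g x)"
  "r \<odot>\<^bsub>ext_cochains R n A B\<^esub> f = (\<lambda>x\<in>carrier (P n). r \<odot>\<^bsub>B\<^esub> f x)"
  by (simp_all add: ext_cochains_def hom_module_simps)

definition push_relation ::
  "('a, 'u) module \<Rightarrow> ('a, 'v) module \<Rightarrow> ('u \<Rightarrow> 'v) \<Rightarrow> nat \<Rightarrow>
    (((('a, 'm) resgen \<Rightarrow> 'a) \<Rightarrow> 'u) \<times> ((('a, 'm) resgen \<Rightarrow> 'a) \<Rightarrow> 'v)) set"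
  where "push_relation X Y t j =
    {(g, g'). g \<in> ext_cocycles R j A X \<and> g' \<in> ext_cocycles R j A Y \<and> (\<forall>p\<in>carrier (P j). g' p = t (g p))}"

text \<open>The connecting homomorphism: a cocycle \<open>h\<close> with values in \<open>H\<close> is lifted to a cochain \<open>k\<close> with
  values in \<open>Z\<close>, whose coboundary has values in \<open>B\<close>. The relation contains the results of all
  choices of a lift.\<close>

definition connecting_relation ::
  "('a, 'u) module \<Rightarrow> ('a, 'v) module \<Rightarrow> ('a, 'w) module \<Rightarrow> ('u \<Rightarrow> 'v) \<Rightarrow> ('v \<Rightarrow> 'w) \<Rightarrow> nat \<Rightarrow>
    (((('a, 'm) resgen \<Rightarrow> 'a) \<Rightarrow> 'w) \<times> ((('a, 'm) resgen \<Rightarrow> 'a) \<Rightarrow> 'u)) set"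
  where "connecting_relation B Z H \<beta> \<pi> j =
    {(h, b). h \<in> ext_cocycles R j A H \<and> b \<in> ext_cocycles R (Suc j) A B \<and>
      (\<exists>k\<in>module_homs R (P j) Z. (\<forall>p\<in>carrier (P j). \<pi> (k p) = h p) \<and>
        (\<forall>p\<in>carrier (P (Suc j)). \<beta> (b p) = k (\<delta> p)))}"

lemma push_relation_subset: "push_relation X Y t j \<subseteq> ext_cocycles R j A X \<times> ext_cocycles R j A Y"
  and connecting_relation_subset:
    "connecting_relation B Z H \<beta> \<pi> j \<subseteq> ext_cocycles R j A H \<times> ext_cocycles R (Suc j) A B"
  by (auto simp: push_relation_def connecting_relation_def)

lemma push_relation_total:
  assumes X: "module R X" and Y: "module R Y" and t: "t \<in> module_homs R X Y" and g: "g \<in> ext_cocycles R j A X"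
  shows "(g, \<lambda>p\<in>carrier (P j). t (g p)) \<in> push_relation X Y t j"
proof -
  have "(\<lambda>p\<in>carrier (P j). t (g p)) \<in> ext_cocycles R j A Y"
    using g t unfolding ext_cocycles_iff[OF X]
    by (intro restrict_cocycle[OF Y] module_homs_comp'[OF _ t]) (auto simp: module_homs_zero[OF X Y t])
  then show ?thesis using g by (simp add: push_relation_def)
qed

lemma push_relation_total':
  "module R X \<Longrightarrow> module R Y \<Longrightarrow> t \<in> module_homs R X Y \<Longrightarrow> g \<in> ext_cocycles R j A X \<Longrightarrow>
    \<exists>g'. (g, g') \<in> push_relation X Y t j"
  by (blast intro: push_relation_total)

lemma push_relation_linear:
  assumes X: "module R X" and Y: "module R Y" and t: "t \<in> module_homs R X Y"
  shows "linear_relation R (ext_cochains R j A X) (ext_cochains R j A Y) (push_relation X Y t j)"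
proof (rule linear_relationI)
  interpret X: module R X by fact
  interpret Y: module R Y by fact
  interpret CX: module R "ext_cochains R j A X" by (rule module_ext_cochains[OF A X])
  interpret CY: module R "ext_cochains R j A Y" by (rule module_ext_cochains[OF A Y])
  note XD = CX.submoduleD[OF submodule_ext_cocycles[OF X]] and YD = CY.submoduleD[OF submodule_ext_cocycles[OF Y]]
  show "(\<zero>\<^bsub>ext_cochains R j A X\<^esub>, \<zero>\<^bsub>ext_cochains R j A Y\<^esub>) \<in> push_relation X Y t j"
    using XD(3) YD(3) by (simp add: push_relation_def ext_cochains_simps module_homs_zero[OF X Y t])
  fix g g' assume g: "(g, g') \<in> push_relation X Y t j"
  then show "g \<in> carrier (ext_cochains R j A X) \<and> g' \<in> carrier (ext_cochains R j A Y)"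
    using XD(2) YD(2) by (simp add: push_relation_def)
  have gc: "g p \<in> carrier X" if "p \<in> carrier (P j)" for p
    using g ext_cocycles_closed[OF X _ that] by (simp add: push_relation_def)
  show "(r \<odot>\<^bsub>ext_cochains R j A X\<^esub> g, r \<odot>\<^bsub>ext_cochains R j A Y\<^esub> g') \<in> push_relation X Y t j"
    if "r \<in> carrier R" for r
    using g that XD(5)[of r g] YD(5)[of r g'] gc
    by (simp add: push_relation_def ext_cochains_simps module_homs_smult[OF t])
  fix h h' assume h: "(h, h') \<in> push_relation X Y t j"
  have hc: "h p \<in> carrier X" if "p \<in> carrier (P j)" for p
    using h ext_cocycles_closed[OF X _ that] by (simp add: push_relation_def)
  show "(g \<oplus>\<^bsub>ext_cochains R j A X\<^esub> h, g' \<oplus>\<^bsub>ext_cochains R j A Y\<^esub> h') \<in> push_relation X Y t j"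
    using g h XD(4)[of g h] YD(4)[of g' h'] gc hc
    by (simp add: push_relation_def ext_cochains_simps module_homs_add[OF t])
qed

lemma push_relation_coboundary:
  assumes X: "module R X" and Y: "module R Y" and t: "t \<in> module_homs R X Y"
    and g: "(g, g') \<in> push_relation X Y t j" "g \<in> ext_coboundaries R j A X"
  shows "g' \<in> ext_coboundaries R j A Y"
proof (cases j)
  case 0
  then show ?thesis using g module_homs_zero[OF X Y t]
    by (auto simp: push_relation_def ext_coboundaries_0_iff ext_cocycles_iff[OF Y])
next
  case (Suc n)
  then obtain k where k: "k \<in> module_homs R (P n) X" "\<forall>x\<in>carrier (P (Suc n)). g x = k (\<delta> x)"
    using g unfolding Suc ext_coboundaries_Suc_iff[OF X] by blast
  then show ?thesis using g module_homs_comp'[OF k(1) t]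
    unfolding Suc ext_coboundaries_Suc_iff[OF Y] push_relation_def ext_cocycles_iff[OF Y]
    by (intro conjI bexI[of _ "\<lambda>x. t (k x)"]) auto
qed

lemma ext_cochains_minus_self:
  assumes "module R X" "g \<in> ext_cocycles R j A X" "c \<in> ext_coboundaries R j A X" "g' \<in> ext_cocycles R j A X"
    and "\<And>p. p \<in> carrier (P j) \<Longrightarrow> g p = g' p \<oplus>\<^bsub>X\<^esub> c p"
  shows "g \<ominus>\<^bsub>ext_cochains R j A X\<^esub> g' \<in> ext_coboundaries R j A X"
proof -
  interpret C: module R "ext_cochains R j A X" by (rule module_ext_cochains[OF A assms(1)])
  note ZD = C.submoduleD[OF submodule_ext_cocycles[OF assms(1)]]
  have c: "c \<in> ext_cocycles R j A X" using assms(3) ext_coboundaries_subset[OF assms(1)] by blast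
  have "g = g' \<oplus>\<^bsub>ext_cochains R j A X\<^esub> c"
    using assms(2,5) unfolding ext_cocycles_iff[OF assms(1)] ext_cochains_simps
    by (intro extensionalityI[of g "carrier (P j)"]) auto
  then show ?thesis using C.M.add_minus_cancel(4)[OF ZD(2)[OF c] ZD(2)[OF assms(4)]] assms(3) by simp
qed

lemma ext_zero_coboundary: "module R X \<Longrightarrow> (\<lambda>p\<in>carrier (P j). \<zero>\<^bsub>X\<^esub>) \<in> ext_coboundaries R j A X"
  using module.submoduleD(3)[OF module_ext_cochains[OF A] submodule_ext_coboundaries, of X j]
  by (simp add: ext_cochains_simps)

lemma ext_cochains_minus_eq:
  assumes "module R X" "g \<in> ext_cocycles R j A X" "g' \<in> ext_cocycles R j A X"
    and "\<And>p. p \<in> carrier (P j) \<Longrightarrow> g p = g' p"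
  shows "g \<ominus>\<^bsub>ext_cochains R j A X\<^esub> g' \<in> ext_coboundaries R j A X"
proof (rule ext_cochains_minus_self[OF assms(1,2) ext_zero_coboundary[OF assms(1)] assms(3)])
  interpret X: module R X by fact
  show "g p = g' p \<oplus>\<^bsub>X\<^esub> (\<lambda>p\<in>carrier (P j). \<zero>\<^bsub>X\<^esub>) p" if "p \<in> carrier (P j)" for p
    using assms(4)[OF that] ext_cocycles_closed[OF assms(1,3) that] that by simp
qed

context
  fixes B :: "('a, 'u) module" and Z :: "('a, 'v) module" and H :: "('a, 'w) module" and \<beta> \<pi>
  assumes ses: "short_exact R B Z H \<beta> \<pi>"
begin

private lemmas ses_B = short_exact_B[OF ses]
  and ses_Z = short_exact_Z[OF ses]
  and ses_H = short_exact_H[OF ses]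
  and ses_\<beta> = short_exact_\<beta>[OF ses]
  and ses_\<pi> = short_exact_\<pi>[OF ses]
  and ses_inj = short_exact_inj[OF ses]
  and ses_surj = short_exact_surj[OF ses]
  and ses_exact = short_exact_exact[OF ses]
  and ses_comp = short_exact_comp[OF ses]
  and ses_inj0 = short_exact_inj0[OF ses]

lemma ses_lift:
  assumes "h \<in> module_homs R (P j) H"
  obtains k where "k \<in> module_homs R (P j) Z" "\<And>p. p \<in> carrier (P j) \<Longrightarrow> \<pi> (k p) = h p"
proof (rule res_lift[OF ses_Z ses_H ses_\<pi> assms])
  show "h p \<in> \<pi> ` carrier Z" if "p \<in> carrier (P j)" for p
    using ses_surj module_homs_closed[OF assms that] by blast
qed (rule that)

lemma ses_lower:
  assumes "k \<in> module_homs R (P j) Z" "\<And>p. p \<in> carrier (P j) \<Longrightarrow> \<pi> (k p) = \<zero>\<^bsub>H\<^esub>"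
  obtains b where "b \<in> module_homs R (P j) B" "\<And>p. p \<in> carrier (P j) \<Longrightarrow> \<beta> (b p) = k p"
proof (rule res_lift[OF ses_B ses_Z ses_\<beta> assms(1)])
  show "k p \<in> \<beta> ` carrier B" if "p \<in> carrier (P j)" for p
    by (rule ses_exact[OF module_homs_closed[OF assms(1) that] assms(2)[OF that]])
qed (rule that)

lemma connecting_relation_total:
  assumes h: "h \<in> ext_cocycles R j A H"
  shows "\<exists>b. (h, b) \<in> connecting_relation B Z H \<beta> \<pi> j"
proof -
  have h': "h \<in> module_homs R (P j) H" "\<And>x. x \<in> carrier (P (Suc j)) \<Longrightarrow> h (\<delta> x) = \<zero>\<^bsub>H\<^esub>"
    using h by (auto simp: ext_cocycles_iff[OF ses_H])
  obtain k where k: "k \<in> module_homs R (P j) Z" "\<And>p. p \<in> carrier (P j) \<Longrightarrow> \<pi> (k p) = h p"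
    using ses_lift[OF h'(1)] by blast
  obtain b where b: "b \<in> module_homs R (P (Suc j)) B" "\<And>p. p \<in> carrier (P (Suc j)) \<Longrightarrow> \<beta> (b p) = k (\<delta> p)"
    using ses_lower[OF hom_res_differential[OF k(1)]] k(2) h'(2) res_differential_closed by auto
  have "b (\<delta> x) = \<zero>\<^bsub>B\<^esub>" if "x \<in> carrier (P (Suc (Suc j)))" for x
    using that b(2) res_differential_closed[OF that] module_homs_closed[OF b(1)]
    by (intro ses_inj0) (auto simp: res_differential_differential module_homs_zero[OF module_res_module ses_Z k(1)])
  then have "restrict b (carrier (P (Suc j))) \<in> ext_cocycles R (Suc j) A B"
    by (intro restrict_cocycle[OF ses_B b(1)])
  then have "(h, restrict b (carrier (P (Suc j)))) \<in> connecting_relation B Z H \<beta> \<pi> j"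
    using h k b by (auto simp: connecting_relation_def)
  then show ?thesis by blast
qed

lemma connecting_relation_linear:
  "linear_relation R (ext_cochains R j A H) (ext_cochains R (Suc j) A B) (connecting_relation B Z H \<beta> \<pi> j)"
proof (rule linear_relationI)
  interpret B: module R B by (rule ses_B)
  interpret Z: module R Z by (rule ses_Z)
  interpret H: module R H by (rule ses_H)
  interpret CH: module R "ext_cochains R j A H" by (rule module_ext_cochains[OF A ses_H])
  interpret CB: module R "ext_cochains R (Suc j) A B" by (rule module_ext_cochains[OF A ses_B])
  note HD = CH.submoduleD[OF submodule_ext_cocycles[OF ses_H]] and BD = CB.submoduleD[OF submodule_ext_cocycles[OF ses_B]]
  show "(\<zero>\<^bsub>ext_cochains R j A H\<^esub>, \<zero>\<^bsub>ext_cochains R (Suc j) A B\<^esub>) \<in> connecting_relation B Z H \<beta> \<pi> j"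
    using HD(3) BD(3) module_homs_const_zero[OF module_res_module[of j] ses_Z]
    by (auto simp: connecting_relation_def ext_cochains_simps module_homs_zero[OF ses_Z ses_H ses_\<pi>]
        module_homs_zero[OF ses_B ses_Z ses_\<beta>] intro!: bexI[of _ "\<lambda>x. \<zero>\<^bsub>Z\<^esub>"])
  fix g b assume g: "(g, b) \<in> connecting_relation B Z H \<beta> \<pi> j"
  then show "g \<in> carrier (ext_cochains R j A H) \<and> b \<in> carrier (ext_cochains R (Suc j) A B)"
    using HD(2) BD(2) by (simp add: connecting_relation_def)
  from g obtain k where k: "k \<in> module_homs R (P j) Z" "\<forall>p\<in>carrier (P j). \<pi> (k p) = g p"
    "\<forall>p\<in>carrier (P (Suc j)). \<beta> (b p) = k (\<delta> p)" and gb: "g \<in> ext_cocycles R j A H" "b \<in> ext_cocycles R (Suc j) A B"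
    by (auto simp: connecting_relation_def)
  have bc: "b p \<in> carrier B" if "p \<in> carrier (P (Suc j))" for p
    using ext_cocycles_closed[OF ses_B gb(2) that] .
  note kc = module_homs_closed[OF k(1)]
  show "(r \<odot>\<^bsub>ext_cochains R j A H\<^esub> g, r \<odot>\<^bsub>ext_cochains R (Suc j) A B\<^esub> b) \<in> connecting_relation B Z H \<beta> \<pi> j"
    if r: "r \<in> carrier R" for r
    using HD(5)[OF r gb(1)] BD(5)[OF r gb(2)] k r
      module_homs_pointwise_smult[OF module_res_module ses_Z k(1) r]
    unfolding connecting_relation_def
    by (auto simp: ext_cochains_simps module_homs_smult[OF ses_\<pi>] module_homs_smult[OF ses_\<beta>] kc bc
        intro!: bexI[of _ "\<lambda>p. r \<odot>\<^bsub>Z\<^esub> k p"])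
  fix g' b' assume g': "(g', b') \<in> connecting_relation B Z H \<beta> \<pi> j"
  then obtain k' where k': "k' \<in> module_homs R (P j) Z" "\<forall>p\<in>carrier (P j). \<pi> (k' p) = g' p"
    "\<forall>p\<in>carrier (P (Suc j)). \<beta> (b' p) = k' (\<delta> p)" and gb': "g' \<in> ext_cocycles R j A H" "b' \<in> ext_cocycles R (Suc j) A B"
    by (auto simp: connecting_relation_def)
  have bc': "b' p \<in> carrier B" if "p \<in> carrier (P (Suc j))" for p
    using ext_cocycles_closed[OF ses_B gb'(2) that] .
  show "(g \<oplus>\<^bsub>ext_cochains R j A H\<^esub> g', b \<oplus>\<^bsub>ext_cochains R (Suc j) A B\<^esub> b') \<in> connecting_relation B Z H \<beta> \<pi> j"
    using HD(4)[OF gb(1) gb'(1)] BD(4)[OF gb(2) gb'(2)] k k'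
      module_homs_pointwise_add[OF module_res_module ses_Z k(1) k'(1)]
    unfolding connecting_relation_def
    by (auto simp: ext_cochains_simps module_homs_add[OF ses_\<pi>] module_homs_add[OF ses_\<beta>] kc bc bc' module_homs_closed[OF k'(1)]
        intro!: bexI[of _ "\<lambda>p. k p \<oplus>\<^bsub>Z\<^esub> k' p"])
qed

text \<open>The terms of the free resolution are projective, so coboundaries lift.\<close>

lemma ext_coboundary_lift:
  assumes h: "h \<in> ext_coboundaries R j A H"
  shows "\<exists>c\<in>ext_coboundaries R j A Z. \<forall>p\<in>carrier (P j). \<pi> (c p) = h p"
  proof (cases j)
    case 0
    then show ?thesis using h ext_zero_coboundary[OF ses_Z, of j]
      by (intro bexI[OF _ ext_zero_coboundary[OF ses_Z]])
        (auto simp: ext_coboundaries_0_iff module_homs_zero[OF ses_Z ses_H ses_\<pi>])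
  next
    case (Suc n)
    then obtain k where k: "k \<in> module_homs R (P n) H" "\<forall>x\<in>carrier (P (Suc n)). h x = k (\<delta> x)"
      using h unfolding Suc ext_coboundaries_Suc_iff[OF ses_H] by blast
    obtain l where l: "l \<in> module_homs R (P n) Z" "\<And>p. p \<in> carrier (P n) \<Longrightarrow> \<pi> (l p) = k p"
      using ses_lift[OF k(1)] by blast
    have "(\<lambda>x\<in>carrier (P j). l (\<delta> x)) \<in> ext_coboundaries R j A Z"
      unfolding Suc ext_coboundaries_Suc_iff[OF ses_Z] using l(1) by auto
    then show ?thesis by (rule bexI[rotated]) (simp add: Suc k l res_differential_closed)
  qed

text \<open>Three consecutive terms of the long exact sequence occur in this lemma and in the two lemmas that
  follow it.\<close>

lemma weakly_laskerian_Ext_middle: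
  assumes "weakly_laskerian R (Ext R j A B)" "weakly_laskerian R (Ext R j A H)"
  shows "weakly_laskerian R (Ext R j A Z)"
  unfolding weakly_laskerian_Ext_iff[OF ses_Z]
proof (rule weakly_laskerian_subquotient_exact[OF module_ext_cochains[OF A ses_B] module_ext_cochains[OF A ses_Z]
      module_ext_cochains[OF A ses_H] assms[unfolded weakly_laskerian_Ext_iff[OF ses_B] weakly_laskerian_Ext_iff[OF ses_H]]
      push_relation_linear[OF ses_B ses_Z ses_\<beta>] _ push_relation_linear[OF ses_Z ses_H ses_\<pi>] _ _
      ext_coboundaries_subset[OF ses_B] submodule_ext_coboundaries[OF ses_Z] submodule_ext_coboundaries[OF ses_H]
      ext_coboundaries_subset[OF ses_H] submodule_ext_cocycles[OF ses_H]])
  interpret CB: module R "ext_cochains R j A B" by (rule module_ext_cochains[OF A ses_B])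
  interpret Z: module R Z by (rule ses_Z)
  show "\<zero>\<^bsub>ext_cochains R j A B\<^esub> \<in> ext_coboundaries R j A B"
    by (rule CB.submoduleD(3)[OF submodule_ext_coboundaries[OF ses_B]])
  show "\<exists>x y'. (x, y') \<in> push_relation B Z \<beta> j \<and> z \<ominus>\<^bsub>ext_cochains R j A Z\<^esub> y' \<in> ext_coboundaries R j A Z"
    if zh: "(z, h) \<in> push_relation Z H \<pi> j" and h: "h \<in> ext_coboundaries R j A H" for z h
  proof -
    have z: "z \<in> ext_cocycles R j A Z" "\<And>p. p \<in> carrier (P j) \<Longrightarrow> h p = \<pi> (z p)"
      using zh by (auto simp: push_relation_def)
    then have z': "z \<in> module_homs R (P j) Z" "\<And>p. p \<in> carrier (P (Suc j)) \<Longrightarrow> z (\<delta> p) = \<zero>\<^bsub>Z\<^esub>"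
      by (auto simp: ext_cocycles_iff[OF ses_Z])
    have "\<exists>c\<in>ext_coboundaries R j A Z. \<forall>p\<in>carrier (P j). \<pi> (c p) = h p"
      by (rule ext_coboundary_lift[OF h])
    then obtain c where c: "c \<in> ext_coboundaries R j A Z" "\<And>p. p \<in> carrier (P j) \<Longrightarrow> \<pi> (c p) = h p" by blast
    have cz: "c \<in> ext_cocycles R j A Z" using c(1) ext_coboundaries_subset[OF ses_Z] by blast
    then have c': "c \<in> module_homs R (P j) Z" "\<And>p. p \<in> carrier (P (Suc j)) \<Longrightarrow> c (\<delta> p) = \<zero>\<^bsub>Z\<^esub>"
      by (auto simp: ext_cocycles_iff[OF ses_Z])
    note d = module_homs_pointwise_diff[OF module_res_module ses_Z z'(1) c'(1)]
    note cl = module_homs_closed[OF z'(1)] module_homs_closed[OF c'(1)]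
    interpret H: module R H by (rule ses_H)
    have "\<pi> (z p \<ominus>\<^bsub>Z\<^esub> c p) = \<zero>\<^bsub>H\<^esub>" if "p \<in> carrier (P j)" for p
      using z(2)[OF that] c(2)[OF that] cl[OF that] module_homs_closed[OF ses_\<pi> cl(1)[OF that]]
      by (simp add: module_homs_minus[OF ses_Z ses_H ses_\<pi>] H.M.minus_eq_zero_iff)
    then obtain b where b: "b \<in> module_homs R (P j) B" "\<And>p. p \<in> carrier (P j) \<Longrightarrow> \<beta> (b p) = z p \<ominus>\<^bsub>Z\<^esub> c p"
      using ses_lower[OF d] by blast
    have "b (\<delta> p) = \<zero>\<^bsub>B\<^esub>" if "p \<in> carrier (P (Suc j))" for p
      using b(2)[OF res_differential_closed[OF that]] z'(2)[OF that] c'(2)[OF that]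
        module_homs_closed[OF b(1) res_differential_closed[OF that]]
      by (intro ses_inj0) (simp_all add: Z.M.minus_eq_zero_iff)
    note bz = restrict_cocycle[OF ses_B b(1) this]
    note pr = push_relation_total[OF ses_B ses_Z ses_\<beta> bz]
    have "z \<ominus>\<^bsub>ext_cochains R j A Z\<^esub> (\<lambda>p\<in>carrier (P j). \<beta> (restrict b (carrier (P j)) p)) \<in> ext_coboundaries R j A Z"
    proof (rule ext_cochains_minus_self[OF ses_Z z(1) c(1)])
      show "(\<lambda>p\<in>carrier (P j). \<beta> (restrict b (carrier (P j)) p)) \<in> ext_cocycles R j A Z"
        using pr by (simp add: push_relation_def)
      show "z p = (\<lambda>p\<in>carrier (P j). \<beta> (restrict b (carrier (P j)) p)) p \<oplus>\<^bsub>Z\<^esub> c p" if "p \<in> carrier (P j)" for p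
        using that b(2)[OF that] cl[OF that] by (simp add: Z.M.add_minus_cancel)
    qed
    with pr show ?thesis by blast
  qed
qed (rule push_relation_subset push_relation_total'[OF ses_B ses_Z ses_\<beta>] push_relation_total'[OF ses_Z ses_H ses_\<pi>]
    push_relation_coboundary[OF ses_B ses_Z ses_\<beta>]; assumption)+

text \<open>Let \<open>D\<close> be a set of cocycles with values in \<open>Z\<close> that become trivial in \<open>H\<close>, such as the
  coboundaries or the cocycles with values in \<open>B\<close>. The second choice matters in degree $0$, where
  $\mathrm{Hom}(A, Z)$ itself need not be weakly Laskerian.\<close>

lemma weakly_laskerian_Ext_right:
  assumes D: "weakly_laskerian_subquotient R (ext_cochains R j A Z) (ext_cocycles R j A Z) D"
      "\<zero>\<^bsub>ext_cochains R j A Z\<^esub> \<in> D" "D \<subseteq> ext_cocycles R j A Z"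
    and DH: "\<And>z h. (z, h) \<in> push_relation Z H \<pi> j \<Longrightarrow> z \<in> D \<Longrightarrow> h \<in> ext_coboundaries R j A H"
    and "weakly_laskerian R (Ext R (Suc j) A B)"
  shows "weakly_laskerian R (Ext R j A H)"
  unfolding weakly_laskerian_Ext_iff[OF ses_H]
proof (rule weakly_laskerian_subquotient_exact[OF module_ext_cochains[OF A ses_Z] module_ext_cochains[OF A ses_H]
      module_ext_cochains[OF A ses_B] D(1) assms(5)[unfolded weakly_laskerian_Ext_iff[OF ses_B]]
      push_relation_linear[OF ses_Z ses_H ses_\<pi>] _ connecting_relation_linear _ D(2,3) submodule_ext_coboundaries[OF ses_H]
      submodule_ext_coboundaries[OF ses_B] ext_coboundaries_subset[OF ses_B] submodule_ext_cocycles[OF ses_B]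
      _ DH connecting_relation_total])
  interpret Z: module R Z by (rule ses_Z)
  interpret H: module R H by (rule ses_H)
  show "\<exists>x y'. (x, y') \<in> push_relation Z H \<pi> j \<and> h \<ominus>\<^bsub>ext_cochains R j A H\<^esub> y' \<in> ext_coboundaries R j A H"
    if hb: "(h, b) \<in> connecting_relation B Z H \<beta> \<pi> j" and b: "b \<in> ext_coboundaries R (Suc j) A B" for h b
  proof -
    obtain k where h: "h \<in> ext_cocycles R j A H" and k: "k \<in> module_homs R (P j) Z"
      "\<And>p. p \<in> carrier (P j) \<Longrightarrow> \<pi> (k p) = h p" "\<And>p. p \<in> carrier (P (Suc j)) \<Longrightarrow> \<beta> (b p) = k (\<delta> p)"
      using hb by (auto simp: connecting_relation_def)
    obtain c where c: "c \<in> module_homs R (P j) B" "\<And>p. p \<in> carrier (P (Suc j)) \<Longrightarrow> b p = c (\<delta> p)"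
      using b unfolding ext_coboundaries_Suc_iff[OF ses_B] by blast
    note \<beta>c = module_homs_comp'[OF c(1) ses_\<beta>]
    note d = module_homs_pointwise_diff[OF module_res_module ses_Z k(1) \<beta>c]
    have z: "(\<lambda>p\<in>carrier (P j). k p \<ominus>\<^bsub>Z\<^esub> \<beta> (c p)) \<in> ext_cocycles R j A Z"
    proof (rule restrict_cocycle[OF ses_Z d])
      show "k (\<delta> x) \<ominus>\<^bsub>Z\<^esub> \<beta> (c (\<delta> x)) = \<zero>\<^bsub>Z\<^esub>" if "x \<in> carrier (P (Suc j))" for x
        using k(3)[OF that] c(2)[OF that] module_homs_closed[OF k(1) res_differential_closed[OF that]]
        by (simp add: Z.M.minus_eq_zero_iff)
    qed
    note pr = push_relation_total[OF ses_Z ses_H ses_\<pi> z]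
    have "h \<ominus>\<^bsub>ext_cochains R j A H\<^esub>
        (\<lambda>p\<in>carrier (P j). \<pi> ((\<lambda>p\<in>carrier (P j). k p \<ominus>\<^bsub>Z\<^esub> \<beta> (c p)) p)) \<in> ext_coboundaries R j A H"
    proof (rule ext_cochains_minus_eq[OF ses_H h])
      fix p assume p: "p \<in> carrier (P j)"
      show "h p = (\<lambda>p\<in>carrier (P j). \<pi> ((\<lambda>p\<in>carrier (P j). k p \<ominus>\<^bsub>Z\<^esub> \<beta> (c p)) p)) p"
        using p k(2)[OF p] module_homs_closed[OF k(1) p] module_homs_closed[OF \<beta>c p]
          ses_comp[OF module_homs_closed[OF c(1) p]] ext_cocycles_closed[OF ses_H h p]
        by (simp add: module_homs_minus[OF ses_Z ses_H ses_\<pi>] H.M.minus_eq)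
    qed (use pr in \<open>simp add: push_relation_def\<close>)
    with pr show ?thesis by blast
  qed
qed (rule push_relation_subset connecting_relation_subset push_relation_total'[OF ses_Z ses_H ses_\<pi>]; assumption)+

text \<open>Let \<open>D\<close> be a set of cocycles with values in \<open>H\<close> that lift to cocycles with values in \<open>Z\<close>. In
  degree $0$ this allows the hypothesis to speak of the cokernel of
  $\mathrm{Hom}(A, Z) \to \mathrm{Hom}(A, H)$ in place of $\mathrm{Hom}(A, H)$.\<close>

lemma weakly_laskerian_Ext_left:
  assumes D: "weakly_laskerian_subquotient R (ext_cochains R j A H) (ext_cocycles R j A H) D"
      "\<zero>\<^bsub>ext_cochains R j A H\<^esub> \<in> D" "D \<subseteq> ext_cocycles R j A H"
    and DZ: "\<And>h. h \<in> D \<Longrightarrow> \<exists>z\<in>ext_cocycles R j A Z. \<forall>p\<in>carrier (P j). \<pi> (z p) = h p"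
    and "weakly_laskerian R (Ext R (Suc j) A Z)"
  shows "weakly_laskerian R (Ext R (Suc j) A B)"
  unfolding weakly_laskerian_Ext_iff[OF ses_B]
proof (rule weakly_laskerian_subquotient_exact[OF module_ext_cochains[OF A ses_H] module_ext_cochains[OF A ses_B]
      module_ext_cochains[OF A ses_Z] D(1) assms(5)[unfolded weakly_laskerian_Ext_iff[OF ses_Z]]
      connecting_relation_linear _ push_relation_linear[OF ses_B ses_Z ses_\<beta>] _ D(2,3) submodule_ext_coboundaries[OF ses_B]
      submodule_ext_coboundaries[OF ses_Z] ext_coboundaries_subset[OF ses_Z] submodule_ext_cocycles[OF ses_Z]
      connecting_relation_total])
  interpret Z: module R Z by (rule ses_Z)
  interpret H: module R H by (rule ses_H)
  show "b \<in> ext_coboundaries R (Suc j) A B" if hb: "(h, b) \<in> connecting_relation B Z H \<beta> \<pi> j" and "h \<in> D" for h b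
  proof -
    obtain k where b: "b \<in> ext_cocycles R (Suc j) A B" and k: "k \<in> module_homs R (P j) Z"
      "\<And>p. p \<in> carrier (P j) \<Longrightarrow> \<pi> (k p) = h p" "\<And>p. p \<in> carrier (P (Suc j)) \<Longrightarrow> \<beta> (b p) = k (\<delta> p)"
      using hb by (auto simp: connecting_relation_def)
    obtain z where z: "z \<in> module_homs R (P j) Z" "\<And>p. p \<in> carrier (P (Suc j)) \<Longrightarrow> z (\<delta> p) = \<zero>\<^bsub>Z\<^esub>"
      "\<And>p. p \<in> carrier (P j) \<Longrightarrow> \<pi> (z p) = h p"
      using DZ[OF \<open>h \<in> D\<close>] by (auto simp: ext_cocycles_iff[OF ses_Z])
    note d = module_homs_pointwise_diff[OF module_res_module ses_Z k(1) z(1)]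
    have "\<pi> (k p \<ominus>\<^bsub>Z\<^esub> z p) = \<zero>\<^bsub>H\<^esub>" if p: "p \<in> carrier (P j)" for p
      using k(2)[OF p] z(3)[OF p] module_homs_closed[OF k(1) p] module_homs_closed[OF z(1) p]
        module_homs_closed[OF ses_\<pi> module_homs_closed[OF z(1) p]]
      by (simp add: module_homs_minus[OF ses_Z ses_H ses_\<pi>] H.M.minus_eq_zero_iff)
    then obtain c where c: "c \<in> module_homs R (P j) B" "\<And>p. p \<in> carrier (P j) \<Longrightarrow> \<beta> (c p) = k p \<ominus>\<^bsub>Z\<^esub> z p"
      using ses_lower[OF d] by blast
    have "b p = c (\<delta> p)" if p: "p \<in> carrier (P (Suc j))" for p
    proof (rule ses_inj[OF ext_cocycles_closed[OF ses_B b p] module_homs_closed[OF c(1) res_differential_closed[OF p]]])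
      show "\<beta> (b p) = \<beta> (c (\<delta> p))"
        using k(3)[OF p] c(2)[OF res_differential_closed[OF p]] z(2)[OF p]
          module_homs_closed[OF k(1) res_differential_closed[OF p]] by (simp add: a_minus_def)
    qed
    then show ?thesis using b c(1) unfolding ext_coboundaries_Suc_iff[OF ses_B] ext_cocycles_iff[OF ses_B] by blast
  qed
  show "\<exists>x y'. (x, y') \<in> connecting_relation B Z H \<beta> \<pi> j \<and> b \<ominus>\<^bsub>ext_cochains R (Suc j) A B\<^esub> y' \<in> ext_coboundaries R (Suc j) A B"
    if bz: "(b, z) \<in> push_relation B Z \<beta> (Suc j)" and zc: "z \<in> ext_coboundaries R (Suc j) A Z" for b z
  proof -
    have b: "b \<in> ext_cocycles R (Suc j) A B" "\<And>p. p \<in> carrier (P (Suc j)) \<Longrightarrow> z p = \<beta> (b p)"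
      using bz by (auto simp: push_relation_def)
    obtain k where k: "k \<in> module_homs R (P j) Z" "\<And>p. p \<in> carrier (P (Suc j)) \<Longrightarrow> z p = k (\<delta> p)"
      using zc unfolding ext_coboundaries_Suc_iff[OF ses_Z] by blast
    have "(\<lambda>p\<in>carrier (P j). \<pi> (k p)) \<in> ext_cocycles R j A H"
    proof (rule restrict_cocycle[OF ses_H module_homs_comp'[OF k(1) ses_\<pi>]])
      show "\<pi> (k (\<delta> p)) = \<zero>\<^bsub>H\<^esub>" if p: "p \<in> carrier (P (Suc j))" for p
        using k(2)[OF p] b(2)[OF p] ses_comp[OF ext_cocycles_closed[OF ses_B b(1) p]] by simp
    qed
    then have "((\<lambda>p\<in>carrier (P j). \<pi> (k p)), b) \<in> connecting_relation B Z H \<beta> \<pi> j"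
      using b k by (auto simp: connecting_relation_def)
    then show ?thesis using ext_cochains_minus_eq[OF ses_B b(1) b(1)] by blast
  qed
  show "\<exists>z. (b, z) \<in> push_relation B Z \<beta> (Suc j)" if "b \<in> ext_cocycles R (Suc j) A B" for b
    by (rule push_relation_total'[OF ses_B ses_Z ses_\<beta> that])
qed (rule push_relation_subset connecting_relation_subset; assumption)+

end

end

end

context cring
begin

context
  fixes A :: "('a, 'm) module"
  assumes A: "module R A"
begin

lemma weakly_laskerian_Ext_trivial:
  assumes "module R W" "ext_cocycles R j A W \<subseteq> ext_coboundaries R j A W"
  shows "weakly_laskerian R (Ext R j A W)"
proof -
  have "ext_cocycles R j A W = ext_coboundaries R j A W"
    using assms ext_coboundaries_subset[OF A] by blast
  then show ?thesis
    unfolding weakly_laskerian_Ext_iff[OF A assms(1)] by (simp add: weakly_laskerian_subquotient_self)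
qed

text \<open>The Ext module is zero: a cocycle vanishes on the kernel of the preceding differential, and hence
  extends along it.\<close>

lemma weakly_laskerian_Ext_injective:
  assumes "injective_module R T"
  shows "weakly_laskerian R (Ext R (Suc j) A T)"
proof (rule weakly_laskerian_Ext_trivial)
  show T: "module R T" using assms by (simp add: injective_module_def)
  show "ext_cocycles R (Suc j) A T \<subseteq> ext_coboundaries R (Suc j) A T"
  proof
    fix g assume g: "g \<in> ext_cocycles R (Suc j) A T"
    then have g': "g \<in> module_homs R (res_module R A (Suc j)) T"
      and z: "\<And>x. x \<in> carrier (res_module R A (Suc (Suc j))) \<Longrightarrow> g (res_differential R x) = \<zero>\<^bsub>T\<^esub>"
      by (auto simp: ext_cocycles_iff[OF A T])
    obtain k where k: "k \<in> module_homs R (res_module R A j) T"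
      "\<And>x. x \<in> carrier (res_module R A (Suc j)) \<Longrightarrow> k (res_differential R x) = g x"
    proof (rule injective_factor[OF module_res_module[OF A] module_res_module[OF A] assms res_differential_hom[OF A] g'])
      show "g x = \<zero>\<^bsub>T\<^esub>" if "x \<in> carrier (res_module R A (Suc j))" "res_differential R x = \<zero>\<^bsub>res_module R A j\<^esub>" for x
        using that z res_kernel(2)[OF A that(1)] by auto
    qed blast
    then show "g \<in> ext_coboundaries R (Suc j) A T"
      using g by (auto simp: ext_coboundaries_Suc_iff[OF A T] ext_cocycles_iff[OF A T] intro!: bexI[OF _ k(1)])
  qed
qed

lemma weakly_laskerian_Ext_zero:
  assumes W: "module R W" and "carrier W = {\<zero>\<^bsub>W\<^esub>}"
  shows "weakly_laskerian R (Ext R j A W)"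
proof (rule weakly_laskerian_Ext_trivial[OF W])
  show "ext_cocycles R j A W \<subseteq> ext_coboundaries R j A W"
  proof
    fix g assume g: "g \<in> ext_cocycles R j A W"
    have "g x = \<zero>\<^bsub>W\<^esub>" if "x \<in> carrier (res_module R A j)" for x
      using ext_cocycles_closed[OF A W g that] assms(2) by simp
    then have "g = (\<lambda>x\<in>carrier (res_module R A j). \<zero>\<^bsub>W\<^esub>)"
      using g by (intro extensionalityI[of g "carrier (res_module R A j)"]) (auto simp: ext_cocycles_iff[OF A W])
    then show "g \<in> ext_coboundaries R j A W" using ext_zero_coboundary[OF A W] by simp
  qed
qed

context
  fixes B :: "('a, 'u) module" and Z :: "('a, 'v) module" and H :: "('a, 'w) module" and \<beta> \<pi>
  assumes ses: "short_exact R B Z H \<beta> \<pi>"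
begin

text \<open>Taking the coboundaries for \<open>D\<close> gives the ordinary long exact sequence.\<close>

lemma weakly_laskerian_Ext_right':
  assumes "weakly_laskerian R (Ext R j A Z)" "weakly_laskerian R (Ext R (Suc j) A B)"
  shows "weakly_laskerian R (Ext R j A H)"
proof (rule weakly_laskerian_Ext_right[OF A ses assms(1)[unfolded weakly_laskerian_Ext_iff[OF A short_exact_Z[OF ses]]] _ _ _ assms(2)])
  show "\<zero>\<^bsub>ext_cochains R j A Z\<^esub> \<in> ext_coboundaries R j A Z"
    using ext_zero_coboundary[OF A short_exact_Z[OF ses]] by (simp add: ext_cochains_simps[OF A])
qed (auto intro: ext_coboundaries_subset[OF A short_exact_Z[OF ses], THEN subsetD]
    push_relation_coboundary[OF A short_exact_Z[OF ses] short_exact_H[OF ses] short_exact_\<pi>[OF ses]])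

lemma weakly_laskerian_Ext_left':
  assumes "weakly_laskerian R (Ext R j A H)" "weakly_laskerian R (Ext R (Suc j) A Z)"
  shows "weakly_laskerian R (Ext R (Suc j) A B)"
proof (rule weakly_laskerian_Ext_left[OF A ses assms(1)[unfolded weakly_laskerian_Ext_iff[OF A short_exact_H[OF ses]]] _ _ _ assms(2)])
  note Z = short_exact_Z[OF ses] and H = short_exact_H[OF ses]
  show "\<zero>\<^bsub>ext_cochains R j A H\<^esub> \<in> ext_coboundaries R j A H"
    using ext_zero_coboundary[OF A H] by (simp add: ext_cochains_simps[OF A])
  show "ext_coboundaries R j A H \<subseteq> ext_cocycles R j A H" by (rule ext_coboundaries_subset[OF A H])
  show "\<exists>z\<in>ext_cocycles R j A Z. \<forall>p\<in>carrier (res_module R A j). \<pi> (z p) = h p"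
    if h: "h \<in> ext_coboundaries R j A H" for h
  proof -
    obtain c where "c \<in> ext_coboundaries R j A Z" "\<forall>p\<in>carrier (res_module R A j). \<pi> (c p) = h p"
      using ext_coboundary_lift[OF A ses h] by blast
    then show ?thesis using ext_coboundaries_subset[OF A Z] by blast
  qed
qed

end

end

lemma submodule_ideal: "ideal I R \<Longrightarrow> submodule I R (ring_as_module R)"
proof -
  assume I: "ideal I R"
  interpret ideal I R by fact
  interpret M: module R "ring_as_module R" by (rule module_ring_as_module)
  show ?thesis by (rule M.submoduleI') (auto simp: I_l_closed)
qed

end

definition torsion :: "'r set \<Rightarrow> ('r, 'a) module \<Rightarrow> 'a set"
  where "torsion I W = {x \<in> carrier W. \<forall>r\<in>I. r \<odot>\<^bsub>W\<^esub> x = \<zero>\<^bsub>W\<^esub>}"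

context cring
begin

lemma submodule_torsion:
  assumes "module R W" "I \<subseteq> carrier R"
  shows "submodule (torsion I W) R W"
proof -
  interpret W: module R W by fact
  have "r \<odot>\<^bsub>W\<^esub> (s \<odot>\<^bsub>W\<^esub> x) = s \<odot>\<^bsub>W\<^esub> (r \<odot>\<^bsub>W\<^esub> x)" if "r \<in> carrier R" "s \<in> carrier R" "x \<in> carrier W" for r s x
    using that by (simp flip: W.smult_assoc1 add: m_comm)
  then show ?thesis using assms(2)
    by (intro W.submoduleI') (auto simp: torsion_def subset_iff W.smult_r_distr)
qed

context
  fixes I :: "'a set"
  assumes I: "ideal I R"
begin

interpretation I: ideal I R by (rule I)

private abbreviation "K \<equiv> quotient_module (ring_as_module R) I"
private abbreviation one_class :: "('a, 'a set) resgen \<Rightarrow> 'a"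
  where "one_class \<equiv> basis_vector R (Gen (I +>\<^bsub>ring_as_module R\<^esub> \<one>))"

lemma module_cyclic: "module R K"
  by (rule module_quotient_module[OF module_ring_as_module submodule_ideal[OF I]])

lemma cyclic_coset_smult: "r \<in> carrier R \<Longrightarrow>
  r \<odot>\<^bsub>K\<^esub> (I +>\<^bsub>ring_as_module R\<^esub> \<one>) = I +>\<^bsub>ring_as_module R\<^esub> r"
  using quotient_module_smult[OF module_ring_as_module submodule_ideal[OF I], of r \<one>] by simp

lemma one_class_closed: "one_class \<in> carrier (res_module R K 0)"
  unfolding res_module_def by (rule basis_vector_closed) (auto simp: quotient_module_simps)

lemma one_class_augmentation: "res_augmentation R K one_class = I +>\<^bsub>ring_as_module R\<^esub> \<one>"
  unfolding res_augmentation_def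
  by (subst linear_extension_basis_vector[OF module_cyclic, where X = "res_basis R K 0"])
    (auto simp: quotient_module_simps)

text \<open>Modulo the image of the differential, on which a cocycle vanishes, each element in degree $0$ of the
  resolution is a multiple of the basis element over the generator of $R/I$.\<close>

lemma cocycle_value:
  assumes W: "module R W" and g: "g \<in> ext_cocycles R 0 K W" and p: "p \<in> carrier (res_module R K 0)"
    and r: "r \<in> carrier R" "res_augmentation R K p = I +>\<^bsub>ring_as_module R\<^esub> r"
  shows "g p = r \<odot>\<^bsub>W\<^esub> g one_class"
proof -
  interpret W: module R W by fact
  interpret P: module R "res_module R K 0" by (rule module_res_module[OF module_cyclic])
  interpret K: module R K by (rule module_cyclic)
  let ?q = "r \<odot>\<^bsub>res_module R K 0\<^esub> one_class"
  note aug = res_augmentation_hom[OF module_cyclic]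
  have q: "?q \<in> carrier (res_module R K 0)" using one_class_closed r by simp
  have gh: "g \<in> module_homs R (res_module R K 0) W"
    and z: "\<And>x. x \<in> carrier (res_module R K (Suc 0)) \<Longrightarrow> g (res_differential R x) = \<zero>\<^bsub>W\<^esub>"
    using g by (auto simp: ext_cocycles_iff[OF module_cyclic W])
  have "res_augmentation R K ?q = I +>\<^bsub>ring_as_module R\<^esub> r"
    using module_homs_smult[OF aug r(1) one_class_closed] cyclic_coset_smult[OF r(1)]
    by (simp add: one_class_augmentation)
  then have "res_augmentation R K (p \<ominus>\<^bsub>res_module R K 0\<^esub> ?q) = \<zero>\<^bsub>K\<^esub>"
    using module_homs_minus[OF P.module_axioms module_cyclic aug p q] r(2) module_homs_closed[OF aug p]
    by (simp add: K.M.minus_eq_zero_iff)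
  then obtain x where "x \<in> carrier (res_module R K (Suc 0))" "p \<ominus>\<^bsub>res_module R K 0\<^esub> ?q = res_differential R x"
    using res_kernel(1)[OF module_cyclic, of "p \<ominus>\<^bsub>res_module R K 0\<^esub> ?q"] p q by auto
  then have "g (p \<ominus>\<^bsub>res_module R K 0\<^esub> ?q) = \<zero>\<^bsub>W\<^esub>" using z by simp
  then have "g p = g ?q"
    using module_homs_minus[OF P.module_axioms W gh p q] module_homs_closed[OF gh p] module_homs_closed[OF gh q]
    by (simp add: W.M.minus_eq_zero_iff)
  then show ?thesis using module_homs_smult[OF gh r(1) one_class_closed] by simp
qed

text \<open>Evaluation at that basis element identifies $\mathrm{Hom}(R/I, X)$ with the
  $I$-torsion of \<open>X\<close>, compatibly with the maps induced by \<open>t\<close>.\<close>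

lemma weakly_laskerian_cocycles:
  fixes W :: "('a, 'w) module" and X :: "('a, 'u) module"
  assumes W: "module R W" and X: "module R X" and t: "t \<in> module_homs R W X"
    and wl: "weakly_laskerian_subquotient R X (torsion I X) (t ` torsion I W)"
  shows "weakly_laskerian_subquotient R (ext_cochains R 0 K X) (ext_cocycles R 0 K X)
    {g. \<exists>k\<in>ext_cocycles R 0 K W. (k, g) \<in> push_relation K W X t 0}"
proof (rule weakly_laskerian_subquotient_embed[OF module_ext_cochains[OF module_cyclic X] X wl])
  interpret W: module R W by fact
  interpret X: module R X by fact
  interpret C: module R "ext_cochains R 0 K X" by (rule module_ext_cochains[OF module_cyclic X])
  note ID = I.a_subset
  let ?G = "{(g, g one_class) | g. g \<in> ext_cocycles R 0 K X}"
  note CD = C.submoduleD[OF submodule_ext_cocycles[OF module_cyclic X]]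
  note gc = ext_cocycles_closed[OF module_cyclic X _ one_class_closed]
  show "linear_relation R (ext_cochains R 0 K X) X ?G"
  proof (rule linear_relationI)
    show "(\<zero>\<^bsub>ext_cochains R 0 K X\<^esub>, \<zero>\<^bsub>X\<^esub>) \<in> ?G"
      using CD(3) one_class_closed by (auto simp: ext_cochains_simps[OF module_cyclic])
    fix g x assume "(g, x) \<in> ?G"
    then have g: "g \<in> ext_cocycles R 0 K X" "x = g one_class" by auto
    then show "g \<in> carrier (ext_cochains R 0 K X) \<and> x \<in> carrier X" using CD(2) gc by simp
    show "(r \<odot>\<^bsub>ext_cochains R 0 K X\<^esub> g, r \<odot>\<^bsub>X\<^esub> x) \<in> ?G" if "r \<in> carrier R" for r
      using CD(5)[OF that g(1)] g(2) one_class_closed by (auto simp: ext_cochains_simps[OF module_cyclic])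
    fix g' x' assume "(g', x') \<in> ?G"
    then have g': "g' \<in> ext_cocycles R 0 K X" "x' = g' one_class" by auto
    show "(g \<oplus>\<^bsub>ext_cochains R 0 K X\<^esub> g', x \<oplus>\<^bsub>X\<^esub> x') \<in> ?G"
      using CD(4)[OF g(1) g'(1)] g(2) g'(2) one_class_closed by (auto simp: ext_cochains_simps[OF module_cyclic])
  qed
  have "g one_class \<in> torsion I X" if g: "g \<in> ext_cocycles R 0 K X" for g
  proof -
    interpret P: module R "res_module R K 0" by (rule module_res_module[OF module_cyclic])
    have gh: "g \<in> module_homs R (res_module R K 0) X" using g by (auto simp: ext_cocycles_iff[OF module_cyclic X])
    have "r \<odot>\<^bsub>X\<^esub> g one_class = \<zero>\<^bsub>X\<^esub>" if r: "r \<in> I" for r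
    proof -
      have "I +>\<^bsub>ring_as_module R\<^esub> r = I"
        using coset_eq_self_iff[OF module_ring_as_module submodule_ideal[OF I], of r] r ID by auto
      then have "res_augmentation R K \<zero>\<^bsub>res_module R K 0\<^esub> = I +>\<^bsub>ring_as_module R\<^esub> r"
        using module_homs_zero[OF P.module_axioms module_cyclic res_augmentation_hom[OF module_cyclic]]
        by (simp add: quotient_module_simps)
      then have "g \<zero>\<^bsub>res_module R K 0\<^esub> = r \<odot>\<^bsub>X\<^esub> g one_class"
        using r ID by (intro cocycle_value[OF X g]) auto
      then show ?thesis using module_homs_zero[OF P.module_axioms X gh] by simp
    qed
    then show ?thesis using gc[OF g] by (simp add: torsion_def)
  qed
  then show "?G \<subseteq> ext_cocycles R 0 K X \<times> torsion I X" by auto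
  show "submodule {g. \<exists>k\<in>ext_cocycles R 0 K W. (k, g) \<in> push_relation K W X t 0} R (ext_cochains R 0 K X)"
    by (rule submodule_relation_image[OF module_ext_cochains[OF module_cyclic W] module_ext_cochains[OF module_cyclic X]
          push_relation_linear[OF module_cyclic W X t] submodule_ext_cocycles[OF module_cyclic W]])
  show "submodule (t ` torsion I W) R X"
    by (rule submodule_image_of_submodule[OF W X t submodule_torsion[OF W ID]])
  show "t ` torsion I W \<subseteq> torsion I X"
  proof
    fix x assume "x \<in> t ` torsion I W"
    then obtain w where w: "w \<in> carrier W" "\<And>r. r \<in> I \<Longrightarrow> r \<odot>\<^bsub>W\<^esub> w = \<zero>\<^bsub>W\<^esub>" "x = t w" by (auto simp: torsion_def)
    have "r \<odot>\<^bsub>X\<^esub> t w = \<zero>\<^bsub>X\<^esub>" if "r \<in> I" for r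
      using module_homs_smult[OF t subsetD[OF ID that] w(1)] w(2)[OF that] module_homs_zero[OF W X t] by simp
    then show "x \<in> torsion I X" using w module_homs_closed[OF t w(1)] by (simp add: torsion_def)
  qed
  show "submodule (torsion I X) R X" by (rule submodule_torsion[OF X ID])
  show "g \<in> {g. \<exists>k\<in>ext_cocycles R 0 K W. (k, g) \<in> push_relation K W X t 0}"
    if gx: "(g, x) \<in> ?G" "x \<in> t ` torsion I W" for g x
  proof -
    obtain w where g: "g \<in> ext_cocycles R 0 K X" and w: "w \<in> torsion I W" "g one_class = t w" using gx by auto
    have wc: "w \<in> carrier W" and w0: "\<And>r. r \<in> I \<Longrightarrow> r \<odot>\<^bsub>W\<^esub> w = \<zero>\<^bsub>W\<^esub>" using w(1) by (auto simp: torsion_def)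
    have h: "(\<lambda>r. r \<odot>\<^bsub>W\<^esub> w) \<in> module_homs R (ring_as_module R) W"
      using wc by (intro module_homsI) (auto simp: W.smult_l_distr W.smult_assoc1)
    obtain \<kappa> where \<kappa>: "\<kappa> \<in> module_homs R K W" "\<And>r. r \<in> carrier R \<Longrightarrow> \<kappa> (I +>\<^bsub>ring_as_module R\<^esub> r) = r \<odot>\<^bsub>W\<^esub> w"
    proof (rule surjective_factor[OF module_ring_as_module module_cyclic W
          quotient_projection_hom[OF module_ring_as_module submodule_ideal[OF I]] _ h])
      show "carrier K \<subseteq> (+>\<^bsub>ring_as_module R\<^esub>) I ` carrier (ring_as_module R)"
        by (auto simp: quotient_module_simps)
      show "r \<odot>\<^bsub>W\<^esub> w = \<zero>\<^bsub>W\<^esub>" if "r \<in> carrier (ring_as_module R)" "I +>\<^bsub>ring_as_module R\<^esub> r = \<zero>\<^bsub>K\<^esub>" for r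
        using coset_eq_self_iff[OF module_ring_as_module submodule_ideal[OF I] that(1)] that(2) w0
        by (simp add: quotient_module_simps)
    qed auto
    note k = module_homs_comp'[OF res_augmentation_hom[OF module_cyclic] \<kappa>(1)]
    have kc: "restrict (\<lambda>p. \<kappa> (res_augmentation R K p)) (carrier (res_module R K 0)) \<in> ext_cocycles R 0 K W"
      by (rule restrict_cocycle[OF module_cyclic W k])
        (simp add: res_augmentation_differential[OF module_cyclic] module_homs_zero[OF module_cyclic W \<kappa>(1)])
    have "g p = t (\<kappa> (res_augmentation R K p))" if p: "p \<in> carrier (res_module R K 0)" for p
    proof -
      obtain r where r: "r \<in> carrier R" "res_augmentation R K p = I +>\<^bsub>ring_as_module R\<^esub> r"
        using module_homs_closed[OF res_augmentation_hom[OF module_cyclic] p] by (auto simp: quotient_module_simps)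
      show ?thesis
        using cocycle_value[OF X g p r] w(2) module_homs_smult[OF t r(1) wc] \<kappa>(2)[OF r(1)] r(2) by simp
    qed
    then have "(restrict (\<lambda>p. \<kappa> (res_augmentation R K p)) (carrier (res_module R K 0)), g) \<in> push_relation K W X t 0"
      using g kc by (simp add: push_relation_def[OF module_cyclic])
    then show ?thesis using kc by blast
  qed
qed auto

end

end

section \<open>Dimension shifting along a complex of injective modules\<close>

lemma short_exactI:
  assumes "module R B" "module R Z" "module R H" "\<beta> \<in> module_homs R B Z" "\<pi> \<in> module_homs R Z H"
    "inj_on \<beta> (carrier B)" "\<pi> ` carrier Z = carrier H" "{z \<in> carrier Z. \<pi> z = \<zero>\<^bsub>H\<^esub>} = \<beta> ` carrier B"
  shows "short_exact R B Z H \<beta> \<pi>"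
  using assms unfolding short_exact_def by blast

context cring
begin

text \<open>The cohomology is represented by modules \<open>G q\<close> with surjections \<open>\<psi> q\<close> from the cocycles, since
  it occurs below in the form of direct limits. The coboundaries of the subcomplex
  $\mathrm{Hom}(R/I, T^\bullet)$ are \<open>tbd q\<close>.\<close>

context
  fixes I :: "'a set" and T :: "nat \<Rightarrow> ('a, 't) module" and d :: "nat \<Rightarrow> 't \<Rightarrow> 't"
    and G :: "nat \<Rightarrow> ('a, 'g) module" and \<psi> :: "nat \<Rightarrow> 't \<Rightarrow> 'g"
    and cyc bd tbd :: "nat \<Rightarrow> 't set" and s :: nat
  assumes I: "ideal I R" and T: "\<And>q. injective_module R (T q)"
    and d: "\<And>q. d q \<in> module_homs R (T q) (T (Suc q))"
    and dd: "\<And>q x. x \<in> carrier (T q) \<Longrightarrow> d (Suc q) (d q x) = \<zero>\<^bsub>T (Suc (Suc q))\<^esub>"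
    and cyc: "\<And>q. cyc q = {x \<in> carrier (T q). d q x = \<zero>\<^bsub>T (Suc q)\<^esub>}"
    and bd: "bd 0 = {\<zero>\<^bsub>T 0\<^esub>}" "\<And>q. bd (Suc q) = d q ` carrier (T q)"
    and tbd: "tbd 0 = {\<zero>\<^bsub>T 0\<^esub>}" "\<And>q. tbd (Suc q) = d q ` torsion I (T q)"
    and G: "\<And>q. module R (G q)" and \<psi>: "\<And>q. \<psi> q \<in> module_homs R ((T q)\<lparr>carrier := cyc q\<rparr>) (G q)"
    and \<psi>_surj: "\<And>q. \<psi> q ` cyc q = carrier (G q)"
    and \<psi>_ker: "\<And>q x. x \<in> cyc q \<Longrightarrow> \<psi> q x = \<zero>\<^bsub>G q\<^esub> \<longleftrightarrow> x \<in> bd q"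
    and wl_torsion: "\<And>q. weakly_laskerian_subquotient R (T q) (cyc q \<inter> torsion I (T q)) (tbd q)"
    and wl_G: "\<And>q j. q \<noteq> s \<Longrightarrow> weakly_laskerian R (Ext R j (quotient_module (ring_as_module R) I) (G q))"
begin

private abbreviation "RI \<equiv> quotient_module (ring_as_module R) I"
private abbreviation "ZM q \<equiv> (T q)\<lparr>carrier := cyc q\<rparr>"
private abbreviation "BM q \<equiv> (T q)\<lparr>carrier := bd q\<rparr>"

private lemma RI: "module R RI" by (rule module_cyclic[OF I])
private lemma Tm: "module R (T q)" using T[of q] by (simp add: injective_module_def)
private lemma Isub: "I \<subseteq> carrier R" using ideal.axioms(1)[OF I] by (rule additive_subgroup.a_subset)

private lemma cyc_sub: "submodule (cyc q) R (T q)"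
  unfolding cyc by (rule submodule_kernel[OF Tm Tm d])

private lemma bd_sub: "submodule (bd q) R (T q)"
  by (cases q) (simp_all add: bd submodule_zero[OF Tm] submodule_image[OF Tm Tm d])

private lemma bd_cyc: "bd q \<subseteq> cyc q"
proof (cases q)
  case 0
  interpret T: module R "T 0" by (rule Tm)
  show ?thesis using 0 module_homs_zero[OF Tm Tm d[of 0]] by (auto simp: bd cyc)
next
  case (Suc n)
  then show ?thesis using module_homs_closed[OF d[of n]] by (auto simp: bd cyc dd)
qed

private lemma ZM: "module R (ZM q)" by (rule submodule.submodule_is_module[OF cyc_sub Tm])
private lemma BM: "module R (BM q)" by (rule submodule.submodule_is_module[OF bd_sub Tm])

private lemma ses1: "short_exact R (BM q) (ZM q) (G q) (\<lambda>x. x) (\<psi> q)"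
  by (rule short_exactI[OF BM ZM G _ \<psi>]) (use bd_cyc[of q] \<psi>_surj[of q] \<psi>_ker[of _ q] in \<open>auto simp: module_homs_def subset_iff\<close>)

private lemma ses2: "short_exact R (ZM q) (T q) (BM (Suc q)) (\<lambda>x. x) (d q)"
proof (rule short_exactI[OF ZM Tm BM])
  show "d q \<in> module_homs R (T q) (BM (Suc q))"
    using d[of q] by (auto simp: module_homs_def bd)
  show "(\<lambda>x. x) \<in> module_homs R (ZM q) (T q)" by (auto simp: module_homs_def cyc)
qed (auto simp: bd cyc)

private lemma torsion_restrict: "torsion I ((T q)\<lparr>carrier := S\<rparr>) = S \<inter> torsion I (T q)" if "S \<subseteq> carrier (T q)"
  using that by (auto simp: torsion_def)

private lemma tbd_sub: "submodule (tbd q) R (T q)"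
proof (cases q)
  case 0
  then show ?thesis using submodule_zero[OF Tm] by (simp add: tbd)
next
  case (Suc n)
  show ?thesis
    using submodule_image_of_submodule[OF Tm Tm d[of n] submodule_torsion[OF Tm Isub]] by (simp add: Suc tbd)
qed

private lemma tbd_torsion: "tbd q \<subseteq> bd q \<inter> torsion I (T q)"
proof (cases q)
  case 0
  interpret T: module R "T 0" by (rule Tm)
  show ?thesis using 0 Isub by (auto simp: tbd bd torsion_def subset_iff)
next
  case (Suc n)
  have "d n x \<in> torsion I (T (Suc n))" if x: "x \<in> torsion I (T n)" for x
  proof -
    have "r \<odot>\<^bsub>T (Suc n)\<^esub> d n x = \<zero>\<^bsub>T (Suc n)\<^esub>" if "r \<in> I" for r
      using module_homs_smult[OF d[of n], of r x] x that Isub module_homs_zero[OF Tm Tm d[of n]]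
      by (auto simp: torsion_def)
    then show ?thesis using module_homs_closed[OF d[of n]] x by (simp add: torsion_def)
  qed
  then show ?thesis by (auto simp: Suc tbd bd torsion_def)
qed

private lemma identity_relation:
  assumes "submodule S R (T q)" "submodule S' R (T q)" "S' \<subseteq> S"
  shows "linear_relation R ((T q)\<lparr>carrier := S\<rparr>) (T q) {(x, x) | x. x \<in> S'}"
    "linear_relation R (T q) ((T q)\<lparr>carrier := S\<rparr>) {(x, x) | x. x \<in> S'}"
proof -
  note D = module.submoduleD[OF Tm assms(2)] and D' = module.submoduleD(2)[OF Tm assms(1)]
  show "linear_relation R ((T q)\<lparr>carrier := S\<rparr>) (T q) {(x, x) | x. x \<in> S'}"
    by (rule linear_relationI) (use D D' assms(3) in auto)
  show "linear_relation R (T q) ((T q)\<lparr>carrier := S\<rparr>) {(x, x) | x. x \<in> S'}"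
    by (rule linear_relationI) (use D D' assms(3) in auto)
qed

private lemma inter_sub:
  assumes "submodule S R (T q)"
  shows "submodule (S \<inter> torsion I (T q)) R (T q)"
  by (rule submodule_inter[OF Tm assms submodule_torsion[OF Tm Isub]])

text \<open>$\mathrm{Ext}^1(R/I, Z^q)$ is the cokernel of $\mathrm{Hom}(R/I, T^q) \to \mathrm{Hom}(R/I, B^{q+1})$,
  since $T^q$ is injective; and this cokernel is a submodule of the cohomology of
  $\mathrm{Hom}(R/I, T^\bullet)$ in degree $q + 1$.\<close>

private lemma Ext1_ZM: "weakly_laskerian R (Ext R (Suc 0) RI (ZM q))"
proof (rule weakly_laskerian_Ext_left[OF RI ses2 weakly_laskerian_cocycles[OF I Tm BM short_exact_\<pi>[OF ses2]]])
  let ?X = "BM (Suc q)"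
  have tX: "torsion I ?X = bd (Suc q) \<inter> torsion I (T (Suc q))"
    using torsion_restrict module.submoduleD(1)[OF Tm bd_sub] by blast
  have S: "bd (Suc q) \<inter> torsion I (T (Suc q)) \<subseteq> bd (Suc q)" by blast
  note sub = inter_sub[OF bd_sub, of "Suc q"]
  note subX = submodule_restrict[OF Tm bd_sub sub S]
  have tb: "submodule (d q ` torsion I (T q)) R (T (Suc q))" "d q ` torsion I (T q) \<subseteq> bd (Suc q) \<inter> torsion I (T (Suc q))"
    using tbd_sub[of "Suc q"] tbd_torsion[of "Suc q"] by (simp_all add: tbd)
  have tbX: "submodule (d q ` torsion I (T q)) R ?X"
    using tb by (intro submodule_restrict[OF Tm bd_sub]) auto
  show "weakly_laskerian_subquotient R ?X (torsion I ?X) (d q ` torsion I (T q))"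
    unfolding tX
    by (rule weakly_laskerian_subquotient_embed[OF BM Tm wl_torsion[of "Suc q"] identity_relation(1)[OF bd_sub sub S]
          _ tbX tbd_sub _ inter_sub[OF cyc_sub]])
      (use bd_cyc[of "Suc q"] tbd_torsion[of "Suc q"] in \<open>auto simp: tbd(2)\<close>)
  let ?D = "{g. \<exists>k\<in>ext_cocycles R 0 RI (T q). (k, g) \<in> push_relation RI (T q) ?X (d q) 0}"
  have "(\<zero>\<^bsub>ext_cochains R 0 RI (T q)\<^esub>, \<zero>\<^bsub>ext_cochains R 0 RI ?X\<^esub>) \<in> push_relation RI (T q) ?X (d q) 0"
    by (rule linear_relationD(3)[OF module_ext_cochains[OF RI Tm] module_ext_cochains[OF RI BM]
          push_relation_linear[OF RI Tm BM short_exact_\<pi>[OF ses2]]])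
  then show "\<zero>\<^bsub>ext_cochains R 0 RI ?X\<^esub> \<in> ?D" using push_relation_subset[OF RI] by blast
  show "?D \<subseteq> ext_cocycles R 0 RI ?X" using push_relation_subset[OF RI] by blast
  show "\<exists>z\<in>ext_cocycles R 0 RI (T q). \<forall>p\<in>carrier (res_module R RI 0). d q (z p) = h p" if "h \<in> ?D" for h
    using that by (force simp: push_relation_def[OF RI])
  show "weakly_laskerian R (Ext R (Suc 0) RI (T q))" by (rule weakly_laskerian_Ext_injective[OF RI T])
qed

text \<open>Modulo the image of $\mathrm{Hom}(R/I, Z^q)$, the module $\mathrm{Hom}(R/I, G^q)$ embeds into
  $\mathrm{Ext}^1(R/I, B^q)$; and the image is a quotient of the cohomology of
  $\mathrm{Hom}(R/I, T^\bullet)$ in degree $q$.\<close>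

private lemma Ext0_G:
  assumes "weakly_laskerian R (Ext R (Suc 0) RI (BM q))"
  shows "weakly_laskerian R (Ext R 0 RI (G q))"
proof (rule weakly_laskerian_Ext_right[OF RI ses1 weakly_laskerian_cocycles[OF I BM ZM short_exact_\<beta>[OF ses1]] _ _ _ assms])
  let ?X = "ZM q"
  have tX: "torsion I ?X = cyc q \<inter> torsion I (T q)" and tB: "torsion I (BM q) = bd q \<inter> torsion I (T q)"
    by (rule torsion_restrict[OF module.submoduleD(1)[OF Tm cyc_sub]],
        rule torsion_restrict[OF module.submoduleD(1)[OF Tm bd_sub]])
  have S: "cyc q \<inter> torsion I (T q) \<subseteq> cyc q" by blast
  note sub = inter_sub[OF cyc_sub, of q] and subB = inter_sub[OF bd_sub, of q]
  note subX = submodule_restrict[OF Tm cyc_sub sub S]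
  have tbX: "submodule (bd q \<inter> torsion I (T q)) R ?X"
    using bd_cyc by (intro submodule_restrict[OF Tm cyc_sub subB]) auto
  interpret T: module R "T q" by (rule Tm)
  show "weakly_laskerian_subquotient R ?X (torsion I ?X) ((\<lambda>x. x) ` torsion I (BM q))"
    unfolding tX tB image_ident
  proof (rule weakly_laskerian_subquotient_image[OF Tm ZM wl_torsion[of q] identity_relation(2)[OF cyc_sub sub S]
          _ T.submoduleD(3)[OF tbd_sub] _ tbX subX])
    show "\<exists>x y'. (x, y') \<in> {(x, x) |x. x \<in> cyc q \<inter> torsion I (T q)} \<and> y \<ominus>\<^bsub>?X\<^esub> y' \<in> bd q \<inter> torsion I (T q)"
      if "y \<in> cyc q \<inter> torsion I (T q)" for y
    proof -
      interpret Z: module R ?X by (rule ZM)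
      have "y \<ominus>\<^bsub>?X\<^esub> y = \<zero>\<^bsub>T q\<^esub>" using that Z.M.minus_eq_zero_iff[of y y] by simp
      then show ?thesis using that T.submoduleD(3)[OF subB] by auto
    qed
  qed (use tbd_torsion[of q] bd_cyc[of q] in auto)
  let ?D = "{g. \<exists>k\<in>ext_cocycles R 0 RI (BM q). (k, g) \<in> push_relation RI (BM q) ?X (\<lambda>x. x) 0}"
  have "(\<zero>\<^bsub>ext_cochains R 0 RI (BM q)\<^esub>, \<zero>\<^bsub>ext_cochains R 0 RI ?X\<^esub>) \<in> push_relation RI (BM q) ?X (\<lambda>x. x) 0"
    by (rule linear_relationD(3)[OF module_ext_cochains[OF RI BM] module_ext_cochains[OF RI ZM]
          push_relation_linear[OF RI BM ZM short_exact_\<beta>[OF ses1]]])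
  then show "\<zero>\<^bsub>ext_cochains R 0 RI ?X\<^esub> \<in> ?D" using push_relation_subset[OF RI] by blast
  show "?D \<subseteq> ext_cocycles R 0 RI ?X" using push_relation_subset[OF RI] by blast
  show "h \<in> ext_coboundaries R 0 RI (G q)" if zh: "(z, h) \<in> push_relation RI ?X (G q) (\<psi> q) 0" and "z \<in> ?D" for z h
  proof -
    obtain k where k: "k \<in> ext_cocycles R 0 RI (BM q)" "(k, z) \<in> push_relation RI (BM q) ?X (\<lambda>x. x) 0"
      using \<open>z \<in> ?D\<close> by blast
    have "\<psi> q (k p) = \<zero>\<^bsub>G q\<^esub>" if "p \<in> carrier (res_module R RI 0)" for p
      using ext_cocycles_closed[OF RI BM k(1) that] bd_cyc \<psi>_ker by auto
    then show ?thesis using k(2) zh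
      by (auto simp: push_relation_def[OF RI] ext_coboundaries_0_iff[OF RI] ext_cocycles_iff[OF RI G])
  qed
qed

text \<open>Going up to \<open>s\<close>: from $B^q$ to $Z^q$ by the first exact sequence, and from $Z^q$ to $B^{q+1}$
  by the second one with a shift of the degree of Ext.\<close>

private lemma Ext_BM_low: "q \<le> s \<Longrightarrow> weakly_laskerian R (Ext R (Suc j) RI (BM q))"
proof (induction q arbitrary: j)
  case 0
  show ?case by (rule weakly_laskerian_Ext_zero[OF RI BM]) (simp add: bd)
next
  case (Suc q)
  have "weakly_laskerian R (Ext R (Suc (Suc j)) RI (ZM q))"
    by (rule weakly_laskerian_Ext_middle[OF RI ses1]) (use Suc in \<open>auto intro: wl_G\<close>)
  then show ?case
    by (rule weakly_laskerian_Ext_right'[OF RI ses2 weakly_laskerian_Ext_injective[OF RI T]])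
qed

text \<open>Beyond \<open>s\<close> the degree of Ext is reduced: for $j > 0$, $\mathrm{Ext}^{j+1}(R/I, Z^q)$ is isomorphic to
  $\mathrm{Ext}^j(R/I, B^{q+1})$, which lies between $\mathrm{Ext}^{j-1}(R/I, G^{q+1})$ and
  $\mathrm{Ext}^j(R/I, Z^{q+1})$, and $q + 1 \neq s$.\<close>

private lemma Ext_ZM_high: "s \<le> q \<Longrightarrow> weakly_laskerian R (Ext R (Suc j) RI (ZM q))"
proof (induction j arbitrary: q)
  case 0
  show ?case by (rule Ext1_ZM)
next
  case (Suc j)
  have "weakly_laskerian R (Ext R (Suc j) RI (BM (Suc q)))"
    by (rule weakly_laskerian_Ext_left'[OF RI ses1]) (use Suc in \<open>auto intro: wl_G\<close>)
  then show ?case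
    by (rule weakly_laskerian_Ext_left'[OF RI ses2 _ weakly_laskerian_Ext_injective[OF RI T]])
qed

text \<open>For $j > 0$, $\mathrm{Ext}^j(R/I, G^s)$ lies between $\mathrm{Ext}^j(R/I, Z^s)$ and
  $\mathrm{Ext}^{j+1}(R/I, B^s)$.\<close>

lemma weakly_laskerian_Ext_remaining_cohomology: "weakly_laskerian R (Ext R j RI (G s))"
proof (cases j)
  case 0
  then show ?thesis using Ext0_G[OF Ext_BM_low] by simp
next
  case (Suc i)
  then show ?thesis
    using weakly_laskerian_Ext_right'[OF RI ses1 Ext_ZM_high Ext_BM_low] by simp
qed

end

end

section \<open>Finitely generated modules\<close>

context cring
begin

lemma ideal_of_submodule:
  assumes "submodule J R (ring_as_module R)"
  shows "ideal J R"
proof (rule idealI)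
  interpret M: module R "ring_as_module R" by (rule module_ring_as_module)
  note D = M.submoduleD[OF assms]
  show "ring R" by (rule ring_axioms)
  show "subgroup J (add_monoid R)"
  proof (rule add.subgroupI)
    show "J \<subseteq> carrier R" "J \<noteq> {}" using D(1,3) by auto
    fix x y assume x: "x \<in> J"
    show "x \<oplus> y \<in> J" if "y \<in> J" using D(4)[OF x that] by simp
    show "\<ominus> x \<in> J" using D(5)[of "\<ominus> \<one>", OF _ x] D(2)[OF x] by (simp add: l_minus)
  qed
  show "x \<otimes> r \<in> J" "r \<otimes> x \<in> J" if "r \<in> J" "x \<in> carrier R" for r x
    using D(5)[OF that(2,1)] D(2)[OF that(1)] that(2) by (simp_all add: m_comm)
qed

lemma coordinate_hom: "(\<lambda>l. l x) \<in> module_homs R (free_module R X) (ring_as_module R)"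
  by (rule module_homsI) (auto simp: free_module_carrier)

lemma submodule_coordinate:
  assumes "submodule L R (free_module R X)"
  shows "submodule ((\<lambda>l. l x) ` L) R (ring_as_module R)"
  by (rule submodule_image_of_submodule[OF module_free_module module_ring_as_module coordinate_hom assms])

text \<open>As in the proof of the basis theorem: the ideal of last coordinates and the elements with vanishing last
  coordinate are finitely generated.\<close>

lemma submodule_free_finitely_generated:
  assumes noeth: "noetherian_ring R" and "submodule L R (free_module R {..<m::nat})"
  shows "\<exists>S\<subseteq>L. finite S \<and> (\<forall>H. submodule H R (free_module R {..<m}) \<longrightarrow> S \<subseteq> H \<longrightarrow> L \<subseteq> H)"
  using assms(2)
proof (induction m arbitrary: L)
  case 0
  interpret F: module R "free_module R {..<0::nat}" by (rule module_free_module)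
  have "L \<subseteq> {\<zero>\<^bsub>free_module R {..<0::nat}\<^esub>}"
    using F.submoduleD(1)[OF 0] by (force simp: free_module_carrier fun_eq_iff)
  moreover have "\<zero>\<^bsub>free_module R {..<0::nat}\<^esub> \<in> H" if "submodule H R (free_module R {..<0::nat})" for H
    by (rule F.submoduleD(3)[OF that])
  ultimately show ?case by (intro exI[of _ "{}"]) auto
next
  case (Suc m)
  let ?F = "free_module R {..<Suc m}" and ?F' = "free_module R {..<m}"
  interpret F: module R ?F by (rule module_free_module)
  interpret F': module R ?F' by (rule module_free_module)
  interpret RM: module R "ring_as_module R" by (rule module_ring_as_module)
  note L = Suc.prems and LD = F.submoduleD[OF Suc.prems]
  have F'F: "l \<in> carrier ?F' \<longleftrightarrow> l \<in> carrier ?F \<and> l m = \<zero>" for l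
    by (auto simp: free_module_carrier less_Suc_eq)
  have restr: "submodule (H \<inter> carrier ?F') R ?F'" if H: "submodule H R ?F" for H
  proof -
    note HD = F.submoduleD[OF H]
    show ?thesis
      by (rule F'.submoduleI') (use HD F'.zero_closed F'.a_closed F'.smult_closed in \<open>auto simp del: F'.zero_closed\<close>)
  qed
  obtain S' where S': "S' \<subseteq> L \<inter> carrier ?F'" "finite S'"
    "\<And>H. submodule H R ?F' \<Longrightarrow> S' \<subseteq> H \<Longrightarrow> L \<inter> carrier ?F' \<subseteq> H"
    using Suc.IH[OF restr[OF L]] by auto
  let ?J = "\<lambda>H. (\<lambda>l. l m) ` H"
  obtain A where A: "A \<subseteq> carrier R" "finite A" "?J L = Idl A"
    using noetherian_ring.finetely_gen[OF noeth ideal_of_submodule[OF submodule_coordinate[OF L]]] by blast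
  have "\<forall>a\<in>A. \<exists>l\<in>L. l m = a" using genideal_self[OF A(1)] unfolding A(3)[symmetric] by blast
  then obtain g where g: "\<And>a. a \<in> A \<Longrightarrow> g a \<in> L" "\<And>a. a \<in> A \<Longrightarrow> g a m = a" by metis
  show ?case
  proof (intro exI[of _ "S' \<union> g ` A"] conjI allI impI)
    show "S' \<union> g ` A \<subseteq> L" "finite (S' \<union> g ` A)" using S' A g by auto
    fix H assume H: "submodule H R ?F" and SH: "S' \<union> g ` A \<subseteq> H"
    note HD = F.submoduleD[OF H]
    have "L \<inter> carrier ?F' \<subseteq> H \<inter> carrier ?F'"
      by (rule S'(3)[OF restr[OF H]]) (use SH S'(1) in auto)
    moreover have "Idl A \<subseteq> ?J (L \<inter> H)"
    proof (rule genideal_minimal)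
      show "ideal (?J (L \<inter> H)) R"
        by (rule ideal_of_submodule[OF submodule_coordinate[OF submodule_inter[OF F.module_axioms L H]]])
      show "A \<subseteq> ?J (L \<inter> H)"
      proof
        fix a assume "a \<in> A"
        then show "a \<in> ?J (L \<inter> H)" using g SH by (intro image_eqI[of _ _ "g a"]) auto
      qed
    qed
    ultimately show "L \<subseteq> H"
    proof (intro subsetI)
      fix l assume sub: "L \<inter> carrier ?F' \<subseteq> H \<inter> carrier ?F'" "Idl A \<subseteq> ?J (L \<inter> H)" and l: "l \<in> L"
      have "l m \<in> Idl A" unfolding A(3)[symmetric] using l by (rule imageI)
      then have "l m \<in> ?J (L \<inter> H)" using sub(2) by (rule rev_subsetD)
      then obtain h where h: "h \<in> L" "h \<in> H" "h m = l m" by (auto simp: image_iff)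
      have c: "l \<in> carrier ?F" "h \<in> carrier ?F" using LD(2) l h by auto
      have "(l \<ominus>\<^bsub>?F\<^esub> h) m = l m \<ominus>\<^bsub>ring_as_module R\<^esub> h m"
        by (rule module_homs_minus[OF F.module_axioms module_ring_as_module coordinate_hom c])
      then have "(l \<ominus>\<^bsub>?F\<^esub> h) m = \<zero>"
        using h(3) module_homs_closed[OF coordinate_hom c(1), of m] RM.M.minus_eq_zero_iff[of "l m" "l m"] by simp
      then have "l \<ominus>\<^bsub>?F\<^esub> h \<in> H" using sub(1) LD(6)[OF l h(1)] c F'F by blast
      then have "(l \<ominus>\<^bsub>?F\<^esub> h) \<oplus>\<^bsub>?F\<^esub> h \<in> H" using HD(4) h(2) by blast
      then show "l \<in> H" using F.M.add_minus_cancel(2)[OF c] by simp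
    qed
  qed
qed

lemma finite_set_image_of_free:
  assumes M: "module R M" and S: "finite S" "S \<subseteq> carrier M"
  obtains k :: nat and u where "u \<in> module_homs R (free_module R {..<k}) M"
    "S \<subseteq> u ` carrier (free_module R {..<k})"
    "\<And>H. submodule H R M \<Longrightarrow> S \<subseteq> H \<Longrightarrow> u ` carrier (free_module R {..<k}) \<subseteq> H"
proof -
  interpret M: module R M by fact
  obtain k :: nat and s where s: "S = s ` {i. i < k}"
    using finite_imp_nat_seg_image_inj_on[OF S(1)] by blast
  let ?u = "linear_extension R M s"
  have sX: "s \<in> {..<k} \<rightarrow> carrier M" using s S(2) by auto
  note u = linear_extension_hom[OF M sX]
  have "S \<subseteq> ?u ` carrier (free_module R {..<k})"
  proof
    fix x assume "x \<in> S"
    then obtain i where i: "i \<in> {..<k}" "x = s i" using s by auto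
    then show "x \<in> ?u ` carrier (free_module R {..<k})"
      using linear_extension_basis_vector[OF M sX i(1)] basis_vector_closed[OF i(1)]
      by (intro image_eqI[of _ _ "basis_vector R i"]) auto
  qed
  moreover have "?u ` carrier (free_module R {..<k}) \<subseteq> H" if H: "submodule H R M" "S \<subseteq> H" for H
  proof (intro image_subsetI)
    note HD = M.submoduleD[OF H(1)]
    fix f assume "f \<in> carrier (free_module R {..<k})"
    then show "?u f \<in> H"
    proof (induction f rule: free_module_induct)
      case zero
      show ?case using module_homs_zero[OF module_free_module M u] HD(3) by simp
    next
      case (add r x f)
      have "s x \<in> H" using add(2) s H(2) by auto
      then show ?case
        using HD(4)[OF HD(5)[OF add(1)] add(4)]
        by (simp add: module_homs_combination[OF u add(1-3)] linear_extension_basis_vector[OF M sX add(2)])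
    qed
  qed
  ultimately show ?thesis using that u by blast
qed

lemma submodule_free_image:
  assumes "noetherian_ring R" and L: "submodule L R (free_module R {..<m::nat})"
  obtains k :: nat and u where "u \<in> module_homs R (free_module R {..<k}) (free_module R {..<m})"
    "u ` carrier (free_module R {..<k}) = L"
proof -
  interpret F: module R "free_module R {..<m}" by (rule module_free_module)
  obtain S where S: "S \<subseteq> L" "finite S" "\<And>H. submodule H R (free_module R {..<m}) \<Longrightarrow> S \<subseteq> H \<Longrightarrow> L \<subseteq> H"
    using submodule_free_finitely_generated[OF assms] by blast
  have "S \<subseteq> carrier (free_module R {..<m})" using S(1) F.submoduleD(1)[OF L] by blast
  then obtain k :: nat and u where u: "u \<in> module_homs R (free_module R {..<k}) (free_module R {..<m})"
    "S \<subseteq> u ` carrier (free_module R {..<k})"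
    "\<And>H. submodule H R (free_module R {..<m}) \<Longrightarrow> S \<subseteq> H \<Longrightarrow> u ` carrier (free_module R {..<k}) \<subseteq> H"
    using finite_set_image_of_free[OF module_free_module S(2)] by metis
  have "u ` carrier (free_module R {..<k}) = L"
    using u(3)[OF L S(1)] S(3)[OF submodule_image[OF module_free_module module_free_module u(1)] u(2)] by blast
  with u(1) show ?thesis by (rule that)
qed

lemma finitely_generated_image:
  assumes M: "module R M" and "finitely_generated_module R M"
  obtains m :: nat and p where "p \<in> module_homs R (free_module R {..<m}) M"
    "p ` carrier (free_module R {..<m}) = carrier M"
proof -
  obtain S where S: "S \<subseteq> carrier M" "finite S" "carrier M = \<Inter>{H. submodule H R M \<and> S \<subseteq> H}"
    using assms(2) unfolding finitely_generated_module_def by blast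
  obtain m :: nat and p where p: "p \<in> module_homs R (free_module R {..<m}) M"
    "S \<subseteq> p ` carrier (free_module R {..<m})"
    using finite_set_image_of_free[OF M S(2,1)] by metis
  have "submodule (p ` carrier (free_module R {..<m})) R M"
    by (rule submodule_image[OF module_free_module M p(1)])
  then have "carrier M \<subseteq> p ` carrier (free_module R {..<m})"
    using p(2) by (subst S(3)) blast
  then have "p ` carrier (free_module R {..<m}) = carrier M"
    using module_homs_closed[OF p(1)] by blast
  with p(1) show ?thesis by (rule that)
qed

end

section \<open>The cohomology of an injective resolution of a weakly Laskerian module\<close>

text \<open>The complex is $\mathrm{Hom}(A/L, E^\bullet)$; its elements are written as homomorphisms on \<open>A\<close>.\<close>

definition hom_cocycles ::
    "('r, 'x) ring_scheme \<Rightarrow> (nat \<Rightarrow> ('r, 'e) module) \<Rightarrow> (nat \<Rightarrow> 'e \<Rightarrow> 'e) \<Rightarrow> ('r, 'a) module \<Rightarrow>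
      'a set \<Rightarrow> nat \<Rightarrow> ('a \<Rightarrow> 'e) set"
  where "hom_cocycles R E d A L n =
    {f \<in> carrier (hom_module R A (E n)). (\<forall>x\<in>L. f x = \<zero>\<^bsub>E n\<^esub>) \<and> (\<forall>x\<in>carrier A. d n (f x) = \<zero>\<^bsub>E (Suc n)\<^esub>)}"

primrec hom_coboundaries ::
    "('r, 'x) ring_scheme \<Rightarrow> (nat \<Rightarrow> ('r, 'e) module) \<Rightarrow> (nat \<Rightarrow> 'e \<Rightarrow> 'e) \<Rightarrow> ('r, 'a) module \<Rightarrow>
      'a set \<Rightarrow> nat \<Rightarrow> ('a \<Rightarrow> 'e) set"
  where
    "hom_coboundaries R E d A L 0 = {\<lambda>x\<in>carrier A. \<zero>\<^bsub>E 0\<^esub>}"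
  | "hom_coboundaries R E d A L (Suc n) =
      {f \<in> extensional (carrier A). \<exists>g\<in>module_homs R A (E n).
        (\<forall>x\<in>L. g x = \<zero>\<^bsub>E n\<^esub>) \<and> (\<forall>x\<in>carrier A. f x = d n (g x))}"

context cring
begin

context
  fixes E :: "nat \<Rightarrow> ('a, 'e) module" and d :: "nat \<Rightarrow> 'e \<Rightarrow> 'e"
  assumes E: "\<And>n. module R (E n)" and d: "\<And>n. d n \<in> module_homs R (E n) (E (Suc n))"
    and dd: "\<And>n x. x \<in> carrier (E n) \<Longrightarrow> d (Suc n) (d n x) = \<zero>\<^bsub>E (Suc (Suc n))\<^esub>"
begin

lemma submodule_hom_cocycles:
  assumes A: "module R A" and L: "L \<subseteq> carrier A"
  shows "submodule (hom_cocycles R E d A L n) R (hom_module R A (E n))"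
proof -
  interpret H: module R "hom_module R A (E n)" by (rule module_hom_module[OF A E])
  interpret A: module R A by (rule A)
  interpret E: module R "E n" by (rule E)
  interpret E': module R "E (Suc n)" by (rule E)
  have c: "f x \<in> carrier (E n)" if "f \<in> carrier (hom_module R A (E n))" "x \<in> carrier A" for f x
    using that by (auto simp: hom_module_simps module_homs_def)
  show ?thesis
  proof (rule H.submoduleI')
    show "hom_cocycles R E d A L n \<subseteq> carrier (hom_module R A (E n))" by (auto simp: hom_cocycles_def)
    show "\<zero>\<^bsub>hom_module R A (E n)\<^esub> \<in> hom_cocycles R E d A L n"
      using L H.zero_closed module_homs_zero[OF E E d] by (auto simp: hom_cocycles_def hom_module_simps(2) subset_iff)
    fix f assume f: "f \<in> hom_cocycles R E d A L n"
    show "r \<odot>\<^bsub>hom_module R A (E n)\<^esub> f \<in> hom_cocycles R E d A L n" if r: "r \<in> carrier R" for r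
      using f r L H.smult_closed[OF r, of f] c[of f]
      by (auto simp: hom_cocycles_def hom_module_simps(4) subset_iff module_homs_smult[OF d])
    fix g assume g: "g \<in> hom_cocycles R E d A L n"
    show "f \<oplus>\<^bsub>hom_module R A (E n)\<^esub> g \<in> hom_cocycles R E d A L n"
      using f g L H.a_closed[of f g] c[of f] c[of g]
      by (auto simp: hom_cocycles_def hom_module_simps(3) subset_iff module_homs_add[OF d])
  qed
qed

lemma hom_coboundaries_hom:
  assumes A: "module R A" and f: "f \<in> hom_coboundaries R E d A L n"
  shows "f \<in> carrier (hom_module R A (E n))"
proof (cases n)
  case 0
  then show ?thesis using f module.carrier_is_submodule[OF module_hom_module[OF A E], of 0]
      abelian_monoid.zero_closed[of "hom_module R A (E 0)"] module_hom_module[OF A E, of 0]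
    by (simp add: hom_module_simps(2) module_def abelian_group_def)
next
  case (Suc k)
  then obtain g where g: "g \<in> module_homs R A (E k)" "\<forall>x\<in>carrier A. f x = d k (g x)" "f \<in> extensional (carrier A)"
    using f by auto
  have "f \<in> module_homs R A (E (Suc k))"
    by (rule module_homs_cong[OF A module_homs_comp'[OF g(1) d]]) (use g(2) in simp)
  then show ?thesis using g(3) Suc by (simp add: hom_module_simps)
qed

lemma submodule_hom_coboundaries:
  assumes A: "module R A" and L: "L \<subseteq> carrier A"
  shows "submodule (hom_coboundaries R E d A L n) R (hom_module R A (E n))"
proof (cases n)
  case 0
  then show ?thesis using submodule_zero[OF module_hom_module[OF A E[of 0]]] by (simp add: hom_module_simps)
next
  case (Suc k)
  interpret H: module R "hom_module R A (E n)" by (rule module_hom_module[OF A E])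
  interpret A: module R A by (rule A)
  interpret E: module R "E k" by (rule E)
  note bI = bexI[of _ _ "module_homs R A (E k)"]
  show ?thesis
  proof (rule H.submoduleI')
    show "hom_coboundaries R E d A L n \<subseteq> carrier (hom_module R A (E n))"
      using hom_coboundaries_hom[OF A] by blast
    show "\<zero>\<^bsub>hom_module R A (E n)\<^esub> \<in> hom_coboundaries R E d A L n"
      using module_homs_zero[OF E E d[of k]]
      by (auto simp: Suc hom_module_simps(2) intro!: bI[OF _ module_homs_const_zero[OF A E]])
    fix f assume "f \<in> hom_coboundaries R E d A L n"
    then obtain f' where f': "f' \<in> module_homs R A (E k)" "\<forall>x\<in>L. f' x = \<zero>\<^bsub>E k\<^esub>" "\<forall>x\<in>carrier A. f x = d k (f' x)"
      by (auto simp: Suc)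
    note cf = module_homs_closed[OF f'(1)]
    show "r \<odot>\<^bsub>hom_module R A (E n)\<^esub> f \<in> hom_coboundaries R E d A L n" if r: "r \<in> carrier R" for r
      using f' r L cf
      by (auto simp: Suc hom_module_simps(4) module_homs_smult[OF d]
          intro!: bI[OF _ module_homs_pointwise_smult[OF A E f'(1) r]])
    fix g assume "g \<in> hom_coboundaries R E d A L n"
    then obtain g' where g': "g' \<in> module_homs R A (E k)" "\<forall>x\<in>L. g' x = \<zero>\<^bsub>E k\<^esub>" "\<forall>x\<in>carrier A. g x = d k (g' x)"
      by (auto simp: Suc)
    show "f \<oplus>\<^bsub>hom_module R A (E n)\<^esub> g \<in> hom_coboundaries R E d A L n"
      using f' g' L cf module_homs_closed[OF g'(1)]
      by (auto simp: Suc hom_module_simps(3) module_homs_add[OF d]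
          intro!: bI[OF _ module_homs_pointwise_add[OF A E f'(1) g'(1)]])
  qed
qed

lemma hom_coboundaries_subset:
  assumes A: "module R A" and L: "L \<subseteq> carrier A"
  shows "hom_coboundaries R E d A L n \<subseteq> hom_cocycles R E d A L n"
proof
  fix f assume f: "f \<in> hom_coboundaries R E d A L n"
  note fh = hom_coboundaries_hom[OF A f]
  show "f \<in> hom_cocycles R E d A L n"
  proof (cases n)
    case 0
    then show ?thesis using f fh L module_homs_zero[OF E E d[of 0]] by (auto simp: hom_cocycles_def)
  next
    case (Suc k)
    then obtain g where "g \<in> module_homs R A (E k)" "\<forall>x\<in>L. g x = \<zero>\<^bsub>E k\<^esub>" "\<forall>x\<in>carrier A. f x = d k (g x)"
      using f by auto
    then show ?thesis using Suc fh L module_homs_zero[OF E E d[of k]] dd[of _ k] module_homs_closed[of g R A "E k"]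
      by (auto simp: hom_cocycles_def subset_iff)
  qed
qed

context
  fixes N :: "('a, 'n) module" and \<epsilon> :: "'n \<Rightarrow> 'e"
  assumes N: "module R N" and \<epsilon>: "\<epsilon> \<in> module_homs R N (E 0)" "inj_on \<epsilon> (carrier N)"
    and ker0: "{x \<in> carrier (E 0). d 0 x = \<zero>\<^bsub>E 1\<^esub>} = \<epsilon> ` carrier N"
    and ker: "\<And>n. {x \<in> carrier (E (Suc n)). d (Suc n) x = \<zero>\<^bsub>E (Suc (Suc n))\<^esub>} = d n ` carrier (E n)"
    and inj: "\<And>n. injective_module R (E n)" and wl: "weakly_laskerian R N"
    and noeth: "noetherian_ring R"
begin

private lemma weakly_laskerian_kernel: "weakly_laskerian_subquotient R (E 0) (\<epsilon> ` carrier N) {\<zero>\<^bsub>E 0\<^esub>}"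
proof -
  interpret N: module R N by (rule N)
  have eq: "(\<epsilon> x \<in> {\<zero>\<^bsub>E 0\<^esub>}) = (x \<in> {\<zero>\<^bsub>N\<^esub>})" if "x \<in> carrier N" for x
    using that inj_onD[OF \<epsilon>(2), of x "\<zero>\<^bsub>N\<^esub>"] module_homs_zero[OF N E \<epsilon>(1)] by auto
  have z: "\<zero>\<^bsub>E 0\<^esub> \<in> \<epsilon> ` carrier N"
    using module_homs_zero[OF N E \<epsilon>(1)] by (metis N.M.zero_closed imageI)
  note lin = linear_relation_graph[OF N E \<epsilon>(1)]
  have "weakly_laskerian_subquotient R N (carrier N) {\<zero>\<^bsub>N\<^esub>} \<longleftrightarrow>
      weakly_laskerian_subquotient R (E 0) (\<epsilon> ` carrier N) {\<zero>\<^bsub>E 0\<^esub>}"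
    by (rule weakly_laskerian_subquotient_iso[OF N E lin _ submodule_zero[OF N] _ N.carrier_is_submodule
          submodule_zero[OF E] _ submodule_image[OF N E \<epsilon>(1)]]) (use eq z in auto)
  then show ?thesis using wl weakly_laskerian_iff[OF N] by simp
qed

text \<open>In degree $0$ the cocycles form a submodule of $\mathrm{Hom}(R^m, N) \cong N^m$, which is
  filtered by the number of basis vectors that may have a nonzero image.\<close>

private lemma weakly_laskerian_hom_degree_zero:
  assumes L: "L \<subseteq> carrier (free_module R {..<m::nat})"
  shows "weakly_laskerian_subquotient R (hom_module R (free_module R {..<m}) (E 0))
    (hom_cocycles R E d (free_module R {..<m}) L 0) (hom_coboundaries R E d (free_module R {..<m}) L 0)"
proof -
  let ?F = "free_module R {..<m}"
  let ?H = "hom_module R ?F (E 0)"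
  interpret H: module R ?H by (rule module_hom_module[OF module_free_module E])
  interpret E0: module R "E 0" by (rule E)
  note Z = submodule_hom_cocycles[OF module_free_module L, of 0]
  note ZD = H.submoduleD[OF Z]
  define C where "C j = {f \<in> hom_cocycles R E d ?F L 0. \<forall>i<m. j \<le> i \<longrightarrow> f (basis_vector R i) = \<zero>\<^bsub>E 0\<^esub>}" for j
  have b: "basis_vector R i \<in> carrier ?F" if "i < m" for i using that by (auto intro: basis_vector_closed)
  have add: "(f \<oplus>\<^bsub>?H\<^esub> g) (basis_vector R i) = f (basis_vector R i) \<oplus>\<^bsub>E 0\<^esub> g (basis_vector R i)"
    and sm: "(r \<odot>\<^bsub>?H\<^esub> f) (basis_vector R i) = r \<odot>\<^bsub>E 0\<^esub> f (basis_vector R i)"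
    and ze: "\<zero>\<^bsub>?H\<^esub> (basis_vector R i) = \<zero>\<^bsub>E 0\<^esub>" if "i < m" for f g r i
    using b[OF that] by (simp_all add: hom_module_simps)
  have C: "submodule (C j) R ?H" for j
    by (rule H.submoduleI') (use ZD in \<open>auto simp: C_def add sm ze\<close>)
  have "weakly_laskerian_subquotient R ?H (C j) {\<zero>\<^bsub>?H\<^esub>}" for j
  proof (induction j)
    case 0
    have "f = \<zero>\<^bsub>?H\<^esub>" if f: "f \<in> C 0" for f
    proof -
      have fh: "f \<in> module_homs R ?F (E 0)" "f \<in> extensional (carrier ?F)"
        using f by (auto simp: C_def hom_cocycles_def hom_module_simps)
      have "f x = \<zero>\<^bsub>E 0\<^esub>" if "x \<in> carrier ?F" for x
        by (rule free_module_hom_eq[OF E fh(1) module_homs_const_zero[OF module_free_module E] _ that])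
          (use f in \<open>simp add: C_def\<close>)
      then show ?thesis using fh(2) by (intro extensionalityI[of f "carrier ?F"]) (auto simp: hom_module_simps)
    qed
    then have "C 0 = {\<zero>\<^bsub>?H\<^esub>}" using H.submoduleD(3)[OF C] by blast
    then show ?case by (simp add: weakly_laskerian_subquotient_self)
  next
    case (Suc j)
    show ?case
    proof (cases "j < m")
      case False
      then have "C (Suc j) = C j" unfolding C_def by (metis (no_types, lifting) Suc_leD le_less_trans not_le)
      then show ?thesis using Suc by simp
    next
      case True
      have sub: "C j \<subseteq> C (Suc j)" by (auto simp: C_def)
      note D = H.submoduleD[OF C[of j]] and D' = H.submoduleD[OF C[of "Suc j"]]
      have F: "linear_relation R ?H ?H {(f, f) | f. f \<in> C j}"
        by (rule linear_relationI) (use D in auto)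
      have val: "f (basis_vector R j) \<in> \<epsilon> ` carrier N" if "f \<in> C (Suc j)" for f
        using that b[OF True] unfolding ker0[symmetric] by (auto simp: C_def hom_cocycles_def hom_module_simps module_homs_def)
      then have valc: "f (basis_vector R j) \<in> carrier (E 0)" if "f \<in> C (Suc j)" for f
        using val[OF that] module_homs_closed[OF \<epsilon>(1)] by auto
      have G: "linear_relation R ?H (E 0) {(f, f (basis_vector R j)) | f. f \<in> C (Suc j)}"
      proof (rule linear_relationI)
        show "(\<zero>\<^bsub>?H\<^esub>, \<zero>\<^bsub>E 0\<^esub>) \<in> {(f, f (basis_vector R j)) | f. f \<in> C (Suc j)}"
          using D'(3) ze[OF True] by auto
        fix f z assume "(f, z) \<in> {(f, f (basis_vector R j)) | f. f \<in> C (Suc j)}"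
        then have f: "f \<in> C (Suc j)" "z = f (basis_vector R j)" by auto
        then show "f \<in> carrier ?H \<and> z \<in> carrier (E 0)" using D'(2) valc by simp
        show "(r \<odot>\<^bsub>?H\<^esub> f, r \<odot>\<^bsub>E 0\<^esub> z) \<in> {(f, f (basis_vector R j)) | f. f \<in> C (Suc j)}" if "r \<in> carrier R" for r
          using D'(5)[OF that f(1)] sm[OF True] f(2) by auto
        fix f' z' assume "(f', z') \<in> {(f, f (basis_vector R j)) | f. f \<in> C (Suc j)}"
        then have f': "f' \<in> C (Suc j)" "z' = f' (basis_vector R j)" by auto
        then show "(f \<oplus>\<^bsub>?H\<^esub> f', z \<oplus>\<^bsub>E 0\<^esub> z') \<in> {(f, f (basis_vector R j)) | f. f \<in> C (Suc j)}"
          using D'(4)[OF f(1) f'(1)] add[OF True] f(2) by auto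
      qed
      show ?thesis
      proof (rule weakly_laskerian_subquotient_exact[OF H.module_axioms H.module_axioms E Suc weakly_laskerian_kernel
            F _ G _ _ _ submodule_zero[OF H.module_axioms] submodule_zero[OF E] _ submodule_image[OF N E \<epsilon>(1)]])
        show "\<exists>x y'. (x, y') \<in> {(f, f) |f. f \<in> C j} \<and> f \<ominus>\<^bsub>?H\<^esub> y' \<in> {\<zero>\<^bsub>?H\<^esub>}"
          if "(f, z) \<in> {(f, f (basis_vector R j)) |f. f \<in> C (Suc j)}" "z \<in> {\<zero>\<^bsub>E 0\<^esub>}" for f z
        proof -
          have f: "f \<in> C (Suc j)" "f (basis_vector R j) = \<zero>\<^bsub>E 0\<^esub>" using that by auto
          have "f (basis_vector R i) = \<zero>\<^bsub>E 0\<^esub>" if "i < m" "j \<le> i" for i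
            using f that by (cases "i = j") (auto simp: C_def)
          then have "f \<in> C j" using f by (auto simp: C_def)
          moreover have "f \<ominus>\<^bsub>?H\<^esub> f = \<zero>\<^bsub>?H\<^esub>" using H.M.minus_eq_zero_iff[of f f] D(2)[OF \<open>f \<in> C j\<close>] by simp
          ultimately show ?thesis by auto
        qed
        show "{\<zero>\<^bsub>E 0\<^esub>} \<subseteq> \<epsilon> ` carrier N"
          using module_homs_zero[OF N E \<epsilon>(1)] module.submoduleD(3)[OF E submodule_image[OF N E \<epsilon>(1)]] by simp
      qed (use D sub val in auto)
    qed
  qed
  from this[of m] show ?thesis by (auto simp: C_def hom_module_simps)
qed

text \<open>Dimension shifting along \<open>E\<close>. By projectivity a cocycle \<open>e\<close> on \<open>F/L\<close> of degree $n + 1$ is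
  $d \circ g$ for a homomorphism \<open>g\<close> on \<open>F\<close>, and \<open>g\<close> restricts to a cocycle of degree \<open>n\<close> on \<open>L\<close>. The
  module \<open>L\<close> is again a quotient of a finitely generated free module, by its relations \<open>?L'\<close>, and if
  the restriction is a coboundary, then so is \<open>e\<close>, because homomorphisms from \<open>L\<close> to \<open>E\<close> extend
  to \<open>F\<close>. This reverses the surjection $\mathrm{Ext}^n(L, N) \to \mathrm{Ext}^{n+1}(F/L, N)$.\<close>

lemma weakly_laskerian_hom_free:
  "submodule L R (free_module R {..<m::nat}) \<Longrightarrow>
    weakly_laskerian_subquotient R (hom_module R (free_module R {..<m}) (E n))
      (hom_cocycles R E d (free_module R {..<m}) L n) (hom_coboundaries R E d (free_module R {..<m}) L n)"
proof (induction n arbitrary: m L)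
  case 0
  then show ?case by (intro weakly_laskerian_hom_degree_zero module.submoduleD(1)[OF module_free_module])
next
  case (Suc n)
  let ?F = "free_module R {..<m}"
  obtain k :: nat and u where u: "u \<in> module_homs R (free_module R {..<k}) ?F" "u ` carrier (free_module R {..<k}) = L"
    using submodule_free_image[OF noeth Suc.prems] .
  let ?F' = "free_module R {..<k}"
  let ?L' = "{x \<in> carrier ?F'. u x = \<zero>\<^bsub>?F\<^esub>}"
  interpret E1: module R "E n" by (rule E)
  interpret F': module R ?F' by (rule module_free_module)
  note F = module_free_module[of "{..<m}"] and F' = module_free_module[of "{..<k}"]
  note Lc = module.submoduleD(1)[OF F Suc.prems]
  have L': "submodule ?L' R ?F'" by (rule submodule_kernel[OF F' F u(1)])
  then have L'c: "?L' \<subseteq> carrier ?F'" by blast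
  let ?Y = "hom_module R ?F (E (Suc n))" and ?V = "hom_module R ?F' (E n)"
  note Y = module_hom_module[OF F E] and V = module_hom_module[OF F' E]
  interpret Y: module R ?Y by (rule Y)
  interpret V: module R ?V by (rule V)
  note Zs = Y.submoduleD[OF submodule_hom_cocycles[OF F Lc]] and Zs' = V.submoduleD[OF submodule_hom_cocycles[OF F' L'c]]
  note uc = module_homs_closed[OF u(1)]
  define G where "G = {(e, y). e \<in> hom_cocycles R E d ?F L (Suc n) \<and> y \<in> hom_cocycles R E d ?F' ?L' n \<and>
    (\<exists>g\<in>module_homs R ?F (E n). (\<forall>x\<in>carrier ?F. d n (g x) = e x) \<and> (\<forall>x\<in>carrier ?F'. y x = g (u x)))}"
  have G: "linear_relation R ?Y ?V G"
  proof (rule linear_relationI)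
    show "(\<zero>\<^bsub>?Y\<^esub>, \<zero>\<^bsub>?V\<^esub>) \<in> G"
      using Zs(3) Zs'(3) uc module_homs_zero[OF E E d[of n]]
      by (auto simp: G_def hom_module_simps(2) intro!: bexI[OF _ module_homs_const_zero[OF F E]])
    fix e y assume "(e, y) \<in> G"
    then obtain g where ey: "e \<in> hom_cocycles R E d ?F L (Suc n)" "y \<in> hom_cocycles R E d ?F' ?L' n"
      and g: "g \<in> module_homs R ?F (E n)" "\<forall>x\<in>carrier ?F. d n (g x) = e x" "\<forall>x\<in>carrier ?F'. y x = g (u x)"
      by (auto simp: G_def)
    then show "e \<in> carrier ?Y \<and> y \<in> carrier ?V" using Zs(2) Zs'(2) by blast
    note gc = module_homs_closed[OF g(1)]
    show "(r \<odot>\<^bsub>?Y\<^esub> e, r \<odot>\<^bsub>?V\<^esub> y) \<in> G" if r: "r \<in> carrier R" for r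
      using Zs(5)[OF r ey(1)] Zs'(5)[OF r ey(2)] g(2,3) uc gc r
      by (auto simp: G_def hom_module_simps(4) module_homs_smult[OF d]
          intro!: bexI[OF _ module_homs_pointwise_smult[OF F E g(1) r]])
    fix e' y' assume "(e', y') \<in> G"
    then obtain g' where ey': "e' \<in> hom_cocycles R E d ?F L (Suc n)" "y' \<in> hom_cocycles R E d ?F' ?L' n"
      and g': "g' \<in> module_homs R ?F (E n)" "\<forall>x\<in>carrier ?F. d n (g' x) = e' x" "\<forall>x\<in>carrier ?F'. y' x = g' (u x)"
      by (auto simp: G_def)
    show "(e \<oplus>\<^bsub>?Y\<^esub> e', y \<oplus>\<^bsub>?V\<^esub> y') \<in> G"
      using Zs(4)[OF ey(1) ey'(1)] Zs'(4)[OF ey(2) ey'(2)] g(2,3) g'(2,3) uc gc module_homs_closed[OF g'(1)]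
      by (auto simp: G_def hom_module_simps(3) module_homs_add[OF d]
          intro!: bexI[OF _ module_homs_pointwise_add[OF F E g(1) g'(1)]])
  qed
  show ?case
  proof (rule weakly_laskerian_subquotient_embed[OF Y V Suc.IH[OF L'] G _ submodule_hom_coboundaries[OF F Lc]
        submodule_hom_coboundaries[OF F' L'c] hom_coboundaries_subset[OF F' L'c] submodule_hom_cocycles[OF F' L'c]])
    show "G \<subseteq> hom_cocycles R E d ?F L (Suc n) \<times> hom_cocycles R E d ?F' ?L' n" by (auto simp: G_def)
    show "\<exists>y. (e, y) \<in> G" if e: "e \<in> hom_cocycles R E d ?F L (Suc n)" for e
    proof -
      have e': "e \<in> module_homs R ?F (E (Suc n))" "\<And>x. x \<in> L \<Longrightarrow> e x = \<zero>\<^bsub>E (Suc n)\<^esub>"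
        "\<And>x. x \<in> carrier ?F \<Longrightarrow> d (Suc n) (e x) = \<zero>\<^bsub>E (Suc (Suc n))\<^esub>"
        using e by (auto simp: hom_cocycles_def hom_module_simps)
      obtain g where g: "g \<in> module_homs R ?F (E n)" "\<And>x. x \<in> carrier ?F \<Longrightarrow> d n (g x) = e x"
      proof (rule free_lift[OF E E d e'(1)])
        show "e x \<in> d n ` carrier (E n)" if "x \<in> carrier ?F" for x
          unfolding ker[symmetric] using e'(3)[OF that] module_homs_closed[OF e'(1) that] by simp
      qed blast
      have y: "(\<lambda>x\<in>carrier ?F'. g (u x)) \<in> hom_cocycles R E d ?F' ?L' n"
        unfolding hom_cocycles_def
      proof (intro CollectI conjI ballI)
        show "(\<lambda>x\<in>carrier ?F'. g (u x)) \<in> carrier ?V"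
          using module_homs_cong[OF F' module_homs_comp'[OF u(1) g(1)], of "\<lambda>x\<in>carrier ?F'. g (u x)"]
          by (simp add: hom_module_simps)
        show "(\<lambda>x\<in>carrier ?F'. g (u x)) x = \<zero>\<^bsub>E n\<^esub>" if "x \<in> ?L'" for x
          using that module_homs_zero[OF F E g(1)] by simp
        show "d n ((\<lambda>x\<in>carrier ?F'. g (u x)) x) = \<zero>\<^bsub>E (Suc n)\<^esub>" if "x \<in> carrier ?F'" for x
          using that g(2)[OF uc[OF that]] e'(2)[of "u x"] u(2) by auto
      qed
      then have "(e, \<lambda>x\<in>carrier ?F'. g (u x)) \<in> G" using e g by (auto simp: G_def)
      then show ?thesis by blast
    qed
    show "e \<in> hom_coboundaries R E d ?F L (Suc n)" if "(e, y) \<in> G" and yb: "y \<in> hom_coboundaries R E d ?F' ?L' n" for e y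
    proof -
      obtain g where e: "e \<in> hom_cocycles R E d ?F L (Suc n)"
        and g: "g \<in> module_homs R ?F (E n)" "\<And>x. x \<in> carrier ?F \<Longrightarrow> d n (g x) = e x" "\<And>x. x \<in> carrier ?F' \<Longrightarrow> y x = g (u x)"
        using \<open>(e, y) \<in> G\<close> by (auto simp: G_def)
      have ext: "e \<in> extensional (carrier ?F)" using e by (auto simp: hom_cocycles_def hom_module_simps)
      have "\<exists>h\<in>module_homs R ?F (E n). (\<forall>x\<in>L. h x = \<zero>\<^bsub>E n\<^esub>) \<and> (\<forall>x\<in>carrier ?F. e x = d n (h x))"
      proof (cases n)
        case 0
        have "g (u x) = \<zero>\<^bsub>E n\<^esub>" if "x \<in> carrier ?F'" for x
          using g(3)[OF that] yb that 0 by simp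
        then show ?thesis using g(1,2) u(2) by (intro bexI[of _ g]) auto
      next
        case (Suc i)
        then obtain y' where y': "y' \<in> module_homs R ?F' (E i)" "\<And>x. x \<in> ?L' \<Longrightarrow> y' x = \<zero>\<^bsub>E i\<^esub>"
          "\<And>x. x \<in> carrier ?F' \<Longrightarrow> y x = d i (y' x)"
          using yb by auto
        obtain f where f: "f \<in> module_homs R ?F (E i)" "\<And>x. x \<in> carrier ?F' \<Longrightarrow> f (u x) = y' x"
          using injective_factor[OF F' F inj u(1) y'(1)] y'(2) by blast
        \<comment> \<open>Subtracting a coboundary makes \<open>g\<close> vanish on \<open>L\<close>.\<close>
        have df: "(\<lambda>x. d i (f x)) \<in> module_homs R ?F (E n)" using module_homs_comp'[OF f(1) d] Suc by simp
        note h = module_homs_pointwise_diff[OF F E g(1) df]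
        note gc = module_homs_closed[OF g(1)] and dfc = module_homs_closed[OF df]
        have "g (u x) \<ominus>\<^bsub>E n\<^esub> d i (f (u x)) = \<zero>\<^bsub>E n\<^esub>" if "x \<in> carrier ?F'" for x
          using g(3)[OF that] y'(3)[OF that] f(2)[OF that] gc[OF uc[OF that]] by (simp add: E1.M.minus_eq_zero_iff)
        moreover have "e x = d n (g x \<ominus>\<^bsub>E n\<^esub> d i (f x))" if x: "x \<in> carrier ?F" for x
        proof -
          interpret E2: module R "E (Suc n)" by (rule E)
          have "d n (d i (f x)) = \<zero>\<^bsub>E (Suc n)\<^esub>" using dd[OF module_homs_closed[OF f(1) x]] Suc by simp
          then show ?thesis
            using module_homs_minus[OF E E d gc[OF x] dfc[OF x]] g(2)[OF x] module_homs_closed[OF d gc[OF x]]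
            by (simp add: E2.M.minus_eq)
        qed
        ultimately show ?thesis using u(2) by (intro bexI[OF _ h]) auto
      qed
      then show ?thesis using ext by simp
    qed
  qed
qed

text \<open>A presentation of \<open>M\<close> by a free module reduces this to the preceding lemma.\<close>

lemma weakly_laskerian_hom_finitely_generated:
  fixes M :: "('a, 'm) module"
  assumes M: "module R M" and "finitely_generated_module R M" and L: "submodule L R M"
  shows "weakly_laskerian_subquotient R (hom_module R M (E n)) (hom_cocycles R E d M L n) (hom_coboundaries R E d M L n)"
proof -
  obtain m :: nat and p where p: "p \<in> module_homs R (free_module R {..<m}) M" "p ` carrier (free_module R {..<m}) = carrier M"
    using finitely_generated_image[OF assms(1,2)] .
  let ?F = "free_module R {..<m}"
  note F = module_free_module[of "{..<m}"]
  interpret M: module R M by (rule M)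
  interpret F: module R ?F by (rule F)
  note LD = M.submoduleD[OF L]
  let ?L = "{x \<in> carrier ?F. p x \<in> L}"
  have "?L = {x. \<exists>y\<in>L. (x, y) \<in> {(x, p x) | x. x \<in> carrier ?F}}" by auto
  then have L': "submodule ?L R ?F"
    by (simp only:) (rule submodule_relation_preimage[OF F M linear_relation_graph[OF F M p(1)] L])
  have L'c: "?L \<subseteq> carrier ?F" by blast
  let ?Y = "hom_module R M (E n)" and ?V = "hom_module R ?F (E n)"
  note Y = module_hom_module[OF M E] and V = module_hom_module[OF F E]
  interpret Y: module R ?Y by (rule Y)
  interpret V: module R ?V by (rule V)
  note Zs = Y.submoduleD[OF submodule_hom_cocycles[OF M LD(1)]] and Zs' = V.submoduleD[OF submodule_hom_cocycles[OF F L'c]]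
  note pc = module_homs_closed[OF p(1)]
  define G where "G = {(f, y). f \<in> hom_cocycles R E d M L n \<and> y \<in> hom_cocycles R E d ?F ?L n \<and>
    (\<forall>x\<in>carrier ?F. y x = f (p x))}"
  have G: "linear_relation R ?Y ?V G"
  proof (rule linear_relationI)
    show "(\<zero>\<^bsub>?Y\<^esub>, \<zero>\<^bsub>?V\<^esub>) \<in> G" using Zs(3) Zs'(3) pc by (auto simp: G_def hom_module_simps(2))
    fix f y assume fy: "(f, y) \<in> G"
    then show "f \<in> carrier ?Y \<and> y \<in> carrier ?V" using Zs(2) Zs'(2) by (simp add: G_def)
    show "(r \<odot>\<^bsub>?Y\<^esub> f, r \<odot>\<^bsub>?V\<^esub> y) \<in> G" if r: "r \<in> carrier R" for r
      using fy Zs(5)[OF r, of f] Zs'(5)[OF r, of y] pc by (simp add: G_def hom_module_simps(4))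
    fix f' y' assume "(f', y') \<in> G"
    then show "(f \<oplus>\<^bsub>?Y\<^esub> f', y \<oplus>\<^bsub>?V\<^esub> y') \<in> G"
      using fy Zs(4)[of f f'] Zs'(4)[of y y'] pc by (simp add: G_def hom_module_simps(3))
  qed
  show ?thesis
  proof (rule weakly_laskerian_subquotient_embed[OF Y V weakly_laskerian_hom_free[OF L'] G _ submodule_hom_coboundaries[OF M LD(1)]
        submodule_hom_coboundaries[OF F L'c] hom_coboundaries_subset[OF F L'c] submodule_hom_cocycles[OF F L'c]])
    show "G \<subseteq> hom_cocycles R E d M L n \<times> hom_cocycles R E d ?F ?L n" by (auto simp: G_def)
    show "\<exists>y. (f, y) \<in> G" if f: "f \<in> hom_cocycles R E d M L n" for f
    proof -
      have f': "f \<in> module_homs R M (E n)" using f by (auto simp: hom_cocycles_def hom_module_simps)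
      have "(\<lambda>x\<in>carrier ?F. f (p x)) \<in> hom_cocycles R E d ?F ?L n"
        using f pc module_homs_cong[OF F module_homs_comp'[OF p(1) f'], of "\<lambda>x\<in>carrier ?F. f (p x)"]
        by (auto simp: hom_cocycles_def hom_module_simps)
      then show ?thesis using f by (intro exI[of _ "\<lambda>x\<in>carrier ?F. f (p x)"]) (simp add: G_def)
    qed
    show "f \<in> hom_coboundaries R E d M L n" if "(f, y) \<in> G" and yb: "y \<in> hom_coboundaries R E d ?F ?L n" for f y
    proof -
      have f: "f \<in> hom_cocycles R E d M L n" and y: "\<And>x. x \<in> carrier ?F \<Longrightarrow> y x = f (p x)"
        using that(1) by (auto simp: G_def)
      have ext: "f \<in> extensional (carrier M)" using f by (auto simp: hom_cocycles_def hom_module_simps)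
      show ?thesis
      proof (cases n)
        case 0
        have "f x = \<zero>\<^bsub>E 0\<^esub>" if x: "x \<in> carrier M" for x
        proof -
          obtain z where "z \<in> carrier ?F" "x = p z" using x p(2) by auto
          then show ?thesis using y yb 0 by auto
        qed
        then have "f = (\<lambda>x\<in>carrier M. \<zero>\<^bsub>E 0\<^esub>)" by (intro extensionalityI[OF ext]) auto
        then show ?thesis using 0 by simp
      next
        case (Suc i)
        then obtain g where g: "g \<in> module_homs R ?F (E i)" "\<And>x. x \<in> ?L \<Longrightarrow> g x = \<zero>\<^bsub>E i\<^esub>"
          "\<And>x. x \<in> carrier ?F \<Longrightarrow> y x = d i (g x)"
          using yb by auto
        obtain h where h: "h \<in> module_homs R M (E i)" "\<And>x. x \<in> carrier ?F \<Longrightarrow> h (p x) = g x"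
          using surjective_factor[OF F M E p(1) _ g(1)] p(2) g(2) LD(3) by auto
        have "h x = \<zero>\<^bsub>E i\<^esub>" if x: "x \<in> L" for x
        proof -
          obtain z where z: "z \<in> carrier ?F" "x = p z" using LD(2)[OF x] p(2) by blast
          then show ?thesis using h(2)[OF z(1)] g(2)[of z] x by simp
        qed
        moreover have "f x = d i (h x)" if x: "x \<in> carrier M" for x
        proof -
          obtain z where z: "z \<in> carrier ?F" "x = p z" using x p(2) by blast
          then show ?thesis using h(2)[OF z(1)] g(3)[OF z(1)] y[OF z(1)] by simp
        qed
        ultimately show ?thesis using Suc ext h(1) by auto
      qed
    qed
  qed
qed

end

end

end

section \<open>Comparing the two ways to compute Ext\<close>

text \<open>\<open>zigzag R A E d k b f w\<close> connects a map \<open>f\<close> on \<open>A\<close> with a map \<open>w\<close> on the $k$-th term of the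
  free resolution by a staircase in the double complex $\mathrm{Hom}(P_\bullet, E^\bullet)$; \<open>w\<close> has values
  in $E^b$ and \<open>f\<close> in $E^{k+b}$. Each step pulls a map back along the differential of \<open>E\<close> and
  composes the result with the differential of the resolution.\<close>

primrec zigzag ::
    "('r, 'x) ring_scheme \<Rightarrow> ('r, 'm) module \<Rightarrow> (nat \<Rightarrow> ('r, 'e) module) \<Rightarrow> (nat \<Rightarrow> 'e \<Rightarrow> 'e) \<Rightarrow>
      nat \<Rightarrow> nat \<Rightarrow> ('m \<Rightarrow> 'e) \<Rightarrow> ((('r, 'm) resgen \<Rightarrow> 'r) \<Rightarrow> 'e) \<Rightarrow> bool"
  where
    "zigzag R A E d 0 b f w \<longleftrightarrow> w \<in> module_homs R (res_module R A 0) (E b) \<and>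
      (\<forall>p\<in>carrier (res_module R A 0). w p = f (res_augmentation R A p))"
  | "zigzag R A E d (Suc k) b f w \<longleftrightarrow> w \<in> module_homs R (res_module R A (Suc k)) (E b) \<and>
      (\<exists>c v. zigzag R A E d k (Suc b) f v \<and> c \<in> module_homs R (res_module R A k) (E b) \<and>
        (\<forall>p\<in>carrier (res_module R A k). d b (c p) = v p) \<and>
        (\<forall>p\<in>carrier (res_module R A (Suc k)). w p = c (res_differential R p)))"

lemma zigzag_hom: "zigzag R A E d k b f w \<Longrightarrow> w \<in> module_homs R (res_module R A k) (E b)"
  by (cases k) auto

context cring
begin

context
  fixes E :: "nat \<Rightarrow> ('a, 'e) module" and d :: "nat \<Rightarrow> 'e \<Rightarrow> 'e"
  assumes E: "\<And>i. module R (E i)" and d: "\<And>i. d i \<in> module_homs R (E i) (E (Suc i))"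
begin

lemma zigzag_natural:
  fixes A :: "('a, 'm) module" and A' :: "('a, 'p) module"
  assumes A: "module R A" and A': "module R A'" and \<phi>: "\<phi> \<in> module_homs R A A'"
  shows "zigzag R A' E d k b f w \<Longrightarrow> zigzag R A E d k b (\<lambda>x. f (\<phi> x)) (\<lambda>p. w (res_map R \<phi> p))"
proof (induction k arbitrary: b w)
  case 0
  note h = res_map_hom[OF A A' \<phi>, of 0]
  show ?case
    using 0 module_homs_comp'[OF h, of w "E b"] module_homs_closed[OF h] by (simp add: res_map_augmentation[OF A A' \<phi>])
next
  case (Suc k)
  note h = res_map_hom[OF A A' \<phi>]
  obtain c v where *: "zigzag R A' E d k (Suc b) f v" "c \<in> module_homs R (res_module R A' k) (E b)"
    "\<And>p. p \<in> carrier (res_module R A' k) \<Longrightarrow> d b (c p) = v p"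
    "\<And>p. p \<in> carrier (res_module R A' (Suc k)) \<Longrightarrow> w p = c (res_differential R p)"
    and w: "w \<in> module_homs R (res_module R A' (Suc k)) (E b)"
    using Suc.prems by auto
  have "\<forall>p\<in>carrier (res_module R A k). d b (c (res_map R \<phi> p)) = v (res_map R \<phi> p)"
    using *(3) module_homs_closed[OF h] by blast
  moreover have "\<forall>p\<in>carrier (res_module R A (Suc k)). w (res_map R \<phi> p) = c (res_map R \<phi> (res_differential R p))"
    using *(4) module_homs_closed[OF h] res_map_differential[OF A A' \<phi>] by metis
  ultimately show ?case
    using Suc.IH[OF *(1)] module_homs_comp'[OF h *(2)] module_homs_comp'[OF h w]
    by (simp only: zigzag.simps) blast
qed

context
  fixes A :: "('a, 'm) module"
  assumes A: "module R A"
begin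

private abbreviation "F \<equiv> res_module R A"
private abbreviation "\<Delta> \<equiv> res_differential R :: (('a, 'm) resgen \<Rightarrow> 'a) \<Rightarrow> _"
private abbreviation "aug \<equiv> res_augmentation R A"

private lemma F: "module R (F k)" by (rule module_res_module[OF A])

lemma zigzag_cong:
  assumes "zigzag R A E d k b f w" "\<And>x. x \<in> carrier A \<Longrightarrow> f' x = f x" "\<And>p. p \<in> carrier (F k) \<Longrightarrow> w' p = w p"
  shows "zigzag R A E d k b f' w'"
proof -
  have f: "zigzag R A E d k b f' w" if "zigzag R A E d k b f w" for w
    using that
  proof (induction k arbitrary: b w)
    case 0
    then show ?case using assms(2) module_homs_closed[OF res_augmentation_hom[OF A]] by simp
  next
    case (Suc k)
    then show ?case by (simp only: zigzag.simps) blast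
  qed
  have "w' \<in> module_homs R (F k) (E b)" by (rule module_homs_cong[OF F zigzag_hom[OF assms(1)] assms(3)])
  then show ?thesis using f[OF assms(1)] assms(3) by (cases k) auto
qed

lemma zigzag_zero: "zigzag R A E d k b (\<lambda>x. \<zero>\<^bsub>E (k + b)\<^esub>) (\<lambda>p. \<zero>\<^bsub>E b\<^esub>)"
proof (induction k arbitrary: b)
  case 0
  show ?case using module_homs_const_zero[OF F E] by simp
next
  case (Suc k)
  have "zigzag R A E d k (Suc b) (\<lambda>x. \<zero>\<^bsub>E (Suc k + b)\<^esub>) (\<lambda>p. \<zero>\<^bsub>E (Suc b)\<^esub>)"
    using Suc[of "Suc b"] by simp
  moreover have "\<forall>p\<in>carrier (F k). d b \<zero>\<^bsub>E b\<^esub> = \<zero>\<^bsub>E (Suc b)\<^esub>" using module_homs_zero[OF E E d] by simp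
  ultimately show ?case
    unfolding zigzag.simps using module_homs_const_zero[OF F E]
    by (intro conjI exI[of _ "\<lambda>p. \<zero>\<^bsub>E b\<^esub>"] exI[of _ "\<lambda>p. \<zero>\<^bsub>E (Suc b)\<^esub>"]) auto
qed

lemma zigzag_add:
  "zigzag R A E d k b f w \<Longrightarrow> zigzag R A E d k b f' w' \<Longrightarrow> n = k + b \<Longrightarrow>
    zigzag R A E d k b (\<lambda>x. f x \<oplus>\<^bsub>E n\<^esub> f' x) (\<lambda>p. w p \<oplus>\<^bsub>E b\<^esub> w' p)"
proof (induction k arbitrary: b w w')
  case 0
  then show ?case using module_homs_pointwise_add[OF F E] by simp
next
  case (Suc k)
  obtain c v where *: "zigzag R A E d k (Suc b) f v" "c \<in> module_homs R (F k) (E b)"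
    "\<forall>p\<in>carrier (F k). d b (c p) = v p" "\<forall>p\<in>carrier (F (Suc k)). w p = c (\<Delta> p)"
    and w: "w \<in> module_homs R (F (Suc k)) (E b)"
    using Suc.prems(1) by auto
  obtain c' v' where **: "zigzag R A E d k (Suc b) f' v'" "c' \<in> module_homs R (F k) (E b)"
    "\<forall>p\<in>carrier (F k). d b (c' p) = v' p" "\<forall>p\<in>carrier (F (Suc k)). w' p = c' (\<Delta> p)"
    and w': "w' \<in> module_homs R (F (Suc k)) (E b)"
    using Suc.prems(2) by auto
  have "zigzag R A E d k (Suc b) (\<lambda>x. f x \<oplus>\<^bsub>E n\<^esub> f' x) (\<lambda>p. v p \<oplus>\<^bsub>E (Suc b)\<^esub> v' p)"
    using Suc.IH[OF *(1) **(1)] Suc.prems(3) by simp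
  moreover have "\<forall>p\<in>carrier (F k). d b (c p \<oplus>\<^bsub>E b\<^esub> c' p) = v p \<oplus>\<^bsub>E (Suc b)\<^esub> v' p"
    using *(3) **(3) module_homs_add[OF d] module_homs_closed[OF *(2)] module_homs_closed[OF **(2)] by simp
  moreover have "\<forall>p\<in>carrier (F (Suc k)). w p \<oplus>\<^bsub>E b\<^esub> w' p = c (\<Delta> p) \<oplus>\<^bsub>E b\<^esub> c' (\<Delta> p)"
    using *(4) **(4) by simp
  ultimately show ?case
    using module_homs_pointwise_add[OF F E *(2) **(2)] module_homs_pointwise_add[OF F E w w']
    unfolding zigzag.simps by (intro conjI exI[of _ "\<lambda>p. c p \<oplus>\<^bsub>E b\<^esub> c' p"] exI[of _ "\<lambda>p. v p \<oplus>\<^bsub>E (Suc b)\<^esub> v' p"])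
qed

lemma zigzag_smult:
  assumes r: "r \<in> carrier R"
  shows "zigzag R A E d k b f w \<Longrightarrow> n = k + b \<Longrightarrow>
    zigzag R A E d k b (\<lambda>x. r \<odot>\<^bsub>E n\<^esub> f x) (\<lambda>p. r \<odot>\<^bsub>E b\<^esub> w p)"
proof (induction k arbitrary: b w)
  case 0
  then show ?case using module_homs_pointwise_smult[OF F E _ r] by simp
next
  case (Suc k)
  obtain c v where *: "zigzag R A E d k (Suc b) f v" "c \<in> module_homs R (F k) (E b)"
    "\<forall>p\<in>carrier (F k). d b (c p) = v p" "\<forall>p\<in>carrier (F (Suc k)). w p = c (\<Delta> p)"
    and w: "w \<in> module_homs R (F (Suc k)) (E b)"
    using Suc.prems(1) by auto
  have "zigzag R A E d k (Suc b) (\<lambda>x. r \<odot>\<^bsub>E n\<^esub> f x) (\<lambda>p. r \<odot>\<^bsub>E (Suc b)\<^esub> v p)"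
    using Suc.IH[OF *(1)] Suc.prems(2) by simp
  moreover have "\<forall>p\<in>carrier (F k). d b (r \<odot>\<^bsub>E b\<^esub> c p) = r \<odot>\<^bsub>E (Suc b)\<^esub> v p"
    using *(3) module_homs_smult[OF d r] module_homs_closed[OF *(2)] by simp
  moreover have "\<forall>p\<in>carrier (F (Suc k)). r \<odot>\<^bsub>E b\<^esub> w p = r \<odot>\<^bsub>E b\<^esub> c (\<Delta> p)"
    using *(4) by simp
  ultimately show ?case
    using module_homs_pointwise_smult[OF F E *(2) r] module_homs_pointwise_smult[OF F E w r]
    unfolding zigzag.simps by (intro conjI exI[of _ "\<lambda>p. r \<odot>\<^bsub>E b\<^esub> c p"] exI[of _ "\<lambda>p. r \<odot>\<^bsub>E (Suc b)\<^esub> v p"])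
qed

text \<open>Each further corner is the image under one differential of an element whose image under the other
  differential is the preceding corner.\<close>

lemma zigzag_cocycle:
  assumes f: "f \<in> module_homs R A (E n)" "\<And>x. x \<in> carrier A \<Longrightarrow> d n (f x) = \<zero>\<^bsub>E (Suc n)\<^esub>"
  shows "zigzag R A E d k b f w \<Longrightarrow> n = k + b \<Longrightarrow>
    (\<forall>p\<in>carrier (F k). d b (w p) = \<zero>\<^bsub>E (Suc b)\<^esub>) \<and> (\<forall>p\<in>carrier (F (Suc k)). w (\<Delta> p) = \<zero>\<^bsub>E b\<^esub>)"
proof (induction k arbitrary: b w)
  case 0
  have "aug (\<Delta> p) = \<zero>\<^bsub>A\<^esub>" if "p \<in> carrier (F (Suc 0))" for p
    by (rule res_augmentation_differential[OF A that])
  then show ?case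
    using 0 f module_homs_closed[OF res_augmentation_hom[OF A]] module_homs_zero[OF A E f(1)]
      res_differential_closed[OF A] by simp
next
  case (Suc k)
  obtain c v where *: "zigzag R A E d k (Suc b) f v" "c \<in> module_homs R (F k) (E b)"
    "\<forall>p\<in>carrier (F k). d b (c p) = v p" "\<forall>p\<in>carrier (F (Suc k)). w p = c (\<Delta> p)"
    using Suc.prems(1) by auto
  have v: "\<forall>p\<in>carrier (F (Suc k)). v (\<Delta> p) = \<zero>\<^bsub>E (Suc b)\<^esub>"
    using Suc.IH[OF *(1)] Suc.prems(2) by simp
  show ?case
    using *(3,4) v res_differential_closed[OF A] res_differential_differential[OF A] module_homs_zero[OF F E *(2)] by simp
qed

text \<open>\<open>E' b \<rightarrow> E b\<close> is the map that precedes $E^b \to E^{b+1}$ in the augmented resolution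
  $N \to E^0 \to E^1 \to \cdots$. A staircase that ends over $E^0$ and begins over $E^q$ needs
  exactness up to $E^q$ and injectivity below it.\<close>

context
  fixes E' :: "nat \<Rightarrow> ('a, 'e) module" and d' :: "nat \<Rightarrow> 'e \<Rightarrow> 'e" and q :: nat
  assumes E': "\<And>i. module R (E' i)" "\<And>i. E' (Suc i) = E i"
    and d': "\<And>i. d' i \<in> module_homs R (E' i) (E i)" "\<And>i. d' (Suc i) = d i"
    and exact: "\<And>i. i \<le> q \<Longrightarrow> {x \<in> carrier (E i). d i x = \<zero>\<^bsub>E (Suc i)\<^esub>} = d' i ` carrier (E' i)"
    and inj: "\<And>i. i < q \<Longrightarrow> injective_module R (E i)"
begin

text \<open>The staircase is descended from \<open>f\<close>: the terms of the free resolution are projective and \<open>E\<close> is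
  exact.\<close>

lemma zigzag_total:
  assumes f: "f \<in> module_homs R A (E q)" "\<And>x. x \<in> carrier A \<Longrightarrow> d q (f x) = \<zero>\<^bsub>E (Suc q)\<^esub>"
  shows "q = k + b \<Longrightarrow> \<exists>w. zigzag R A E d k b f w"
proof (induction k arbitrary: b)
  case 0
  then show ?case
    using module_homs_comp'[OF res_augmentation_hom[OF A] f(1)] by (intro exI[of _ "\<lambda>p. f (aug p)"]) simp
next
  case (Suc k)
  then obtain v where v: "zigzag R A E d k (Suc b) f v" by (metis add_Suc_shift)
  note vh = zigzag_hom[OF v]
  have v0: "\<forall>p\<in>carrier (F k). d (Suc b) (v p) = \<zero>\<^bsub>E (Suc (Suc b))\<^esub>"
    using zigzag_cocycle[OF f v] Suc.prems by simp
  have "v p \<in> d b ` carrier (E b)" if p: "p \<in> carrier (F k)" for p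
  proof -
    have "v p \<in> {x \<in> carrier (E (Suc b)). d (Suc b) x = \<zero>\<^bsub>E (Suc (Suc b))\<^esub>}"
      using v0 p module_homs_closed[OF vh p] by simp
    then show ?thesis using exact[of "Suc b"] Suc.prems by (simp add: E' d')
  qed
  then obtain c where c: "c \<in> module_homs R (F k) (E b)" "\<And>p. p \<in> carrier (F k) \<Longrightarrow> d b (c p) = v p"
    using res_lift[OF A E E d vh] by blast
  show ?case
    using v c hom_res_differential[OF A c(1)] by (intro exI[of _ "\<lambda>p. c (\<Delta> p)"]) auto
qed

text \<open>The staircase is ascended from \<open>w\<close>: the modules \<open>E b\<close> are injective and the free resolution is
  exact.\<close>

lemma zigzag_surj:
  "w \<in> module_homs R (F k) (E b) \<Longrightarrow> \<forall>p\<in>carrier (F k). d b (w p) = \<zero>\<^bsub>E (Suc b)\<^esub> \<Longrightarrow>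
    \<forall>p\<in>carrier (F (Suc k)). w (\<Delta> p) = \<zero>\<^bsub>E b\<^esub> \<Longrightarrow> q = k + b \<Longrightarrow>
    \<exists>f\<in>module_homs R A (E q). (\<forall>x\<in>carrier A. d q (f x) = \<zero>\<^bsub>E (Suc q)\<^esub>) \<and> zigzag R A E d k b f w"
proof (induction k arbitrary: b w)
  case 0
  note w = 0(1)
  have "w p = \<zero>\<^bsub>E b\<^esub>" if "p \<in> carrier (F 0)" "aug p = \<zero>\<^bsub>A\<^esub>" for p
    using res_kernel(1)[OF A that(1)] that(2) 0(3) by auto
  then obtain f where f: "f \<in> module_homs R A (E b)" "\<And>p. p \<in> carrier (F 0) \<Longrightarrow> f (aug p) = w p"
    using surjective_factor[OF F A E res_augmentation_hom[OF A] _ w] res_augmentation_surj[OF A] by blast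
  have "d b (f x) = \<zero>\<^bsub>E (Suc b)\<^esub>" if x: "x \<in> carrier A" for x
  proof -
    obtain p where "p \<in> carrier (F 0)" "x = aug p" using x res_augmentation_surj[OF A] by blast
    then show ?thesis using f(2) 0(2) by simp
  qed
  then show ?case using f w 0(4) by (intro bexI[of _ f]) auto
next
  case (Suc k)
  note w = Suc.prems(1)
  have b: "b < q" using Suc.prems(4) by simp
  have ker: "w p = \<zero>\<^bsub>E b\<^esub>" if "p \<in> carrier (F (Suc k))" "\<Delta> p = \<zero>\<^bsub>F k\<^esub>" for p
    using res_kernel(2)[OF A that(1)] that(2) Suc.prems(3) by auto
  obtain c where c: "c \<in> module_homs R (F k) (E b)" "\<And>p. p \<in> carrier (F (Suc k)) \<Longrightarrow> c (\<Delta> p) = w p"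
    using injective_factor[OF F F inj[OF b] res_differential_hom[OF A] w ker] by blast
  note v = module_homs_comp'[OF c(1) d]
  have "d (Suc b) (d b (c p)) = \<zero>\<^bsub>E (Suc (Suc b))\<^esub>" if "p \<in> carrier (F k)" for p
  proof -
    have "d b (c p) \<in> d' (Suc b) ` carrier (E' (Suc b))"
      unfolding E'(2) d'(2) using module_homs_closed[OF c(1) that] by (rule imageI)
    then show ?thesis using exact[of "Suc b"] b by auto
  qed
  then obtain f where f: "f \<in> module_homs R A (E q)" "\<forall>x\<in>carrier A. d q (f x) = \<zero>\<^bsub>E (Suc q)\<^esub>"
    "zigzag R A E d k (Suc b) f (\<lambda>p. d b (c p))"
    using Suc.IH[OF v] c(2) res_differential_closed[OF A] Suc.prems(2,4) by auto
  then show ?case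
    unfolding zigzag.simps using c w by (intro bexI[OF _ f(1)] conjI exI[of _ c] exI[of _ "\<lambda>p. d b (c p)"]) auto
qed

text \<open>One step of the staircase respects the property of being a boundary. Here \<open>u\<close> stands for the
  augmentation or for a differential of the resolution.\<close>

private lemma zigzag_boundary_step:
  fixes Q :: "('a, 's) module"
  assumes b: "b < q" and Q: "module R Q" and u: "u \<in> module_homs R (F k) Q"
    and ker: "\<And>p. p \<in> carrier (F k) \<Longrightarrow> u p = \<zero>\<^bsub>Q\<^esub> \<longleftrightarrow> p \<in> \<Delta> ` carrier (F (Suc k))"
    and c: "c \<in> module_homs R (F k) (E b)"
  shows "(\<exists>y\<in>module_homs R Q (E b). \<forall>p\<in>carrier (F k). d b (c p) = d b (y (u p))) \<longleftrightarrow>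
    (\<exists>y\<in>module_homs R (F k) (E' b). \<forall>p\<in>carrier (F (Suc k)). c (\<Delta> p) = d' b (y (\<Delta> p)))"
proof
  interpret Eb: module R "E b" by (rule E)
  interpret Es: module R "E (Suc b)" by (rule E)
  note cc = module_homs_closed[OF c] and uc = module_homs_closed[OF u]
  {
    assume "\<exists>y\<in>module_homs R Q (E b). \<forall>p\<in>carrier (F k). d b (c p) = d b (y (u p))"
    then obtain y where y: "y \<in> module_homs R Q (E b)" "\<And>p. p \<in> carrier (F k) \<Longrightarrow> d b (c p) = d b (y (u p))"
      by blast
    note yc = module_homs_closed[OF y(1)]
    note h = module_homs_pointwise_diff[OF F E c module_homs_comp'[OF u y(1)]]
    have "c p \<ominus>\<^bsub>E b\<^esub> y (u p) \<in> d' b ` carrier (E' b)" if p: "p \<in> carrier (F k)" for p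
    proof -
      have "d b (c p \<ominus>\<^bsub>E b\<^esub> y (u p)) = \<zero>\<^bsub>E (Suc b)\<^esub>"
        using module_homs_minus[OF E E d cc[OF p] yc[OF uc[OF p]]] y(2)[OF p] module_homs_closed[OF d yc[OF uc[OF p]]]
        by (simp add: Es.M.minus_eq_zero_iff)
      moreover have "c p \<ominus>\<^bsub>E b\<^esub> y (u p) \<in> carrier (E b)" using cc[OF p] yc[OF uc[OF p]] by simp
      ultimately show ?thesis using exact[of b] b by auto
    qed
    then obtain z where z: "z \<in> module_homs R (F k) (E' b)" "\<And>p. p \<in> carrier (F k) \<Longrightarrow> d' b (z p) = c p \<ominus>\<^bsub>E b\<^esub> y (u p)"
      using res_lift[OF A E'(1) E d'(1) h] by blast
    have "c (\<Delta> p) = d' b (z (\<Delta> p))" if p: "p \<in> carrier (F (Suc k))" for p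
    proof -
      note pc = res_differential_closed[OF A p]
      have "u (\<Delta> p) = \<zero>\<^bsub>Q\<^esub>" using ker[OF pc] p by blast
      then show ?thesis using z(2)[OF pc] module_homs_zero[OF Q E y(1)] cc[OF pc] by (simp add: Eb.M.minus_eq)
    qed
    then show "\<exists>y\<in>module_homs R (F k) (E' b). \<forall>p\<in>carrier (F (Suc k)). c (\<Delta> p) = d' b (y (\<Delta> p))" using z(1) by blast
  next
    assume "\<exists>y\<in>module_homs R (F k) (E' b). \<forall>p\<in>carrier (F (Suc k)). c (\<Delta> p) = d' b (y (\<Delta> p))"
    then obtain z where z: "z \<in> module_homs R (F k) (E' b)" "\<And>p. p \<in> carrier (F (Suc k)) \<Longrightarrow> c (\<Delta> p) = d' b (z (\<Delta> p))"
      by blast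
    note dz = module_homs_comp'[OF z(1) d'(1)]
    note dzc = module_homs_closed[OF dz]
    note h = module_homs_pointwise_diff[OF F E c dz]
    have "c p \<ominus>\<^bsub>E b\<^esub> d' b (z p) = \<zero>\<^bsub>E b\<^esub>" if p: "p \<in> carrier (F k)" "u p = \<zero>\<^bsub>Q\<^esub>" for p
    proof -
      obtain p' where "p' \<in> carrier (F (Suc k))" "p = \<Delta> p'" using ker[OF p(1)] p(2) by blast
      then show ?thesis using z(2) dzc[OF p(1)] by (simp add: Eb.M.minus_eq_zero_iff)
    qed
    then obtain y where y: "y \<in> module_homs R Q (E b)" "\<And>p. p \<in> carrier (F k) \<Longrightarrow> y (u p) = c p \<ominus>\<^bsub>E b\<^esub> d' b (z p)"
      using injective_factor[OF F Q inj[OF b] u h] by blast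
    have "d b (c p) = d b (y (u p))" if p: "p \<in> carrier (F k)" for p
    proof -
      have "d' b (z p) \<in> d' b ` carrier (E' b)" using module_homs_closed[OF z(1) p] by (rule imageI)
      then have "d b (d' b (z p)) = \<zero>\<^bsub>E (Suc b)\<^esub>" using exact[of b] b by auto
      then show ?thesis
        using module_homs_minus[OF E E d cc[OF p] dzc[OF p]] y(2)[OF p] module_homs_closed[OF d cc[OF p]]
        by (simp add: Es.M.minus_eq)
    qed
    then show "\<exists>y\<in>module_homs R Q (E b). \<forall>p\<in>carrier (F k). d b (c p) = d b (y (u p))" using y(1) by blast
  }
qed

text \<open>By induction along the staircase. The element \<open>y\<close> on the right-hand side lies diagonally below the
  corner of \<open>w\<close>, and the composition of both differentials maps it to \<open>w\<close>.\<close>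

lemma zigzag_boundary:
  assumes f: "f \<in> module_homs R A (E q)"
  shows "zigzag R A E d k b f w \<Longrightarrow> q = k + b \<Longrightarrow>
    (\<exists>y\<in>module_homs R A (E' q). \<forall>x\<in>carrier A. f x = d' q (y x)) \<longleftrightarrow>
    (case k of 0 \<Rightarrow> \<exists>y\<in>module_homs R A (E' b). \<forall>p\<in>carrier (F 0). w p = d' b (y (aug p))
     | Suc i \<Rightarrow> \<exists>y\<in>module_homs R (F i) (E' b). \<forall>p\<in>carrier (F (Suc i)). w p = d' b (y (\<Delta> p)))"
proof (induction k arbitrary: b w)
  case 0
  have "(\<forall>x\<in>carrier A. f x = d' q (y x)) \<longleftrightarrow> (\<forall>p\<in>carrier (F 0). f (aug p) = d' q (y (aug p)))" for y
    using res_augmentation_surj[OF A, symmetric] by simp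
  then show ?case using 0 by simp
next
  case (Suc k)
  obtain c v where *: "zigzag R A E d k (Suc b) f v" "c \<in> module_homs R (F k) (E b)"
    "\<And>p. p \<in> carrier (F k) \<Longrightarrow> d b (c p) = v p" "\<And>p. p \<in> carrier (F (Suc k)) \<Longrightarrow> w p = c (\<Delta> p)"
    using Suc.prems(1) by auto
  have b: "b < q" using Suc.prems(2) by simp
  have "(\<exists>y\<in>module_homs R A (E' q). \<forall>x\<in>carrier A. f x = d' q (y x)) \<longleftrightarrow>
    (case k of 0 \<Rightarrow> \<exists>y\<in>module_homs R A (E b). \<forall>p\<in>carrier (F 0). v p = d b (y (aug p))
     | Suc i \<Rightarrow> \<exists>y\<in>module_homs R (F i) (E b). \<forall>p\<in>carrier (F (Suc i)). v p = d b (y (\<Delta> p)))"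
    by (rule Suc.IH[OF *(1), unfolded E'(2) d'(2)]) (use Suc.prems(2) in simp)
  also have "\<dots> \<longleftrightarrow> (\<exists>y\<in>module_homs R (F k) (E' b). \<forall>p\<in>carrier (F (Suc k)). c (\<Delta> p) = d' b (y (\<Delta> p)))"
  proof (cases k)
    case 0
    then show ?thesis
      using zigzag_boundary_step[OF b A, of aug 0 c] res_augmentation_hom[OF A] res_kernel(1)[OF A] *(2,3) by simp
  next
    case (Suc i)
    then show ?thesis
      using zigzag_boundary_step[OF b F, of \<Delta> "Suc i" i c] res_differential_hom[OF A] res_kernel(2)[OF A] *(2,3) by simp
  qed
  finally show ?case using *(4) by simp
qed

end

end

end

end

section \<open>Homomorphisms into direct limits\<close>

context cring
begin

text \<open>Suppose that compatible linear relations \<open>Rel n\<close> identify larger and larger parts of \<open>X\<close> with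
  the modules \<open>G n\<close>, up to elements of \<open>B\<close> on the side of \<open>X\<close>. Then the direct limit is $X/B$.\<close>

context
  fixes G :: "nat \<Rightarrow> ('a, 'g) module" and \<phi> :: "nat \<Rightarrow> 'g \<Rightarrow> 'g" and X :: "('a, 'u) module"
    and Rel :: "nat \<Rightarrow> ('u \<times> 'g) set" and B :: "'u set"
  assumes G: "\<And>n. module R (G n)" and \<phi>: "\<And>n. \<phi> n \<in> module_homs R (G n) (G (Suc n))"
    and X: "module R X" and lin: "\<And>n. linear_relation R X (G n) (Rel n)"
    and step: "\<And>n x g. (x, g) \<in> Rel n \<Longrightarrow> (x, \<phi> n g) \<in> Rel (Suc n)"
    and total: "\<And>x. x \<in> carrier X \<Longrightarrow> \<exists>n g. (x, g) \<in> Rel n"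
    and surj: "\<And>n g. g \<in> carrier (G n) \<Longrightarrow> \<exists>x. (x, g) \<in> Rel n"
    and single: "\<And>n g. (\<zero>\<^bsub>X\<^esub>, g) \<in> Rel n \<Longrightarrow> g = \<zero>\<^bsub>G n\<^esub>"
    and B1: "\<And>n x. (x, \<zero>\<^bsub>G n\<^esub>) \<in> Rel n \<Longrightarrow> x \<in> B" and B2: "\<And>x. x \<in> B \<Longrightarrow> \<exists>n. (x, \<zero>\<^bsub>G n\<^esub>) \<in> Rel n"
begin

private abbreviation "L \<equiv> direct_limit G \<phi>"
private abbreviation "cls \<equiv> limit_class G \<phi>"

private lemmas limit_class_eq' = limit_class_eq[where R = R and G = G and \<phi> = \<phi>, OF is_cring G \<phi>]
  and transition_hom' = transition_hom[where R = R and G = G and \<phi> = \<phi>, OF is_cring G \<phi>]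
  and limit_class_transition' = limit_class_transition[where R = R and G = G and \<phi> = \<phi>, OF is_cring G \<phi>]
  and direct_limit_smult' = direct_limit_smult[where R = R and G = G and \<phi> = \<phi>, OF is_cring G \<phi>]
  and direct_limit_add' = direct_limit_add[where R = R and G = G and \<phi> = \<phi>, OF is_cring G \<phi>]
  and limit_class_self' = limit_class_self[where R = R and G = G and \<phi> = \<phi>, OF is_cring G \<phi>]

private lemma Rel_transition: "n \<le> k \<Longrightarrow> (x, g) \<in> Rel n \<Longrightarrow> (x, transition \<phi> n k g) \<in> Rel k"
proof (induction k rule: dec_induct)
  case base
  then show ?case by (simp add: transition_def)
next
  case (step k)
  then show ?case using \<open>\<And>n x g. (x, g) \<in> Rel n \<Longrightarrow> (x, \<phi> n g) \<in> Rel (Suc n)\<close>[of x _ k]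
    by (simp add: transition_def)
qed

private lemma Rel_class_eq:
  assumes "(x, g) \<in> Rel n" "(x, h) \<in> Rel m"
  shows "cls n g = cls m h"
proof -
  let ?k = "max n m"
  interpret Gk: module R "G ?k" by (rule G)
  interpret X: module R X by (rule X)
  let ?g = "transition \<phi> n ?k g" and ?h = "transition \<phi> m ?k h"
  have g: "(x, ?g) \<in> Rel ?k" and h: "(x, ?h) \<in> Rel ?k" using Rel_transition assms by simp_all
  note D = linear_relationD[OF X G lin]
  have "(\<zero>\<^bsub>X\<^esub>, ?g \<ominus>\<^bsub>G ?k\<^esub> ?h) \<in> Rel ?k"
    using D(6)[OF g h] D(1)[OF g] X.M.minus_eq_zero_iff[of x x] by simp
  then have "?g = ?h" using single D(2)[OF g] D(2)[OF h] Gk.M.minus_eq_zero_iff by blast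
  then show ?thesis by (intro limit_class_eq'[of n ?k m]) auto
qed

private lemma class_zero: "cls n \<zero>\<^bsub>G n\<^esub> = \<zero>\<^bsub>L\<^esub>"
proof -
  have "transition \<phi> 0 n \<zero>\<^bsub>G 0\<^esub> = \<zero>\<^bsub>G n\<^esub>"
    by (rule module_homs_zero[OF G G transition_hom']) simp
  then show ?thesis
    using limit_class_transition'[of 0 n "\<zero>\<^bsub>G 0\<^esub>"] by (simp add: direct_limit_def)
qed

lemma direct_limit_presentation:
  obtains \<psi> where "\<psi> \<in> module_homs R X L" "\<psi> ` carrier X = carrier L"
    "\<And>x. x \<in> carrier X \<Longrightarrow> \<psi> x = \<zero>\<^bsub>L\<^esub> \<longleftrightarrow> x \<in> B"
proof -
  define \<psi> where "\<psi> x = (SOME c. \<exists>n g. (x, g) \<in> Rel n \<and> c = cls n g)" for x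
  have \<psi>: "\<psi> x = cls n g" if xg: "(x, g) \<in> Rel n" for x g n
    unfolding \<psi>_def
  proof (rule some_equality)
    show "\<exists>n' g'. (x, g') \<in> Rel n' \<and> cls n g = cls n' g'" using xg by blast
    show "c = cls n g" if "\<exists>n g. (x, g) \<in> Rel n \<and> c = cls n g" for c
      using that Rel_class_eq[OF _ xg] by blast
  qed
  note D = linear_relationD[OF X G lin]
  have car: "carrier L = {cls n x | n x. x \<in> carrier (G n)}" by (simp add: direct_limit_def)
  have hom: "\<psi> \<in> module_homs R X L"
  proof (rule module_homsI)
    fix x assume "x \<in> carrier X"
    then obtain n g where g: "(x, g) \<in> Rel n" using total by blast
    show "\<psi> x \<in> carrier L" unfolding \<psi>[OF g] car using D(2)[OF g] by blast
    show "\<psi> (r \<odot>\<^bsub>X\<^esub> x) = r \<odot>\<^bsub>L\<^esub> \<psi> x" if r: "r \<in> carrier R" for r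
      using \<psi>[OF D(5)[OF r g]] \<psi>[OF g] direct_limit_smult'[OF r D(2)[OF g]] by simp
    fix y assume "y \<in> carrier X"
    then obtain m h where h: "(y, h) \<in> Rel m" using total by blast
    let ?k = "max n m"
    have g': "(x, transition \<phi> n ?k g) \<in> Rel ?k" and h': "(y, transition \<phi> m ?k h) \<in> Rel ?k"
      using Rel_transition g h by simp_all
    show "\<psi> (x \<oplus>\<^bsub>X\<^esub> y) = \<psi> x \<oplus>\<^bsub>L\<^esub> \<psi> y"
      using \<psi>[OF D(4)[OF g' h']] \<psi>[OF g'] \<psi>[OF h'] direct_limit_add'[OF D(2)[OF g'] D(2)[OF h']] by simp
  qed
  moreover have "\<psi> ` carrier X = carrier L"
  proof
    show "\<psi> ` carrier X \<subseteq> carrier L" using module_homs_closed[OF hom] by blast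
    show "carrier L \<subseteq> \<psi> ` carrier X"
    proof
      fix c assume "c \<in> carrier L"
      then obtain n g where g: "g \<in> carrier (G n)" "c = cls n g" unfolding car by blast
      then obtain x where x: "(x, g) \<in> Rel n" using surj by blast
      then show "c \<in> \<psi> ` carrier X" using \<psi>[OF x] g(2) D(1)[OF x] by blast
    qed
  qed
  moreover have "\<psi> x = \<zero>\<^bsub>L\<^esub> \<longleftrightarrow> x \<in> B" if x: "x \<in> carrier X" for x
  proof
    assume "x \<in> B"
    then obtain n where "(x, \<zero>\<^bsub>G n\<^esub>) \<in> Rel n" using B2 by blast
    then show "\<psi> x = \<zero>\<^bsub>L\<^esub>" using \<psi> class_zero by simp
  next
    assume z: "\<psi> x = \<zero>\<^bsub>L\<^esub>"
    obtain n g where g: "(x, g) \<in> Rel n" using total[OF x] by blast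
    have "(n, g) \<in> cls n g" using limit_class_self'[OF D(2)[OF g]] .
    also have "cls n g = cls n \<zero>\<^bsub>G n\<^esub>" using \<psi>[OF g] z class_zero by simp
    finally obtain k where k: "k \<ge> n" "transition \<phi> n k g = transition \<phi> n k \<zero>\<^bsub>G n\<^esub>"
      by (auto simp: limit_class_def)
    then have "transition \<phi> n k g = \<zero>\<^bsub>G k\<^esub>"
      using module_homs_zero[OF G G transition_hom'[OF k(1)]] by simp
    then show "x \<in> B" using Rel_transition[OF k(1) g] B1 by simp
  qed
  ultimately show ?thesis by (rule that)
qed

end

end

section \<open>Functoriality of Ext\<close>

definition ext_class ::
    "('r, 'x) ring_scheme \<Rightarrow> nat \<Rightarrow> ('r, 'a) module \<Rightarrow> ('r, 'b) module \<Rightarrow>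
      ((('r, 'a) resgen \<Rightarrow> 'r) \<Rightarrow> 'b) \<Rightarrow> ((('r, 'a) resgen \<Rightarrow> 'r) \<Rightarrow> 'b) set"
  where "ext_class R n A B h = ext_coboundaries R n A B +>\<^bsub>ext_cochains R n A B\<^esub> h"

lemma coset_restrict: "U +>\<^bsub>W\<lparr>carrier := Z\<rparr>\<^esub> x = U +>\<^bsub>W\<^esub> x"
  by (simp add: a_r_coset_def r_coset_def)

context cring
begin

context
  fixes A :: "('a, 'm) module" and B :: "('a, 'n) module"
  assumes A: "module R A" and B: "module R B"
begin

private abbreviation "C n \<equiv> ext_cochains R n A B"
private abbreviation "CZ n \<equiv> (ext_cochains R n A B)\<lparr>carrier := ext_cocycles R n A B\<rparr>"

lemma module_ext_cocycles: "module R (CZ n)"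
  by (rule submodule.submodule_is_module[OF submodule_ext_cocycles[OF A B] module_ext_cochains[OF A B]])

private lemma cob_sub: "submodule (ext_coboundaries R n A B) R (CZ n)"
  by (rule submodule_restrict[OF module_ext_cochains[OF A B] submodule_ext_cocycles[OF A B]
        submodule_ext_coboundaries[OF A B] ext_coboundaries_subset[OF A B]])

lemma ext_class_hom: "ext_class R n A B \<in> module_homs R (CZ n) (Ext R n A B)"
  using quotient_projection_hom[OF module_ext_cocycles cob_sub, of n]
  by (simp add: Ext_def coset_restrict ext_class_def[abs_def])

lemma carrier_Ext: "carrier (Ext R n A B) = ext_class R n A B ` ext_cocycles R n A B"
  by (auto simp: Ext_def quotient_module_simps coset_restrict ext_class_def)

lemma ext_class_zero_iff:
  "h \<in> ext_cocycles R n A B \<Longrightarrow> ext_class R n A B h = \<zero>\<^bsub>Ext R n A B\<^esub> \<longleftrightarrow> h \<in> ext_coboundaries R n A B"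
  using coset_eq_self_iff[OF module_ext_cocycles cob_sub, of h n]
  by (simp add: Ext_def quotient_module_simps coset_restrict ext_class_def)

end

context
  fixes A :: "('a, 'm) module" and B :: "('a, 'n) module" and A' :: "('a, 'p) module" and f :: "'m \<Rightarrow> 'p"
  assumes A: "module R A" and B: "module R B" and A': "module R A'" and f: "f \<in> module_homs R A A'"
begin

private abbreviation "pull n h \<equiv> (\<lambda>x\<in>carrier (res_module R A n). h (res_map R f x))"

lemma ext_pullback_hom: "(\<lambda>h. pull n h) \<in> module_homs R (ext_cochains R n A' B) (ext_cochains R n A B)"
proof (rule module_homsI)
  note fc = module_homs_closed[OF res_map_hom[OF A A' f]]
  fix h assume h: "h \<in> carrier (ext_cochains R n A' B)"
  then have h': "h \<in> module_homs R (res_module R A' n) B" by (simp add: ext_cochains_def hom_module_simps)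
  have "pull n h \<in> module_homs R (res_module R A n) B"
    by (rule module_homs_cong[OF module_res_module[OF A] module_homs_comp'[OF res_map_hom[OF A A' f] h']]) simp
  then show "pull n h \<in> carrier (ext_cochains R n A B)" by (simp add: ext_cochains_def hom_module_simps)
  show "pull n (r \<odot>\<^bsub>ext_cochains R n A' B\<^esub> h) = r \<odot>\<^bsub>ext_cochains R n A B\<^esub> pull n h" for r
    using fc by (auto simp: ext_cochains_def hom_module_simps)
  show "pull n (h \<oplus>\<^bsub>ext_cochains R n A' B\<^esub> g) = pull n h \<oplus>\<^bsub>ext_cochains R n A B\<^esub> pull n g" for g
    using fc by (auto simp: ext_cochains_def hom_module_simps)
qed

lemma ext_pullback_cocycle:
  assumes h: "h \<in> ext_cocycles R n A' B"
  shows "pull n h \<in> ext_cocycles R n A B"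
proof (rule restrict_cocycle[OF A B])
  have h': "h \<in> module_homs R (res_module R A' n) B"
    "\<And>x. x \<in> carrier (res_module R A' (Suc n)) \<Longrightarrow> h (res_differential R x) = \<zero>\<^bsub>B\<^esub>"
    using h by (auto simp: ext_cocycles_iff[OF A' B])
  show "(\<lambda>x. h (res_map R f x)) \<in> module_homs R (res_module R A n) B"
    by (rule module_homs_comp'[OF res_map_hom[OF A A' f] h'(1)])
  show "h (res_map R f (res_differential R x)) = \<zero>\<^bsub>B\<^esub>" if "x \<in> carrier (res_module R A (Suc n))" for x
    using h'(2)[OF module_homs_closed[OF res_map_hom[OF A A' f] that]] res_map_differential[OF A A' f that] by simp
qed

lemma ext_pullback_coboundary:
  assumes h: "h \<in> ext_coboundaries R n A' B"
  shows "pull n h \<in> ext_coboundaries R n A B"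
proof (cases n)
  case 0
  then show ?thesis
    using h module_homs_closed[OF res_map_hom[OF A A' f, of 0]] unfolding 0 ext_coboundaries_0_iff[OF A] ext_coboundaries_0_iff[OF A']
    by simp
next
  case (Suc m)
  obtain k where k: "k \<in> module_homs R (res_module R A' m) B"
    "\<And>x. x \<in> carrier (res_module R A' (Suc m)) \<Longrightarrow> h x = k (res_differential R x)"
    using h unfolding Suc ext_coboundaries_Suc_iff[OF A' B] by blast
  have "\<forall>x\<in>carrier (res_module R A (Suc m)). h (res_map R f x) = k (res_map R f (res_differential R x))"
    using k(2)[OF module_homs_closed[OF res_map_hom[OF A A' f]]] res_map_differential[OF A A' f] by simp
  then show ?thesis unfolding Suc ext_coboundaries_Suc_iff[OF A B]
    using module_homs_comp'[OF res_map_hom[OF A A' f] k(1)] by auto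
qed

text \<open>The value of the union in the definition is constant, because pulling back preserves coboundaries.\<close>

lemma Ext_map_class:
  assumes h: "h \<in> ext_cocycles R n A' B"
  shows "Ext_map R n A f B (ext_class R n A' B h) = ext_class R n A B (pull n h)"
proof -
  note M = module_ext_cochains[OF A B, of n] and M' = module_ext_cochains[OF A' B, of n]
  interpret M: module R "ext_cochains R n A B" by (rule M)
  interpret M': module R "ext_cochains R n A' B" by (rule M')
  note S = submodule_ext_coboundaries[OF A B, of n] and S' = submodule_ext_coboundaries[OF A' B, of n]
  have hc: "h \<in> carrier (ext_cochains R n A' B)" using M'.submoduleD(2)[OF submodule_ext_cocycles[OF A' B] h] .
  note pc = module_homs_closed[OF ext_pullback_hom]
  have const: "ext_class R n A B (pull n g) = ext_class R n A B (pull n h)" if "g \<in> ext_class R n A' B h" for g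
  proof -
    have g: "g \<in> carrier (ext_cochains R n A' B)" "g \<ominus>\<^bsub>ext_cochains R n A' B\<^esub> h \<in> ext_coboundaries R n A' B"
      using that mem_coset_iff[OF M' S' hc] by (auto simp: ext_class_def)
    have "pull n g \<ominus>\<^bsub>ext_cochains R n A B\<^esub> pull n h \<in> ext_coboundaries R n A B"
      using ext_pullback_coboundary[OF g(2)] module_homs_minus[OF M' M ext_pullback_hom g(1) hc] by simp
    then show ?thesis using coset_eq_iff[OF M S pc[OF g(1)] pc[OF hc]] by (simp add: ext_class_def)
  qed
  have mem: "h \<in> ext_class R n A' B h"
    using mem_coset_iff[OF M' S' hc, of h] hc M'.M.minus_eq_zero_iff[OF hc hc] M'.submoduleD(3)[OF S']
    by (simp add: ext_class_def)
  have "Ext_map R n A f B (ext_class R n A' B h) = (\<Union>g\<in>ext_class R n A' B h. ext_class R n A B (pull n g))"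
    unfolding Ext_map_def ext_class_def[of R n A B] ..
  also have "\<dots> = ext_class R n A B (pull n h)"
    by (rule SUP_eq_const) (use mem const in blast)+
  finally show ?thesis .
qed

lemma Ext_map_hom: "Ext_map R n A f B \<in> module_homs R (Ext R n A' B) (Ext R n A B)"
proof (rule module_homsI)
  note M' = module_ext_cochains[OF A' B, of n] and M = module_ext_cochains[OF A B, of n]
  interpret M': module R "ext_cochains R n A' B" by (rule M')
  note Z' = M'.submoduleD[OF submodule_ext_cocycles[OF A' B]]
  note ch = ext_class_hom[OF A' B, of n] and ca = carrier_Ext[OF A' B, of n]
  fix x assume "x \<in> carrier (Ext R n A' B)"
  then obtain h where h: "h \<in> ext_cocycles R n A' B" "x = ext_class R n A' B h" unfolding ca by blast
  note ph = ext_pullback_cocycle[OF h(1)]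
  show "Ext_map R n A f B x \<in> carrier (Ext R n A B)"
    unfolding h(2) Ext_map_class[OF h(1)] carrier_Ext[OF A B] using ph by (rule imageI)
  show "Ext_map R n A f B (r \<odot>\<^bsub>Ext R n A' B\<^esub> x) = r \<odot>\<^bsub>Ext R n A B\<^esub> Ext_map R n A f B x" if r: "r \<in> carrier R" for r
    using module_homs_smult[OF ch r, of h] h Ext_map_class[OF h(1)] Ext_map_class[OF Z'(5)[OF r h(1)]]
      module_homs_smult[OF ext_pullback_hom r Z'(2)[OF h(1)]] module_homs_smult[OF ext_class_hom[OF A B] r, of "pull n h"] ph
    by simp
  fix y assume "y \<in> carrier (Ext R n A' B)"
  then obtain g where g: "g \<in> ext_cocycles R n A' B" "y = ext_class R n A' B g" unfolding ca by blast
  show "Ext_map R n A f B (x \<oplus>\<^bsub>Ext R n A' B\<^esub> y) = Ext_map R n A f B x \<oplus>\<^bsub>Ext R n A B\<^esub> Ext_map R n A f B y"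
    using module_homs_add[OF ch, of h g] h g Ext_map_class[OF h(1)] Ext_map_class[OF g(1)] Ext_map_class[OF Z'(4)[OF h(1) g(1)]]
      module_homs_add[OF ext_pullback_hom Z'(2)[OF h(1)] Z'(2)[OF g(1)]] module_homs_add[OF ext_class_hom[OF A B, of n], of "pull n h" "pull n g"]
      ph ext_pullback_cocycle[OF g(1)]
    by simp
qed

end

end

section \<open>Powers of an ideal\<close>

context cring
begin

lemma submodule_ideal_smult:
  assumes W: "module R W" and J: "ideal J R"
  shows "submodule (ideal_smult W J) R W"
proof -
  interpret W: module R W by (rule W)
  interpret J: ideal J R by (rule J)
  show ?thesis
  proof (rule W.submoduleI')
    show "ideal_smult W J \<subseteq> carrier W"
    proof
      fix x assume "x \<in> ideal_smult W J"
      then show "x \<in> carrier W" by induction auto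
    qed
    show "\<zero>\<^bsub>W\<^esub> \<in> ideal_smult W J" using ideal_smult.smult[of \<zero> J "\<zero>\<^bsub>W\<^esub>" W] by simp
    show "x \<oplus>\<^bsub>W\<^esub> y \<in> ideal_smult W J" if "x \<in> ideal_smult W J" "y \<in> ideal_smult W J" for x y
      using that by (rule ideal_smult.sum)
    fix r x assume r: "r \<in> carrier R" and "x \<in> ideal_smult W J"
    from this(2) have "x \<in> carrier W \<and> r \<odot>\<^bsub>W\<^esub> x \<in> ideal_smult W J"
    proof induction
      case (smult s x)
      then have s: "s \<in> carrier R" by auto
      have "(r \<otimes> s) \<odot>\<^bsub>W\<^esub> x \<in> ideal_smult W J"
        by (rule ideal_smult.smult[OF J.I_l_closed[OF smult(1) r] smult(2)])
      then show ?case using s smult r by (simp add: W.smult_assoc1)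
    next
      case (sum x y)
      then show ?case using ideal_smult.sum[of "r \<odot>\<^bsub>W\<^esub> x" W J "r \<odot>\<^bsub>W\<^esub> y"] r by (simp add: W.smult_r_distr)
    qed
    then show "r \<odot>\<^bsub>W\<^esub> x \<in> ideal_smult W J" by simp
  qed
qed

lemma ideal_smult_vanish_iff:
  assumes W: "module R W" and V: "module R V" and f: "f \<in> module_homs R W V" and J: "J \<subseteq> carrier R"
  shows "(\<forall>x\<in>ideal_smult W J. f x = \<zero>\<^bsub>V\<^esub>) \<longleftrightarrow> (\<forall>r\<in>J. \<forall>x\<in>carrier W. r \<odot>\<^bsub>V\<^esub> f x = \<zero>\<^bsub>V\<^esub>)"
proof
  interpret W: module R W by (rule W)
  interpret V: module R V by (rule V)
  show "\<forall>r\<in>J. \<forall>x\<in>carrier W. r \<odot>\<^bsub>V\<^esub> f x = \<zero>\<^bsub>V\<^esub>" if "\<forall>x\<in>ideal_smult W J. f x = \<zero>\<^bsub>V\<^esub>"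
    using that ideal_smult.smult[of _ J _ W] module_homs_smult[OF f] J by (metis subsetD)
  assume z: "\<forall>r\<in>J. \<forall>x\<in>carrier W. r \<odot>\<^bsub>V\<^esub> f x = \<zero>\<^bsub>V\<^esub>"
  show "\<forall>x\<in>ideal_smult W J. f x = \<zero>\<^bsub>V\<^esub>"
  proof
    fix x assume "x \<in> ideal_smult W J"
    then have "x \<in> carrier W \<and> f x = \<zero>\<^bsub>V\<^esub>"
      by induction (use z J in \<open>auto simp: module_homs_smult[OF f] module_homs_add[OF f] subset_iff\<close>)
    then show "f x = \<zero>\<^bsub>V\<^esub>" by simp
  qed
qed

lemma ideal_power:
  assumes I: "ideal I R"
  shows ideal_power_ideal: "ideal (I [^]\<^bsub>ideals_set R\<^esub> (n::nat)) R"
    and ideal_power_Suc_subset: "I [^]\<^bsub>ideals_set R\<^esub> (Suc n) \<subseteq> I [^]\<^bsub>ideals_set R\<^esub> n"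
    and ideal_power_one: "I [^]\<^bsub>ideals_set R\<^esub> (1::nat) = I"
    and ideal_power_mem: "a \<in> I \<Longrightarrow> a [^] n \<in> I [^]\<^bsub>ideals_set R\<^esub> n"
proof -
  interpret S: comm_monoid "ideals_set R" by (rule ideals_set_is_comm_monoid)
  have Ic: "I \<in> carrier (ideals_set R)" using I by (simp add: ideals_set_def)
  have id: "ideal (I [^]\<^bsub>ideals_set R\<^esub> (n::nat)) R" for n
    using S.nat_pow_closed[OF Ic, of n] by (simp add: ideals_set_def)
  then show "ideal (I [^]\<^bsub>ideals_set R\<^esub> (n::nat)) R" .
  have power_Suc: "I [^]\<^bsub>ideals_set R\<^esub> (Suc n) = ideal_prod R (I [^]\<^bsub>ideals_set R\<^esub> n) I" for n
    using S.nat_pow_Suc by (simp add: ideals_set_def)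
  show "I [^]\<^bsub>ideals_set R\<^esub> (Suc n) \<subseteq> I [^]\<^bsub>ideals_set R\<^esub> n"
    unfolding power_Suc using ideal_prod_inter[OF id I, of n] by blast
  show "I [^]\<^bsub>ideals_set R\<^esub> (1::nat) = I" using S.nat_pow_eone[OF Ic] by simp
  show "a [^] n \<in> I [^]\<^bsub>ideals_set R\<^esub> n" if a: "a \<in> I"
  proof (induction n)
    case 0
    then show ?case by (simp add: nat_pow_def) (simp add: ideals_set_def)
  next
    case (Suc n)
    then show ?case unfolding power_Suc nat_pow_Suc using ideal_prod.prod[OF _ a] by blast
  qed
qed

end

section \<open>Generalized local cohomology as the cohomology of a complex\<close>

text \<open>The elements of $\Gamma_I(\mathrm{Hom}(M, V))$: for a homomorphism \<open>f\<close>, vanishing on $I^n M$ means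
  $I^n f = 0$.\<close>

definition gamma_homs ::
    "('r, 'x) ring_scheme \<Rightarrow> 'r set \<Rightarrow> ('r, 'm) module \<Rightarrow> ('r, 'e) module \<Rightarrow> ('m \<Rightarrow> 'e) set"
  where "gamma_homs R I M V =
    {f \<in> carrier (hom_module R M V). \<exists>n. \<forall>x\<in>power_submodule R I M n. f x = \<zero>\<^bsub>V\<^esub>}"

context cring
begin

context
  fixes I :: "'a set" and M :: "('a, 'm) module"
  assumes I: "ideal I R" and M: "module R M"
begin

private abbreviation "U \<equiv> power_submodule R I M"
private abbreviation "A \<equiv> power_quotient R I M"

lemma submodule_power_submodule: "submodule (U n) R M"
  unfolding power_submodule_def by (rule submodule_ideal_smult[OF M ideal_power_ideal[OF I]])

lemma ideal_smult_mono: "J \<subseteq> J' \<Longrightarrow> ideal_smult M J \<subseteq> ideal_smult M J'"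
proof
  fix x assume J: "J \<subseteq> J'" and "x \<in> ideal_smult M J"
  from this(2) show "x \<in> ideal_smult M J'"
    by induction (use J in \<open>auto intro: ideal_smult.intros\<close>)
qed

lemma power_submodule_antimono: "m \<le> n \<Longrightarrow> U n \<subseteq> U m"
proof (induction n rule: dec_induct)
  case (step n)
  have "U (Suc n) \<subseteq> U n"
    unfolding power_submodule_def by (rule ideal_smult_mono[OF ideal_power_Suc_subset[OF I]])
  then show ?case using step by blast
qed simp

lemma module_power_quotient: "module R (A n)"
  unfolding power_quotient_def by (rule module_quotient_module[OF M submodule_power_submodule])

lemma carrier_power_quotient: "carrier (A n) = (\<lambda>x. U n +>\<^bsub>M\<^esub> x) ` carrier M"
  by (auto simp: power_quotient_def quotient_module_simps)

lemma power_quotient_projection_hom: "(\<lambda>x. U n +>\<^bsub>M\<^esub> x) \<in> module_homs R M (A n)"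
  unfolding power_quotient_def by (rule quotient_projection_hom[OF M submodule_power_submodule])

lemma power_quotient_zero_iff: "x \<in> carrier M \<Longrightarrow> U n +>\<^bsub>M\<^esub> x = \<zero>\<^bsub>A n\<^esub> \<longleftrightarrow> x \<in> U n"
  using coset_eq_self_iff[OF M submodule_power_submodule] by (simp add: power_quotient_def quotient_module_simps)

lemma power_projection_coset:
  assumes x: "x \<in> carrier M"
  shows "power_projection R I M n (U (Suc n) +>\<^bsub>M\<^esub> x) = U n +>\<^bsub>M\<^esub> x"
  unfolding power_projection_def
proof (rule SUP_eq_const)
  interpret M: module R M by (rule M)
  note mem = mem_coset_iff[OF M submodule_power_submodule x]
  show "U (Suc n) +>\<^bsub>M\<^esub> x \<noteq> {}"
    using mem[of x "Suc n"] x M.M.minus_eq_zero_iff[OF x x] M.submoduleD(3)[OF submodule_power_submodule] by auto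
  show "U n +>\<^bsub>M\<^esub> y = U n +>\<^bsub>M\<^esub> x" if "y \<in> U (Suc n) +>\<^bsub>M\<^esub> x" for y
  proof -
    have y: "y \<in> carrier M" "y \<ominus>\<^bsub>M\<^esub> x \<in> U (Suc n)" using that mem by auto
    then have "y \<ominus>\<^bsub>M\<^esub> x \<in> U n" using power_submodule_antimono[of n "Suc n"] by auto
    then show ?thesis using coset_eq_iff[OF M submodule_power_submodule y(1) x] by simp
  qed
qed

lemma power_projection_hom: "power_projection R I M n \<in> module_homs R (A (Suc n)) (A n)"
proof (rule module_homsI)
  interpret M: module R M by (rule M)
  note p = power_quotient_projection_hom
  fix X assume "X \<in> carrier (A (Suc n))"
  then obtain x where x: "x \<in> carrier M" "X = U (Suc n) +>\<^bsub>M\<^esub> x" unfolding carrier_power_quotient by blast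
  show "power_projection R I M n X \<in> carrier (A n)"
    unfolding x(2) power_projection_coset[OF x(1)] by (rule module_homs_closed[OF p x(1)])
  show "power_projection R I M n (r \<odot>\<^bsub>A (Suc n)\<^esub> X) = r \<odot>\<^bsub>A n\<^esub> power_projection R I M n X" if r: "r \<in> carrier R" for r
    unfolding x(2) module_homs_smult[OF p r x(1), symmetric] power_projection_coset[OF x(1)]
    by (rule power_projection_coset[OF M.smult_closed[OF r x(1)]])
  fix Y assume "Y \<in> carrier (A (Suc n))"
  then obtain y where y: "y \<in> carrier M" "Y = U (Suc n) +>\<^bsub>M\<^esub> y" unfolding carrier_power_quotient by blast
  show "power_projection R I M n (X \<oplus>\<^bsub>A (Suc n)\<^esub> Y) = power_projection R I M n X \<oplus>\<^bsub>A n\<^esub> power_projection R I M n Y"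
    unfolding x(2) y(2) module_homs_add[OF p x(1) y(1), symmetric] power_projection_coset[OF x(1)] power_projection_coset[OF y(1)]
    by (rule power_projection_coset[OF M.M.a_closed[OF x(1) y(1)]])
qed

lemma power_quotient_factor:
  assumes V: "module R V" and f: "f \<in> module_homs R M V" "\<And>x. x \<in> U n \<Longrightarrow> f x = \<zero>\<^bsub>V\<^esub>"
  obtains \<gamma> where "\<gamma> \<in> module_homs R (A n) V" "\<And>x. x \<in> carrier M \<Longrightarrow> \<gamma> (U n +>\<^bsub>M\<^esub> x) = f x"
  using surjective_factor[OF M module_power_quotient V power_quotient_projection_hom _ f(1)]
    power_quotient_zero_iff f(2) carrier_power_quotient by (metis order_refl)

lemma submodule_gamma_homs:
  assumes V: "module R V"
  shows "submodule (gamma_homs R I M V) R (hom_module R M V)"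
proof -
  interpret H: module R "hom_module R M V" by (rule module_hom_module[OF M V])
  interpret V: module R V by (rule V)
  interpret M: module R M by (rule M)
  have Uc: "x \<in> carrier M" if "x \<in> U n" for x n using M.submoduleD(2)[OF submodule_power_submodule that] .
  show ?thesis
  proof (rule H.submoduleI')
    show "gamma_homs R I M V \<subseteq> carrier (hom_module R M V)" by (auto simp: gamma_homs_def)
    show "\<zero>\<^bsub>hom_module R M V\<^esub> \<in> gamma_homs R I M V"
      using H.zero_closed Uc by (auto simp: gamma_homs_def hom_module_simps(2))
    fix f assume f: "f \<in> gamma_homs R I M V"
    then obtain n where n: "\<And>x. x \<in> U n \<Longrightarrow> f x = \<zero>\<^bsub>V\<^esub>" by (auto simp: gamma_homs_def)
    show "r \<odot>\<^bsub>hom_module R M V\<^esub> f \<in> gamma_homs R I M V" if r: "r \<in> carrier R" for r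
    proof -
      have "\<forall>x\<in>U n. (r \<odot>\<^bsub>hom_module R M V\<^esub> f) x = \<zero>\<^bsub>V\<^esub>" using n Uc r by (simp add: hom_module_simps)
      then show ?thesis using H.smult_closed[OF r, of f] f by (auto simp: gamma_homs_def)
    qed
    fix g assume g: "g \<in> gamma_homs R I M V"
    then obtain m where m: "\<And>x. x \<in> U m \<Longrightarrow> g x = \<zero>\<^bsub>V\<^esub>" by (auto simp: gamma_homs_def)
    have "\<forall>x\<in>U (max n m). (f \<oplus>\<^bsub>hom_module R M V\<^esub> g) x = \<zero>\<^bsub>V\<^esub>"
      using n m Uc power_submodule_antimono[of n "max n m"] power_submodule_antimono[of m "max n m"]
      by (auto simp: hom_module_simps subset_iff)
    then show "f \<oplus>\<^bsub>hom_module R M V\<^esub> g \<in> gamma_homs R I M V"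
      using H.a_closed[of f g] f g by (auto simp: gamma_homs_def)
  qed
qed

text \<open>Exactness and injectivity are required only as far as they concern degree \<open>q\<close>. In this form the
  result also applies to $q = 0$ and $E^0 = N$, which is how $H^0_I(\mathrm{Hom}(M, E^i))$ is computed below.\<close>

context
  fixes N :: "('a, 'n) module" and \<epsilon> :: "'n \<Rightarrow> 'e" and E :: "nat \<Rightarrow> ('a, 'e) module" and d :: "nat \<Rightarrow> 'e \<Rightarrow> 'e"
    and q :: nat
  assumes N: "module R N" and E: "\<And>i. module R (E i)" and \<epsilon>: "\<epsilon> \<in> module_homs R N (E 0)" "inj_on \<epsilon> (carrier N)"
    and d: "\<And>i. d i \<in> module_homs R (E i) (E (Suc i))"
    and ker0: "{x \<in> carrier (E 0). d 0 x = \<zero>\<^bsub>E 1\<^esub>} = \<epsilon> ` carrier N"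
    and ker: "\<And>i. i < q \<Longrightarrow> {x \<in> carrier (E (Suc i)). d (Suc i) x = \<zero>\<^bsub>E (Suc (Suc i))\<^esub>} = d i ` carrier (E i)"
    and inj: "\<And>i. i < q \<Longrightarrow> injective_module R (E i)"
begin

private abbreviation "EE i \<equiv> case i of 0 \<Rightarrow> (E 0)\<lparr>carrier := \<epsilon> ` carrier N\<rparr> | Suc j \<Rightarrow> E j"
private abbreviation "ed i \<equiv> case i of 0 \<Rightarrow> (\<lambda>x. x) | Suc j \<Rightarrow> d j"

private lemma EE:
  "module R (EE i)" "EE (Suc i) = E i" "ed i \<in> module_homs R (EE i) (E i)" "ed (Suc i) = d i"
  "i \<le> q \<Longrightarrow> {x \<in> carrier (E i). d i x = \<zero>\<^bsub>E (Suc i)\<^esub>} = ed i ` carrier (EE i)"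
proof -
  show "module R (EE i)"
    using submodule.submodule_is_module[OF submodule_image[OF N E \<epsilon>(1)] E] E by (cases i) simp_all
  show "ed i \<in> module_homs R (EE i) (E i)"
    using d module_homs_closed[OF \<epsilon>(1)] by (cases i) (auto simp: module_homs_def)
  show "i \<le> q \<Longrightarrow> {x \<in> carrier (E i). d i x = \<zero>\<^bsub>E (Suc i)\<^esub>} = ed i ` carrier (EE i)"
    using ker0 ker by (cases i) simp_all
qed simp_all

private lemmas zz_cong = zigzag_cong[where E = E and d = d, OF E d]
  and zz_zero = zigzag_zero[where E = E and d = d, OF E d]
  and zz_add = zigzag_add[where E = E and d = d, OF E d]
  and zz_smult = zigzag_smult[where E = E and d = d, OF E d]
  and zz_cocycle = zigzag_cocycle[where E = E and d = d, OF E d]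
  and zz_natural = zigzag_natural[where E = E and d = d, OF E d]
  and zz_boundary = zigzag_boundary[where E = E and d = d and E' = "\<lambda>i. EE i" and d' = "\<lambda>i. ed i" and q = q, OF E d _ EE inj]
  and zz_total = zigzag_total[where E = E and d = d and E' = "\<lambda>i. EE i" and d' = "\<lambda>i. ed i" and q = q, OF E d _ EE inj]
  and zz_surj = zigzag_surj[where E = E and d = d and E' = "\<lambda>i. EE i" and d' = "\<lambda>i. ed i" and q = q, OF E d _ EE inj]

private lemma \<epsilon>_zero: "x \<in> carrier N \<Longrightarrow> \<epsilon> x = \<zero>\<^bsub>E 0\<^esub> \<longleftrightarrow> x = \<zero>\<^bsub>N\<^esub>"
proof -
  interpret N: module R N by (rule N)
  show "x \<in> carrier N \<Longrightarrow> \<epsilon> x = \<zero>\<^bsub>E 0\<^esub> \<longleftrightarrow> x = \<zero>\<^bsub>N\<^esub>"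
    using inj_onD[OF \<epsilon>(2), of x "\<zero>\<^bsub>N\<^esub>"] module_homs_zero[OF N E \<epsilon>(1)] by auto
qed

private lemma \<epsilon>_hom: "\<epsilon> \<in> module_homs R N (EE 0)"
  using \<epsilon>(1) by (auto simp: module_homs_def)

text \<open>At the end of the staircase the element \<open>y\<close> of \<open>zigzag_boundary\<close> has values in the image of \<open>\<epsilon>\<close>,
  and so it is a cochain with values in \<open>N\<close>.\<close>

lemma zigzag_coboundary:
  fixes Q :: "('a, 'u) module"
  assumes Q: "module R Q" and h: "h \<in> ext_cocycles R q Q N" and \<gamma>: "\<gamma> \<in> module_homs R Q (E q)"
    and zz: "zigzag R Q E d q 0 \<gamma> (\<lambda>p. \<epsilon> (h p))"
  shows "h \<in> ext_coboundaries R q Q N \<longleftrightarrow>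
    (case q of 0 \<Rightarrow> \<forall>x\<in>carrier Q. \<gamma> x = \<zero>\<^bsub>E 0\<^esub> | Suc i \<Rightarrow> \<exists>y\<in>module_homs R Q (E i). \<forall>x\<in>carrier Q. \<gamma> x = d i (y x))"
proof -
  have ext: "h \<in> extensional (carrier (res_module R Q q))" using h by (simp add: ext_cocycles_iff[OF Q N])
  note hc = ext_cocycles_closed[OF Q N h]
  show ?thesis
  proof (cases q)
    case 0
    have "\<gamma> (res_augmentation R Q p) = \<zero>\<^bsub>E 0\<^esub> \<longleftrightarrow> h p = \<zero>\<^bsub>N\<^esub>" if "p \<in> carrier (res_module R Q 0)" for p
      using zz that \<epsilon>_zero[OF hc, of p] by (simp add: 0)
    then have "(\<forall>p\<in>carrier (res_module R Q 0). h p = \<zero>\<^bsub>N\<^esub>) \<longleftrightarrow> (\<forall>x\<in>carrier Q. \<gamma> x = \<zero>\<^bsub>E 0\<^esub>)"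
      unfolding res_augmentation_surj[OF Q, symmetric] by auto
    then show ?thesis using ext by (simp add: 0 ext_coboundaries_0_iff[OF Q])
  next
    case (Suc i)
    have "(\<exists>y\<in>module_homs R Q (EE q). \<forall>x\<in>carrier Q. \<gamma> x = ed q (y x)) \<longleftrightarrow>
      (case q of 0 \<Rightarrow> \<exists>y\<in>module_homs R Q (EE 0). \<forall>p\<in>carrier (res_module R Q 0). \<epsilon> (h p) = ed 0 (y (res_augmentation R Q p))
       | Suc i \<Rightarrow> \<exists>y\<in>module_homs R (res_module R Q i) (EE 0). \<forall>p\<in>carrier (res_module R Q (Suc i)). \<epsilon> (h p) = ed 0 (y (res_differential R p)))"
      by (rule zz_boundary[OF Q _ _ \<gamma> zz]) simp_all
    then have "(\<exists>y\<in>module_homs R Q (E i). \<forall>x\<in>carrier Q. \<gamma> x = d i (y x)) \<longleftrightarrow>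
        (\<exists>y\<in>module_homs R (res_module R Q i) (EE 0). \<forall>p\<in>carrier (res_module R Q (Suc i)). \<epsilon> (h p) = y (res_differential R p))"
      by (simp add: Suc)
    also have "\<dots> \<longleftrightarrow> (\<exists>k\<in>module_homs R (res_module R Q i) N. \<forall>p\<in>carrier (res_module R Q (Suc i)). h p = k (res_differential R p))"
    proof
      assume "\<exists>k\<in>module_homs R (res_module R Q i) N. \<forall>p\<in>carrier (res_module R Q (Suc i)). h p = k (res_differential R p)"
      then obtain k where k: "k \<in> module_homs R (res_module R Q i) N"
        "\<forall>p\<in>carrier (res_module R Q (Suc i)). h p = k (res_differential R p)" by blast
      then show "\<exists>y\<in>module_homs R (res_module R Q i) (EE 0). \<forall>p\<in>carrier (res_module R Q (Suc i)). \<epsilon> (h p) = y (res_differential R p)"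
        by (intro bexI[OF _ module_homs_comp'[OF k(1) \<epsilon>_hom]]) simp
    next
      assume "\<exists>y\<in>module_homs R (res_module R Q i) (EE 0). \<forall>p\<in>carrier (res_module R Q (Suc i)). \<epsilon> (h p) = y (res_differential R p)"
      then obtain y where y: "y \<in> module_homs R (res_module R Q i) (EE 0)"
        "\<And>p. p \<in> carrier (res_module R Q (Suc i)) \<Longrightarrow> \<epsilon> (h p) = y (res_differential R p)" by blast
      have "y p \<in> \<epsilon> ` carrier N" if "p \<in> carrier (res_module R Q i)" for p
        using module_homs_closed[OF y(1) that] by simp
      then obtain k where k: "k \<in> module_homs R (res_module R Q i) N" "\<And>p. p \<in> carrier (res_module R Q i) \<Longrightarrow> \<epsilon> (k p) = y p"
        using res_lift[OF Q N EE(1)[of 0] \<epsilon>_hom y(1)] by blast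
      have "h p = k (res_differential R p)" if p: "p \<in> carrier (res_module R Q (Suc i))" for p
      proof (rule inj_onD[OF \<epsilon>(2)])
        show "\<epsilon> (h p) = \<epsilon> (k (res_differential R p))"
          using y(2)[OF p] k(2)[OF res_differential_closed[OF Q p]] by simp
        show "h p \<in> carrier N" using hc p Suc by simp
        show "k (res_differential R p) \<in> carrier N" by (rule module_homs_closed[OF k(1) res_differential_closed[OF Q p]])
      qed
      then show "\<exists>k\<in>module_homs R (res_module R Q i) N. \<forall>p\<in>carrier (res_module R Q (Suc i)). h p = k (res_differential R p)"
        using k(1) by blast
    qed
    finally show ?thesis using ext by (simp add: Suc ext_coboundaries_Suc_iff[OF Q N])
  qed
qed

private abbreviation "H \<equiv> hom_module R M (E q)"

private definition "Zq = {f \<in> gamma_homs R I M (E q). \<forall>x\<in>carrier M. d q (f x) = \<zero>\<^bsub>E (Suc q)\<^esub>}"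

private definition "Bq = (case q of 0 \<Rightarrow> {\<lambda>x\<in>carrier M. \<zero>\<^bsub>E 0\<^esub>}
  | Suc i \<Rightarrow> (\<lambda>g. \<lambda>x\<in>carrier M. d i (g x)) ` gamma_homs R I M (E i))"

text \<open>A homomorphism on \<open>M\<close> is related to an Ext class over $M/I^n M$ if it is induced by a
  homomorphism \<open>\<gamma>\<close> on $M/I^n M$ that a staircase connects with a cocycle of the class.\<close>

private definition "Rel n = {(f, g). f \<in> Zq \<and> (\<exists>h\<in>ext_cocycles R q (A n) N. \<exists>\<gamma>\<in>module_homs R (A n) (E q).
  g = ext_class R q (A n) N h \<and> (\<forall>x\<in>carrier M. \<gamma> (U n +>\<^bsub>M\<^esub> x) = f x) \<and>
  zigzag R (A n) E d q 0 \<gamma> (\<lambda>p. \<epsilon> (h p)))}"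

private lemma RelI:
  "f \<in> Zq \<Longrightarrow> h \<in> ext_cocycles R q (A n) N \<Longrightarrow> \<gamma> \<in> module_homs R (A n) (E q) \<Longrightarrow> g = ext_class R q (A n) N h \<Longrightarrow>
    (\<And>x. x \<in> carrier M \<Longrightarrow> \<gamma> (U n +>\<^bsub>M\<^esub> x) = f x) \<Longrightarrow> zigzag R (A n) E d q 0 \<gamma> (\<lambda>p. \<epsilon> (h p)) \<Longrightarrow> (f, g) \<in> Rel n"
  unfolding Rel_def by blast

private lemma RelE:
  assumes "(f, g) \<in> Rel n"
  obtains h \<gamma> where "f \<in> Zq" "h \<in> ext_cocycles R q (A n) N" "\<gamma> \<in> module_homs R (A n) (E q)" "g = ext_class R q (A n) N h"
    "\<And>x. x \<in> carrier M \<Longrightarrow> \<gamma> (U n +>\<^bsub>M\<^esub> x) = f x" "zigzag R (A n) E d q 0 \<gamma> (\<lambda>p. \<epsilon> (h p))"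
  using assms unfolding Rel_def by blast

private lemma Zq_hom: "f \<in> Zq \<Longrightarrow> f \<in> module_homs R M (E q) \<and> f \<in> extensional (carrier M)"
  by (simp add: Zq_def gamma_homs_def hom_module_simps)

private lemma submodule_Zq: "submodule Zq R H"
proof -
  interpret M: module R M by (rule M)
  interpret H: module R H by (rule module_hom_module[OF M E])
  interpret E1: module R "E (Suc q)" by (rule E)
  note D = H.submoduleD[OF submodule_gamma_homs[OF E]]
  have c: "f x \<in> carrier (E q)" if "f \<in> gamma_homs R I M (E q)" "x \<in> carrier M" for f x
    using that by (auto simp: gamma_homs_def hom_module_simps module_homs_def)
  show ?thesis
  proof (rule H.submoduleI')
    show "Zq \<subseteq> carrier H" using D(1) by (auto simp: Zq_def)
    show "\<zero>\<^bsub>H\<^esub> \<in> Zq" using D(3) module_homs_zero[OF E E d] by (simp add: Zq_def hom_module_simps)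
    fix f assume f: "f \<in> Zq"
    show "r \<odot>\<^bsub>H\<^esub> f \<in> Zq" if r: "r \<in> carrier R" for r
      using D(5)[OF r, of f] f c[of f] module_homs_smult[OF d r] r by (simp add: Zq_def hom_module_simps)
    fix g assume g: "g \<in> Zq"
    show "f \<oplus>\<^bsub>H\<^esub> g \<in> Zq"
      using D(4)[of f g] f g c[of f] c[of g] module_homs_add[OF d] by (simp add: Zq_def hom_module_simps)
  qed
qed

private lemma Rel_linear: "linear_relation R (H\<lparr>carrier := Zq\<rparr>) (Ext R q (A n) N) (Rel n)"
proof (rule linear_relationI)
  note Q = module_power_quotient[of n]
  interpret M: module R M by (rule M)
  interpret H: module R H by (rule module_hom_module[OF M E])
  interpret C: module R "ext_cochains R q (A n) N" by (rule module_ext_cochains[OF Q N])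
  note ZD = H.submoduleD[OF submodule_Zq] and CD = C.submoduleD[OF submodule_ext_cocycles[OF Q N]]
  note ch = ext_class_hom[OF Q N, of q]
  note pr = module_homs_closed[OF power_quotient_projection_hom[of n]]
  have val: "h p \<in> carrier N" if "h \<in> ext_cocycles R q (A n) N" "p \<in> carrier (res_module R (A n) q)" for h p
    using ext_cocycles_closed[OF Q N that] .
  show "(\<zero>\<^bsub>H\<lparr>carrier := Zq\<rparr>\<^esub>, \<zero>\<^bsub>Ext R q (A n) N\<^esub>) \<in> Rel n"
  proof (rule RelI[OF _ CD(3) module_homs_const_zero[OF Q E]])
    show "\<zero>\<^bsub>H\<lparr>carrier := Zq\<rparr>\<^esub> \<in> Zq" using ZD(3) by simp
    show "\<zero>\<^bsub>Ext R q (A n) N\<^esub> = ext_class R q (A n) N \<zero>\<^bsub>ext_cochains R q (A n) N\<^esub>"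
      using module_homs_zero[OF module_ext_cocycles[OF Q N] module_Ext[OF Q N] ch] by simp
    show "zigzag R (A n) E d q 0 (\<lambda>x. \<zero>\<^bsub>E q\<^esub>) (\<lambda>p. \<epsilon> (\<zero>\<^bsub>ext_cochains R q (A n) N\<^esub> p))"
      by (rule zz_cong[OF Q zz_zero[OF Q, of q 0]])
        (simp_all add: ext_cochains_simps[OF Q] module_homs_zero[OF N E \<epsilon>(1)])
  qed (simp add: hom_module_simps)
  fix f g assume "(f, g) \<in> Rel n"
  then obtain h \<gamma> where *: "f \<in> Zq" "h \<in> ext_cocycles R q (A n) N" "\<gamma> \<in> module_homs R (A n) (E q)" "g = ext_class R q (A n) N h"
    "\<And>x. x \<in> carrier M \<Longrightarrow> \<gamma> (U n +>\<^bsub>M\<^esub> x) = f x" "zigzag R (A n) E d q 0 \<gamma> (\<lambda>p. \<epsilon> (h p))"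
    by (rule RelE) blast
  show "f \<in> carrier (H\<lparr>carrier := Zq\<rparr>) \<and> g \<in> carrier (Ext R q (A n) N)"
    using * by (simp add: carrier_Ext[OF Q N])
  show "(r \<odot>\<^bsub>H\<lparr>carrier := Zq\<rparr>\<^esub> f, r \<odot>\<^bsub>Ext R q (A n) N\<^esub> g) \<in> Rel n" if r: "r \<in> carrier R" for r
  proof (rule RelI[OF _ CD(5)[OF r *(2)] module_homs_pointwise_smult[OF Q E *(3) r]])
    show "r \<odot>\<^bsub>H\<lparr>carrier := Zq\<rparr>\<^esub> f \<in> Zq" using ZD(5)[OF r *(1)] by simp
    show "r \<odot>\<^bsub>Ext R q (A n) N\<^esub> g = ext_class R q (A n) N (r \<odot>\<^bsub>ext_cochains R q (A n) N\<^esub> h)"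
      using module_homs_smult[OF ch r, of h] * by simp
    show "zigzag R (A n) E d q 0 (\<lambda>x. r \<odot>\<^bsub>E q\<^esub> \<gamma> x) (\<lambda>p. \<epsilon> ((r \<odot>\<^bsub>ext_cochains R q (A n) N\<^esub> h) p))"
      by (rule zz_cong[OF Q zz_smult[OF Q r *(6)]])
        (use val[OF *(2)] r in \<open>simp_all add: ext_cochains_simps[OF Q] module_homs_smult[OF \<epsilon>(1)]\<close>)
    show "r \<odot>\<^bsub>E q\<^esub> \<gamma> (U n +>\<^bsub>M\<^esub> x) = (r \<odot>\<^bsub>H\<lparr>carrier := Zq\<rparr>\<^esub> f) x" if "x \<in> carrier M" for x
      using *(5)[OF that] that by (simp add: hom_module_simps)
  qed
  fix f' g' assume "(f', g') \<in> Rel n"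
  then obtain h' \<gamma>' where **: "f' \<in> Zq" "h' \<in> ext_cocycles R q (A n) N" "\<gamma>' \<in> module_homs R (A n) (E q)" "g' = ext_class R q (A n) N h'"
    "\<And>x. x \<in> carrier M \<Longrightarrow> \<gamma>' (U n +>\<^bsub>M\<^esub> x) = f' x" "zigzag R (A n) E d q 0 \<gamma>' (\<lambda>p. \<epsilon> (h' p))"
    by (rule RelE) blast
  show "(f \<oplus>\<^bsub>H\<lparr>carrier := Zq\<rparr>\<^esub> f', g \<oplus>\<^bsub>Ext R q (A n) N\<^esub> g') \<in> Rel n"
  proof (rule RelI[OF _ CD(4)[OF *(2) **(2)] module_homs_pointwise_add[OF Q E *(3) **(3)]])
    show "f \<oplus>\<^bsub>H\<lparr>carrier := Zq\<rparr>\<^esub> f' \<in> Zq" using ZD(4)[OF *(1) **(1)] by simp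
    show "g \<oplus>\<^bsub>Ext R q (A n) N\<^esub> g' = ext_class R q (A n) N (h \<oplus>\<^bsub>ext_cochains R q (A n) N\<^esub> h')"
      using module_homs_add[OF ch, of h h'] * ** by simp
    show "zigzag R (A n) E d q 0 (\<lambda>x. \<gamma> x \<oplus>\<^bsub>E q\<^esub> \<gamma>' x) (\<lambda>p. \<epsilon> ((h \<oplus>\<^bsub>ext_cochains R q (A n) N\<^esub> h') p))"
      by (rule zz_cong[OF Q zz_add[OF Q *(6) **(6)]])
        (use val[OF *(2)] val[OF **(2)] in \<open>simp_all add: ext_cochains_simps[OF Q] module_homs_add[OF \<epsilon>(1)]\<close>)
    show "\<gamma> (U n +>\<^bsub>M\<^esub> x) \<oplus>\<^bsub>E q\<^esub> \<gamma>' (U n +>\<^bsub>M\<^esub> x) = (f \<oplus>\<^bsub>H\<lparr>carrier := Zq\<rparr>\<^esub> f') x" if "x \<in> carrier M" for x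
      using *(5)[OF that] **(5)[OF that] that by (simp add: hom_module_simps)
  qed
qed

private lemma Rel_step:
  assumes "(f, g) \<in> Rel n"
  shows "(f, Ext_map R q (A (Suc n)) (power_projection R I M n) N g) \<in> Rel (Suc n)"
proof -
  note Q = module_power_quotient[of n] and Q' = module_power_quotient[of "Suc n"] and p = power_projection_hom[of n]
  obtain h \<gamma> where *: "f \<in> Zq" "h \<in> ext_cocycles R q (A n) N" "\<gamma> \<in> module_homs R (A n) (E q)" "g = ext_class R q (A n) N h"
    "\<And>x. x \<in> carrier M \<Longrightarrow> \<gamma> (U n +>\<^bsub>M\<^esub> x) = f x" "zigzag R (A n) E d q 0 \<gamma> (\<lambda>p. \<epsilon> (h p))"
    using assms by (rule RelE) blast
  show ?thesis
  proof (rule RelI[OF *(1) ext_pullback_cocycle[OF Q' N Q p *(2)] module_homs_comp'[OF p *(3)]])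
    show "Ext_map R q (A (Suc n)) (power_projection R I M n) N g =
        ext_class R q (A (Suc n)) N (\<lambda>x\<in>carrier (res_module R (A (Suc n)) q). h (res_map R (power_projection R I M n) x))"
      unfolding *(4) by (rule Ext_map_class[OF Q' N Q p *(2)])
    show "\<gamma> (power_projection R I M n (U (Suc n) +>\<^bsub>M\<^esub> x)) = f x" if "x \<in> carrier M" for x
      using power_projection_coset[OF that] *(5)[OF that] by simp
    show "zigzag R (A (Suc n)) E d q 0 (\<lambda>x. \<gamma> (power_projection R I M n x))
        (\<lambda>x. \<epsilon> ((\<lambda>x\<in>carrier (res_module R (A (Suc n)) q). h (res_map R (power_projection R I M n) x)) x))"
      by (rule zz_cong[OF Q' zz_natural[OF Q' Q p *(6)]]) simp_all
  qed
qed

private lemma Rel_total: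
  assumes f: "f \<in> Zq" "\<And>x. x \<in> U n \<Longrightarrow> f x = \<zero>\<^bsub>E q\<^esub>"
  shows "\<exists>g. (f, g) \<in> Rel n"
proof -
  note Q = module_power_quotient[of n]
  obtain \<gamma> where \<gamma>: "\<gamma> \<in> module_homs R (A n) (E q)" "\<And>x. x \<in> carrier M \<Longrightarrow> \<gamma> (U n +>\<^bsub>M\<^esub> x) = f x"
    using power_quotient_factor[OF E, of f q n] Zq_hom[OF f(1)] f(2) by blast
  have d\<gamma>: "d q (\<gamma> x) = \<zero>\<^bsub>E (Suc q)\<^esub>" if "x \<in> carrier (A n)" for x
    using that f(1) \<gamma>(2) by (auto simp: carrier_power_quotient Zq_def)
  obtain w where w: "zigzag R (A n) E d q 0 \<gamma> w"
    using zz_total[OF Q _ _ \<gamma>(1) d\<gamma>, of q 0] by auto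
  note wh = zigzag_hom[OF w] and wz = zz_cocycle[OF Q \<gamma>(1) d\<gamma> w]
  have "w p \<in> \<epsilon> ` carrier N" if "p \<in> carrier (res_module R (A n) q)" for p
    unfolding ker0[symmetric] using wz that module_homs_closed[OF wh that] by simp
  then obtain k where k: "k \<in> module_homs R (res_module R (A n) q) N" "\<And>p. p \<in> carrier (res_module R (A n) q) \<Longrightarrow> \<epsilon> (k p) = w p"
    using res_lift[OF Q N E \<epsilon>(1) wh] by blast
  have "k (res_differential R x) = \<zero>\<^bsub>N\<^esub>" if "x \<in> carrier (res_module R (A n) (Suc q))" for x
    using k(2)[OF res_differential_closed[OF Q that]] wz that \<epsilon>_zero[OF module_homs_closed[OF k(1) res_differential_closed[OF Q that]]]
    by simp
  note h = restrict_cocycle[OF Q N k(1) this]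
  have "zigzag R (A n) E d q 0 \<gamma> (\<lambda>p. \<epsilon> (restrict k (carrier (res_module R (A n) q)) p))"
    by (rule zz_cong[OF Q w]) (simp_all add: k(2))
  from RelI[OF f(1) h \<gamma>(1) refl \<gamma>(2) this] show ?thesis by blast
qed

private lemma Rel_surj:
  assumes "g \<in> carrier (Ext R q (A n) N)"
  shows "\<exists>f. (f, g) \<in> Rel n"
proof -
  note Q = module_power_quotient[of n]
  interpret M: module R M by (rule M)
  obtain h where h: "h \<in> ext_cocycles R q (A n) N" "g = ext_class R q (A n) N h"
    using assms by (auto simp: carrier_Ext[OF Q N])
  have h': "h \<in> module_homs R (res_module R (A n) q) N"
    "\<And>x. x \<in> carrier (res_module R (A n) (Suc q)) \<Longrightarrow> h (res_differential R x) = \<zero>\<^bsub>N\<^esub>"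
    using h(1) by (auto simp: ext_cocycles_iff[OF Q N])
  have "d 0 (\<epsilon> y) = \<zero>\<^bsub>E 1\<^esub>" if "y \<in> carrier N" for y
    using ker0 that by blast
  then have 1: "\<forall>p\<in>carrier (res_module R (A n) q). d 0 (\<epsilon> (h p)) = \<zero>\<^bsub>E (Suc 0)\<^esub>"
    using module_homs_closed[OF h'(1)] by simp
  have 2: "\<forall>p\<in>carrier (res_module R (A n) (Suc q)). \<epsilon> (h (res_differential R p)) = \<zero>\<^bsub>E 0\<^esub>"
    using h'(2) module_homs_zero[OF N E \<epsilon>(1)] by simp
  obtain \<gamma> where \<gamma>: "\<gamma> \<in> module_homs R (A n) (E q)" "\<forall>x\<in>carrier (A n). d q (\<gamma> x) = \<zero>\<^bsub>E (Suc q)\<^esub>"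
    "zigzag R (A n) E d q 0 \<gamma> (\<lambda>p. \<epsilon> (h p))"
    using zz_surj[OF Q _ _ module_homs_comp'[OF h'(1) \<epsilon>(1)] 1 2] by auto
  let ?f = "\<lambda>x\<in>carrier M. \<gamma> (U n +>\<^bsub>M\<^esub> x)"
  note pr = power_quotient_projection_hom[of n]
  have "?f \<in> module_homs R M (E q)" by (rule module_homs_cong[OF M module_homs_comp'[OF pr \<gamma>(1)]]) simp
  moreover have "\<exists>n. \<forall>x\<in>U n. ?f x = \<zero>\<^bsub>E q\<^esub>"
  proof (intro exI ballI)
    show "?f x = \<zero>\<^bsub>E q\<^esub>" if "x \<in> U n" for x
    using that M.submoduleD(2)[OF submodule_power_submodule that] power_quotient_zero_iff[of x n] module_homs_zero[OF Q E \<gamma>(1)] by simp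
  qed
  ultimately have "?f \<in> gamma_homs R I M (E q)" by (simp only: gamma_homs_def hom_module_simps) simp
  then have "?f \<in> Zq" using \<gamma>(2) module_homs_closed[OF pr] by (simp add: Zq_def)
  then show ?thesis using RelI[OF _ h(1) \<gamma>(1) h(2) _ \<gamma>(3), of ?f] by auto
qed

private lemma Rel_zero_iff:
  assumes "(f, g) \<in> Rel n"
  shows "g = \<zero>\<^bsub>Ext R q (A n) N\<^esub> \<longleftrightarrow> (case q of 0 \<Rightarrow> \<forall>x\<in>carrier M. f x = \<zero>\<^bsub>E 0\<^esub>
    | Suc i \<Rightarrow> \<exists>y\<in>module_homs R M (E i). (\<forall>x\<in>U n. y x = \<zero>\<^bsub>E i\<^esub>) \<and> (\<forall>x\<in>carrier M. f x = d i (y x)))"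
proof -
  note Q = module_power_quotient[of n] and pr = power_quotient_projection_hom[of n]
  interpret M: module R M by (rule M)
  obtain h \<gamma> where *: "f \<in> Zq" "h \<in> ext_cocycles R q (A n) N" "\<gamma> \<in> module_homs R (A n) (E q)" "g = ext_class R q (A n) N h"
    "\<And>x. x \<in> carrier M \<Longrightarrow> \<gamma> (U n +>\<^bsub>M\<^esub> x) = f x" "zigzag R (A n) E d q 0 \<gamma> (\<lambda>p. \<epsilon> (h p))"
    using assms by (rule RelE) blast
  have "g = \<zero>\<^bsub>Ext R q (A n) N\<^esub> \<longleftrightarrow> h \<in> ext_coboundaries R q (A n) N"
    unfolding *(4) by (rule ext_class_zero_iff[OF Q N *(2)])
  also note zigzag_coboundary[OF Q *(2,3,6)]
  also have "(case q of 0 \<Rightarrow> \<forall>x\<in>carrier (A n). \<gamma> x = \<zero>\<^bsub>E 0\<^esub>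
      | Suc i \<Rightarrow> \<exists>y\<in>module_homs R (A n) (E i). \<forall>x\<in>carrier (A n). \<gamma> x = d i (y x)) \<longleftrightarrow>
    (case q of 0 \<Rightarrow> \<forall>x\<in>carrier M. f x = \<zero>\<^bsub>E 0\<^esub>
      | Suc i \<Rightarrow> \<exists>y\<in>module_homs R M (E i). (\<forall>x\<in>U n. y x = \<zero>\<^bsub>E i\<^esub>) \<and> (\<forall>x\<in>carrier M. f x = d i (y x)))"
  proof (cases q)
    case 0
    then show ?thesis using *(5) by (simp add: carrier_power_quotient)
  next
    case (Suc i)
    have "(\<exists>y\<in>module_homs R (A n) (E i). \<forall>x\<in>carrier (A n). \<gamma> x = d i (y x)) \<longleftrightarrow>
      (\<exists>y\<in>module_homs R M (E i). (\<forall>x\<in>U n. y x = \<zero>\<^bsub>E i\<^esub>) \<and> (\<forall>x\<in>carrier M. f x = d i (y x)))"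
    proof
      assume "\<exists>y\<in>module_homs R (A n) (E i). \<forall>x\<in>carrier (A n). \<gamma> x = d i (y x)"
      then obtain y where y: "y \<in> module_homs R (A n) (E i)" "\<forall>x\<in>carrier (A n). \<gamma> x = d i (y x)" by blast
      have "y (U n +>\<^bsub>M\<^esub> x) = \<zero>\<^bsub>E i\<^esub>" if "x \<in> U n" for x
        using that M.submoduleD(2)[OF submodule_power_submodule that] power_quotient_zero_iff[of x n] module_homs_zero[OF Q E y(1)] by simp
      then show "\<exists>y\<in>module_homs R M (E i). (\<forall>x\<in>U n. y x = \<zero>\<^bsub>E i\<^esub>) \<and> (\<forall>x\<in>carrier M. f x = d i (y x))"
        using y(2) *(5) by (intro bexI[OF _ module_homs_comp'[OF pr y(1)]]) (auto simp: carrier_power_quotient)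
    next
      assume "\<exists>y\<in>module_homs R M (E i). (\<forall>x\<in>U n. y x = \<zero>\<^bsub>E i\<^esub>) \<and> (\<forall>x\<in>carrier M. f x = d i (y x))"
      then obtain y where y: "y \<in> module_homs R M (E i)" "\<And>x. x \<in> U n \<Longrightarrow> y x = \<zero>\<^bsub>E i\<^esub>" "\<forall>x\<in>carrier M. f x = d i (y x)" by blast
      obtain z where z: "z \<in> module_homs R (A n) (E i)" "\<And>x. x \<in> carrier M \<Longrightarrow> z (U n +>\<^bsub>M\<^esub> x) = y x"
        using power_quotient_factor[OF E y(1,2)] by blast
      then show "\<exists>y\<in>module_homs R (A n) (E i). \<forall>x\<in>carrier (A n). \<gamma> x = d i (y x)"
        using y(3) *(5) by (intro bexI[OF _ z(1)]) (auto simp: carrier_power_quotient)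
    qed
    then show ?thesis by (simp add: Suc)
  qed
  finally show ?thesis .
qed

text \<open>The complex $\Gamma_I(\mathrm{Hom}(M, E^\bullet))$ is the union of the complexes
  $\mathrm{Hom}(M/I^n M, E^\bullet)$. The staircases compute their cohomology and are compatible with the
  projections $M/I^{n+1} M \to M/I^n M$.\<close>

lemma gen_local_cohomology_presentation:
  obtains \<psi> where
    "\<psi> \<in> module_homs R ((hom_module R M (E q))\<lparr>carrier := {f \<in> gamma_homs R I M (E q). \<forall>x\<in>carrier M. d q (f x) = \<zero>\<^bsub>E (Suc q)\<^esub>}\<rparr>)
      (gen_local_cohomology R I q M N)"
    "\<psi> ` {f \<in> gamma_homs R I M (E q). \<forall>x\<in>carrier M. d q (f x) = \<zero>\<^bsub>E (Suc q)\<^esub>} = carrier (gen_local_cohomology R I q M N)"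
    "\<And>f. f \<in> gamma_homs R I M (E q) \<Longrightarrow> \<forall>x\<in>carrier M. d q (f x) = \<zero>\<^bsub>E (Suc q)\<^esub> \<Longrightarrow>
      \<psi> f = \<zero>\<^bsub>gen_local_cohomology R I q M N\<^esub> \<longleftrightarrow> f \<in> (case q of 0 \<Rightarrow> {\<lambda>x\<in>carrier M. \<zero>\<^bsub>E 0\<^esub>}
        | Suc i \<Rightarrow> (\<lambda>g. \<lambda>x\<in>carrier M. d i (g x)) ` gamma_homs R I M (E i))"
proof -
  let ?X = "H\<lparr>carrier := Zq\<rparr>" and ?G = "\<lambda>n. Ext R q (A n) N"
    and ?\<phi> = "\<lambda>n. Ext_map R q (A (Suc n)) (power_projection R I M n) N"
  interpret M: module R M by (rule M)
  have X: "module R ?X" by (rule submodule.submodule_is_module[OF submodule_Zq module_hom_module[OF M E]])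
  have total: "\<exists>n g. (f, g) \<in> Rel n" if f: "f \<in> carrier ?X" for f
  proof -
    obtain n where "\<forall>x\<in>U n. f x = \<zero>\<^bsub>E q\<^esub>" using f by (auto simp: Zq_def gamma_homs_def)
    then show ?thesis using Rel_total[of f n] f by auto
  qed
  have B1: "f \<in> Bq" if f0: "(f, \<zero>\<^bsub>?G n\<^esub>) \<in> Rel n" for f n
  proof -
    have f: "f \<in> extensional (carrier M)" using f0 Zq_hom by (auto simp: Rel_def)
    show ?thesis
    proof (cases q)
      case 0
      then have "f = (\<lambda>x\<in>carrier M. \<zero>\<^bsub>E 0\<^esub>)"
        using Rel_zero_iff[OF f0] by (intro extensionalityI[OF f]) auto
      then show ?thesis unfolding Bq_def by (simp add: 0)
    next
      case (Suc i)
      then obtain y where y: "y \<in> module_homs R M (E i)" "\<forall>x\<in>U n. y x = \<zero>\<^bsub>E i\<^esub>" "\<forall>x\<in>carrier M. f x = d i (y x)"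
        using Rel_zero_iff[OF f0] by auto
      have "restrict y (carrier M) \<in> gamma_homs R I M (E i)"
        using y(1,2) M.submoduleD(2)[OF submodule_power_submodule[of n]] module_homs_cong[OF M y(1), of "restrict y (carrier M)"]
        by (auto simp: gamma_homs_def hom_module_simps intro!: exI[of _ n])
      moreover have "f = (\<lambda>x\<in>carrier M. d i (restrict y (carrier M) x))"
        by (rule extensionalityI[OF f]) (use y(3) in auto)
      ultimately have "f \<in> (\<lambda>g. \<lambda>x\<in>carrier M. d i (g x)) ` gamma_homs R I M (E i)"
        by (intro image_eqI[where x = "restrict y (carrier M)"])
      then show ?thesis unfolding Bq_def by (simp add: Suc)
    qed
  qed
  have B2: "\<exists>n. (f, \<zero>\<^bsub>?G n\<^esub>) \<in> Rel n" if f: "f \<in> Bq" for f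
  proof (cases q)
    case 0
    then have z: "f = \<zero>\<^bsub>?X\<^esub>" using f unfolding Bq_def by (simp add: hom_module_simps)
    show ?thesis unfolding z using linear_relationD(3)[OF X module_Ext[OF module_power_quotient N] Rel_linear] by blast
  next
    case (Suc i)
    then obtain y where y: "y \<in> gamma_homs R I M (E i)" "f = (\<lambda>x\<in>carrier M. d i (y x))" using f unfolding Bq_def by auto
    obtain n where n: "\<And>x. x \<in> U n \<Longrightarrow> y x = \<zero>\<^bsub>E i\<^esub>" using y(1) by (auto simp: gamma_homs_def)
    have yh: "y \<in> module_homs R M (E i)" using y(1) by (simp add: gamma_homs_def hom_module_simps)
    note Uc = M.submoduleD(2)[OF submodule_power_submodule]
    have fU: "f x = \<zero>\<^bsub>E q\<^esub>" if "x \<in> U n" for x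
      using n[OF that] Uc[OF that] y(2) Suc module_homs_zero[OF E E d] by simp
    have "f \<in> module_homs R M (E (Suc i))"
      by (rule module_homs_cong[OF M module_homs_comp'[OF yh d]]) (simp add: y(2))
    moreover have "d (Suc i) (d i (y x)) = \<zero>\<^bsub>E (Suc (Suc i))\<^esub>" if "x \<in> carrier M" for x
      using ker[of i] Suc imageI[OF module_homs_closed[OF yh that], of "d i"] by auto
    moreover have "\<exists>n. \<forall>x\<in>U n. f x = \<zero>\<^bsub>E q\<^esub>" using fU by blast
    moreover have "f \<in> extensional (carrier M)" by (simp add: y(2))
    moreover have "f x = d i (y x)" if "x \<in> carrier M" for x using that by (simp add: y(2))
    ultimately have "f \<in> Zq" unfolding Zq_def gamma_homs_def by (simp add: hom_module_simps Suc)
    then obtain g where g: "(f, g) \<in> Rel n" using Rel_total[of f n] fU by blast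
    have "g = \<zero>\<^bsub>?G n\<^esub>" using Rel_zero_iff[OF g] Suc yh n y(2) by auto
    then show ?thesis using g by blast
  qed
  have single: "g = \<zero>\<^bsub>?G n\<^esub>" if "(\<zero>\<^bsub>?X\<^esub>, g) \<in> Rel n" for n g
  proof (cases q)
    case 0
    then show ?thesis using Rel_zero_iff[OF that] by (simp add: hom_module_simps)
  next
    case (Suc i)
    have "\<exists>y\<in>module_homs R M (E i). (\<forall>x\<in>U n. y x = \<zero>\<^bsub>E i\<^esub>) \<and> (\<forall>x\<in>carrier M. \<zero>\<^bsub>?X\<^esub> x = d i (y x))"
      by (rule bexI[OF _ module_homs_const_zero[OF M E]]) (simp add: hom_module_simps Suc module_homs_zero[OF E E d])
    then show ?thesis using Rel_zero_iff[OF that] Suc by simp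
  qed
  obtain \<psi> where \<psi>: "\<psi> \<in> module_homs R ?X (direct_limit ?G ?\<phi>)" "\<psi> ` carrier ?X = carrier (direct_limit ?G ?\<phi>)"
    "\<And>x. x \<in> carrier ?X \<Longrightarrow> \<psi> x = \<zero>\<^bsub>direct_limit ?G ?\<phi>\<^esub> \<longleftrightarrow> x \<in> Bq"
    by (rule direct_limit_presentation[of ?G ?\<phi> ?X Rel Bq, OF module_Ext[OF module_power_quotient N]
          Ext_map_hom[OF module_power_quotient N module_power_quotient power_projection_hom] X Rel_linear Rel_step total
          Rel_surj single B1 B2]) blast+
  show ?thesis
    by (rule that[of \<psi>]) (use \<psi> in \<open>simp_all add: gen_local_cohomology_def Zq_def Bq_def\<close>)
qed

end

end

end

section \<open>The complex of torsion homomorphisms\<close>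

context cring
begin

lemma injective_module_transport:
  assumes E: "injective_module R E" and T: "module R T" and \<theta>: "\<theta> \<in> module_homs R T E"
    and bij: "bij_betw \<theta> (carrier T) (carrier E)"
  shows "injective_module R T"
proof -
  interpret T: module R T by (rule T)
  let ?\<eta> = "inv_into (carrier T) \<theta>"
  have inv: "?\<eta> (\<theta> x) = x" if "x \<in> carrier T" for x using bij_betw_inv_into_left[OF bij that] .
  have "?\<eta> \<in> module_homs R E T"
  proof (rule module_homsI)
    fix x assume "x \<in> carrier E"
    then obtain a where a: "a \<in> carrier T" "x = \<theta> a" using bij by (auto simp: bij_betw_def)
    show "?\<eta> x \<in> carrier T" using a inv by simp
    show "?\<eta> (r \<odot>\<^bsub>E\<^esub> x) = r \<odot>\<^bsub>T\<^esub> ?\<eta> x" if r: "r \<in> carrier R" for r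
      using inv[OF T.smult_closed[OF r a(1)]] module_homs_smult[OF \<theta> r a(1)] a inv[OF a(1)] by simp
    fix y assume "y \<in> carrier E"
    then obtain b where b: "b \<in> carrier T" "y = \<theta> b" using bij by (auto simp: bij_betw_def)
    show "?\<eta> (x \<oplus>\<^bsub>E\<^esub> y) = ?\<eta> x \<oplus>\<^bsub>T\<^esub> ?\<eta> y"
      using inv[OF T.M.a_closed[OF a(1) b(1)]] module_homs_add[OF \<theta> a(1) b(1)] a b inv[OF a(1)] inv[OF b(1)] by simp
  qed
  note \<eta> = this
  have "extension_property R A B T" if AB: "module R A" "module R B" for A B :: "('a, 'a) module"
    unfolding extension_property_def
  proof (intro ballI impI)
    fix i f assume i: "i \<in> module_homs R A B" "inj_on i (carrier A)" and f: "f \<in> module_homs R A T"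
    have "extension_property R A B E" using E AB by (simp add: injective_module_def)
    then have "\<exists>g\<in>module_homs R B E. \<forall>x\<in>carrier A. g (i x) = \<theta> (f x)"
      using module_homs_comp'[OF f \<theta>] i
      by (simp only: extension_property_def)
    then obtain g where g: "g \<in> module_homs R B E" "\<And>x. x \<in> carrier A \<Longrightarrow> g (i x) = \<theta> (f x)" by blast
    then show "\<exists>g\<in>module_homs R B T. \<forall>x\<in>carrier A. g (i x) = f x"
      using inv module_homs_closed[OF f] by (intro bexI[OF _ module_homs_comp'[OF g(1) \<eta>]]) simp
  qed
  then show ?thesis using T by (simp add: injective_module_def)
qed

lemma weakly_laskerian_subquotient_restrict:
  assumes W: "module R W" and S: "submodule S R W" and "weakly_laskerian_subquotient R W Z B"
  shows "weakly_laskerian_subquotient R (W\<lparr>carrier := S\<rparr>) Z B"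
proof -
  interpret W: module R W by (rule W)
  have W': "module R (W\<lparr>carrier := S\<rparr>)" by (rule submodule.submodule_is_module[OF S W])
  have "submodule U R W" if U: "submodule U R (W\<lparr>carrier := S\<rparr>)" for U
  proof (rule W.module_incl_imp_submodule)
    show "U \<subseteq> carrier W"
      using module.submoduleD(1)[OF W' U] W.submoduleD(1)[OF S] by simp
    show "module R (W\<lparr>carrier := U\<rparr>)" using submodule.submodule_is_module[OF U W'] by simp
  qed
  then show ?thesis using assms(3) unfolding weakly_laskerian_subquotient_def by simp
qed

text \<open>If $a \in I$ does not lie in \<open>P\<close>, then its powers are invertible in the localization at \<open>P\<close>,
  and they annihilate everything: any two fractions are equal.\<close>

lemma Supp_subset_zero_locus:
  assumes W: "module R W" and I: "ideal I R"
    and tors: "\<And>x. x \<in> carrier W \<Longrightarrow> \<exists>n. \<forall>r\<in>I [^]\<^bsub>ideals_set R\<^esub> (n::nat). r \<odot>\<^bsub>W\<^esub> x = \<zero>\<^bsub>W\<^esub>"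
  shows "Supp R W \<subseteq> zero_locus R I"
proof
  interpret W: module R W by (rule W)
  interpret I: ideal I R by (rule I)
  fix P assume P: "P \<in> Supp R W"
  then have PS: "P \<in> spec R" by (simp add: Supp_def)
  interpret P: primeideal P R using PS by (simp add: spec_def)
  have "I \<subseteq> P"
  proof (rule ccontr)
    assume "\<not> I \<subseteq> P"
    then obtain a where a: "a \<in> I" "a \<notin> P" by blast
    then have ac: "a \<in> carrier R" using I.a_subset by blast
    have one: "\<one> \<notin> P" using P.I_notcarr P.one_imp_carrier by blast
    have pow: "a [^] n \<in> carrier R - P" for n :: nat
    proof (induction n)
      case (Suc n)
      then show ?case using P.I_prime[of "a [^] n" a] ac a(2) by auto
    qed (use one in simp)
    have whole: "fraction R W P x s = {(y, t). y \<in> carrier W \<and> t \<in> carrier R - P}"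
      if x: "x \<in> carrier W" and s: "s \<in> carrier R - P" for x s
    proof -
      obtain n :: nat where n: "a [^] n \<odot>\<^bsub>W\<^esub> x = \<zero>\<^bsub>W\<^esub>" using tors[OF x] ideal_power_mem[OF I a(1)] by blast
      have "\<exists>u\<in>carrier R - P. u \<odot>\<^bsub>W\<^esub> (t \<odot>\<^bsub>W\<^esub> x) = u \<odot>\<^bsub>W\<^esub> (s \<odot>\<^bsub>W\<^esub> y)"
        if y: "y \<in> carrier W" and t: "t \<in> carrier R - P" for y t
      proof -
        obtain m :: nat where m: "a [^] m \<odot>\<^bsub>W\<^esub> y = \<zero>\<^bsub>W\<^esub>" using tors[OF y] ideal_power_mem[OF I a(1)] by blast
        have "(a [^] (n + m)) \<odot>\<^bsub>W\<^esub> (t \<odot>\<^bsub>W\<^esub> x) = (t \<otimes> a [^] m) \<odot>\<^bsub>W\<^esub> (a [^] n \<odot>\<^bsub>W\<^esub> x)"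
          using x t ac by (simp flip: W.smult_assoc1 nat_pow_mult add: m_ac)
        moreover have "(a [^] (n + m)) \<odot>\<^bsub>W\<^esub> (s \<odot>\<^bsub>W\<^esub> y) = (s \<otimes> a [^] n) \<odot>\<^bsub>W\<^esub> (a [^] m \<odot>\<^bsub>W\<^esub> y)"
          using y s ac by (simp flip: W.smult_assoc1 nat_pow_mult add: m_ac)
        ultimately show ?thesis using n m s t ac pow[of "n + m"]
          by (intro bexI[of _ "a [^] (n + m)"]) simp_all
      qed
      then show ?thesis by (auto simp: fraction_def)
    qed
    have "localization R W P = {fraction R W P \<zero>\<^bsub>W\<^esub> \<one>}"
    proof
      show "localization R W P \<subseteq> {fraction R W P \<zero>\<^bsub>W\<^esub> \<one>}"
        unfolding localization_def using whole one by auto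
      show "{fraction R W P \<zero>\<^bsub>W\<^esub> \<one>} \<subseteq> localization R W P"
        unfolding localization_def using one W.zero_closed one_closed by blast
    qed
    then show False using P by (simp add: Supp_def)
  qed
  then show "P \<in> zero_locus R I" using PS by (simp add: zero_locus_def)
qed

lemma ideal_power_subset: "ideal I R \<Longrightarrow> I [^]\<^bsub>ideals_set R\<^esub> (n::nat) \<subseteq> carrier R"
  using additive_subgroup.a_subset[OF ideal.axioms(1)[OF ideal_power_ideal]] .

lemma module_gen_local_cohomology:
  assumes I: "ideal I R" and M: "module R M" and N: "module R N"
  shows "module R (gen_local_cohomology R I q M N)"
  unfolding gen_local_cohomology_def
proof (rule module_direct_limit[OF is_cring])
  note A = module_power_quotient[OF I M]
  show "module R (Ext R q (power_quotient R I M n) N)" for n by (rule module_Ext[OF A N])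
  show "Ext_map R q (power_quotient R I M (Suc n)) (power_projection R I M n) N
      \<in> module_homs R (Ext R q (power_quotient R I M n) N) (Ext R q (power_quotient R I M (Suc n)) N)" for n
    by (rule Ext_map_hom[OF A N A power_projection_hom[OF I M]])
qed

context
  fixes I :: "'a set" and M :: "('a, 'm) module"
  assumes I: "ideal I R" and M: "module R M"
begin

lemma power_submodule_vanish_iff:
  assumes V: "module R V" and f: "f \<in> carrier (hom_module R M V)" and J: "J \<subseteq> carrier R"
  shows "(\<forall>x\<in>ideal_smult M J. f x = \<zero>\<^bsub>V\<^esub>) \<longleftrightarrow> (\<forall>r\<in>J. r \<odot>\<^bsub>hom_module R M V\<^esub> f = \<zero>\<^bsub>hom_module R M V\<^esub>)"
proof -
  have "(\<forall>x\<in>ideal_smult M J. f x = \<zero>\<^bsub>V\<^esub>) \<longleftrightarrow> (\<forall>r\<in>J. \<forall>x\<in>carrier M. r \<odot>\<^bsub>V\<^esub> f x = \<zero>\<^bsub>V\<^esub>)"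
    using f by (intro ideal_smult_vanish_iff[OF M V _ J]) (simp add: hom_module_simps)
  then show ?thesis by (auto simp: hom_module_simps fun_eq_iff restrict_def)
qed

text \<open>$\Gamma_I(\mathrm{Hom}(M, V))$ is $H^0_I(\mathrm{Hom}(M, V))$: an element \<open>f\<close> corresponds to
  the homomorphism $r \mapsto r f$ from \<open>R\<close>.\<close>

lemma gamma_homs_local_cohomology:
  assumes V: "module R V"
  obtains \<theta> where
    "\<theta> \<in> module_homs R ((hom_module R M V)\<lparr>carrier := gamma_homs R I M V\<rparr>) (local_cohomology R I 0 (hom_module R M V))"
    "bij_betw \<theta> (gamma_homs R I M V) (carrier (local_cohomology R I 0 (hom_module R M V)))"
proof -
  let ?H = "hom_module R M V" and ?RM = "ring_as_module R"
  let ?L = "local_cohomology R I 0 ?H" and ?T = "?H\<lparr>carrier := gamma_homs R I M V\<rparr>"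
  note H = module_hom_module[OF M V] and RM = module_ring_as_module
  interpret H: module R ?H by (rule H)
  interpret RM: module R ?RM by (rule RM)
  let ?G = "gamma_homs R I ?RM ?H"
  note GT = H.submoduleD[OF submodule_gamma_homs[OF I M V]]
  have T: "module R ?T" by (rule submodule.submodule_is_module[OF submodule_gamma_homs[OF I M V] H])
  have L: "module R ?L"
    unfolding local_cohomology_def by (rule module_gen_local_cohomology[OF I RM H])
  obtain \<psi> where \<psi>: "\<psi> \<in> module_homs R ((hom_module R ?RM ?H)\<lparr>carrier := ?G\<rparr>) ?L" "\<psi> ` ?G = carrier ?L"
    "\<And>g. g \<in> ?G \<Longrightarrow> \<psi> g = \<zero>\<^bsub>?L\<^esub> \<longleftrightarrow> g = (\<lambda>x\<in>carrier R. \<zero>\<^bsub>?H\<^esub>)"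
    using gen_local_cohomology_presentation[where I = I and M = ?RM and N = ?H and \<epsilon> = "\<lambda>x. x" and E = "\<lambda>i. ?H"
        and d = "\<lambda>i x. \<zero>\<^bsub>?H\<^esub>" and q = 0, OF I RM H H _ _ module_homs_const_zero[OF H H]]
    by (auto simp: local_cohomology_def module_homs_def)
  define j where "j f = (\<lambda>r\<in>carrier R. r \<odot>\<^bsub>?H\<^esub> f)" for f
  have jh: "j f \<in> module_homs R ?RM ?H" if "f \<in> carrier ?H" for f
    using that by (intro module_homsI) (auto simp: j_def H.smult_l_distr H.smult_assoc1)
  have jG: "j f \<in> ?G" if f: "f \<in> gamma_homs R I M V" for f
  proof -
    have fc: "f \<in> carrier ?H" using GT(2)[OF f] .
    obtain n where n: "\<forall>x\<in>ideal_smult M (I [^]\<^bsub>ideals_set R\<^esub> (n::nat)). f x = \<zero>\<^bsub>V\<^esub>"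
      using f by (auto simp: gamma_homs_def power_submodule_def)
    then have n': "\<forall>r\<in>I [^]\<^bsub>ideals_set R\<^esub> (n::nat). r \<odot>\<^bsub>?H\<^esub> f = \<zero>\<^bsub>?H\<^esub>"
      using power_submodule_vanish_iff[OF V fc ideal_power_subset[OF I]] by blast
    have "r \<odot>\<^bsub>?H\<^esub> j f x = \<zero>\<^bsub>?H\<^esub>" if "r \<in> I [^]\<^bsub>ideals_set R\<^esub> n" "x \<in> carrier R" for r x
    proof -
      have r: "r \<in> carrier R" using that(1) ideal_power_subset[OF I] by blast
      have "r \<odot>\<^bsub>?H\<^esub> (x \<odot>\<^bsub>?H\<^esub> f) = x \<odot>\<^bsub>?H\<^esub> (r \<odot>\<^bsub>?H\<^esub> f)"
        using r that(2) fc by (simp flip: H.smult_assoc1 add: m_comm)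
      then show ?thesis using n' that by (simp add: j_def)
    qed
    then have "\<forall>x\<in>ideal_smult ?RM (I [^]\<^bsub>ideals_set R\<^esub> n). j f x = \<zero>\<^bsub>?H\<^esub>"
      using ideal_smult_vanish_iff[OF RM H jh[OF fc] ideal_power_subset[OF I], of n] by simp
    moreover have "j f \<in> extensional (carrier R)" by (simp add: j_def)
    ultimately show ?thesis
      using jh[OF fc] by (auto simp: gamma_homs_def power_submodule_def hom_module_simps(1)[of R ?RM])
  qed
  have jhom: "j \<in> module_homs R ?T ((hom_module R ?RM ?H)\<lparr>carrier := ?G\<rparr>)"
  proof (rule module_homsI)
    fix f assume f: "f \<in> carrier ?T"
    then have fc: "f \<in> carrier ?H" using GT(2) by simp
    show "j f \<in> carrier ((hom_module R ?RM ?H)\<lparr>carrier := ?G\<rparr>)" using jG f by simp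
    show "j (r \<odot>\<^bsub>?T\<^esub> f) = r \<odot>\<^bsub>(hom_module R ?RM ?H)\<lparr>carrier := ?G\<rparr>\<^esub> j f" if r: "r \<in> carrier R" for r
    proof -
      have "x \<odot>\<^bsub>?H\<^esub> (r \<odot>\<^bsub>?H\<^esub> f) = r \<odot>\<^bsub>?H\<^esub> (x \<odot>\<^bsub>?H\<^esub> f)" if "x \<in> carrier R" for x
        using that r fc by (simp flip: H.smult_assoc1 add: m_comm)
      then show ?thesis by (auto simp: j_def hom_module_simps(4)[of R ?RM])
    qed
    fix g assume "g \<in> carrier ?T"
    then have gc: "g \<in> carrier ?H" using GT(2) by simp
    show "j (f \<oplus>\<^bsub>?T\<^esub> g) = j f \<oplus>\<^bsub>(hom_module R ?RM ?H)\<lparr>carrier := ?G\<rparr>\<^esub> j g"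
      using fc gc by (auto simp: j_def hom_module_simps(3)[of R ?RM] H.smult_r_distr)
  qed
  have jsurj: "g \<in> j ` gamma_homs R I M V" if g: "g \<in> ?G" for g
  proof -
    have gh: "g \<in> module_homs R ?RM ?H" "g \<in> extensional (carrier R)"
      using g by (auto simp: gamma_homs_def hom_module_simps(1)[of R ?RM])
    obtain n where "\<forall>x\<in>ideal_smult ?RM (I [^]\<^bsub>ideals_set R\<^esub> (n::nat)). g x = \<zero>\<^bsub>?H\<^esub>"
      using g by (auto simp: gamma_homs_def power_submodule_def)
    then have n: "\<forall>r\<in>I [^]\<^bsub>ideals_set R\<^esub> n. r \<odot>\<^bsub>?H\<^esub> g \<one> = \<zero>\<^bsub>?H\<^esub>"
      using ideal_smult_vanish_iff[OF RM H gh(1) ideal_power_subset[OF I], of n] by simp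
    have g1: "g \<one> \<in> carrier ?H" using module_homs_closed[OF gh(1), of \<one>] by simp
    have "\<forall>x\<in>power_submodule R I M n. g \<one> x = \<zero>\<^bsub>V\<^esub>"
      unfolding power_submodule_def power_submodule_vanish_iff[OF V g1 ideal_power_subset[OF I]] using n .
    then have "g \<one> \<in> gamma_homs R I M V" using g1 by (auto simp: gamma_homs_def)
    moreover have "g = j (g \<one>)"
    proof (rule extensionalityI[OF gh(2)])
      show "g r = j (g \<one>) r" if "r \<in> carrier R" for r
        using module_homs_smult[OF gh(1) that, of \<one>] that by (simp add: j_def)
    qed (simp add: j_def)
    ultimately show ?thesis by (intro image_eqI[where x = "g \<one>"])
  qed
  have \<theta>: "(\<lambda>f. \<psi> (j f)) \<in> module_homs R ?T ?L" by (rule module_homs_comp'[OF jhom \<psi>(1)])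
  have "inj_on (\<lambda>f. \<psi> (j f)) (gamma_homs R I M V)"
  proof (rule inj_onI)
    interpret L: module R ?L by (rule L)
    interpret T: module R ?T by (rule T)
    fix f g assume f: "f \<in> gamma_homs R I M V" and g: "g \<in> gamma_homs R I M V" and eq: "\<psi> (j f) = \<psi> (j g)"
    have fg: "f \<ominus>\<^bsub>?T\<^esub> g \<in> carrier ?T" using f g T.M.minus_closed by simp
    have "\<psi> (j (f \<ominus>\<^bsub>?T\<^esub> g)) = \<zero>\<^bsub>?L\<^esub>"
      using module_homs_minus[OF T L \<theta>, of f g] f g eq module_homs_closed[OF \<theta>, of g] by (simp add: L.M.minus_eq_zero_iff)
    then have "j (f \<ominus>\<^bsub>?T\<^esub> g) = (\<lambda>x\<in>carrier R. \<zero>\<^bsub>?H\<^esub>)" using \<psi>(3)[OF jG] fg by simp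
    then have "j (f \<ominus>\<^bsub>?T\<^esub> g) \<one> = (\<lambda>x\<in>carrier R. \<zero>\<^bsub>?H\<^esub>) \<one>" by (rule fun_cong)
    then have "f \<ominus>\<^bsub>?T\<^esub> g = \<zero>\<^bsub>?T\<^esub>" using fg GT(2) by (simp add: j_def)
    then show "f = g" using T.M.minus_eq_zero_iff[of f g] f g by simp
  qed
  moreover have "(\<lambda>f. \<psi> (j f)) ` gamma_homs R I M V = carrier ?L"
  proof -
    have "j ` gamma_homs R I M V = ?G" using jG jsurj by blast
    then show ?thesis using \<psi>(2) by (simp flip: image_image)
  qed
  ultimately show ?thesis using that[OF \<theta>] by (simp add: bij_betw_def)
qed

end

end

section \<open>The last cohomology module\<close>

context cring
begin

context
  fixes I :: "'a set" and M :: "('a, 'm) module" and N :: "('a, 'n) module" and \<epsilon> :: "'n \<Rightarrow> 'e"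
    and E :: "nat \<Rightarrow> ('a, 'e) module" and d :: "nat \<Rightarrow> 'e \<Rightarrow> 'e"
  assumes I: "ideal I R" and M: "module R M" and N: "module R N"
    and res: "injective_resolution R N \<epsilon> E d"
begin

private abbreviation "T q \<equiv> (hom_module R M (E q))\<lparr>carrier := gamma_homs R I M (E q)\<rparr>"
private abbreviation "dT q \<equiv> (\<lambda>f. \<lambda>x\<in>carrier M. d q (f x))"
private abbreviation "G q \<equiv> gen_local_cohomology R I q M N"

private lemma E_inj: "injective_module R (E i)" using res by (simp add: injective_resolution_def)
private lemma E: "module R (E i)" using E_inj by (simp add: injective_module_def)
private lemma d: "d i \<in> module_homs R (E i) (E (Suc i))" using res by (simp add: injective_resolution_def)
private lemma \<epsilon>: "\<epsilon> \<in> module_homs R N (E 0)" "inj_on \<epsilon> (carrier N)" using res by (simp_all add: injective_resolution_def)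
private lemma ker0: "{x \<in> carrier (E 0). d 0 x = \<zero>\<^bsub>E 1\<^esub>} = \<epsilon> ` carrier N"
  using res by (simp add: injective_resolution_def a_kernel_def kernel_def)
private lemma ker: "{x \<in> carrier (E (Suc i)). d (Suc i) x = \<zero>\<^bsub>E (Suc (Suc i))\<^esub>} = d i ` carrier (E i)"
  using res by (simp add: injective_resolution_def a_kernel_def kernel_def)
private lemma dd: "x \<in> carrier (E i) \<Longrightarrow> d (Suc i) (d i x) = \<zero>\<^bsub>E (Suc (Suc i))\<^esub>"
  using ker[of i] by blast
private lemma H: "module R (hom_module R M (E q))" by (rule module_hom_module[OF M E])
private lemma gamma_sub: "submodule (gamma_homs R I M (E q)) R (hom_module R M (E q))"
  by (rule submodule_gamma_homs[OF I M E])
private lemma T: "module R (T q)" by (rule submodule.submodule_is_module[OF gamma_sub H])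

private lemma gammaD:
  assumes "f \<in> gamma_homs R I M (E q)"
  shows "f \<in> module_homs R M (E q)" "f \<in> extensional (carrier M)" "x \<in> carrier M \<Longrightarrow> f x \<in> carrier (E q)"
  using assms by (auto simp: gamma_homs_def hom_module_simps intro: module_homs_closed)

private lemma dT_gamma:
  assumes f: "f \<in> gamma_homs R I M (E q)"
  shows "dT q f \<in> gamma_homs R I M (E (Suc q))"
proof -
  obtain n where n: "\<forall>x\<in>power_submodule R I M n. f x = \<zero>\<^bsub>E q\<^esub>" using f by (auto simp: gamma_homs_def)
  have "\<forall>x\<in>power_submodule R I M n. dT q f x = \<zero>\<^bsub>E (Suc q)\<^esub>"
    using n module.submoduleD(2)[OF M submodule_power_submodule[OF I M]] module_homs_zero[OF E E d] by simp
  moreover have "dT q f \<in> module_homs R M (E (Suc q))"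
    by (rule module_homs_cong[OF M module_homs_comp'[OF gammaD(1)[OF f] d]]) simp
  moreover have "dT q f \<in> extensional (carrier M)" by simp
  ultimately show ?thesis unfolding gamma_homs_def hom_module_simps by blast
qed

private lemma dT: "dT q \<in> module_homs R (T q) (T (Suc q))"
proof (rule module_homsI)
  fix f assume f: "f \<in> carrier (T q)"
  then show "dT q f \<in> carrier (T (Suc q))" using dT_gamma by simp
  have fc: "f x \<in> carrier (E q)" if "x \<in> carrier M" for x using gammaD(3)[of f q x] f that by simp
  show "dT q (r \<odot>\<^bsub>T q\<^esub> f) = r \<odot>\<^bsub>T (Suc q)\<^esub> dT q f" if "r \<in> carrier R" for r
    using module_homs_smult[OF d that fc] by (auto simp: hom_module_simps)
  fix g assume g: "g \<in> carrier (T q)"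
  have gc: "g x \<in> carrier (E q)" if "x \<in> carrier M" for x using gammaD(3)[of g q x] g that by simp
  show "dT q (f \<oplus>\<^bsub>T q\<^esub> g) = dT q f \<oplus>\<^bsub>T (Suc q)\<^esub> dT q g"
    using module_homs_add[OF d fc gc] by (auto simp: hom_module_simps)
qed

text \<open>A homomorphism that is annihilated by \<open>I\<close> is one that vanishes on $IM$; in particular it lies in
  $\Gamma_I$.\<close>

private lemma torsion_T:
  "torsion I (T q) = {f \<in> carrier (hom_module R M (E q)). \<forall>x\<in>ideal_smult M I. f x = \<zero>\<^bsub>E q\<^esub>}"
proof -
  have Ic: "I \<subseteq> carrier R" using additive_subgroup.a_subset[OF ideal.axioms(1)[OF I]] .
  have gamma: "f \<in> gamma_homs R I M (E q)"
    if "f \<in> carrier (hom_module R M (E q))" "\<forall>x\<in>ideal_smult M I. f x = \<zero>\<^bsub>E q\<^esub>" for f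
    using that ideal_power_one[OF I] unfolding gamma_homs_def power_submodule_def by (auto intro!: exI[of _ "1 :: nat"])
  have "torsion I (T q) = {f \<in> gamma_homs R I M (E q). \<forall>r\<in>I. r \<odot>\<^bsub>hom_module R M (E q)\<^esub> f = \<zero>\<^bsub>hom_module R M (E q)\<^esub>}"
    by (simp add: torsion_def)
  also have "\<dots> = {f \<in> gamma_homs R I M (E q). \<forall>x\<in>ideal_smult M I. f x = \<zero>\<^bsub>E q\<^esub>}"
    by (rule Collect_cong) (use power_submodule_vanish_iff[OF I M E _ Ic, of _ q] in \<open>auto simp only: gamma_homs_def mem_Collect_eq\<close>)
  also have "\<dots> = {f \<in> carrier (hom_module R M (E q)). \<forall>x\<in>ideal_smult M I. f x = \<zero>\<^bsub>E q\<^esub>}"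
    using gamma by (auto simp: gamma_homs_def)
  finally show ?thesis .
qed

text \<open>The $I$-torsion of the complex is $\mathrm{Hom}(M/IM, E^\bullet)$, which computes
  $\mathrm{Ext}^q(M/IM, N)$.\<close>

private lemma wl_torsion:
  assumes "noetherian_ring R" "finitely_generated_module R M" "weakly_laskerian R N"
  shows "weakly_laskerian_subquotient R (T q) ({f \<in> carrier (T q). dT q f = \<zero>\<^bsub>T (Suc q)\<^esub>} \<inter> torsion I (T q))
    (case q of 0 \<Rightarrow> {\<zero>\<^bsub>T 0\<^esub>} | Suc i \<Rightarrow> dT i ` torsion I (T i))"
proof -
  let ?IM = "ideal_smult M I"
  have IM: "submodule ?IM R M" by (rule submodule_ideal_smult[OF M I])
  have cocycles: "hom_cocycles R E d M ?IM q = {f \<in> carrier (T q). dT q f = \<zero>\<^bsub>T (Suc q)\<^esub>} \<inter> torsion I (T q)"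
    unfolding torsion_T hom_cocycles_def
    using torsion_T[of q] by (auto simp: torsion_def hom_module_simps fun_eq_iff restrict_def)
  have coboundaries: "hom_coboundaries R E d M ?IM q = (case q of 0 \<Rightarrow> {\<zero>\<^bsub>T 0\<^esub>} | Suc i \<Rightarrow> dT i ` torsion I (T i))"
  proof (cases q)
    case 0
    then show ?thesis by (simp add: hom_module_simps)
  next
    case (Suc i)
    have "f \<in> dT i ` torsion I (T i)"
      if f: "f \<in> extensional (carrier M)" and g: "g \<in> module_homs R M (E i)" "\<forall>x\<in>?IM. g x = \<zero>\<^bsub>E i\<^esub>" "\<forall>x\<in>carrier M. f x = d i (g x)" for f g
    proof (rule image_eqI)
      show "f = dT i (restrict g (carrier M))" by (rule extensionalityI[OF f]) (use g(3) in auto)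
      have "restrict g (carrier M) \<in> carrier (hom_module R M (E i))"
        using module_homs_cong[OF M g(1), of "restrict g (carrier M)"] by (simp add: hom_module_simps)
      moreover have "\<forall>x\<in>?IM. restrict g (carrier M) x = \<zero>\<^bsub>E i\<^esub>"
        using g(2) module.submoduleD(2)[OF M IM] by simp
      ultimately show "restrict g (carrier M) \<in> torsion I (T i)" unfolding torsion_T by blast
    qed
    then show ?thesis using Suc unfolding torsion_T by (auto simp: hom_module_simps)
  qed
  have "weakly_laskerian_subquotient R (hom_module R M (E q)) (hom_cocycles R E d M ?IM q) (hom_coboundaries R E d M ?IM q)"
    by (rule weakly_laskerian_hom_finitely_generated[OF E d dd N \<epsilon> ker0 ker E_inj assms(3,1) M assms(2) IM])
  from weakly_laskerian_subquotient_restrict[OF H gamma_sub this] show ?thesis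
    unfolding cocycles coboundaries .
qed

private lemma presentation:
  "\<exists>\<psi>. \<psi> \<in> module_homs R ((T q)\<lparr>carrier := {f \<in> carrier (T q). dT q f = \<zero>\<^bsub>T (Suc q)\<^esub>}\<rparr>) (G q) \<and>
    \<psi> ` {f \<in> carrier (T q). dT q f = \<zero>\<^bsub>T (Suc q)\<^esub>} = carrier (G q) \<and>
    (\<forall>f\<in>{f \<in> carrier (T q). dT q f = \<zero>\<^bsub>T (Suc q)\<^esub>}. \<psi> f = \<zero>\<^bsub>G q\<^esub> \<longleftrightarrow>
      f \<in> (case q of 0 \<Rightarrow> {\<zero>\<^bsub>T 0\<^esub>} | Suc i \<Rightarrow> dT i ` carrier (T i)))"
proof -
  have cyc: "{f \<in> carrier (T q). dT q f = \<zero>\<^bsub>T (Suc q)\<^esub>} =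
      {f \<in> gamma_homs R I M (E q). \<forall>x\<in>carrier M. d q (f x) = \<zero>\<^bsub>E (Suc q)\<^esub>}"
    by (auto simp: hom_module_simps fun_eq_iff restrict_def)
  have bd: "(case q of 0 \<Rightarrow> {\<zero>\<^bsub>T 0\<^esub>} | Suc i \<Rightarrow> dT i ` carrier (T i)) =
      (case q of 0 \<Rightarrow> {\<lambda>x\<in>carrier M. \<zero>\<^bsub>E 0\<^esub>} | Suc i \<Rightarrow> dT i ` gamma_homs R I M (E i))"
    by (cases q) (simp_all add: hom_module_simps(2))
  show ?thesis
    unfolding cyc bd
  proof (rule gen_local_cohomology_presentation[where E = E and d = d and q = q, OF I M N E \<epsilon> d ker0 ker E_inj],
      intro exI conjI ballI)
  qed (simp, simp, elim CollectE conjE, assumption)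
qed

lemma gen_local_cohomology_torsion:
  assumes x: "x \<in> carrier (G q)"
  shows "\<exists>n. \<forall>r\<in>I [^]\<^bsub>ideals_set R\<^esub> (n::nat). r \<odot>\<^bsub>G q\<^esub> x = \<zero>\<^bsub>G q\<^esub>"
proof -
  let ?Z = "{f \<in> carrier (T q). dT q f = \<zero>\<^bsub>T (Suc q)\<^esub>}"
  obtain \<psi> where \<psi>: "\<psi> \<in> module_homs R ((T q)\<lparr>carrier := ?Z\<rparr>) (G q)" "\<psi> ` ?Z = carrier (G q)"
    by (rule exE[OF presentation[of q]], elim conjE, rule that)
  obtain f where f: "f \<in> ?Z" "x = \<psi> f" using x \<psi>(2) by blast
  obtain n where n: "\<forall>y\<in>ideal_smult M (I [^]\<^bsub>ideals_set R\<^esub> (n::nat)). f y = \<zero>\<^bsub>E q\<^esub>"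
    using f(1) by (auto simp: gamma_homs_def power_submodule_def)
  have fc: "f \<in> carrier (hom_module R M (E q))" using f(1) by (simp add: gamma_homs_def)
  have Z: "module R ((T q)\<lparr>carrier := ?Z\<rparr>)"
    by (rule submodule.submodule_is_module[OF submodule_kernel[OF T T dT] T])
  have "r \<odot>\<^bsub>G q\<^esub> x = \<zero>\<^bsub>G q\<^esub>" if r: "r \<in> I [^]\<^bsub>ideals_set R\<^esub> n" for r
  proof -
    have "r \<odot>\<^bsub>hom_module R M (E q)\<^esub> f = \<zero>\<^bsub>hom_module R M (E q)\<^esub>"
      using power_submodule_vanish_iff[OF I M E fc ideal_power_subset[OF I]] n r by blast
    then show ?thesis
      using module_homs_smult[OF \<psi>(1), of r f] f r ideal_power_subset[OF I] 
        module_homs_zero[OF Z module_gen_local_cohomology[OF I M N] \<psi>(1)] by auto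
  qed
  then show ?thesis by blast
qed

text \<open>$T^q$ is injective because it is isomorphic to $H^0_I(\mathrm{Hom}(M, E^q))$.\<close>

lemma weakly_cofinite_remaining:
  assumes "noetherian_ring R" "finitely_generated_module R M" "weakly_laskerian R N"
    and inj: "\<And>i. injective_module R (local_cohomology R I 0 (hom_module R M (E i)))"
    and cof: "\<And>i. i \<noteq> s \<Longrightarrow> weakly_cofinite R I (G i)"
  shows "weakly_cofinite R I (G s)"
proof -
  let ?Z = "\<lambda>q. {f \<in> carrier (T q). dT q f = \<zero>\<^bsub>T (Suc q)\<^esub>}"
  let ?B = "\<lambda>q. case q of 0 \<Rightarrow> {\<zero>\<^bsub>T 0\<^esub>} | Suc i \<Rightarrow> dT i ` carrier (T i)"
  let ?D = "\<lambda>q. case q of 0 \<Rightarrow> {\<zero>\<^bsub>T 0\<^esub>} | Suc i \<Rightarrow> dT i ` torsion I (T i)"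
  have "\<exists>\<psi>. \<forall>q. \<psi> q \<in> module_homs R ((T q)\<lparr>carrier := ?Z q\<rparr>) (G q) \<and> \<psi> q ` ?Z q = carrier (G q) \<and>
      (\<forall>f\<in>?Z q. \<psi> q f = \<zero>\<^bsub>G q\<^esub> \<longleftrightarrow> f \<in> ?B q)"
    by (rule choice, rule allI, rule presentation)
  then obtain \<psi> where p: "\<forall>q. \<psi> q \<in> module_homs R ((T q)\<lparr>carrier := ?Z q\<rparr>) (G q) \<and> \<psi> q ` ?Z q = carrier (G q) \<and>
      (\<forall>f\<in>?Z q. \<psi> q f = \<zero>\<^bsub>G q\<^esub> \<longleftrightarrow> f \<in> ?B q)"
    by (rule exE)
  note \<psi> = p[THEN spec, THEN conjunct1] p[THEN spec, THEN conjunct2, THEN conjunct1]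
    p[THEN spec, THEN conjunct2, THEN conjunct2, THEN bspec]
  have Tinj: "injective_module R (T q)" for q
  proof -
    obtain \<theta> where "\<theta> \<in> module_homs R (T q) (local_cohomology R I 0 (hom_module R M (E q)))"
      "bij_betw \<theta> (gamma_homs R I M (E q)) (carrier (local_cohomology R I 0 (hom_module R M (E q))))"
      using gamma_homs_local_cohomology[OF I M E] by blast
    then show ?thesis by (intro injective_module_transport[OF inj T]) simp_all
  qed
  have ddT: "dT (Suc q) (dT q f) = \<zero>\<^bsub>T (Suc (Suc q))\<^esub>" if f: "f \<in> carrier (T q)" for q f
    using dd gammaD(3)[of f q] f by (auto simp: hom_module_simps fun_eq_iff restrict_def)
  have "weakly_laskerian R (Ext R j (quotient_module (ring_as_module R) I) (G s))" for j
  proof (rule weakly_laskerian_Ext_remaining_cohomology[where T = T and d = dT and cyc = ?Z and bd = ?B and tbd = ?D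
        and G = G and \<psi> = \<psi> and s = s, OF I Tinj dT])
    show "weakly_laskerian_subquotient R (T q) (?Z q \<inter> torsion I (T q)) (?D q)" for q
      by (rule wl_torsion[OF assms(1-3)])
    show "weakly_laskerian R (Ext R j (quotient_module (ring_as_module R) I) (G q))" if "q \<noteq> s" for q j
      using cof[OF that] by (simp add: weakly_cofinite_def)
  qed (use ddT \<psi> module_gen_local_cohomology[OF I M N] in simp_all)
  moreover have "Supp R (G s) \<subseteq> zero_locus R I"
    by (rule Supp_subset_zero_locus[OF module_gen_local_cohomology[OF I M N] I gen_local_cohomology_torsion])
  ultimately show ?thesis by (simp add: weakly_cofinite_def)
qed

end

end

theorem theorem3p6:
  fixes R :: "('r, 'x) ring_scheme"
    and I :: "'r set"
    and M :: "('r, 'm) module"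
    and N :: "('r, 'n) module"
    and s :: nat
  assumes "cring R" and "noetherian_ring R"
    and "ideal I R" and "I \<noteq> carrier R"
    and "module R M" and "finitely_generated_module R M"
    and "module R N" and "weakly_laskerian R N"
    and "cohomologically_injective TYPE('e) R I M N"
    and "\<And>i. i \<noteq> s \<Longrightarrow> weakly_cofinite R I (gen_local_cohomology R I i M N)"
  shows "weakly_cofinite R I (gen_local_cohomology R I s M N)"
proof -
  obtain \<epsilon> and E :: "nat \<Rightarrow> ('r, 'e) module" and d where "injective_resolution R N \<epsilon> E d"
    "\<And>i. injective_module R (local_cohomology R I 0 (hom_module R M (E i)))"
    using assms(9) unfolding cohomologically_injective_def by blast
  then show ?thesis
    by (rule cring.weakly_cofinite_remaining[OF assms(1,3,5,7) _ assms(2,6,8) _ assms(10)])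
qed

end
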